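(* Assume that (A1) and (A2) hold and that the Lévy process $\xi$ does not drift to $-\infty$. Then $$\left(\frac{X_n(\lfloor a_n t\rfloor)}{n};\ t\ge 0\right)\ \xrightarrow[n\to\infty]{(d)}\ (Y(t);\ t\ge0)$$ in distribution in $\mathbb D(\mathbb R_+,\mathbb R)$.
   Context: Let $\mathbb N=\{1,2,\dots\}$. For every $n\ge1$ let $(p_{n,k})_{k\ge1}$ be nonnegative reals with $\sum_{k\ge1}p_{n,k}=1$, and let $(X_n(k))_{k\ge0}$ be the discrete-time Markov chain on $\mathbb N$ with $X_n(0)=n$ and $\mathbb P(X_n(k+1)=j\mid X_n(k)=i)=p_{i,j}$. Let $\Pi_n^*(dx)=\sum_{k\ge1}p_{n,k}\,\delta_{\ln k-\ln n}(dx)$ (the law of $\ln(X_n(1)/n)$). Let $(a_n)_{n\ge0}$ be positive reals, regularly varying with index $\gamma>0$, i.e. $a_{\lfloor xn\rfloor}/a_n\to x^\gamma$ for every $x>0$. Let $\Pi$ be a measure on $\mathbb R\setminus\{0\}$ with $\Pi(\{-1,1\})=0$ and $\int(1\wedge x^2)\,\Pi(dx)<\infty$. (A1): for every continuous function $f$ with compact support in $[0,\infty]\setminus\{1\}$, $a_n\,\mathbb E[f(X_n(1)/n)]\to\int_{\mathbb R}f(e^x)\,\Pi(dx)$ as $n\to\infty$ (i.e. $a_n\Pi_n^*\to\Pi$ vaguely on $[-\infty,\infty]\setminus\{0\}$). (A2): there exist $b\in\mathbb R$ and $\sigma^2\ge0$ such that $a_n\int_{-1}^1x\,\Pi_n^*(dx)\to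 b$ and $a_n\int_{-1}^1x^2\,\Pi_n^*(dx)\to\sigma^2+\int_{-1}^1x^2\,\Pi(dx)$. Let $\xi$ be the Lévy process with $\xi(0)=0$ and $\mathbb E[e^{i\lambda\xi(t)}]=e^{t\Phi(\lambda)}$, where $\Phi(\lambda)=-\frac12\sigma^2\lambda^2+ib\lambda+\int_{\mathbb R}(e^{i\lambda x}-1-i\lambda x\mathbb 1_{|x|\le1})\,\Pi(dx)$. We say $\xi$ drifts to $-\infty$ if $\xi(t)\to-\infty$ a.s. Let $I_\infty=\int_0^\infty e^{\gamma\xi(s)}ds\in(0,\infty]$, $\tau(t)=\inf\{u\ge0:\int_0^ue^{\gamma\xi(s)}ds>t\}$ (with $\inf\emptyset=\infty$), and $Y(t)=e^{\xi(\tau(t))}$ for $0\le t<I_\infty$, $Y(t)=0$ for $t\ge I_\infty$ (the Lamperti transform of $\xi$). $\mathbb D(\mathbb R_+,\mathbb R)$ is the space of càdlàg functions with the Skorokhod $J_1$ topology. *)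

theory Defs
  imports "HOL-Probability.Probability"
begin

definition markov_chain ::
  "'a measure \<Rightarrow> (nat \<Rightarrow> 'a \<Rightarrow> nat) \<Rightarrow> (nat \<Rightarrow> nat \<Rightarrow> real) \<Rightarrow> nat \<Rightarrow> bool" where
  "markov_chain M X p n \<longleftrightarrow>
     prob_space M \<and>
     (\<forall>k. X k \<in> measurable M (count_space UNIV)) \<and>
     (\<forall>k (xs :: nat \<Rightarrow> nat).
        measure M {\<omega> \<in> space M. \<forall>j\<le>k. X j \<omega> = xs j}
          = (if xs 0 = n then (\<Prod>j<k. p (xs j) (xs (Suc j))) else 0))"

definition Pistar :: "'a measure \<Rightarrow> (nat \<Rightarrow> 'a \<Rightarrow> nat) \<Rightarrow> nat \<Rightarrow> real measure" where
  "Pistar M X n = distr M borel (\<lambda>\<omega>. ln (real (X 1 \<omega>)) - ln (real n))"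

definition regularly_varying :: "(nat \<Rightarrow> real) \<Rightarrow> real \<Rightarrow> bool" where
  "regularly_varying a \<gamma> \<longleftrightarrow>
     (\<forall>x::real. x > 0 \<longrightarrow>
        ((\<lambda>n. a (nat \<lfloor>x * real n\<rfloor>) / a n) \<longlonglongrightarrow> x powr \<gamma>))"

(* Levy measure: measure on R\{0} (represented on borel R with no mass at 0) *)
definition levy_measure :: "real measure \<Rightarrow> bool" where
  "levy_measure Lm \<longleftrightarrow> sets Lm = sets borel \<and> emeasure Lm {0} = 0 \<and>
     (\<integral>\<^sup>+ x. ennreal (min 1 (x\<^sup>2)) \<partial>Lm) < \<infinity>"

definition levy_exponent :: "real \<Rightarrow> real \<Rightarrow> real measure \<Rightarrow> real \<Rightarrow> complex" where
  "levy_exponent b sigma2 Lm l =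
     complex_of_real (- (1/2) * sigma2 * l\<^sup>2) + \<i> * complex_of_real (b * l) +
     (\<integral>x. (cis (l * x) - 1 - \<i> * complex_of_real (l * x * indicator {-1..1} x)) \<partial>Lm)"

definition cadlag :: "(real \<Rightarrow> real) \<Rightarrow> bool" where
  "cadlag f \<longleftrightarrow> (\<forall>t\<ge>0. (f \<longlongrightarrow> f t) (at_right t) \<and>
                        (t > 0 \<longrightarrow> (\<exists>l. (f \<longlongrightarrow> l) (at_left t))))"

definition levy_process :: "'b measure \<Rightarrow> (real \<Rightarrow> 'b \<Rightarrow> real) \<Rightarrow> (real \<Rightarrow> complex) \<Rightarrow> bool" where
  "levy_process N \<xi> \<Phi> \<longleftrightarrow>
     prob_space N \<and>
     (\<forall>t. \<xi> t \<in> borel_measurable N) \<and>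
     (\<forall>\<omega>\<in>space N. \<xi> 0 \<omega> = 0 \<and> cadlag (\<lambda>t. \<xi> t \<omega>)) \<and>
     (\<forall>k (ts :: nat \<Rightarrow> real) (ls :: nat \<Rightarrow> real).
        ts 0 = 0 \<longrightarrow> (\<forall>j<k. ts j \<le> ts (Suc j)) \<longrightarrow>
        (\<integral>\<omega>. cis (\<Sum>j<k. ls j * (\<xi> (ts (Suc j)) \<omega> - \<xi> (ts j) \<omega>)) \<partial>N)
          = (\<Prod>j<k. exp (complex_of_real (ts (Suc j) - ts j) * \<Phi> (ls j))))"

definition lamperti :: "real \<Rightarrow> (real \<Rightarrow> real) \<Rightarrow> real \<Rightarrow> real" where
  "lamperti \<gamma> x t =
     (if ennreal t < (\<integral>\<^sup>+ s. ennreal (exp (\<gamma> * x s)) * indicator {0..} s \<partial>lborel)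
      then exp (x (Inf {u. 0 \<le> u \<and> t < (LBINT s:{0..u}. exp (\<gamma> * x s))}))
      else 0)"

definition time_change :: "(real \<Rightarrow> real) \<Rightarrow> bool" where
  "time_change l \<longleftrightarrow> strict_mono_on {0..} l \<and> continuous_on {0..} l \<and> l ` {0..} = {0..}"

definition J1_tendsto :: "(nat \<Rightarrow> real \<Rightarrow> real) \<Rightarrow> (real \<Rightarrow> real) \<Rightarrow> bool" where
  "J1_tendsto xs x \<longleftrightarrow>
     (\<exists>ls. (\<forall>k. time_change (ls k)) \<and>
        (\<forall>T>0. \<forall>\<epsilon>>0. eventually (\<lambda>k. \<forall>t\<in>{0..T}.
            \<bar>ls k t - t\<bar> < \<epsilon> \<and> \<bar>xs k (ls k t) - x t\<bar> < \<epsilon>) sequentially))"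

definition J1_bounded_continuous :: "((real \<Rightarrow> real) \<Rightarrow> real) \<Rightarrow> bool" where
  "J1_bounded_continuous F \<longleftrightarrow>
     (\<exists>B. \<forall>x. cadlag x \<longrightarrow> \<bar>F x\<bar> \<le> B) \<and>
     (\<forall>xs x. (\<forall>k. cadlag (xs k)) \<longrightarrow> cadlag x \<longrightarrow> J1_tendsto xs x \<longrightarrow>
        (\<lambda>k. F (xs k)) \<longlonglongrightarrow> F x)"

end

theory Submission
  imports Defs
begin

abbreviation (input) eventually_sequentially_binder :: "(nat => bool) => bool" (binder "EV " 10)
  where "EV n. P n == eventually P sequentially"

abbreviation (input) tends_to :: "(nat => 'a::topological_space) => 'a => bool" ("((_)/ ----> (_))" [60, 60] 60)
  where "X ----> l == X \<longlonglongrightarrow> l"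

abbreviation (input) pmf_E :: "'a pmf => ('a => 'b::{banach, second_countable_topology}) => 'b"
  where "pmf_E == measure_pmf.expectation"

text \<open>
  In the clock \<open>\<theta>\<^sub>k = \<Sum>i<k. 1 / a(X\<^sub>i)\<close> the chain \<open>ln (X\<^sub>k / n)\<close> behaves like \<open>\<xi>\<close>: sampled at the first times
  with \<open>j\<delta> \<le> \<theta>\<^sub>k\<close>, its increments converge jointly in law to those of \<open>\<xi>\<close>, because
  \<open>a\<^sub>i (E exp (i\<lambda> ln (X\<^sub>1 / i)) - 1) \<longrightarrow> \<Phi> \<lambda>\<close> uniformly along the part of the chain that is seen. During one block of
  length \<open>\<delta>\<close> the chain moves by more than \<open>\<eta>\<close> with probability \<open>O(\<delta>)\<close> and does so twice with probability
  \<open>O(\<delta>\<^sup>2)\<close>, so it is \<open>J\<^sub>1\<close>-close to the step path built from the sampled values; by regular variation a block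
  at height \<open>x\<close> takes real time \<open>\<delta> exp (\<gamma> x)\<close>. The step path depends continuously on the increments, and the
  same construction applied to \<open>\<xi>\<close> is close to its Lamperti transform, whose clock is unbounded because \<open>\<xi>\<close> does
  not drift to \<open>-\<infinity>\<close>.
\<close>

section \<open>Regular variation\<close>

text \<open>(A1) and (A2) describe one step from a large state, so the chain is controlled only
  while \<open>ln (X / n)\<close> stays in a box of half-width A. The bounded function x^2 / (1 +
  x^2) serves twice. At scale A its generator tends to 0 as A grows, which makes leaving the box
  before clock time S unlikely. At a small scale \<eta> its generator is merely bounded, which
  bounds the exits within a block. Constants are chosen in the order accuracy, S, A, \<eta>,
  \<delta>, and last the bound e on one clock step. Over S / \<delta> blocks, double exits cost
  O(\<delta>) in total; single exits cannot be excluded, but each of them disturbs real time only by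
  O(\<delta>). The clock is unbounded by a zero-one law: a finite clock has a vanishing remainder,
  whereas a late visit above -K adds a fixed amount with probability at least 1/2. A functional of
  the Lamperti path agrees only almost surely with a limit of measurable functions, hence the
  completion of \<open>N\<close>.\<close>

lemma regularly_varying_at_top:
 assumes pos: "!!n. 0 < a n" and g: "0 < \<gamma>" and rv: "regularly_varying a \<gamma>"
 shows "filterlim a at_top sequentially"
proof -
 define r where "r = (1/2::real) powr \<gamma>"
 have r: "0 < r" "r < 1"
  using g powr_less_mono2[of \<gamma> "1/2" 1] by (auto simp: r_def)
 have "(%n. a (nat \<lfloor>1/2 * real n\<rfloor>) / a n) ----> r"
  using rv unfolding regularly_varying_def r_def by (metis half_gt_zero_iff zero_less_one)
 then have "EV n. a (nat \<lfloor>1/2 * real n\<rfloor>) / a n < (1+r)/2"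
  using r by (intro order_tendstoD(2)) auto
 then obtain N where N: "!!n. n >= N ==> a (nat \<lfloor>1/2 * real n\<rfloor>) / a n < (1+r)/2"
  by (auto simp: eventually_sequentially)
 define q where "q = 2/(1+r)"
 have q: "q > 1" using r by (auto simp: q_def)
 have fl: "nat \<lfloor>real n / 2\<rfloor> = n div 2" for n
  by (simp add: floor_divide_of_nat_eq[of n 2, simplified])
 define M where "M = max N 1"
 have M1: "M >= 1" by (simp add: M_def)
 have step: "a n >= q * a (n div 2)" if "n >= M" for n
 proof -
  have "a (n div 2) / a n < (1+r)/2" using N[of n] that by (simp add: M_def fl)
  then have "a (n div 2) < (1+r)/2 * a n" using pos[of n] by (simp add: field_simps)
  then show ?thesis using r by (simp add: q_def field_simps)
 qed
 \<comment> \<open>The inequality \<open>a n >= q * a (n div 2)\<close> carries the minimum over the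
   initial segment to all indices; k halvings then gain the factor \<open>q ^ k\<close>.\<close>
 define c where "c = Min (a ` {..M})"
 have c0: "c > 0" using pos by (auto simp: c_def)
 have low: "a n >= c" for n
 proof (induction n rule: less_induct)
  case (less n)
  show ?case
  proof (cases "n <= M")
   case True then show ?thesis by (auto simp: c_def)
  next
   case False
   then have "n div 2 < n" using M1 by auto
   then have "a (n div 2) >= c" using less by blast
   moreover have "q * a (n div 2) >= 1 * a (n div 2)" using q pos[of "n div 2"] by (intro mult_right_mono) auto
   ultimately show ?thesis using step[of n] False by auto
  qed
 qed
 have pw: "a n >= q ^ k * c" if "n >= 2 ^ k * M" for k n
  using that
 proof (induction k arbitrary: n)
  case 0 then show ?case using low by simp
 next
  case (Suc k)
  have "n div 2 >= 2 ^ k * M" using Suc.prems by simp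
  then have "a (n div 2) >= q ^ k * c" by (rule Suc.IH)
  moreover have "n >= M" using Suc.prems by (metis le_trans mult_le_mono1 nat_mult_1 one_le_numeral one_le_power)
  ultimately show ?case using step[of n] q
   by (smt (verit) mult.assoc mult_left_mono power_Suc)
 qed
 show ?thesis
  unfolding filterlim_at_top
 proof
  fix Z :: real
  obtain k where k: "q ^ k > Z / c" using real_arch_pow[OF q] by blast
  have "\<forall>n\<ge>2^k*M. Z <= a n"
   using pw[where k=k] k c0 by (smt (verit) pos_divide_less_eq)
  then show "EV n. Z <= a n" by (auto simp: eventually_sequentially)
 qed
qed

text \<open>The measure-theoretic proof of the uniform convergence theorem: for every \<open>v \<in> [0, 1]\<close> the defect
  between \<open>a\<^sub>m\<close> and \<open>a\<^sub>i\<close> is at most the defect at \<open>u + v\<close> seen from \<open>m\<close> plus the defect at \<open>v\<close> seen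
  from \<open>i = e\<^sup>u m\<close>; both tend to 0 in mean by dominated convergence.\<close>

lemma regularly_varying_uniform_ln:
 assumes pos: "!!n. 0 < a n" and rv: "regularly_varying a \<gamma>" and A: "0 < A" and e: "0 < e"
 shows "EV n. ALL i. exp (-A) * real n <= real i & real i <= exp A * real n -->
  abs(ln (a i) - ln (a n) - \<gamma> * ln (real i / real n)) <= e"
proof (rule ccontr)
 define bad where "bad n i \<longleftrightarrow> exp (-A) * real n <= real i & real i <= exp A * real n &
  abs(ln (a i) - ln (a n) - \<gamma> * ln (real i / real n)) > e" for n i
 assume "\<not> ?thesis"
 then have "\<exists>\<^sub>F n in sequentially. EX i. bad n i"
  unfolding frequently_def by (rule contrapos_nn) (erule eventually_mono, auto simp: bad_def not_less)
 then have "ALL k. \<exists>n\<ge>Suc k. EX i. bad n i" by (simp add: frequently_sequentially)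
 then obtain m i where m: "!!k. m k >= Suc k" and bad: "!!k. bad (m k) (i k)" by metis
 have m_top: "filterlim m at_top sequentially"
  unfolding filterlim_at_top by (metis Suc_leD eventually_sequentiallyI le_trans m)
 have m0: "real (m k) > 0" for k using m[of k] by simp
 have i0: "real (i k) > 0" for k
  using bad[of k] m0[of k] unfolding bad_def
  by (smt (verit) exp_gt_zero mult_pos_pos)
 have i_top: "filterlim i at_top sequentially"
 proof -
  have "filterlim (%k. exp (-A) * real (m k)) at_top sequentially"
   by (rule filterlim_tendsto_pos_mult_at_top[OF tendsto_const])
    (auto intro: filterlim_compose[OF filterlim_real_sequentially m_top])
  then have "filterlim (%k. real (i k)) at_top sequentially"
   by (rule filterlim_at_top_mono) (use bad in "auto simp: bad_def")
  then show ?thesis using filterlim_sequentially_iff_filterlim_real by blast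
 qed
 define u where "u k = ln (real (i k) / real (m k))" for k
 have eu: "exp (u k) * real (m k) = real (i k)" for k
  using m0 i0 by (simp add: u_def)
 have u: "-A <= u k" "u k <= A" for k
 proof -
  have "exp (-A) * real (m k) <= exp (u k) * real (m k)" "exp (u k) * real (m k) <= exp A * real (m k)"
   using bad[of k] unfolding bad_def eu by auto
  then show "-A <= u k" "u k <= A" using m0[of k] by auto
 qed
 \<comment> \<open>Capping the defect at 1 supplies the dominating function.\<close>
 define d where "d n w = min 1 \<bar>ln (a (nat \<lfloor>exp w * real n\<rfloor>)) - ln (a n) - \<gamma> * w\<bar>" for n :: nat and w
 have d_meas [measurable]: "d n \<in> borel_measurable borel" for n
 proof -
  have 1: "(%w. nat \<lfloor>exp w * real n\<rfloor>) \<in> measurable borel (count_space UNIV)" by measurable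
  have "(%w. ln (a (nat \<lfloor>exp w * real n\<rfloor>))) \<in> borel_measurable borel"
   by (rule measurable_compose[OF 1]) simp
  then show ?thesis unfolding d_def by measurable
 qed
 have d01: "0 <= d n w" "d n w <= 1" for n w by (auto simp: d_def)
 have dlim: "(%n. d n w) ----> 0" for w
 proof -
  have "(%n. a (nat \<lfloor>exp w * real n\<rfloor>) / a n) ----> exp w powr \<gamma>"
   using rv unfolding regularly_varying_def by (metis exp_gt_zero)
  then have "(%n. ln (a (nat \<lfloor>exp w * real n\<rfloor>) / a n)) ----> ln (exp w powr \<gamma>)"
   by (intro tendsto_ln) auto
  then have "(%n. ln (a (nat \<lfloor>exp w * real n\<rfloor>)) - ln (a n)) ----> \<gamma> * w"
   using pos[THEN less_imp_neq] by (simp add: ln_div ln_powr)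
  then have "(%n. min 1 \<bar>ln (a (nat \<lfloor>exp w * real n\<rfloor>)) - ln (a n) - \<gamma> * w\<bar>) ----> min 1 \<bar>\<gamma> * w - \<gamma> * w\<bar>"
   by (intro tendsto_intros)
  then show ?thesis by (simp add: d_def)
 qed
 \<comment> \<open>Since e^u m = i exactly, both defects are taken at the same index floor(e^(u+v)
   m) = floor(e^v i); the value of \<open>a\<close> there cancels and a defect above
   \<open>e\<close> remains.\<close>
 have key: "min 1 e <= d (m k) (u k + v) + d (i k) v" for k v
 proof -
  have "exp (u k + v) * real (m k) = exp v * real (i k)"
   using eu[of k] by (simp add: exp_add mult_ac)
  moreover have "abs(ln (a (i k)) - ln (a (m k)) - \<gamma> * u k) > e"
   using bad[of k] by (simp add: bad_def u_def)
  ultimately show ?thesis unfolding d_def by (auto simp: min_def abs_if algebra_simps split: if_splits)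
 qed
 have ii: "integrable lborel (indicator {b..c} :: real => real)" for b c :: real
  by (rule integrable_real_indicator) (auto simp: emeasure_lborel_Icc_eq)
 define I where "I b c f = (LINT w|lborel. indicator {b..c} w * f w)" for b c :: real and f :: "real => real"
 have Ilim: "(%k. I b c (d (s k))) ----> 0" if "filterlim s at_top sequentially" for b c s
 proof -
  have "(%k. LINT w|lborel. indicator {b..c} w * d (s k) w) ----> (LINT w|lborel. indicator {b..c} w * (0::real))"
  proof (rule integral_dominated_convergence[where w="indicator {b..c}"])
   show "AE x in lborel. (%k. indicator {b..c} x * d (s k) x) ----> indicator {b..c} x * 0"
    by (intro AE_I2 tendsto_mult tendsto_const filterlim_compose[OF dlim that])
  qed (use d01 ii in "auto simp: indicator_def")
  then show ?thesis by (simp add: I_def)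
 qed
 have int: "integrable lborel (%w. indicator {b..c} w * d n (x + w))" for b c n x
  by (rule Bochner_Integration.integrable_bound[of _ "indicator {b..c} :: real => real"])
   (use d01 ii in "auto simp: indicator_def")
 have "min 1 e <= I (-A) (A+1) (d (m k)) + I 0 1 (d (i k))" for k
 proof -
  have "min 1 e = (LINT v|lborel. indicator {0..1::real} v * min 1 e)" by simp
  also have "... <= (LINT v|lborel. indicator {0..1} v * d (m k) (u k + v) + indicator {0..1} v * d (i k) v)"
  proof (intro integral_mono Bochner_Integration.integrable_add)
   show "integrable lborel (%v. indicator {0..1::real} v * min 1 e)"
    by (intro integrable_mult_left ii)
  qed (use int[of 0 1 _ 0] int[of 0 1] key in "auto simp: indicator_def")
  also have "... = (LINT v|lborel. indicator {0..1} v * d (m k) (u k + v)) + I 0 1 (d (i k))"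
   unfolding I_def using int[of 0 1 _ 0] int[of 0 1] by (intro Bochner_Integration.integral_add) auto
  also have "(LINT v|lborel. indicator {0..1} v * d (m k) (u k + v))
    <= (LINT v|lborel. indicator {-A..A+1} (u k + 1 * v) * d (m k) (u k + 1 * v))"
  proof (intro integral_mono)
   have "integrable lborel (%v. indicator {-A..A+1} (u k + 1 * v) * d (m k) (u k + 1 * v))"
    using lborel_integrable_real_affine_iff[of 1 "%w. indicator {-A..A+1} w * d (m k) w" "u k"] int[of "-A" "A+1" _ 0]
    by simp
   then show "integrable lborel (%v. indicator {-A..A+1} (u k + 1 * v) * d (m k) (u k + 1 * v))" .
  qed (use int u[of k] d01 in "auto simp: indicator_def")
  also have "... = I (-A) (A+1) (d (m k))"
   unfolding I_def by (subst lborel_integral_real_affine[where c=1 and t="u k"]) auto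
  finally show ?thesis by simp
 qed
 moreover have "(%k. I (-A) (A+1) (d (m k)) + I 0 1 (d (i k))) ----> 0 + 0"
  by (intro tendsto_add Ilim m_top i_top)
 ultimately have "min 1 e <= 0 + 0"
  by (intro LIMSEQ_le_const) auto
 then show False using e by (auto simp: min_def split: if_splits)
qed

lemma regularly_varying_uniform:
 assumes pos: "!!n. 0 < a n" and rv: "regularly_varying a \<gamma>" and A: "0 < A" and e: "0 < e"
 shows "EV n. ALL i. exp (-A) * real n <= real i & real i <= exp A * real n -->
  abs(a i / a n - exp (\<gamma> * (ln (real i) - ln (real n)))) <= e"
proof -
 define B where "B = exp (abs(\<gamma>) * A)"
 have B: "B > 0" by (simp add: B_def)
 have "isCont (%x. B * abs(exp x - 1)) (0::real)" by (intro continuous_intros)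
 then have "((%x. B * abs(exp x - 1)) \<longlongrightarrow> 0) (at (0::real))" by (auto simp: isCont_def)
 then have "\<forall>\<^sub>F x in at 0. B * abs(exp x - 1) < e" using e by (rule order_tendstoD(2))
 then obtain d where d: "d > 0" "!!x::real. x ~= 0 ==> abs(x) < d ==> B * abs(exp x - 1) < e"
  by (auto simp: eventually_at dist_real_def)
 have "0 < d / 2" using d by simp
 from regularly_varying_uniform_ln[OF pos rv A this] eventually_gt_at_top[of 0]
 show ?thesis
 proof eventually_elim
  case (elim n)
  show ?case
  proof (intro allI impI)
   fix i assume i: "exp (-A) * real n <= real i & real i <= exp A * real n"
   have n: "real n > 0" using elim by simp
   have i0: "real i > 0" using i n by (smt (verit) exp_gt_zero mult_pos_pos)
   define x where "x = ln (a i) - ln (a n) - \<gamma> * ln (real i / real n)"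
   define y where "y = \<gamma> * (ln (real i) - ln (real n))"
   have x: "abs(x) <= d / 2" using elim i by (simp add: x_def)
   have "ln (exp (-A) * real n) <= ln (real i)" "ln (real i) <= ln (exp A * real n)"
    using i i0 n by (auto simp: ln_le_cancel_iff simp del: ln_mult)
   then have "abs(ln (real i) - ln (real n)) <= A" using n by (auto simp: ln_mult)
   then have "abs(y) <= abs(\<gamma>) * A" unfolding y_def abs_mult by (intro mult_left_mono) auto
   then have y: "exp y <= B" unfolding B_def by simp
   have "a i / a n = exp (ln (a i) - ln (a n))" using pos by (simp add: exp_diff)
   also have "... = exp y * exp x" using n i0 by (simp add: x_def y_def ln_div exp_add[symmetric])
   finally have "abs(a i / a n - exp y) = exp y * abs(exp x - 1)"
    by (simp add: abs_mult right_diff_distrib[symmetric] flip: abs_mult)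
     (metis abs_exp_cancel abs_mult mult.right_neutral right_diff_distrib)
   also have "... <= B * abs(exp x - 1)" using y by (intro mult_right_mono) auto
   also have "... <= e" using d(2)[of x] d(1) x e by (cases "x = 0") auto
   finally show "abs(a i / a n - exp (\<gamma> * (ln (real i) - ln (real n)))) <= e" by (simp add: y_def)
  qed
 qed
qed

section \<open>One step of the chain\<close>

definition ramp :: "real => real" where "ramp x = max 0 (min 1 x)"

lemma ramp_bounds: "0 <= ramp x" "ramp x <= 1"
 by (auto simp: ramp_def)

lemma ramp_0: "x <= 0 ==> ramp x = 0" and ramp_1: "1 <= x ==> ramp x = 1"
 by (auto simp: ramp_def)

lemma continuous_on_ramp [continuous_intros]: "continuous_on S f ==> continuous_on S (%x. ramp (f x))"
 unfolding ramp_def by (intro continuous_intros)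

lemma ramp_measurable [measurable]: "ramp \<in> borel_measurable borel"
 unfolding ramp_def[abs_def] by measurable

lemma isCont_mult_zero:
 fixes q c :: "real => real"
 assumes "\<forall>\<^sub>F y in nhds x. c y = 0" shows "isCont (%y. q y * c y) x"
proof -
 have "isCont (%y. 0::real) x" by simp
 moreover have "\<forall>\<^sub>F y in nhds x. q y * c y = 0" using assms by eventually_elim simp
 ultimately show ?thesis using isCont_cong[of "%y. q y * c y" "%y. 0" x] by simp
qed

text \<open>The approximating sequence may change with \<open>eps\<close>, so a different truncation
  can be used for every accuracy.\<close>

lemma tendsto_if_approx:
 fixes s :: "nat => real"
 assumes "!!eps. 0 < eps ==> EX u U. u ----> U & (EV n. abs(s n - u n) <= eps) & abs(S - U) <= eps"
 shows "s ----> S"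
proof (rule tendstoI)
 fix e :: real assume "0 < e"
 then have "0 < e / 4" by simp
 from assms[OF this] obtain u U where u: "u ----> U" "EV n. abs(s n - u n) <= e/4" "abs(S - U) <= e/4" by blast
 have "EV n. dist (u n) U < e/4" using u(1) \<open>0 < e/4\<close> by (rule tendstoD)
 with u(2) show "EV n. dist (s n) S < e"
 proof eventually_elim
  case (elim n)
  then show ?case using u(3) \<open>0 < e\<close> unfolding dist_real_def by linarith
 qed
qed

text \<open>A bounded version of x^2: it vanishes at 0 to second order, so its generator is
  controlled by truncated first and second moments, and it is at least 1/2 once |x| reaches 1, so it
  detects exits. \<open>sat'\<close> is its derivative.\<close>

definition sat :: "real => real" where "sat x = x\<^sup>2 / (1 + x\<^sup>2)"
definition sat' :: "real => real" where "sat' x = 2 * x / (1 + x\<^sup>2)\<^sup>2"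

lemma sat_bounds: "0 <= sat x" "sat x <= 1" "sat 0 = 0"
proof -
 have "0 < 1 + x\<^sup>2" by (simp add: add_pos_nonneg)
 then show "0 <= sat x" "sat x <= 1" by (simp_all add: sat_def divide_le_eq_1)
qed (simp add: sat_def)

lemma sat_half: "1 <= abs(x) ==> 1/2 <= sat x"
 using abs_le_square_iff[of 1 x] by (simp add: sat_def field_simps add_pos_nonneg)

lemma abs_le_half_square: "abs(x) <= (1 + x\<^sup>2) / 2" for x :: real
 using zero_le_power2[of "abs(x) - 1"] by (simp add: power2_diff)

lemma sat_diff: "sat y - sat x = (y - x) * (x + y) / ((1 + x\<^sup>2) * (1 + y\<^sup>2))"
proof -
 have "1 + x\<^sup>2 ~= 0" "1 + y\<^sup>2 ~= 0" by (smt (verit) zero_le_power2)+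
 then show ?thesis unfolding sat_def by (simp add: divide_simps) (simp add: power2_eq_square algebra_simps)
qed

lemma sat_lipschitz: "abs(sat y - sat x) <= abs(y - x)"
proof -
 define A B where "A = 1 + x\<^sup>2" and "B = 1 + y\<^sup>2"
 have AB: "1 <= A" "1 <= B" by (auto simp: A_def B_def)
 have "abs(x + y) <= A / 2 + B / 2" using abs_le_half_square[of x] abs_le_half_square[of y] unfolding A_def B_def by linarith
 also have "... <= A * B" using mult_nonneg_nonneg[of "A - 1" "B - 1"] AB by (simp add: algebra_simps)
 finally have "abs(x + y) / (A * B) <= 1" using AB by (simp add: divide_le_eq_1)
 then have "abs(y - x) * (abs(x + y) / (A * B)) <= abs(y - x) * 1" by (intro mult_left_mono) auto
 moreover have "abs(sat y - sat x) = abs(y - x) * (abs(x + y) / (A * B))"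
  unfolding sat_diff A_def[symmetric] B_def[symmetric] using AB by (simp add: abs_mult)
 ultimately show ?thesis by simp
qed

lemma sat'_bound: "abs(sat' x) <= 1"
proof -
 define A where "A = 1 + x\<^sup>2"
 have A: "1 <= A" by (simp add: A_def)
 have "abs(2 * x) <= A" using abs_le_half_square[of x] by (simp add: A_def abs_mult)
 also have "... <= A\<^sup>2" using A by (simp add: power2_eq_square)
 finally show ?thesis using A unfolding sat'_def A_def[symmetric] by (simp add: divide_le_eq_1)
qed

text \<open>The remainder is exactly (y - x)^2 times a rational function whose numerator is at most
  2 A + B; since A and B are both at most A^2 B, the constant is 3.\<close>

lemma sat_taylor: "abs(sat y - sat x - sat' x * (y - x)) <= 3 * (y - x)\<^sup>2"
proof -
 define A B where "A = 1 + x\<^sup>2" and "B = 1 + y\<^sup>2"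
 have AB: "1 <= A" "1 <= B" by (auto simp: A_def B_def)
 have "sat y - sat x - sat' x * (y - x) = (y - x) * ((x + y) * A - 2 * x * B) / (A\<^sup>2 * B)"
  unfolding sat_diff sat'_def A_def[symmetric] B_def[symmetric] using AB
  by (simp add: field_simps power2_eq_square)
 also have "(x + y) * A - 2 * x * B = (y - x) * (1 - x\<^sup>2 - 2 * x * y)"
  by (simp add: A_def B_def power2_eq_square algebra_simps)
 finally have eq: "sat y - sat x - sat' x * (y - x) = (y - x)\<^sup>2 * ((1 - x\<^sup>2 - 2 * x * y) / (A\<^sup>2 * B))"
  by (simp add: power2_eq_square)
 have "2 * abs(x * y) <= x\<^sup>2 + y\<^sup>2" using sum_squares_bound[of "abs(x)" "abs(y)"] by (simp add: abs_mult)
 then have "abs(1 - x\<^sup>2 - 2 * x * y) <= A + (A + B)" unfolding A_def B_def by (auto simp: abs_le_iff mult.assoc) (smt (verit) zero_le_power2)+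
 also have "... <= 3 * (A\<^sup>2 * B)"
 proof -
  have "A <= A\<^sup>2" using AB by (simp add: power2_eq_square)
  moreover have "A\<^sup>2 <= A\<^sup>2 * B" using AB by simp
  moreover have "B <= A\<^sup>2 * B" using AB mult_right_mono[of 1 "A\<^sup>2" B] by simp
  ultimately show ?thesis by linarith
 qed
 finally have "abs((1 - x\<^sup>2 - 2 * x * y) / (A\<^sup>2 * B)) <= 3" using AB by (simp add: abs_mult divide_le_eq)
 then have "(y - x)\<^sup>2 * abs((1 - x\<^sup>2 - 2 * x * y) / (A\<^sup>2 * B)) <= (y - x)\<^sup>2 * 3" by (intro mult_left_mono) auto
 then show ?thesis unfolding eq by (simp add: abs_mult)
qed

lemma cis_cubic: "abs(cos y - 1 + y\<^sup>2 / 2) <= abs(y) ^ 3" "abs(sin y - y) <= abs(y) ^ 3" for y :: real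
proof -
 define z where "z = iexp y - (\<Sum>k\<le>2. (\<i> * complex_of_real y) ^ k / fact k)"
 have z: "z = Complex (cos y - 1 + y\<^sup>2 / 2) (sin y - y)"
  unfolding z_def cis_conv_exp[symmetric]
  by (simp add: complex_eq_iff numeral_2_eq_2 power_mult_distrib)
 have "cmod z <= abs(y) ^ Suc 2 / fact (Suc 2)" unfolding z_def by (rule iexp_approx1)
 also have "... <= abs(y) ^ 3" 
 proof -
  have "abs(y) ^ 3 / fact 3 <= abs(y) ^ 3 / (1::real)" by (rule divide_left_mono) (simp_all add: fact_numeral)
  then show ?thesis by (simp add: numeral_3_eq_3 numeral_2_eq_2)
 qed
 finally have "cmod z <= abs(y) ^ 3" .
 then show "abs(cos y - 1 + y\<^sup>2 / 2) <= abs(y) ^ 3" "abs(sin y - y) <= abs(y) ^ 3"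
  using abs_Re_le_cmod[of z] abs_Im_le_cmod[of z] by (auto simp: z)
qed

section \<open>Test functions for one step and convergence of its exponent\<close>

locale one_step =
 fixes step :: "nat => nat pmf" and a :: "nat => real" and Lm :: "real measure" and b sigma2 :: real
 assumes step_pos: "!!n. 1 <= n ==> 0 \<notin> set_pmf (step n)"
  and a_pos: "!!n. 0 < a n"
  and Lm: "levy_measure Lm" "emeasure Lm {-1, 1} = 0"
  and A1: "!!f :: ereal => real. continuous_on {0..\<infinity>} f ==>
       (EX K. compact K & K \<subseteq> {0..\<infinity>} - {1} & (\<forall>x\<in>{0..\<infinity>} - K. f x = 0)) ==>
       (%n. a n * pmf_E (step n) (%j. f (ereal (real j / real n))))
        ----> (LINT x|Lm. f (ereal (exp x)))"
  and A2_1: "(%n. a n * pmf_E (step n) (%j. indicator {-1..1} (ln (real j) - ln (real n)) * (ln (real j) - ln (real n)))) ----> b"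
  and sigma2: "0 <= sigma2"
  and A2_2: "(%n. a n * pmf_E (step n) (%j. indicator {-1..1} (ln (real j) - ln (real n)) * (ln (real j) - ln (real n))\<^sup>2))
        ----> sigma2 + (LINT x:{-1..1}|Lm. x\<^sup>2)"
begin

definition E :: "nat => (real => real) => real" where
 "E n g = pmf_E (step n) (%j. g (ln (real j) - ln (real n)))"

lemma sets_Lm [measurable_cong, simp]: "sets Lm = sets borel" using Lm(1) by (simp add: levy_measure_def)

lemma space_Lm [simp]: "space Lm = UNIV" using sets_eq_imp_space_eq[OF sets_Lm] by simp

lemma E_integrable:
 fixes g :: "real => real" and B :: real
 assumes "!!x. abs(g x) <= B" shows "integrable (step n) (%j. g (ln (real j) - ln (real n)))"
 by (rule measure_pmf.integrable_const_bound[where B=B]) (use assms in auto)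

lemma E_mono:
 fixes g h :: "real => real" and B B' :: real
 assumes "!!x. abs(g x) <= B" "!!x. abs(h x) <= B'" "!!x. g x <= h x" shows "E n g <= E n h"
 unfolding E_def by (intro integral_mono E_integrable[where g=g, OF assms(1)] E_integrable[where g=h, OF assms(2)] assms(3))

lemma E_add:
 fixes g h :: "real => real" and B B' :: real
 assumes "!!x. abs(g x) <= B" "!!x. abs(h x) <= B'" shows "E n (%x. g x + h x) = E n g + E n h"
 unfolding E_def by (intro Bochner_Integration.integral_add E_integrable[where g=g, OF assms(1)] E_integrable[where g=h, OF assms(2)])

lemma E_diff:
 fixes g h :: "real => real" and B B' :: real
 assumes "!!x. abs(g x) <= B" "!!x. abs(h x) <= B'" shows "E n (%x. g x - h x) = E n g - E n h"
 unfolding E_def by (intro Bochner_Integration.integral_diff E_integrable[where g=g, OF assms(1)] E_integrable[where g=h, OF assms(2)])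

lemma E_cmult: "E n (%x. c * g x) = c * E n g"
 unfolding E_def by simp

lemma E_const: "E n (%x. c) = c"
 unfolding E_def by simp

lemma E_abs: assumes "!!x. abs(g x) <= B" shows "abs(E n g) <= E n (%x. abs(g x))"
 unfolding E_def using integral_norm_bound[of "step n" "%j. g (ln (real j) - ln (real n))"] by simp

lemma Lm_integrable_min: "integrable Lm (%x. min 1 (x\<^sup>2))"
 using Lm(1) by (intro integrableI_bounded) (auto simp: levy_measure_def)

lemma Lm_integrable:
 assumes [measurable]: "g \<in> borel_measurable borel" and "!!x. abs(g x) <= C * min 1 (x\<^sup>2)"
 shows "integrable Lm g"
proof (rule Bochner_Integration.integrable_bound)
 show "integrable Lm (%x. C * min 1 (x\<^sup>2))" using Lm_integrable_min by simp
 show "AE x in Lm. norm (g x) <= norm (C * min 1 (x\<^sup>2))"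
  using assms(2) by (auto intro!: AE_I2 order_trans[OF assms(2)])
qed measurable

text \<open>(A1) concerns ratios in [0, \<infinity>] without 1; under \<open>ln\<close> the excluded
  point becomes 0. Since \<open>g\<close> is constant beyond R on each side, clamping the ratio to
  [e^-R, e^R] before taking \<open>ln\<close> extends it continuously to the end points 0 and
  \<infinity>. The support avoids 1 because \<open>g\<close> vanishes near 0.\<close>

lemma vague_test:
 fixes g :: "real => real"
 assumes cont: "continuous_on UNIV g" and r: "0 < r" "r <= R" and zero: "!!x. abs(x) < r ==> g x = 0"
  and up: "!!x. R <= x ==> g x = g R" and down: "!!x. x <= - R ==> g x = g (- R)"
 shows "(%n. a n * E n g) ----> (LINT x|Lm. g x)"
proof -
 define k where "k z = max (ereal (exp (- R))) (min (ereal (exp R)) z)" for z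
 define f where "f z = g (ln (real_of_ereal (k z)))" for z
 have RR: "exp (- R) <= exp R" using r by simp
 have k_fin: "ereal (exp (- R)) <= k z" "k z <= ereal (exp R)" for z
  using RR by (auto simp: k_def)
 have k_ne: "k z ~= \<infinity>" "k z ~= -\<infinity>" for z
  using le_less_trans[OF k_fin(2)[of z], of \<infinity>] less_le_trans[OF _ k_fin(1)[of z], of "-\<infinity>"] by auto
 have ck: "continuous_on {0..\<infinity>} k" unfolding k_def by (intro continuous_intros)
 have k_pos: "0 < real_of_ereal (k z)" for z
  using k_fin(1)[of z] k_ne[of z] by (cases "k z") (auto intro: less_le_trans[OF exp_gt_zero])
 have "continuous_on {0..\<infinity>} (%z. real_of_ereal (k z))"
  by (rule continuous_on_compose2[OF continuous_on_real ck]) (use k_ne in auto)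
 then have cf: "continuous_on {0..\<infinity>} f"
  unfolding f_def using k_pos
  by (intro continuous_on_compose2[OF cont]) (auto intro!: continuous_intros simp: less_imp_neq[symmetric])
 have kexp: "ln (real_of_ereal (k (ereal (exp x)))) = max (- R) (min R x)" for x
 proof -
  have "k (ereal (exp x)) = ereal (exp (max (- R) (min R x)))"
   by (auto simp: k_def max_def min_def)
  then show ?thesis by simp
 qed
 have fexp: "f (ereal (exp x)) = g x" for x
  unfolding f_def kexp using up[of x] down[of x] r by (auto simp: max_def min_def)
 define K where "K = {0..ereal (exp (- r))} \<union> {ereal (exp r)..\<infinity>}"
 have K: "compact K & K \<subseteq> {0..\<infinity>} - {1} & (\<forall>x\<in>{0..\<infinity>} - K. f x = 0)"
 proof (intro conjI ballI)
  show "compact K" unfolding K_def by (intro compact_Un) (simp_all add: compact_eq_closed)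
  have "ereal (exp (- r)) < 1" "1 < ereal (exp r)" using r by (auto simp: one_ereal_def)
  moreover have "0 <= ereal (exp r)" by simp
  ultimately show "K \<subseteq> {0..\<infinity>} - {1}" unfolding K_def using order_trans[of 0 "ereal (exp r)"] by auto
  fix z assume z: "z \<in> {0..\<infinity>} - K"
  then have "z ~= \<infinity>" "0 <= z" "ereal (exp (- r)) < z" "z < ereal (exp r)" by (auto simp: K_def)
  then obtain y where y: "z = ereal y" "exp (- r) < y" "y < exp r" by (cases z) auto
  then have y0: "y > 0" using exp_gt_zero[of "- r"] by linarith
  have "ln (exp (- r)) < ln y" "ln y < ln (exp r)" using y y0 by (auto simp del: ln_exp)
  then have "abs(ln y) < r" by simp
  then have "g (ln y) = 0" by (rule zero)
  then show "f z = 0" using fexp[of "ln y"] y0 y(1) by simp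
 qed
 have "(%n. a n * pmf_E (step n) (%j. f (ereal (real j / real n)))) ----> (LINT x|Lm. f (ereal (exp x)))"
  by (rule A1[OF cf]) (use K in blast)
 then have lim: "(%n. a n * pmf_E (step n) (%j. f (ereal (real j / real n)))) ----> (LINT x|Lm. g x)"
  by (simp add: fexp)
 have "EV n. a n * pmf_E (step n) (%j. f (ereal (real j / real n))) = a n * E n g"
  using eventually_ge_at_top[of "1::nat"]
 proof eventually_elim
  case (elim n)
  have "pmf_E (step n) (%j. f (ereal (real j / real n))) = E n g"
   unfolding E_def
  proof (rule integral_cong_AE)
   show "AE j in step n. f (ereal (real j / real n)) = g (ln (real j) - ln (real n))"
   proof (rule AE_pmfI)
    fix j assume "j \<in> set_pmf (step n)"
    then have j: "real j > 0" using step_pos[OF elim] by (cases j) auto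
    then show "f (ereal (real j / real n)) = g (ln (real j) - ln (real n))"
     using fexp[of "ln (real j) - ln (real n)"] elim by (simp add: exp_diff)
   qed
  qed auto
  then show ?case by simp
 qed
 from tendsto_cong[OF this] lim show ?thesis by simp
qed

text \<open>Majorants for the errors below. \<open>wI\<close> is the truncated square of (A2);
  \<open>w1 r\<close> is 1 within r of the points 1 and -1, where the truncation jumps;
  \<open>wR R\<close> is 1 beyond R + 1 and 0 up to R; \<open>wt\<close> is 1 for |x| >= 1 and 0 for
  |x| <= 1/2.\<close>

definition wI :: "real => real" where "wI x = indicator {-1..1} x * x\<^sup>2"
definition w1 :: "real => real => real" where "w1 r x = ramp (2 - \<bar>\<bar>x\<bar> - 1\<bar> / r)"
definition wR :: "real => real => real" where "wR R x = ramp (abs(x) - R)"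
definition wt :: "real => real" where "wt x = ramp (2 * abs(x) - 1)"

lemma wI_bounds: "0 <= wI x" "wI x <= 1" "wI x <= min 1 (x\<^sup>2)"
 by (auto simp: wI_def indicator_def abs_square_le_1 abs_le_iff)

lemma w1_bounds: "0 <= w1 r x" "w1 r x <= 1"
 and wR_bounds: "0 <= wR R x" "wR R x <= 1"
 and wt_bounds: "0 <= wt x" "wt x <= 1"
 by (auto simp: w1_def wR_def wt_def ramp_bounds)

lemma w_measurable [measurable]: "wI \<in> borel_measurable borel" "w1 r \<in> borel_measurable borel"
 "wR R \<in> borel_measurable borel" "wt \<in> borel_measurable borel"
 unfolding wI_def[abs_def] w1_def[abs_def] wR_def[abs_def] wt_def[abs_def] by measurable

lemma half_le_square: "1/2 <= abs(x) ==> 1 <= 4 * min 1 (x\<^sup>2)" for x :: real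
proof -
 assume "1/2 <= abs(x)"
 then have "(1/2)\<^sup>2 <= \<bar>x\<bar>\<^sup>2" by (intro power_mono) auto
 then show ?thesis by (auto simp: min_def power2_eq_square)
qed

lemma w1_le: assumes "0 < r" "r <= 1/4" shows "abs(w1 r x) <= 4 * min 1 (x\<^sup>2)"
proof (cases "1/2 <= abs(x)")
 case True
 then show ?thesis using half_le_square[OF True] w1_bounds[of r x] by linarith
next
 case False
 then have "2 * r <= \<bar>\<bar>x\<bar> - 1\<bar>" using assms by auto
 then have "2 <= \<bar>\<bar>x\<bar> - 1\<bar> / r" using assms by (simp add: field_simps)
 then show ?thesis by (simp add: w1_def ramp_0)
qed

lemma wR_le: assumes "1/2 <= R" shows "abs(wR R x) <= 4 * min 1 (x\<^sup>2)"
proof (cases "1/2 <= abs(x)")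
 case True
 then show ?thesis using half_le_square[OF True] wR_bounds[of R x] by linarith
next
 case False
 then show ?thesis using assms by (simp add: wR_def ramp_0)
qed

lemma w1_tendsto: assumes "0 < r" "r <= 1/4" shows "(%n. a n * E n (w1 r)) ----> (LINT x|Lm. w1 r x)"
proof (rule vague_test[where r="1/2" and R=2])
 show "continuous_on UNIV (w1 r)" unfolding w1_def[abs_def] using assms by (intro continuous_intros) auto
 have *: "w1 r x = 0" if "1/2 <= \<bar>\<bar>x\<bar> - 1\<bar>" for x
 proof -
  have "2 * r <= \<bar>\<bar>x\<bar> - 1\<bar>" using that assms by auto
  then have "2 <= \<bar>\<bar>x\<bar> - 1\<bar> / r" using assms by (simp add: field_simps)
  then show ?thesis by (simp add: w1_def ramp_0)
 qed
 show "w1 r x = 0" if "abs(x) < 1/2" for x using that by (intro *) auto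
 show "w1 r x = w1 r 2" if "2 <= x" for x using that *[of x] *[of 2] by auto
 show "w1 r x = w1 r (- 2)" if "x <= - 2" for x using that *[of x] *[of "-2"] by auto
qed auto

lemma wR_tendsto: assumes "1/2 <= R" shows "(%n. a n * E n (wR R)) ----> (LINT x|Lm. wR R x)"
proof (rule vague_test[where r="1/2" and R="R+1"])
 show "continuous_on UNIV (wR R)" unfolding wR_def[abs_def] by (intro continuous_intros)
qed (use assms in "auto simp: wR_def ramp_0 ramp_1")

lemma wt_tendsto: "(%n. a n * E n wt) ----> (LINT x|Lm. wt x)"
proof (rule vague_test[where r="1/2" and R="1"])
 show "continuous_on UNIV wt" unfolding wt_def[abs_def] by (intro continuous_intros)
qed (auto simp: wt_def ramp_0 ramp_1)

definition V :: real where "V = sigma2 + (LINT x|Lm. wI x)"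

lemma wI_tendsto: "(%n. a n * E n wI) ----> V"
 using A2_2 by (simp add: E_def wI_def V_def set_lebesgue_integral_def)

lemma wI_integrable: "integrable Lm wI"
 by (rule Lm_integrable[where C=1]) (use wI_bounds in "auto simp: abs_of_nonneg")

lemma V_ge: "(LINT x|Lm. wI x) <= V" "0 <= V"
proof -
 have "0 <= (LINT x|Lm. wI x)" by (intro integral_nonneg_AE) (simp add: wI_bounds)
 then show "(LINT x|Lm. wI x) <= V" "0 <= V" using sigma2 by (auto simp: V_def)
qed

lemma wR_small: assumes "0 < eps" obtains R where "1 <= R" "(LINT x|Lm. wR R x) < eps"
proof -
 have "(%k. LINT x|Lm. wR (real (Suc k)) x) ----> (LINT x|Lm. 0)"
 proof (rule integral_dominated_convergence[where w="%x. 4 * min 1 (x\<^sup>2)"])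
  show "AE x in Lm. (%k. wR (real (Suc k)) x) ----> 0"
  proof (rule AE_I2)
   fix x
   obtain k0 :: nat where k0: "abs(x) <= real k0" using real_arch_simple by blast
   have "EV k. wR (real (Suc k)) x = 0"
    using eventually_ge_at_top[of k0] by eventually_elim (use k0 in "auto simp: wR_def ramp_0")
   then show "(%k. wR (real (Suc k)) x) ----> 0" by (rule tendsto_eventually)
  qed
  show "AE x in Lm. norm (wR (real (Suc k)) x) <= 4 * min 1 (x\<^sup>2)" for k
   using wR_le[of "real (Suc k)"] by (intro AE_I2) simp
 qed (use Lm_integrable_min in auto)
 then have "EV k. (LINT x|Lm. wR (real (Suc k)) x) < eps" using assms by (intro order_tendstoD(2)) auto
 then obtain k where "(LINT x|Lm. wR (real (Suc k)) x) < eps" using eventually_happens'[OF sequentially_bot] by blast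
 then show ?thesis using that[of "real (Suc k)"] by simp
qed

text \<open>As r tends to 0, \<open>w1 r\<close> tends to the indicator of {-1, 1}, a null set of
  the limit measure, and it is dominated by a multiple of min 1 x^2.\<close>

lemma w1_small: assumes "0 < eps" obtains r where "0 < r" "r <= 1/4" "r < eps" "(LINT x|Lm. w1 r x) < eps"
proof -
 define q where "q k = 1 / real (Suc (k + 3))" for k
 have q: "0 < q k" "q k <= 1/4" for k by (auto simp: q_def field_simps)
 have "(%k. 1 / real (Suc k)) ----> 0" using LIMSEQ_inverse_real_of_nat by (simp add: inverse_eq_divide)
 then have q0: "q ----> 0" unfolding q_def by (rule LIMSEQ_ignore_initial_segment)
 have "(%k. LINT x|Lm. w1 (q k) x) ----> (LINT x|Lm. indicator {-1, 1} x)"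
 proof (rule integral_dominated_convergence[where w="%x. 4 * min 1 (x\<^sup>2)"])
  show "AE x in Lm. (%k. w1 (q k) x) ----> indicator {-1, 1} x"
  proof (rule AE_I2)
   fix x :: real
   show "(%k. w1 (q k) x) ----> indicator {-1, 1} x"
   proof (cases "abs(x) = 1")
    case True
    then show ?thesis by (auto simp: w1_def ramp_1 indicator_def abs_if split: if_splits)
   next
    case False
    then have d: "\<bar>\<bar>x\<bar> - 1\<bar> / 2 > 0" by simp
    have "EV k. q k < \<bar>\<bar>x\<bar> - 1\<bar> / 2" using q0 d by (rule order_tendstoD)
    then have "EV k. w1 (q k) x = 0"
    proof eventually_elim
     case (elim k)
     then have "2 <= \<bar>\<bar>x\<bar> - 1\<bar> / q k" using q[of k] by (simp add: field_simps)
     then show ?case by (simp add: w1_def ramp_0)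
    qed
    moreover have "indicator {-1, 1} x = (0::real)" using False by (auto simp: indicator_def)
    ultimately show ?thesis by (simp add: tendsto_eventually)
   qed
  qed
  show "AE x in Lm. norm (w1 (q k) x) <= 4 * min 1 (x\<^sup>2)" for k
   using w1_le[OF q] by (intro AE_I2) simp
 qed (use Lm_integrable_min in auto)
 moreover have "(LINT x|Lm. indicator {-1, 1} x) = (0::real)" using Lm(2) by (simp add: measure_def)
 ultimately have "EV k. (LINT x|Lm. w1 (q k) x) < eps" using assms by (intro order_tendstoD(2)) auto
 moreover have "EV k. q k < eps" using q0 assms by (rule order_tendstoD)
 ultimately have "EV k. (LINT x|Lm. w1 (q k) x) < eps & q k < eps" by eventually_elim simp
 then obtain k where "(LINT x|Lm. w1 (q k) x) < eps" "q k < eps" using eventually_happens'[OF sequentially_bot] by blast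
 then show ?thesis using that[of "q k"] q by simp
qed

text \<open>Cutting \<open>q\<close> off near 0, near the points 1 and -1 and near infinity leaves a
  function for \<open>vague_test\<close>. Near 0 the discarded part is at most 2 C r x^2, and the
  scaled second moments stay bounded; near 1, -1 and infinity the discarded mass is small by
  \<open>w1_small\<close> and \<open>wR_small\<close>. The cubic bound at 0 is why the quadratic
  part of an exponential has to be split off and left to (A2).\<close>

lemma cubic_test:
 fixes q :: "real => real"
 assumes qm [measurable]: "q \<in> borel_measurable borel" and C: "0 < C" "!!x. abs(q x) <= C" "!!x. abs(x) <= 1 ==> abs(q x) <= C * abs(x) ^ 3"
  and cont: "!!x. x ~= 1 ==> x ~= -1 ==> isCont q x"
 shows "(%n. a n * E n q) ----> (LINT x|Lm. q x)" "integrable Lm q"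
proof -
 have qmin: "abs(q x) <= C * min 1 (x\<^sup>2)" for x
 proof (cases "abs(x) <= 1")
  case True
  have x32: "abs(x) ^ 3 <= abs(x) ^ 2" using True by (intro power_decreasing) auto
  then have "abs(q x) <= C * x\<^sup>2" using order_trans[OF C(3)[OF True] mult_left_mono[OF x32, of C]] C(1) by simp
  then show ?thesis using True C(2)[of x] by (auto simp: min_def)
 next
  case False
  then have "1 <= x\<^sup>2" using abs_square_le_1[of x] by linarith
  then show ?thesis using C(2)[of x] by (simp add: min_def)
 qed
 show iq: "integrable Lm q" by (rule Lm_integrable[OF qm qmin])
 show "(%n. a n * E n q) ----> (LINT x|Lm. q x)"
 proof (rule tendsto_if_approx)
  fix eps :: real assume e: "0 < eps"
  \<comment> \<open>The three error terms add up to less than C eps' (2 V + 2).\<close>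
  define eps' where "eps' = eps / (C * (2 * (V + 1) + 4))"
  have den: "C * (2 * (V + 1) + 4) > 0" using C(1) V_ge(2) by simp
  have e': "eps' > 0" using e den by (simp add: eps'_def)
  have ee: "C * (eps' * (2 * (V + 1) + 4)) = eps" using den by (simp add: eps'_def field_simps)
  obtain r where r: "0 < r" "r <= 1/4" "r < eps'" "(LINT x|Lm. w1 r x) < eps'" using w1_small[OF e'] by blast
  obtain R where R: "1 <= R" "(LINT x|Lm. wR R x) < eps'" using wR_small[OF e'] by blast
  define w0 where "w0 x = ramp (2 - abs(x) / r)" for x
  define c where "c x = (1 - w0 x) * (1 - w1 r x) * (1 - wR R x)" for x
  have w0: "0 <= w0 x" "w0 x <= 1" for x by (auto simp: w0_def ramp_bounds)
  have [measurable]: "w0 \<in> borel_measurable borel" "c \<in> borel_measurable borel" unfolding w0_def[abs_def] c_def[abs_def] by measurable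
  have cc: "continuous_on UNIV c" unfolding c_def[abs_def] w0_def w1_def wR_def using r by (intro continuous_intros) auto
  have c01: "0 <= c x" "c x <= 1" for x
   using w0[of x] w1_bounds[of r x] wR_bounds[of R x] unfolding c_def by (auto intro!: mult_nonneg_nonneg mult_le_one)
  \<comment> \<open>A union bound for weights: a product of factors 1 - w falls short of 1 by at
    most the sum of the w.\<close>
  have c1: "1 - c x <= w0 x + w1 r x + wR R x" for x
  proof -
   have *: "1 - (1 - p) * (1 - q) <= p + q" if "0 <= p" "0 <= q" for p q :: real
    using mult_nonneg_nonneg[OF that] by (simp add: algebra_simps)
   have "1 - c x = 1 - (1 - (1 - (1 - w0 x) * (1 - w1 r x))) * (1 - wR R x)" by (simp add: c_def)
   also have "... <= (1 - (1 - w0 x) * (1 - w1 r x)) + wR R x"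
   proof (rule *)
    have "(1 - w0 x) * (1 - w1 r x) <= 1" using w0[of x] w1_bounds[of r x] by (intro mult_le_one) auto
    then show "0 <= 1 - (1 - w0 x) * (1 - w1 r x)" by simp
   qed (rule w1_bounds wR_bounds)
   also have "... <= w0 x + w1 r x + wR R x" using *[OF w0(1)[of x] w1_bounds(1)[of r x]] by simp
   finally show ?thesis .
  qed
  define g where "g x = q x * c x" for x
  have gm [measurable]: "g \<in> borel_measurable borel" unfolding g_def by measurable
  have gb: "abs(g x) <= C" for x
   unfolding g_def abs_mult using C(1) C(2)[of x] c01[of x] mult_mono[of "abs(q x)" C "abs(c x)" 1] by auto
  have near1: "c y = 0" if "\<bar>\<bar>y\<bar> - 1\<bar> <= r" for y
  proof -
   have "\<bar>\<bar>y\<bar> - 1\<bar> / r <= 1" using that r by simp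
   then show ?thesis by (simp add: c_def w1_def ramp_1)
  qed
  have "isCont g x" for x
  proof (cases "x = 1 \<or> x = -1")
   case True
   have "\<forall>\<^sub>F y in nhds x. abs(y - x) < r"
    using r(1) eventually_nhds_metric[of "%y. abs(y - x) < r" x] by (auto simp: dist_real_def)
   then have "\<forall>\<^sub>F y in nhds x. c y = 0"
    by eventually_elim (rule near1, use True in auto)
   then show ?thesis unfolding g_def by (rule isCont_mult_zero)
  next
   case False
   then show ?thesis unfolding g_def using cc by (intro continuous_intros cont) (auto simp: continuous_on_eq_continuous_at)
  qed
  then have gc: "continuous_on UNIV g" by (simp add: continuous_at_imp_continuous_on)
  have glim: "(%n. a n * E n g) ----> (LINT x|Lm. g x)"
  proof (rule vague_test[OF gc r(1), where R="R+1"])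
   show "r <= R + 1" using r R by simp
   show "g x = 0" if "abs(x) < r" for x
   proof -
    have "abs(x) / r <= 1" using that r by simp
    then show ?thesis by (simp add: g_def c_def w0_def ramp_1)
   qed
   have z: "g x = 0" if "R + 1 <= abs(x)" for x using that by (simp add: g_def c_def wR_def ramp_1)
   show "g x = g (R + 1)" if "R + 1 <= x" for x using that z[of x] z[of "R+1"] R by auto
   show "g x = g (- (R + 1))" if "x <= - (R + 1)" for x using that z[of x] z[of "- (R+1)"] R by auto
  qed
  define u where "u x = C * (2 * r) * wI x + C * w1 r x + C * wR R x" for x
  have qg: "abs(q x - g x) <= u x" for x
  proof -
   have "abs(q x - g x) = abs(q x) * (1 - c x)" using c01[of x] by (simp add: g_def abs_mult flip: right_diff_distrib abs_mult)
     (metis (no_types, opaque_lifting) abs_mult abs_of_nonneg diff_ge_0_iff_ge mult.right_neutral right_diff_distrib')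
   also have "... <= abs(q x) * (w0 x + w1 r x + wR R x)" by (intro mult_left_mono c1) auto
   also have "... = abs(q x) * w0 x + abs(q x) * w1 r x + abs(q x) * wR R x" by (simp add: algebra_simps)
   also have "abs(q x) * w0 x <= C * (2 * r) * wI x"
   proof (cases "abs(x) <= 2 * r")
    case True
    then have x1: "abs(x) <= 1" using r by simp
    have "abs(q x) * w0 x <= (C * abs(x) ^ 3) * 1" using C(3)[OF x1] w0[of x] C(1) by (intro mult_mono) auto
    also have "... = C * (abs(x) * x\<^sup>2)" by (simp add: power3_eq_cube power2_eq_square)
    also have "... <= C * ((2 * r) * x\<^sup>2)" using True C(1) by (intro mult_left_mono mult_right_mono) auto
    finally show ?thesis using x1 by (simp add: wI_def abs_le_iff mult_ac)
   next
    case False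
    then have "2 <= abs(x) / r" using r by (simp add: field_simps)
    then have "w0 x = 0" by (simp add: w0_def ramp_0)
    then show ?thesis using C(1) r wI_bounds[of x] by simp
   qed
   also have "abs(q x) * w1 r x <= C * w1 r x" by (intro mult_right_mono C w1_bounds wR_bounds)
   also have "abs(q x) * wR R x <= C * wR R x" by (intro mult_right_mono C w1_bounds wR_bounds)
   finally show ?thesis by (simp add: u_def)
  qed
  have ub: "abs(u x) <= C * (2 * r) + C + C" for x
  proof -
   have "0 <= u x" unfolding u_def using C(1) r wI_bounds(1)[of x] w1_bounds[of r x] wR_bounds[of R x] by simp
   moreover have "u x <= C * (2 * r) * 1 + C * 1 + C * 1" unfolding u_def
    using C(1) r wI_bounds(2)[of x] w1_bounds[of r x] wR_bounds[of R x] by (intro add_mono mult_left_mono) auto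
   ultimately show ?thesis by simp
  qed
  have Eu: "E n u = C * (2 * r) * E n wI + C * E n (w1 r) + C * E n (wR R)" for n
  proof -
   have b1: "abs(C * (2 * r) * wI x) <= C * (2 * r)" for x using C(1) r wI_bounds(1,2)[of x] by (simp add: abs_mult)
   have b2: "abs(C * w1 r x) <= C" "abs(C * wR R x) <= C" for x using C(1) w1_bounds[of r x] wR_bounds[of R x] by (auto simp: abs_mult)
   have b3: "abs(C * (2 * r) * wI x + C * w1 r x) <= C * (2 * r) + C" for x
    using b1[of x] b2[of x] by linarith
   show ?thesis unfolding u_def E_add[OF b3 b2(2)] E_add[OF b1 b2(1)] by (simp only: E_cmult)
  qed
  have "(%n. C * (2 * r) * (a n * E n wI) + C * (a n * E n (w1 r)) + C * (a n * E n (wR R))) ---->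
   C * (2 * r) * V + C * (LINT x|Lm. w1 r x) + C * (LINT x|Lm. wR R x)"
   using r R by (intro tendsto_intros wI_tendsto w1_tendsto wR_tendsto) auto
  then have ulim: "(%n. a n * E n u) ----> C * (2 * r) * V + C * (LINT x|Lm. w1 r x) + C * (LINT x|Lm. wR R x)"
   unfolding Eu by (simp add: algebra_simps)
  have small: "C * (2 * r) * V + C * (LINT x|Lm. w1 r x) + C * (LINT x|Lm. wR R x) < eps"
  proof -
   have "r * V <= eps' * V" using r V_ge(2) by (intro mult_right_mono) auto
   then have "2 * r * V + (LINT x|Lm. w1 r x) + (LINT x|Lm. wR R x) < eps' * (2 * (V + 1) + 4)"
    using r(4) R(2) e' by (simp add: algebra_simps)
   from mult_strict_left_mono[OF this C(1)] show ?thesis unfolding ee by (simp add: algebra_simps)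
  qed
  have evu: "EV n. a n * E n u < eps" using ulim small by (rule order_tendstoD(2))
  have ev: "EV n. abs(a n * E n q - a n * E n g) <= eps"
   using evu
  proof eventually_elim
   case (elim n)
   have qgb: "abs(q x - g x) <= 2 * C" for x using C(2)[of x] gb[of x] by linarith
   have "abs(E n q - E n g) = abs(E n (%x. q x - g x))" using E_diff[OF C(2) gb] by simp
   also have "... <= E n (%x. abs(q x - g x))" by (rule E_abs[OF qgb])
   also have "... <= E n u" by (rule E_mono[OF _ ub qg]) (use qgb in auto)
   finally have "a n * abs(E n q - E n g) <= a n * E n u" using a_pos[of n] by simp
   moreover have "abs(a n * E n q - a n * E n g) = a n * abs(E n q - E n g)"
    using a_pos[of n] by (simp add: abs_mult flip: right_diff_distrib)
   ultimately show ?case using elim by linarith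
  qed
  have g_le: "abs(g x) <= C * min 1 (x\<^sup>2)" for x
   unfolding g_def abs_mult using qmin[of x] c01[of x] mult_mono[of "abs(q x)" "C * min 1 (x\<^sup>2)" "abs(c x)" 1] by auto
  have ig: "integrable Lm g" by (rule Lm_integrable[OF gm g_le])
  have i1: "integrable Lm (w1 r)" by (rule Lm_integrable[OF _ w1_le[OF r(1,2)]]) simp
  have i2: "integrable Lm (wR R)" by (rule Lm_integrable[OF _ wR_le]) (use R in auto)
  have iu: "integrable Lm u" unfolding u_def using i1 i2 wI_integrable by (intro Bochner_Integration.integrable_add integrable_mult_right)
  have "abs((LINT x|Lm. q x) - (LINT x|Lm. g x)) = abs(LINT x|Lm. q x - g x)" using iq ig by simp
  also have "... <= (LINT x|Lm. abs(q x - g x))" using integral_norm_bound[of Lm "%x. q x - g x"] by simp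
  also have "... <= (LINT x|Lm. u x)" using iq ig iu qg by (intro integral_mono) auto
  also have "... = C * (2 * r) * (LINT x|Lm. wI x) + C * (LINT x|Lm. w1 r x) + C * (LINT x|Lm. wR R x)"
   unfolding u_def using i1 i2 wI_integrable by simp
  also have "... <= C * (2 * r) * V + C * (LINT x|Lm. w1 r x) + C * (LINT x|Lm. wR R x)"
   using V_ge(1) C(1) r by (intro add_mono mult_left_mono) auto
  also have "... <= eps" using small by simp
  finally show "EX u U. u ----> U & (EV n. abs(a n * E n q - u n) <= eps) & abs((LINT x|Lm. q x) - U) <= eps"
   using glim ev by blast
 qed
qed

definition wid :: "real => real" where "wid x = indicator {-1..1} x * x"

lemma wid_bounds: "abs(wid x) <= 1" by (auto simp: wid_def indicator_def)

lemma wid_tendsto: "(%n. a n * E n wid) ----> b"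
 using A2_1 by (simp add: E_def wid_def)

lemma isCont_unit_indicator: "x ~= 1 ==> x ~= -1 ==> isCont (indicator {-1..1} :: real => real) x"
 unfolding isCont_indicator by (simp add: frontier_def)

text \<open>After adding l^2 \<open>wI\<close> / 2 to the real part and subtracting l
  \<open>wid\<close> from the imaginary part, both are cubic at 0 and jump only at 1 and -1, so
  \<open>cubic_test\<close> applies. The split-off terms converge by (A2); the scaled mean of
  \<open>wI\<close> has a limit exceeding its integral by \<open>sigma2\<close>, and this excess is
  the Gaussian part of the exponent.\<close>

lemma char_tendsto:
 "(%n. complex_of_real (a n) * (pmf_E (step n) (%j. cis (l * (ln (real j) - ln (real n)))) - 1))
  ----> levy_exponent b sigma2 Lm l"
proof -
 define qr where "qr x = cos (l * x) - 1 + l\<^sup>2 / 2 * wI x" for x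
 define qi where "qi x = sin (l * x) - l * wid x" for x
 define C where "C = abs(l) ^ 3 + 2 + l\<^sup>2 + abs(l)"
 have C: "C > 0" unfolding C_def by (intro add_pos_nonneg add_nonneg_pos) auto
 have C3: "abs(l * x) ^ 3 <= C * abs(x) ^ 3" for x
 proof -
  have "abs(l) ^ 3 * abs(x) ^ 3 <= C * abs(x) ^ 3" unfolding C_def by (intro mult_right_mono) auto
  then show ?thesis by (simp add: abs_mult power_mult_distrib)
 qed
 have cont: "isCont wI x" "isCont wid x" if "x ~= 1" "x ~= -1" for x
  unfolding wI_def[abs_def] wid_def[abs_def] using isCont_unit_indicator[OF that] by (intro continuous_intros; simp)+
 have [measurable]: "wid \<in> borel_measurable borel" unfolding wid_def[abs_def] by measurable
 have qrm: "qr \<in> borel_measurable borel" unfolding qr_def[abs_def] by measurable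
 have qrb: "abs(qr x) <= C" for x
  proof -
   have "abs(l\<^sup>2 / 2 * wI x) <= l\<^sup>2" using wI_bounds(1,2)[of x] mult_mono[of "l\<^sup>2 / 2" "l\<^sup>2" "wI x" 1] by (simp add: abs_mult)
   moreover have "abs(cos (l * x)) <= 1" by simp
   moreover have "0 <= abs(l) ^ 3" by simp
   ultimately show ?thesis unfolding qr_def C_def by linarith
  qed
 have qr3: "abs(qr x) <= C * abs(x) ^ 3" if "abs(x) <= 1" for x
   using cis_cubic(1)[of "l * x"] C3[of x] that by (simp add: qr_def wI_def abs_le_iff power_mult_distrib)
 have qrc: "isCont qr x" if "x ~= 1" "x ~= -1" for x unfolding qr_def using cont(1)[OF that] by (intro continuous_intros)
 note qr = cubic_test[OF qrm C qrb qr3 qrc]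
 have qim: "qi \<in> borel_measurable borel" unfolding qi_def[abs_def] by measurable
 have qib: "abs(qi x) <= C" for x
  proof -
   have "abs(l * wid x) <= abs(l)" using wid_bounds[of x] mult_left_mono[of "abs(wid x)" 1 "abs(l)"] by (simp add: abs_mult)
   moreover have "abs(sin (l * x)) <= 1" by simp
   moreover have "0 <= abs(l) ^ 3" "0 <= l\<^sup>2" by simp_all
   ultimately show ?thesis unfolding qi_def C_def by linarith
  qed
 have qi3: "abs(qi x) <= C * abs(x) ^ 3" if "abs(x) <= 1" for x
   using cis_cubic(2)[of "l * x"] C3[of x] that by (simp add: qi_def wid_def abs_le_iff)
 have qic: "isCont qi x" if "x ~= 1" "x ~= -1" for x unfolding qi_def using cont(2)[OF that] by (intro continuous_intros)
 note qi = cubic_test[OF qim C qib qi3 qic]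
 define c where "c x = cos (l * x) - 1" for x
 have c_eq: "c x = qr x - l\<^sup>2 / 2 * wI x" for x by (simp add: c_def qr_def)
 have ic: "integrable Lm c" "(LINT x|Lm. c x) = (LINT x|Lm. qr x) - l\<^sup>2 / 2 * (LINT x|Lm. wI x)"
  unfolding c_eq using qr(2) wI_integrable by auto
 have cb: "abs(cos (l * x)) <= 1" "abs(sin (l * x)) <= 1" for x by auto
 have Ere: "a n * (E n (%x. cos (l * x)) - 1) = a n * E n qr - l\<^sup>2 / 2 * (a n * E n wI)" for n
 proof -
  have w: "abs(l\<^sup>2 / 2 * wI x) <= l\<^sup>2 / 2" for x using wI_bounds(1,2)[of x] by (simp add: abs_mult mult_left_le)
  have c2: "abs(cos (l * x) - 1) <= 2" for x using cb(1)[of x] by linarith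
  have "E n qr = E n (%x. cos (l * x) - 1) + E n (%x. l\<^sup>2 / 2 * wI x)" unfolding qr_def by (rule E_add[OF c2 w])
  also have "E n (%x. cos (l * x) - 1) = E n (%x. cos (l * x)) - 1"
   using E_diff[where g="%x. cos (l * x)" and h="%_. 1" and B=1 and B'=1 and n=n] by (simp add: E_const)
  finally have "E n (%x. cos (l * x)) - 1 = E n qr - l\<^sup>2 / 2 * E n wI" unfolding E_cmult by simp
  then show ?thesis by (simp add: right_diff_distrib mult.left_commute)
 qed
 have Eim: "a n * E n (%x. sin (l * x)) = a n * E n qi + l * (a n * E n wid)" for n
 proof -
  have w: "abs(l * wid x) <= abs(l)" for x using wid_bounds[of x] by (simp add: abs_mult mult_left_le)
  have "E n qi = E n (%x. sin (l * x)) - E n (%x. l * wid x)" unfolding qi_def by (rule E_diff[OF cb(2) w])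
  then have "E n (%x. sin (l * x)) = E n qi + l * E n wid" unfolding E_cmult by simp
  then show ?thesis by (simp add: distrib_left mult.left_commute)
 qed
 have Lre: "(%n. a n * (E n (%x. cos (l * x)) - 1)) ----> (LINT x|Lm. c x) - sigma2 * l\<^sup>2 / 2"
 proof -
  have "(%n. a n * (E n (%x. cos (l * x)) - 1)) ----> (LINT x|Lm. qr x) - l\<^sup>2 / 2 * V"
   unfolding Ere by (intro tendsto_intros qr wI_tendsto)
  moreover have "(LINT x|Lm. qr x) - l\<^sup>2 / 2 * V = (LINT x|Lm. c x) - sigma2 * l\<^sup>2 / 2"
   by (simp add: ic V_def distrib_left distrib_right add_divide_distrib mult.commute)
  ultimately show ?thesis by simp
 qed
 have Lim: "(%n. a n * E n (%x. sin (l * x))) ----> (LINT x|Lm. qi x) + l * b"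
  unfolding Eim by (intro tendsto_intros qi wid_tendsto)
 have expect: "pmf_E (step n) (%j. cis (l * (ln (real j) - ln (real n)))) = Complex (E n (%x. cos (l * x))) (E n (%x. sin (l * x)))" for n
 proof -
  have "integrable (step n) (%j. cis (l * (ln (real j) - ln (real n))))"
   by (rule measure_pmf.integrable_const_bound[where B=1]) auto
  from integral_Re[OF this] integral_Im[OF this] show ?thesis
   by (simp add: complex_eq_iff E_def)
 qed
 have levy: "levy_exponent b sigma2 Lm l = Complex ((LINT x|Lm. c x) - sigma2 * l\<^sup>2 / 2) ((LINT x|Lm. qi x) + l * b)"
 proof -
  have "cis (l * x) - 1 - \<i> * complex_of_real (l * x * indicator {-1..1} x) = complex_of_real (c x) + \<i> * complex_of_real (qi x)" for x
   by (simp add: complex_eq_iff c_def qi_def wid_def)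
  then have "(LINT x|Lm. (cis (l * x) - 1 - \<i> * complex_of_real (l * x * indicator {-1..1} x))) = complex_of_real (LINT x|Lm. c x) + \<i> * complex_of_real (LINT x|Lm. qi x)"
   using ic(1) qi(2) by (simp add: integral_complex_of_real)
  then show ?thesis unfolding levy_exponent_def by (simp add: complex_eq_iff)
 qed
 show ?thesis
  unfolding tendsto_complex_iff levy expect using Lre Lim by simp
qed

text \<open>Bounds the change of \<open>sat (x / \<eta>)\<close> under a jump larger than 1, from
  \<open>sat_lipschitz\<close> and the range of \<open>sat\<close>.\<close>

definition wo :: "real => real => real" where "wo \<eta> x = (if abs(x) <= 1 then 0 else min 1 (abs(x) / \<eta>))"

text \<open>Jumps of size at most 1 are expanded with \<open>sat_taylor\<close>, the others are
  bounded by \<open>wo\<close>. Both estimates are uniform in the position x.\<close>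

lemma generator_bound:
 assumes \<eta>: "0 < \<eta>"
 shows "abs(E n (%d. sat ((x + d) / \<eta>)) - sat (x / \<eta>)) <= 1 / \<eta> * abs(E n wid) + 3 / \<eta>\<^sup>2 * E n wI + E n (wo \<eta>)"
proof -
 define h where "h d = sat ((x + d) / \<eta>) - sat (x / \<eta>)" for d
 define k where "k = sat' (x / \<eta>) / \<eta>"
 have k: "abs(k) <= 1 / \<eta>" using sat'_bound[of "x / \<eta>"] \<eta> by (simp add: k_def divide_right_mono)
 have wob: "abs(wo \<eta> d) <= 1" "0 <= wo \<eta> d" for d using \<eta> by (auto simp: wo_def abs_le_iff min_def)
 have wIb: "abs(wI d) <= 1" for d using wI_bounds(1,2)[of d] by simp
 have sb: "abs(sat z) <= 1" for z using sat_bounds(1,2)[of z] by simp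
 have hb: "abs(h d) <= 1" for d unfolding h_def using sat_bounds(1,2)[of "(x + d) / \<eta>"] sat_bounds(1,2)[of "x / \<eta>"] by linarith
 have eq: "(x + d) / \<eta> - x / \<eta> = d / \<eta>" for d by (simp add: add_divide_distrib)
 have pt: "abs(h d - k * wid d) <= 3 / \<eta>\<^sup>2 * wI d + wo \<eta> d" for d
 proof (cases "abs(d) <= 1")
  case True
  have "abs(h d - k * d) <= 3 * (d / \<eta>)\<^sup>2"
   using sat_taylor[of "(x + d) / \<eta>" "x / \<eta>"] unfolding eq h_def k_def by simp
  then show ?thesis using True by (simp add: wid_def wI_def wo_def power_divide abs_le_iff)
 next
  case False
  have "abs(h d) <= abs(d) / \<eta>" using sat_lipschitz[of "(x + d) / \<eta>" "x / \<eta>"] \<eta> unfolding eq h_def by simp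
  then have "abs(h d) <= wo \<eta> d" using hb[of d] False by (simp add: wo_def)
  moreover have "wid d = 0" "wI d = 0" using False by (auto simp: wid_def wI_def indicator_def abs_le_iff)
  ultimately show ?thesis by simp
 qed
 have kb: "abs(k * wid d) <= abs(k)" for d using wid_bounds[of d] by (simp add: abs_mult mult_left_le)
 have hkb: "abs(h d - k * wid d) <= 1 + abs(k)" for d using hb[of d] kb[of d] by linarith
 have w3: "abs(3 / \<eta>\<^sup>2 * wI d) <= 3 / \<eta>\<^sup>2" for d using wI_bounds(1,2)[of d] by (simp add: abs_mult divide_right_mono)
 have rb: "abs(3 / \<eta>\<^sup>2 * wI d + wo \<eta> d) <= 3 / \<eta>\<^sup>2 + 1" for d using w3[of d] wob(1)[of d] by linarith
 have "E n (%d. sat ((x + d) / \<eta>)) - sat (x / \<eta>) = E n h"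
  unfolding h_def by (subst E_diff[where B=1 and B'=1]) (auto simp: sb E_const)
 also have "E n h = k * E n wid + E n (%d. h d - k * wid d)"
  by (subst E_diff[OF hb kb]) (simp add: E_cmult)
 finally have "abs(E n (%d. sat ((x + d) / \<eta>)) - sat (x / \<eta>)) <= abs(k) * abs(E n wid) + abs(E n (%d. h d - k * wid d))"
  by (metis abs_mult abs_triangle_ineq)
 also have "abs(k) * abs(E n wid) <= 1 / \<eta> * abs(E n wid)" using k by (intro mult_right_mono) auto
 also have "abs(E n (%d. h d - k * wid d)) <= E n (%d. abs(h d - k * wid d))" by (rule E_abs[OF hkb])
 also have "... <= E n (%d. 3 / \<eta>\<^sup>2 * wI d + wo \<eta> d)" by (rule E_mono[OF _ rb pt]) (use hkb in auto)
 also have "... = 3 / \<eta>\<^sup>2 * E n wI + E n (wo \<eta>)"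
  by (subst E_add[OF w3 wob(1)]) (simp only: E_cmult)
 finally show ?thesis by simp
qed

text \<open>Multiplied by \<open>a n\<close>, the first two terms of \<open>generator_bound\<close>
  converge, and \<open>wt\<close> is a continuous majorant of \<open>wo\<close> whose scaled mean
  converges as well.\<close>

lemma generator_bounded:
 assumes \<eta>: "0 < \<eta>"
 obtains C where "0 < C" "EV n. ALL x. a n * abs(E n (%d. sat ((x + d) / \<eta>)) - sat (x / \<eta>)) <= C"
proof -
 define C where "C = 1 / \<eta> * abs(b) + 3 / \<eta>\<^sup>2 * V + (LINT x|Lm. wt x) + 1"
 have "0 <= (LINT x|Lm. wt x)" by (intro integral_nonneg_AE) (simp add: wt_bounds)
 then have C: "0 < C" unfolding C_def using \<eta> V_ge(2) by (intro add_nonneg_pos add_nonneg_nonneg) auto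
 have "(%n. 1 / \<eta> * abs(a n * E n wid) + 3 / \<eta>\<^sup>2 * (a n * E n wI) + a n * E n wt) ----> 1 / \<eta> * abs(b) + 3 / \<eta>\<^sup>2 * V + (LINT x|Lm. wt x)"
  using \<eta> by (intro tendsto_intros wid_tendsto wI_tendsto wt_tendsto)
 then have "EV n. 1 / \<eta> * abs(a n * E n wid) + 3 / \<eta>\<^sup>2 * (a n * E n wI) + a n * E n wt < C"
  by (rule order_tendstoD(2)) (simp add: C_def)
 then have "EV n. ALL x. a n * abs(E n (%d. sat ((x + d) / \<eta>)) - sat (x / \<eta>)) <= C"
 proof (eventually_elim, intro allI)
  fix n x
  assume *: "1 / \<eta> * abs(a n * E n wid) + 3 / \<eta>\<^sup>2 * (a n * E n wI) + a n * E n wt < C"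
  have "wo \<eta> d <= wt d" for d using wt_bounds[of d] by (auto simp: wo_def wt_def ramp_1)
  then have "E n (wo \<eta>) <= E n wt"
   using \<eta> wt_bounds by (intro E_mono[where B=1 and B'=1]) (auto simp: wo_def abs_le_iff min_def intro: order_trans[of _ 0])
  then have "1 / \<eta> * abs(E n wid) + 3 / \<eta>\<^sup>2 * E n wI + E n (wo \<eta>) <= 1 / \<eta> * abs(E n wid) + 3 / \<eta>\<^sup>2 * E n wI + E n wt" by simp
  with generator_bound[OF \<eta>, of n x]
  have "a n * abs(E n (%d. sat ((x + d) / \<eta>)) - sat (x / \<eta>)) <= a n * (1 / \<eta> * abs(E n wid) + 3 / \<eta>\<^sup>2 * E n wI + E n wt)"
   using a_pos[of n] by (intro mult_left_mono) auto
  also have "... = 1 / \<eta> * abs(a n * E n wid) + 3 / \<eta>\<^sup>2 * (a n * E n wI) + a n * E n wt"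
   using a_pos[of n] by (simp add: abs_mult algebra_simps)
  finally show "a n * abs(E n (%d. sat ((x + d) / \<eta>)) - sat (x / \<eta>)) <= C" using * by simp
 qed
 with C show ?thesis using that by blast
qed

text \<open>At a large scale A the drift term is O(1/A), the quadratic term O(1/A^2), jumps up to R
  + 1 contribute at most (R + 1) / A times their mass, and larger ones have small mass by the choice
  of R. This is the source of the confinement in the box.\<close>

lemma generator_small:
 assumes eps: "0 < eps"
 obtains A where "0 < A" "EV n. ALL x. a n * abs(E n (%d. sat ((x + d) / A)) - sat (x / A)) <= eps"
proof -
 obtain R where R: "1 <= R" "(LINT x|Lm. wR R x) < eps/2" using wR_small[of "eps/2"] eps by auto
 define W where "W = (LINT x|Lm. wt x)"
 have i0: "(%k. 1 / real (Suc k)) ----> 0" using LIMSEQ_inverse_real_of_nat by (simp add: inverse_eq_divide)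
 have "(%k. (1 / real (Suc k)) * abs(b) + 3 * (1 / real (Suc k))\<^sup>2 * V + ((R + 1) * (1 / real (Suc k))) * W) ----> 0 * abs(b) + 3 * 0\<^sup>2 * V + ((R + 1) * 0) * W"
  by (intro tendsto_intros i0)
 then have "EV k. (1 / real (Suc k)) * abs(b) + 3 * (1 / real (Suc k))\<^sup>2 * V + ((R + 1) * (1 / real (Suc k))) * W < eps/2"
  using eps by (intro order_tendstoD(2)) auto
 then obtain k where k: "(1 / real (Suc k)) * abs(b) + 3 * (1 / real (Suc k))\<^sup>2 * V + ((R + 1) * (1 / real (Suc k))) * W < eps/2"
  using eventually_happens'[OF sequentially_bot] by blast
 define A where "A = real (Suc k)"
 have A: "0 < A" by (simp add: A_def)
 have kA: "1 / A * abs(b) + 3 / A\<^sup>2 * V + ((R + 1) / A) * W < eps/2" using k unfolding A_def[symmetric] by (simp add: power_divide)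
 have "(%n. 1 / A * abs(a n * E n wid) + 3 / A\<^sup>2 * (a n * E n wI) + ((R + 1) / A * (a n * E n wt) + a n * E n (wR R))) ---->
  1 / A * abs(b) + 3 / A\<^sup>2 * V + ((R + 1) / A * W + (LINT x|Lm. wR R x))"
  unfolding W_def using A R by (intro tendsto_intros wid_tendsto wI_tendsto wt_tendsto wR_tendsto) auto
 then have "EV n. 1 / A * abs(a n * E n wid) + 3 / A\<^sup>2 * (a n * E n wI) + ((R + 1) / A * (a n * E n wt) + a n * E n (wR R)) < eps"
  by (rule order_tendstoD(2)) (use kA R in linarith)
 then have "EV n. ALL x. a n * abs(E n (%d. sat ((x + d) / A)) - sat (x / A)) <= eps"
 proof (eventually_elim, intro allI)
  fix n x
  assume *: "1 / A * abs(a n * E n wid) + 3 / A\<^sup>2 * (a n * E n wI) + ((R + 1) / A * (a n * E n wt) + a n * E n (wR R)) < eps"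
  have pt: "wo A d <= (R + 1) / A * wt d + wR R d" for d
  proof (cases "abs(d) <= 1")
   case True
   then show ?thesis using A R wt_bounds[of d] wR_bounds[of R d] by (simp add: wo_def)
  next
   case False
   then have wt: "wt d = 1" by (simp add: wt_def ramp_1)
   show ?thesis
   proof (cases "abs(d) <= R + 1")
    case True
    then have "abs(d) / A <= (R + 1) / A" using A by (intro divide_right_mono) auto
    then show ?thesis using False wt wR_bounds[of R d] by (simp add: wo_def)
   next
    case False
    then have "wR R d = 1" by (simp add: wR_def ramp_1)
    moreover have "0 <= (R + 1) / A" using R A by simp
    ultimately show ?thesis using wt by (auto simp: wo_def)
   qed
  qed
  have b1: "abs((R + 1) / A * wt d) <= (R + 1) / A" for d using wt_bounds[of d] R A mult_left_le[of "wt d" "(R + 1) / A"] by (simp add: abs_mult)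
  have b2: "abs(wR R d) <= 1" for d using wR_bounds[of R d] by simp
  have b3: "abs((R + 1) / A * wt d + wR R d) <= (R + 1) / A + 1" for d using b1[of d] b2[of d] by linarith
  have b4: "abs(wo A d) <= 1" for d
   using A by (auto simp: wo_def abs_le_iff min_def intro: order_trans[of _ 0])
  have "E n (wo A) <= E n (%d. (R + 1) / A * wt d + wR R d)" by (rule E_mono[OF b4 b3 pt])
  also have "... = (R + 1) / A * E n wt + E n (wR R)"
   by (subst E_add[OF b1 b2]) (simp only: E_cmult)
  finally have "1 / A * abs(E n wid) + 3 / A\<^sup>2 * E n wI + E n (wo A) <= 1 / A * abs(E n wid) + 3 / A\<^sup>2 * E n wI + ((R + 1) / A * E n wt + E n (wR R))" by simp
  with generator_bound[OF A, of n x]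
  have "a n * abs(E n (%d. sat ((x + d) / A)) - sat (x / A)) <= a n * (1 / A * abs(E n wid) + 3 / A\<^sup>2 * E n wI + ((R + 1) / A * E n wt + E n (wR R)))"
   using a_pos[of n] by (intro mult_left_mono) auto
  also have "... = 1 / A * abs(a n * E n wid) + 3 / A\<^sup>2 * (a n * E n wI) + ((R + 1) / A * (a n * E n wt) + a n * E n (wR R))"
   using a_pos[of n] by (simp add: abs_mult algebra_simps)
  finally show "a n * abs(E n (%d. sat ((x + d) / A)) - sat (x / A)) <= eps" using * by simp
 qed
 with A show ?thesis using that by blast
qed

end

section \<open>The Skorokhod topology\<close>

lemma time_change_id: "time_change (%t. t)"
 by (auto simp: time_change_def strict_mono_on_def)

lemma time_change_nonneg: "time_change l ==> 0 <= t ==> 0 <= l t"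
 unfolding time_change_def by (metis atLeast_iff image_eqI)

lemma time_change_zero: assumes "time_change l" shows "l 0 = 0"
proof -
 obtain t where t: "0 <= t" "l t = 0" using assms unfolding time_change_def
  by (metis atLeast_iff imageE order_refl)
 then have "t = 0"
  using assms time_change_nonneg[OF assms, of 0] unfolding time_change_def strict_mono_on_def
  by (metis atLeast_iff less_le_not_le order_le_less order_refl)
 then show ?thesis using t by simp
qed

lemma time_change_comp:
 assumes "time_change l" "time_change m" shows "time_change (%t. l (m t))"
proof -
 have "(%t. l (m t)) ` {0..} = l ` (m ` {0..})" by auto
 moreover have "continuous_on {0..} (%t. l (m t))"
  by (rule continuous_on_compose2[of "{0..}" l]) (use assms in "auto simp: time_change_def")
 ultimately show ?thesis
  using assms time_change_nonneg[OF assms(2)] by (auto simp: time_change_def strict_mono_on_def)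
qed

lemma time_changeI:
 assumes mono: "strict_mono_on {0..} l" and cont: "continuous_on {0..} l" and zero: "l 0 = (0::real)"
  and unb: "!!t. 0 <= t ==> \<exists>s\<ge>0. t <= l s"
 shows "time_change l"
proof -
 have "l ` {0..} = {0..}"
 proof safe
  fix t :: real assume "0 <= t"
  then show "0 <= l t"
   using mono zero unfolding strict_mono_on_def by (cases "t = 0") (force, metis atLeast_iff less_eq_real_def order_refl)
 next
  fix t :: real assume "0 <= t"
  then obtain s where s: "s >= 0" "t <= l s" using unb by blast
  have "\<exists>x\<ge>0. x <= s & l x = t"
   by (rule IVT') (use s zero \<open>0 <= t\<close> cont in "auto intro: continuous_on_subset")
  then show "t \<in> l ` {0..}" by auto
 qed
 then show ?thesis using mono cont by (simp add: time_change_def)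
qed

lemma time_change_inverse:
 assumes l: "time_change l"
 obtains m where "time_change m" "!!t. 0 <= t ==> l (m t) = t" "!!t. 0 <= t ==> m (l t) = t"
proof -
 define m where "m = the_inv_into {0..} l"
 have inj: "inj_on l {0..}" using l by (auto simp: time_change_def intro: strict_mono_on_imp_inj_on)
 have img: "l ` {0..} = {0..}" using l by (simp add: time_change_def)
 have lm: "l (m t) = t" if "0 <= t" for t
  unfolding m_def using f_the_inv_into_f[OF inj, of t] img that by auto
 have ml: "m (l t) = t" if "0 <= t" for t
  unfolding m_def using the_inv_into_f_f[OF inj, of t] that by auto
 have m0: "0 <= m t" if "0 <= t" for t
  using the_inv_into_into[OF inj, of t "{0..}"] img that by (auto simp: m_def)
 have smono: "strict_mono_on {0..} m"
 proof (rule strict_mono_onI)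
  fix r s :: real assume rs: "r \<in> {0..}" "s \<in> {0..}" "r < s"
  show "m r < m s"
  proof (rule ccontr)
   assume "\<not> m r < m s"
   then have "l (m s) <= l (m r)"
    using l m0 rs unfolding time_change_def strict_mono_on_def
    by (metis atLeast_iff less_eq_real_def not_le)
   then show False using lm rs by auto
  qed
 qed
 \<comment> \<open>Extended by the identity, the inverse becomes a monotone surjection of the line,
   hence continuous.\<close>
 define m' where "m' t = (if t < 0 then t else m t)" for t
 have "continuous_on UNIV m'"
 proof (rule continuous_onI_mono)
  have "y = m' (if y < 0 then y else l y)" for y
   using time_change_nonneg[OF l, of y] ml[of y] by (auto simp: m'_def)
  then have "range m' = UNIV" by blast
  then show "open (range m')" by simp
  show "m' x <= m' y" if "x <= y" for x y
   using that m0 smono unfolding m'_def strict_mono_on_def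
   by (smt (verit) atLeast_iff)
 qed
 then have "continuous_on {0..} m'" by (rule continuous_on_subset) auto
 then have cont: "continuous_on {0..} m"
  by (rule continuous_on_eq) (auto simp: m'_def)
 have "time_change m"
 proof (rule time_changeI[OF smono cont])
  show "m 0 = 0" using ml[of 0] time_change_zero[OF l] by simp
  show "\<exists>s\<ge>0. t <= m s" if "0 <= t" for t
   using ml[OF that] time_change_nonneg[OF l that] by (intro exI[of _ "l t"]) auto
 qed
 then show ?thesis using that lm ml by blast
qed

text \<open>One number for convergence on all compact intervals: the weight \<open>exp (- t)\<close>
  together with the cap at 1 makes the values at late times irrelevant, while the time change stays
  uniformly close to the identity.\<close>

definition J1_close :: "real => (real => real) => (real => real) => bool" where
 "J1_close eps x y \<longleftrightarrow> (EX l. time_change l & (\<forall>t\<ge>0. abs(l t - t) <= eps) &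
  (\<forall>t\<ge>0. exp (- t) * min 1 \<bar>x (l t) - y t\<bar> <= eps))"

lemma J1_closeE:
 assumes "J1_close eps x y"
 obtains l where "time_change l" "!!t. t >= 0 ==> abs(l t - t) <= eps"
   "!!t. t >= 0 ==> exp (- t) * min 1 \<bar>x (l t) - y t\<bar> <= eps"
proof -
 from assms[unfolded J1_close_def] obtain l where *: "time_change l & (\<forall>t\<ge>0. abs(l t - t) <= eps) &
  (\<forall>t\<ge>0. exp (- t) * min 1 \<bar>x (l t) - y t\<bar> <= eps)" ..
 show ?thesis by (rule that[of l]) (use * in auto)
qed

lemma J1_close_mono: "J1_close eps x y ==> eps <= \<delta> ==> J1_close \<delta> x y"
 unfolding J1_close_def by (elim exE conjE, rule exI, intro conjI, assumption) (auto intro: order_trans)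

lemma J1_close_nonneg: "J1_close eps x y ==> 0 <= eps"
 unfolding J1_close_def by (auto dest: spec[of _ 0])

lemma J1_close_refl: "0 <= eps ==> J1_close eps x x"
 unfolding J1_close_def by (intro exI[of _ "%t. t"]) (auto simp: time_change_id)

lemma J1_close_1: "J1_close 1 x y"
 unfolding J1_close_def
proof (intro exI[of _ "%t. t"] conjI allI impI)
 fix t :: real assume "0 <= t"
 then have "exp (- t) * min 1 \<bar>x t - y t\<bar> <= 1 * 1" by (intro mult_mono) auto
 then show "exp (- t) * min 1 \<bar>x t - y t\<bar> <= 1" by simp
qed (auto simp: time_change_id)

lemma exp_min_shift:
 assumes "abs(s - t) <= eps" "exp (- s) * min 1 \<bar>z\<bar> <= \<delta>"
 shows "exp (- t) * min 1 \<bar>z :: real\<bar> <= exp eps * (\<delta>::real)"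
proof -
 have "exp (- t) * min 1 \<bar>z\<bar> = exp (s - t) * (exp (- s) * min 1 \<bar>z\<bar>)"
  by (simp add: mult.assoc[symmetric] exp_add[symmetric])
 also have "... <= exp eps * \<delta>"
  using assms by (intro mult_mono) auto
 finally show ?thesis .
qed

lemma min_1_triangle:
 fixes a b c :: real
 assumes "c <= a + b" "0 <= a" "0 <= b"
 shows "min 1 c <= min 1 a + min 1 b"
 using assms by (auto simp: min_def)

text \<open>The values of x and y are compared at time m t with weight e^(-m t); returning to the
  weight e^(-t) costs the factor e^\<delta>, because m t and t differ by at most \<delta>.\<close>

lemma J1_close_trans:
 assumes "J1_close eps x y" "J1_close \<delta> y z"
 shows "J1_close (\<delta> + exp \<delta> * eps) x z"
proof -
 obtain l where l: "time_change l" "!!t. t >= 0 ==> abs(l t - t) <= eps"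
   "!!t. t >= 0 ==> exp (- t) * min 1 \<bar>x (l t) - y t\<bar> <= eps"
  using J1_closeE[OF assms(1)] by metis
 obtain m where m: "time_change m" "!!t. t >= 0 ==> abs(m t - t) <= \<delta>"
   "!!t. t >= 0 ==> exp (- t) * min 1 \<bar>y (m t) - z t\<bar> <= \<delta>"
  using J1_closeE[OF assms(2)] by metis
 have d0: "\<delta> >= 0" "eps >= 0" using assms J1_close_nonneg by auto
 then have e: "eps <= exp \<delta> * eps" using mult_right_mono[of 1 "exp \<delta>" eps] by auto
 show ?thesis
  unfolding J1_close_def
 proof (intro exI[of _ "%t. l (m t)"] conjI allI impI)
  show "time_change (%t. l (m t))" by (rule time_change_comp[OF l(1) m(1)])
  fix t :: real assume t: "0 <= t"
  have mt: "m t >= 0" using time_change_nonneg[OF m(1) t] .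
  show "abs(l (m t) - t) <= \<delta> + exp \<delta> * eps" using l(2)[OF mt] m(2)[OF t] e by linarith
  have 1: "exp (- t) * min 1 \<bar>x (l (m t)) - y (m t)\<bar> <= exp \<delta> * eps"
   by (rule exp_min_shift[OF m(2)[OF t] l(3)[OF mt]])
  have "min 1 \<bar>x (l (m t)) - z t\<bar> <= min 1 \<bar>y (m t) - z t\<bar> + min 1 \<bar>x (l (m t)) - y (m t)\<bar>"
   by (rule min_1_triangle) auto
  from mult_left_mono[OF this, of "exp (- t)"]
  have "exp (- t) * min 1 \<bar>x (l (m t)) - z t\<bar> <=
    exp (- t) * min 1 \<bar>y (m t) - z t\<bar> + exp (- t) * min 1 \<bar>x (l (m t)) - y (m t)\<bar>"
   unfolding distrib_left by simp
  also have "... <= \<delta> + exp \<delta> * eps" by (rule add_mono[OF m(3)[OF t] 1])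
  finally show "exp (- t) * min 1 \<bar>x (l (m t)) - z t\<bar> <= \<delta> + exp \<delta> * eps" .
 qed
qed

lemma J1_close_sym:
 assumes "J1_close eps x y" shows "J1_close (exp eps * eps) y x"
proof -
 obtain l where l: "time_change l" "!!t. t >= 0 ==> abs(l t - t) <= eps"
   "!!t. t >= 0 ==> exp (- t) * min 1 \<bar>x (l t) - y t\<bar> <= eps"
  using J1_closeE[OF assms(1)] by metis
 have e0: "eps >= 0" using assms J1_close_nonneg by auto
 obtain m where m: "time_change m" "!!t. 0 <= t ==> l (m t) = t"
  using time_change_inverse[OF l(1)] by metis
 show ?thesis
  unfolding J1_close_def
 proof (intro exI[of _ m] conjI allI impI)
  fix t :: real assume t: "0 <= t"
  have mt: "m t >= 0" using time_change_nonneg[OF m(1) t] .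
  have 1: "abs(m t - t) <= eps" using l(2)[OF mt] m(2)[OF t] by auto
  then show "abs(m t - t) <= exp eps * eps"
   using e0 mult_right_mono[of 1 "exp eps" eps] by auto
  have "exp (- m t) * min 1 \<bar>y (m t) - x t\<bar> <= eps"
   using l(3)[OF mt] m(2)[OF t] by (simp add: abs_minus_commute)
  then show "exp (- t) * min 1 \<bar>y (m t) - x t\<bar> <= exp eps * eps"
   by (rule exp_min_shift[OF 1])
 qed (rule m)
qed

lemma J1_tendsto_if_close:
 assumes "!!k. J1_close (e k) (xs k) x" "e ----> 0"
 shows "J1_tendsto xs x"
proof -
 have "ALL k. EX l. time_change l & (\<forall>t\<ge>0. abs(l t - t) <= e k) &
  (\<forall>t\<ge>0. exp (- t) * min 1 \<bar>xs k (l t) - x t\<bar> <= e k)"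
  using assms(1) unfolding J1_close_def by simp
 from choice[OF this] obtain l where *: "ALL k. time_change (l k) & (\<forall>t\<ge>0. abs(l k t - t) <= e k) &
  (\<forall>t\<ge>0. exp (- t) * min 1 \<bar>xs k (l k t) - x t\<bar> <= e k)" ..
 then have l: "!!k. time_change (l k)" "!!k t. t>=0 ==> abs(l k t - t) <= e k"
  "!!k t. t>=0 ==> exp (- t) * min 1 \<bar>xs k (l k t) - x t\<bar> <= e k" by auto
 show ?thesis
  unfolding J1_tendsto_def
 proof (intro exI[of _ l] conjI allI impI)
  fix T eps :: real assume T: "0 < T" and e: "0 < eps"
  have "exp (- T) * min 1 eps > 0" using e by auto
  then have "EV k. e k < exp (- T) * min 1 eps"
   using order_tendstoD(2)[OF assms(2)] by blast
  moreover have "EV k. e k < eps" using order_tendstoD(2)[OF assms(2) e] .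
  ultimately show "EV k. \<forall>t\<in>{0..T}. abs(l k t - t) < eps & abs(xs k (l k t) - x t) < eps"
  proof eventually_elim
   case (elim k)
   show ?case
   proof
    fix t assume t: "t \<in> {0..T}"
    have "exp (- T) * min 1 \<bar>xs k (l k t) - x t\<bar> <= exp (- t) * min 1 \<bar>xs k (l k t) - x t\<bar>"
     using t by (intro mult_right_mono) auto
    also have "... < exp (- T) * min 1 eps" using l(3)[of t k] t elim by auto
    finally have "min 1 \<bar>xs k (l k t) - x t\<bar> < min 1 eps" by simp
    then show "abs(l k t - t) < eps & abs(xs k (l k t) - x t) < eps"
     using l(2)[of t k] t elim by auto
   qed
  qed
 qed (rule l)
qed

lemma time_change_freeze_after:
 assumes l: "time_change l" and T: "0 < T"
 shows "time_change (%t. if t <= T then l t else l T + (t - T))"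
proof (rule time_changeI)
 show "strict_mono_on {0..} (%t. if t <= T then l t else l T + (t - T))"
 proof (rule strict_mono_onI)
  fix r s :: real assume rs: "r \<in> {0..}" "s \<in> {0..}" "r < s"
  have "l r < l s" "l r <= l T" if "r <= T"
   using l rs that T unfolding time_change_def strict_mono_on_def
   by (auto simp: less_eq_real_def)
  then show "(if r <= T then l r else l T + (r - T)) < (if s <= T then l s else l T + (s - T))"
   using rs by auto
 qed
 have "continuous_on ({0..T} \<union> {T..}) (%t. if t <= T then l t else l T + (t - T))"
  by (rule continuous_on_cases)
   (use l in "auto simp: time_change_def intro!: continuous_intros intro: continuous_on_subset")
 moreover have "{0..T} \<union> {T..} = {0..}" using T by auto
 ultimately show "continuous_on {0..} (%t. if t <= T then l t else l T + (t - T))" by simp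
 show "(if 0 <= T then l 0 else l T + (0 - T)) = 0" using T time_change_zero[OF l] by simp
 show "\<exists>s\<ge>0. t <= (if s <= T then l s else l T + (s - T))" if "0 <= t" for t
  using time_change_nonneg[OF l, of T] T that by (intro exI[of _ "t + T + 1"]) auto
qed

text \<open>T is taken so large that the weight alone is at most \<open>eps\<close> beyond it. The
  time change matters only on [0, T] and continues with slope 1, which preserves its distance to the
  identity.\<close>

lemma J1_close_if_tendsto:
 assumes "J1_tendsto xs x" "0 < eps"
 shows "EV k. J1_close eps (xs k) x"
proof -
 from assms(1) obtain l where l: "!!k. time_change (l k)"
  and ev: "!!T eps. T > 0 ==> eps > 0 ==> EV k. \<forall>t\<in>{0..T}.
      abs(l k t - t) < eps & abs(xs k (l k t) - x t) < eps"
  unfolding J1_tendsto_def by blast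
 define T where "T = max 1 (- ln eps)"
 have T: "T > 0" by (simp add: T_def)
 have eT: "exp (- T) <= eps" 
 proof -
  have "exp (- T) <= exp (ln eps)" unfolding exp_le_cancel_iff by (simp add: T_def)
  then show ?thesis using assms(2) by simp
 qed
 from ev[OF T assms(2)] show ?thesis
 proof eventually_elim
  case (elim k)
  define m where "m = (%t. if t <= T then l k t else l k T + (t - T))"
  have "abs(m t - t) <= eps & exp (- t) * min 1 \<bar>xs k (m t) - x t\<bar> <= eps" if t: "t >= 0" for t
  proof (cases "t <= T")
   case True
   then have 1: "abs(l k t - t) < eps" "abs(xs k (l k t) - x t) < eps" using elim t by auto
   have "exp (- t) * min 1 \<bar>xs k (l k t) - x t\<bar> <= 1 * abs(xs k (l k t) - x t)"
    using t by (intro mult_mono) auto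
   then show ?thesis using 1 True by (simp add: m_def)
  next
   case False
   have "abs(l k T - T) < eps" using elim T by auto
   moreover have "exp (- t) * min 1 \<bar>xs k (m t) - x t\<bar> <= exp (- T) * 1"
    using False by (intro mult_mono) auto
   ultimately show ?thesis using False eT by (auto simp: m_def)
  qed
  moreover have "time_change m" unfolding m_def by (rule time_change_freeze_after[OF l T])
  ultimately show ?case unfolding J1_close_def by blast
 qed
qed

text \<open>A gauge with values in [0, 1]; its symmetry and triangle inequality are available with
  exponential factors only, which suffices for an inf-convolution.\<close>

definition J1_dist :: "(real => real) => (real => real) => real" where
 "J1_dist x y = Inf {eps. J1_close eps x y}"

lemma bdd_below_J1_close: "bdd_below {eps. J1_close eps x y}"
 by (rule bdd_belowI[of _ 0]) (auto dest: J1_close_nonneg)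

lemma J1_dist_le: "J1_close eps x y ==> J1_dist x y <= eps"
 unfolding J1_dist_def by (intro cInf_lower bdd_below_J1_close) simp

lemma J1_dist_nonneg: "0 <= J1_dist x y"
 unfolding J1_dist_def using J1_close_1 by (intro cInf_greatest) (auto dest: J1_close_nonneg)

lemma J1_dist_le_1: "J1_dist x y <= 1"
 by (rule J1_dist_le[OF J1_close_1])

lemma J1_dist_self: "J1_dist x x = 0"
 using J1_dist_le[OF J1_close_refl, of 0 x] J1_dist_nonneg[of x x] by simp

lemma J1_close_if_dist_less:
 assumes "J1_dist x y < eps" shows "J1_close eps x y"
proof -
 have "{eps. J1_close eps x y} ~= {}" using J1_close_1 by auto
 from cInf_lessD[OF this assms[unfolded J1_dist_def]]
 show ?thesis using J1_close_mono by fastforce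
qed

lemma J1_dist_triangle: "J1_dist x z <= J1_dist y z + exp (J1_dist y z) * J1_dist x y"
proof -
 define p q where "p = J1_dist y z" and "q = J1_dist x y"
 \<comment> \<open>The infimum in \<open>J1_dist\<close> may not be attained, so the inequality is
   proved with slack \<eta>, which then tends to 0.\<close>
 have "J1_dist x z <= (p + \<eta>) + exp (p + \<eta>) * (q + \<eta>)" if "\<eta> > 0" for \<eta>
  by (intro J1_dist_le J1_close_trans[of _ x y _ z] J1_close_if_dist_less)
   (use that in "auto simp: p_def q_def")
 then have "\<forall>\<^sub>F \<eta> in at_right 0. J1_dist x z <= (p + \<eta>) + exp (p + \<eta>) * (q + \<eta>)"
  by (auto simp: eventually_at_right_less eventually_at_filter)
 moreover have "((%\<eta>. (p + \<eta>) + exp (p + \<eta>) * (q + \<eta>)) \<longlongrightarrow> (p + 0) + exp (p + 0) * (q + 0)) (at_right 0)"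
  by (intro tendsto_intros)
 ultimately have "J1_dist x z <= (p + 0) + exp (p + 0) * (q + 0)"
  by (intro tendsto_lowerbound[where F="at_right (0::real)"]) auto
 then show ?thesis by (simp add: p_def q_def)
qed

text \<open>Inf-convolution: uniformly continuous functionals increasing to \<open>F\<close>, so that convergence in law need only
 be tested on uniformly continuous functionals.\<close>

definition J1_infconv :: "((real => real) => real) => nat => (real => real) => real" where
 "J1_infconv F m x = (INF y\<in>Collect cadlag. F y + real m * J1_dist y x)"

definition J1_uniform :: "((real => real) => real) => bool" where
 "J1_uniform F \<longleftrightarrow> (\<forall>eps>0. \<exists>\<rho>>0. ALL x y. cadlag x --> cadlag y --> J1_close \<rho> x y --> abs(F x - F y) <= eps)"

context
 fixes F :: "(real => real) => real" and B :: real
 assumes bnd: "!!x. cadlag x ==> abs(F x) <= B"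
begin

lemma bdd_below_infconv: "bdd_below ((%y. F y + real m * J1_dist y x) ` Collect cadlag)"
proof (rule bdd_belowI2[of _ "- B"])
 fix y assume "y \<in> Collect cadlag"
 then have "abs(F y) <= B" using bnd by simp
 moreover have "0 <= real m * J1_dist y x" using J1_dist_nonneg by simp
 ultimately show "- B <= F y + real m * J1_dist y x" by simp
qed

lemma J1_infconv_lower: "cadlag y ==> J1_infconv F m x <= F y + real m * J1_dist y x"
 unfolding J1_infconv_def by (intro cINF_lower bdd_below_infconv) simp

lemma J1_infconv_greatest:
 assumes "!!y. cadlag y ==> c <= F y + real m * J1_dist y x"
 shows "c <= J1_infconv F m x"
proof -
 have "cadlag (%_. 0)" by (auto simp: cadlag_def intro!: exI[of _ 0])
 then show ?thesis unfolding J1_infconv_def using assms by (intro cINF_greatest) auto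
qed

lemma J1_infconv_le: "cadlag x ==> J1_infconv F m x <= F x"
 using J1_infconv_lower[of x m x] by (simp add: J1_dist_self)

lemma J1_infconv_bound: "cadlag x ==> abs(J1_infconv F m x) <= B"
proof -
 assume x: "cadlag x"
 have "- B <= J1_infconv F m x"
 proof (rule J1_infconv_greatest)
  fix y assume "cadlag y"
  then have "abs(F y) <= B" by (rule bnd)
  moreover have "0 <= real m * J1_dist y x" using J1_dist_nonneg by simp
  ultimately show "- B <= F y + real m * J1_dist y x" by simp
 qed
 then show ?thesis using J1_infconv_le[OF x, of m] bnd[OF x] by simp
qed

text \<open>The approximate triangle inequality has the excess (e^d - 1) times a distance; since
  distances are at most 1, this gives the modulus m (d + e^d - 1) without any regularity of
  F.\<close>

lemma J1_infconv_diff: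
 "J1_infconv F m x <= J1_infconv F m y + real m * (J1_dist y x + exp (J1_dist y x) - 1)"
proof -
 define d where "d = J1_dist y x"
 have "J1_infconv F m x - real m * (d + exp d - 1) <= J1_infconv F m y"
 proof (rule J1_infconv_greatest)
  fix w assume w: "cadlag w"
  have d0: "d >= 0" by (simp add: d_def J1_dist_nonneg)
  have "J1_dist w x <= d + exp d * J1_dist w y"
   unfolding d_def by (rule J1_dist_triangle)
  also have "exp d * J1_dist w y = J1_dist w y + (exp d - 1) * J1_dist w y" by (simp add: algebra_simps)
  also have "(exp d - 1) * J1_dist w y <= (exp d - 1) * 1"
   using d0 J1_dist_le_1[of w y] by (intro mult_left_mono) auto
  finally have "J1_dist w x <= J1_dist w y + (d + exp d - 1)" by simp
  from mult_left_mono[OF this, of "real m"]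
  have "real m * J1_dist w x <= real m * J1_dist w y + real m * (d + exp d - 1)"
   by (simp add: distrib_left)
  then show "J1_infconv F m x - real m * (d + exp d - 1) <= F w + real m * J1_dist w y"
   using J1_infconv_lower[OF w, of m x] by linarith
 qed
 then show ?thesis by (simp add: d_def)
qed

lemma J1_infconv_uniform: "J1_uniform (J1_infconv F m)"
 unfolding J1_uniform_def
proof (intro allI impI)
 fix eps :: real assume e: "0 < eps"
 define h where "h d = real m * (d + exp d - 1)" for d
 \<comment> \<open>Closeness within \<rho> in one direction gives closeness within e^\<rho> \<rho>
   in the other, and both directions enter.\<close>
 define g where "g \<rho> = h (exp \<rho> * \<rho>)" for \<rho>
 have "isCont g 0" unfolding g_def h_def by (intro continuous_intros)
 then have "(g \<longlongrightarrow> g 0) (at_right 0)" unfolding isCont_def by (rule filterlim_mono) (auto simp: at_le)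
 then have "\<forall>\<^sub>F \<rho> in at_right 0. g \<rho> < eps" using e order_tendstoD(2)[of g "g 0" "at_right 0" eps] by (simp add: g_def h_def)
 then have "\<forall>\<^sub>F \<rho> in at_right 0. 0 < \<rho> & g \<rho> < eps"
  using eventually_at_right_less[of 0] by eventually_elim simp
 then obtain \<rho> where \<rho>: "\<rho> > 0" "g \<rho> < eps" using eventually_happens'[OF trivial_limit_at_right_real] by blast
 have hm: "h d <= h d'" if "d <= d'" for d d'
  unfolding h_def using that by (intro mult_left_mono) (auto intro: add_mono)
 show "\<exists>\<rho>>0. ALL x y. cadlag x --> cadlag y --> J1_close \<rho> x y --> abs(J1_infconv F m x - J1_infconv F m y) <= eps"
 proof (intro exI[of _ \<rho>] conjI allI impI \<rho>)
  fix x y assume c: "J1_close \<rho> x y"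
  have "\<rho> <= exp \<rho> * \<rho>" using mult_right_mono[of 1 "exp \<rho>" \<rho>] \<rho> by auto
  then have "h (J1_dist x y) <= g \<rho>" unfolding g_def using J1_dist_le[OF c] by (intro hm) linarith
  moreover have "h (J1_dist y x) <= g \<rho>" unfolding g_def by (intro hm J1_dist_le J1_close_sym c)
  ultimately show "abs(J1_infconv F m x - J1_infconv F m y) <= eps"
   using J1_infconv_diff[of m x y] J1_infconv_diff[of m y x] \<rho>(2) unfolding h_def by linarith
 qed
qed

lemma J1_infconv_bounded_continuous: "J1_bounded_continuous (J1_infconv F m)"
 unfolding J1_bounded_continuous_def
proof (intro conjI allI impI)
 show "EX B. ALL x. cadlag x --> abs(J1_infconv F m x) <= B" using J1_infconv_bound by blast
 fix xs x assume c: "ALL k. cadlag (xs k)" "cadlag x" "J1_tendsto xs x"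
 show "(%k. J1_infconv F m (xs k)) ----> J1_infconv F m x"
 proof (rule LIMSEQ_I)
  fix r :: real assume "0 < r"
  then have "0 < r/2" by simp
  then obtain \<rho> where \<rho>: "\<rho> > 0" and u: "!!x y. cadlag x ==> cadlag y ==> J1_close \<rho> x y
    ==> abs(J1_infconv F m x - J1_infconv F m y) <= r/2"
   using J1_infconv_uniform[of m] unfolding J1_uniform_def by blast
  from J1_close_if_tendsto[OF c(3) \<rho>]
  have "EV k. norm (J1_infconv F m (xs k) - J1_infconv F m x) < r"
  proof eventually_elim
   case (elim k)
   then show ?case using u[of "xs k" x] c \<open>0 < r\<close> by auto
  qed
  then show "EX no. \<forall>n\<ge>no. norm (J1_infconv F m (xs n) - J1_infconv F m x) < r"
   by (simp add: eventually_sequentially)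
 qed
qed

text \<open>Near-minimisers for m have distance O(1/m) from x because F is bounded, so they converge
  to x. Continuity of F then gives the lower bound, and y = x gives the upper one.\<close>

lemma J1_infconv_tendsto:
 assumes cont: "!!xs x. (ALL k. cadlag (xs k)) ==> cadlag x ==> J1_tendsto xs x ==> (%k. F (xs k)) ----> F x"
  and x: "cadlag x"
 shows "(%m. J1_infconv F m x) ----> F x"
proof -
 have "EX y. cadlag y & F y + real m * J1_dist y x < J1_infconv F m x + 1 / real (Suc m)" for m
 proof (rule ccontr)
  assume "\<not> ?thesis"
  then have "J1_infconv F m x + 1 / real (Suc m) <= J1_infconv F m x"
   by (intro J1_infconv_greatest) (auto simp: not_less)
  moreover have "1 / real (Suc m) > 0" by simp
  ultimately show False by linarith
 qed
 then obtain y where y: "!!m. cadlag (y m)"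
  "!!m. F (y m) + real m * J1_dist (y m) x < J1_infconv F m x + 1 / real (Suc m)" by metis
 have small: "J1_close ((2 * B + 2) / real (Suc m)) (y (Suc m)) x" for m
 proof (rule J1_close_if_dist_less)
  have "1 / real (Suc (Suc m)) <= 1" by simp
  then have "real (Suc m) * J1_dist (y (Suc m)) x < 2 * B + 2"
   using y(2)[of "Suc m"] bnd[OF y(1), of "Suc m"] J1_infconv_le[OF x, of "Suc m"] bnd[OF x] by linarith
  then show "J1_dist (y (Suc m)) x < (2 * B + 2) / real (Suc m)" by (simp add: field_simps)
 qed
 have "(%m. (2 * B + 2) / real (Suc m)) ----> 0"
  using tendsto_mult[OF tendsto_const[of "2*B+2"] LIMSEQ_inverse_real_of_nat] by (simp add: divide_inverse)
 then have "J1_tendsto (%m. y (Suc m)) x" by (rule J1_tendsto_if_close[OF small])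
 then have "(%m. F (y (Suc m))) ----> F x" using y x by (intro cont) auto
 then have "(%m. F (y m)) ----> F x" by (rule LIMSEQ_imp_Suc)
 then have "(%m. F (y m) - 1 / real (Suc m)) ----> F x - 0"
  using LIMSEQ_inverse_real_of_nat by (intro tendsto_diff) (auto simp: divide_inverse)
 then have lo: "(%m. F (y m) - 1 / real (Suc m)) ----> F x" by simp
 show ?thesis
 proof (rule tendsto_sandwich[OF _ _ lo tendsto_const])
  have "F (y m) - 1 / real (Suc m) <= J1_infconv F m x" for m
  proof -
   have "0 <= real m * J1_dist (y m) x" using J1_dist_nonneg by simp
   then show ?thesis using y(2)[of m] by linarith
  qed
  then show "EV m. F (y m) - 1 / real (Suc m) <= J1_infconv F m x" by simp
  show "EV m. J1_infconv F m x <= F x" using J1_infconv_le[OF x] by simp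
 qed
qed

end

section \<open>From uniformly continuous to bounded continuous functionals\<close>

lemma J1_bounded_continuous_uminus: "J1_bounded_continuous F ==> J1_bounded_continuous (%x. - F x)"
 unfolding J1_bounded_continuous_def by (auto intro: tendsto_minus)

locale J1_convergence_setup =
 fixes M :: "nat => 'a measure" and Z :: "nat => 'a => real => real"
  and N :: "'b measure" and Y :: "'b => real => real"
 assumes prob_M: "!!n. 1 <= n ==> prob_space (M n)" and prob_N: "prob_space N"
  and cadlag_Z: "!!n v. 1 <= n ==> v \<in> space (M n) ==> cadlag (Z n v)"
  and cadlag_Y: "AE v in N. cadlag (Y v)"
  and meas_Z: "!!F n. 1 <= n ==> J1_bounded_continuous F ==> (%v. F (Z n v)) \<in> borel_measurable (M n)"
  and meas_Y: "!!F. J1_bounded_continuous F ==> (%v. F (Y v)) \<in> borel_measurable N"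
  and conv_uniform: "!!F. J1_bounded_continuous F ==> J1_uniform F ==>
   (%n. LINT v|M n. F (Z n v)) ----> (LINT v|N. F (Y v))"
begin

text \<open>An inf-convolution lies below F, its integrals converge by uniform continuity, and its
  limit integral is within eps/2 of that of F. Applied to F and -F this yields both halves of the
  limit.\<close>

lemma eventually_integral_ge:
 assumes F: "J1_bounded_continuous F" and e: "0 < eps"
 shows "EV n. (LINT v|M n. F (Z n v)) > (LINT v|N. F (Y v)) - eps"
proof -
 interpret N: prob_space N by (rule prob_N)
 obtain B where B: "!!x. cadlag x ==> abs(F x) <= B" using F unfolding J1_bounded_continuous_def by blast
 have cont: "!!xs x. (ALL k. cadlag (xs k)) ==> cadlag x ==> J1_tendsto xs x ==> (%k. F (xs k)) ----> F x"
  using F unfolding J1_bounded_continuous_def by blast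
 note bc = J1_infconv_bounded_continuous[of F B, OF B]
 have "(%m. LINT v|N. J1_infconv F m (Y v)) ----> (LINT v|N. F (Y v))"
 proof (rule integral_dominated_convergence[where w="%_. B"])
  show "AE v in N. (%m. J1_infconv F m (Y v)) ----> F (Y v)"
   using cadlag_Y by eventually_elim (rule J1_infconv_tendsto[OF B cont])
  show "AE v in N. norm (J1_infconv F m (Y v)) <= B" for m
   using cadlag_Y by eventually_elim (use J1_infconv_bound[of F B, OF B] in auto)
 qed (auto intro: meas_Y F bc)
 then have "EV m. (LINT v|N. J1_infconv F m (Y v)) > (LINT v|N. F (Y v)) - eps/2"
  using e by (intro order_tendstoD) auto
 then obtain m where m: "(LINT v|N. J1_infconv F m (Y v)) > (LINT v|N. F (Y v)) - eps/2"
  using eventually_happens'[OF sequentially_bot] by blast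
 have "(%n. LINT v|M n. J1_infconv F m (Z n v)) ----> (LINT v|N. J1_infconv F m (Y v))"
  by (intro conv_uniform bc J1_infconv_uniform[of F B, OF B])
 then have "EV n. (LINT v|M n. J1_infconv F m (Z n v)) > (LINT v|N. J1_infconv F m (Y v)) - eps/2"
  using e by (intro order_tendstoD) auto
 then show ?thesis using eventually_ge_at_top[of 1]
 proof eventually_elim
  case (elim n)
  interpret Mn: prob_space "M n" by (rule prob_M) (use elim in simp)
  have "(LINT v|M n. J1_infconv F m (Z n v)) <= (LINT v|M n. F (Z n v))"
  proof (rule integral_mono_AE)
   have *: "AE v in M n. cadlag (Z n v)" using cadlag_Z elim by auto
   show "integrable (M n) (%v. J1_infconv F m (Z n v))"
    by (rule Mn.integrable_const_bound[where B=B])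
     (use * in eventually_elim, use J1_infconv_bound[of F B, OF B] in simp, intro meas_Z bc, use elim in simp)
   show "integrable (M n) (%v. F (Z n v))"
    by (rule Mn.integrable_const_bound[where B=B])
     (use * in eventually_elim, use B in simp, intro meas_Z F, use elim in simp)
   show "AE v in M n. J1_infconv F m (Z n v) <= F (Z n v)"
    using * by eventually_elim (rule J1_infconv_le[of F B, OF B])
  qed
  then show ?case using elim m by linarith
 qed
qed

theorem integral_tendsto:
 assumes F: "J1_bounded_continuous F"
 shows "(%n. LINT v|M n. F (Z n v)) ----> (LINT v|N. F (Y v))"
proof (rule order_tendstoI)
 fix c assume "c < (LINT v|N. F (Y v))"
 then show "EV n. c < (LINT v|M n. F (Z n v))"
  using eventually_integral_ge[OF F, of "(LINT v|N. F (Y v)) - c"] by simp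
next
 fix c assume "(LINT v|N. F (Y v)) < c"
 then show "EV n. (LINT v|M n. F (Z n v)) < c"
  using eventually_integral_ge[OF J1_bounded_continuous_uminus[OF F], of "c - (LINT v|N. F (Y v))"]
  by simp
qed

end

section \<open>Convergence of characteristic functions\<close>

lemma tendsto_fun_coordinatewise:
 fixes x :: "'a => 'i => 'b::topological_space"
 assumes "!!i. ((%n. x n i) \<longlongrightarrow> l i) F"
 shows "(x \<longlongrightarrow> l) F"
proof -
 have "limitin (product_topology (%_. euclidean) UNIV) x l F"
  unfolding limitin_componentwise using assms by auto
 then show ?thesis by (simp add: euclidean_product_topology)
qed

lemma compact_unit_cube: "compact {s :: nat => real. ALL j. s j \<in> {-1..1}}"
proof -
 have "compactin (product_topology (%_. euclidean) UNIV) (PiE (UNIV::nat set) (%_. {-1..1::real}))"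
  unfolding compactin_PiE by simp
 moreover have "PiE UNIV (%_. {-1..1}) = {s :: nat => real. ALL j. s j \<in> {-1..1}}"
  by (auto simp: PiE_UNIV_domain)
 ultimately show ?thesis by (simp add: euclidean_product_topology)
qed

lemma (in prob_space) integral_diff_le:
 fixes u v :: "'a => real"
 assumes "integrable M u" "integrable M v" "E \<in> events"
  and "AE z in M. abs(u z - v z) <= eps + C * indicator E z"
 shows "abs((LINT z|M. u z) - (LINT z|M. v z)) <= eps + C * prob E"
proof -
 have iE: "integrable M (indicator E :: 'a => real)"
  using assms(3) by (intro integrable_real_indicator) (auto simp: emeasure_eq_measure)
 have "abs((LINT z|M. u z) - (LINT z|M. v z)) = norm (LINT z|M. u z - v z)"
  using assms by simp
 also have "... <= (LINT z|M. norm (u z - v z))" by (rule integral_norm_bound)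
 also have "... <= (LINT z|M. eps + C * indicator E z)"
 proof (rule integral_mono_AE)
  show "integrable M (%z. norm (u z - v z))"
   by (intro integrable_norm Bochner_Integration.integrable_diff assms)
  show "integrable M (%z. eps + C * indicator E z)"
   by (intro Bochner_Integration.integrable_add integrable_mult_right iE) simp
  show "AE z in M. norm (u z - v z) <= eps + C * indicator E z"
   using assms(4) by simp
 qed
 also have "... = eps + C * prob E"
  using iE assms(3) by (subst Bochner_Integration.integral_add) (auto simp: prob_space)
 finally show ?thesis .
qed

text \<open>Trigonometric polynomials in finitely many coordinates. Convergence of characteristic
  functions is convergence on the generators and extends by linearity.\<close>

inductive trig :: "((nat => real) => complex) => bool" where
 char: "trig (%x. cis (\<Sum>j<k. l j * x j))"
| scale: "trig f ==> trig (%x. c * f x)"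
| add: "trig f ==> trig g ==> trig (%x. f x + g x)"

lemma trig_mult:
 assumes "trig f" "trig g" shows "trig (%x. f x * g x)"
 using assms(1)
proof induction
 case (char l k)
 from assms(2) show ?case
 proof induction
  case (char l' k')
  define m where "m = max k k'"
  define L where "L j = (if j < k then l j else 0) + (if j < k' then l' j else 0)" for j
  have pad: "(\<Sum>j<q. h j * x j) = (\<Sum>j<m. (if j < q then h j else 0) * x j)" if "q <= m" for q h and x :: "nat => real"
   using that by (intro sum.mono_neutral_cong_left) auto
  have "cis (\<Sum>j<k. l j * x j) * cis (\<Sum>j<k'. l' j * x j) = cis (\<Sum>j<m. L j * x j)" for x
   unfolding cis_mult L_def distrib_right sum.distrib
   by (subst pad[of k l], simp add: m_def, subst pad[of k' l'], simp add: m_def, rule refl)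
  then show ?case using trig.char[where k=m and l=L] by simp
 next
  case (scale f c)
  then show ?case using trig.scale[OF scale.IH, of c] by (simp add: mult_ac)
 next
  case (add f g)
  then show ?case using trig.add[OF add.IH] by (simp add: distrib_left)
 qed
next
 case (scale f c)
 then show ?case using trig.scale[OF scale.IH, of c] by (simp add: mult_ac)
next
 case (add f g)
 then show ?case using trig.add[OF add.IH] by (simp add: distrib_right)
qed

lemma trig_const: "trig (%x. c)"
 using trig.scale[OF trig.char[where k=0 and l="%_. 0"], of c] by simp

lemma trig_sin: "trig (%x. of_real (sin (c * x j)))"
proof -
 have 1: "(\<Sum>i<Suc j. (if i = j then d else 0) * x i) = d * x j" for d and x :: "nat => real"
  by (simp add: sum.delta if_distrib[where f="%y. y * _"] cong: if_cong)
 have "trig (%x. cis (d * x j))" for d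
  using trig.char[where k="Suc j" and l="%i. if i = j then d else 0"] by (simp only: 1)
 then have "trig (%x. 1 / (2 * \<i>) * cis (c * x j) + (- 1 / (2 * \<i>)) * cis (- c * x j))"
  by (intro trig.add trig.scale)
 moreover have "1 / (2 * \<i>) * cis (c * x j) + (- 1 / (2 * \<i>)) * cis (- c * x j) = of_real (sin (c * x j))" for x :: "nat => real"
  by (simp add: complex_eq_iff cis.code)
 ultimately show ?thesis by simp
qed

inductive coord_poly :: "((nat => real) => real) => bool" where
 const: "coord_poly (%s. c)"
| coord: "coord_poly (%s. s j)"
| add: "coord_poly f ==> coord_poly g ==> coord_poly (%s. f s + g s)"
| mult: "coord_poly f ==> coord_poly g ==> coord_poly (%s. f s * g s)"

lemma coord_poly_continuous: "coord_poly h ==> continuous_on UNIV h"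
 by (induction rule: coord_poly.induct) (auto intro: continuous_intros)

text \<open>Replacing coordinates by sines maps the algebra used for Stone-Weierstrass on the cube
  into the trigonometric polynomials.\<close>

lemma trig_coord_poly_sin: "coord_poly h ==> trig (%x. of_real (h (%j. sin (c * x j))))"
 by (induction rule: coord_poly.induct) (auto intro: trig_const trig_sin trig.add trig_mult)

lemma coord_poly_dense:
 assumes "continuous_on {s. ALL j. s j \<in> {-1..1}} g" "0 < e"
 shows "EX h. coord_poly h & (ALL s. (ALL j. s j \<in> {-1..1}) --> abs(g s - h s) < e)"
proof -
 have "EX h. coord_poly h & (\<forall>s\<in>{s. ALL j. s j \<in> {-1..1}}. abs(g s - h s) < e)"
 proof (rule Stone_Weierstrass_HOL[OF compact_unit_cube])
  show "continuous_on {s. ALL j. s j \<in> {- 1..1}} f" if "coord_poly f" for f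
   using coord_poly_continuous[OF that] by (rule continuous_on_subset) auto
  fix x y :: "nat => real"
  assume "x \<in> {s. ALL j. s j \<in> {- 1..1}} & y \<in> {s. ALL j. s j \<in> {- 1..1}} & x ~= y"
  then obtain j where "x j ~= y j" by (auto simp: fun_eq_iff)
  then show "EX f. coord_poly f & f x ~= f y" using coord_poly.coord[of j] by blast
 qed (use assms in "auto intro: coord_poly.intros")
 then show ?thesis by auto
qed

lemma trig_measurable: "trig f ==> (!!j. (%z. D z j) \<in> borel_measurable M) ==> (%z. f (D z)) \<in> borel_measurable M"
 by (induction rule: trig.induct) (auto intro!: borel_measurable_complex_iff[THEN iffD2] simp: cis.sel)

lemma trig_bounded: "trig f ==> EX B. ALL x. norm (f x) <= B"
proof (induction rule: trig.induct)
 case (char k l)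
 then show ?case by (intro exI[of _ 1]) simp
next
 case (scale f c)
 then obtain B where "ALL x. norm (f x) <= B" by blast
 then show ?case by (intro exI[of _ "norm c * B"]) (auto simp: norm_mult intro: mult_left_mono)
next
 case (add f g)
 then obtain B C where "ALL x. norm (f x) <= B" "ALL x. norm (g x) <= C" by blast
 then show ?case by (intro exI[of _ "B + C"]) (auto intro: order_trans[OF norm_triangle_ineq] add_mono)
qed

lemma (in prob_space) trig_integrable:
 assumes "trig f" "!!j. (%z. D z j) \<in> borel_measurable M"
 shows "integrable M (%z. f (D z))"
proof -
 obtain B where "ALL x. norm (f x) <= B" using trig_bounded[OF assms(1)] by blast
 then show ?thesis by (intro integrable_const_bound[where B=B] trig_measurable assms) auto
qed

definition restr :: "nat => (nat => real) => nat => real" where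
 "restr J x = (%j. if j < J then x j else 0)"

lemma continuous_on_restr: "continuous_on UNIV (restr J)"
proof (rule continuous_on_coordinatewise_then_product)
 show "continuous_on UNIV (%x. restr J x i)" for i
  by (cases "i < J") (auto simp: restr_def)
qed

locale cf_convergence =
 fixes M :: "nat => 'a measure" and D :: "nat => 'a => nat => real"
  and N :: "'b measure" and E :: "'b => nat => real"
 assumes prob_M: "!!n. prob_space (M n)" and prob_N: "prob_space N"
  and meas_D: "!!n j. (%z. D n z j) \<in> borel_measurable (M n)"
  and meas_E: "!!j. (%z. E z j) \<in> borel_measurable N"
  and cf: "!!k l. (%n. LINT z|M n. cis (\<Sum>j<k. l j * D n z j)) ----> (LINT z|N. cis (\<Sum>j<k. l j * E z j))"
begin

lemma trig_tendsto: "trig f ==> (%n. LINT z|M n. f (D n z)) ----> (LINT z|N. f (E z))"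
proof (induction rule: trig.induct)
 case (char k l)
 then show ?case by (rule cf)
next
 case (scale f c)
 then show ?case by (simp add: tendsto_mult_left)
next
 case (add f g)
 have "integrable (M n) (%z. h (D n z))" "integrable N (%z. h (E z))" if "trig h" for h n
  using prob_space.trig_integrable[OF prob_M that meas_D] prob_space.trig_integrable[OF prob_N that meas_E] by auto
 then show ?case using add by (simp add: tendsto_add)
qed

text \<open>The one-dimensional continuity theorem gives weak convergence of coordinate j. A
  continuous cutoff between A and A + 1 transfers the tail bound from the limit to all large
  n.\<close>

lemma coordinate_tight:
 assumes e: "0 < eps"
 shows "\<exists>A>0. (EV n. measure (M n) {z\<in>space (M n). abs(D n z j) > A} <= eps) &
  measure N {z\<in>space N. abs(E z j) > A} <= eps"
proof -
 interpret N: prob_space N by (rule prob_N)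
 note [measurable] = meas_D meas_E
 have [measurable]: "(%z. E z j) \<in> borel_measurable N" by (rule meas_E)
 have "(%A. measure N {z\<in>space N. abs(E z j) > real A}) ----> measure N (\<Inter>A. {z\<in>space N. abs(E z j) > real A})"
  by (rule N.finite_Lim_measure_decseq) (auto simp: decseq_def)
 also have "(\<Inter>A. {z\<in>space N. abs(E z j) > real A}) = {}"
 proof safe
  fix z assume *: "z \<in> (\<Inter>A. {z\<in>space N. abs(E z j) > real A})"
  obtain A where "abs(E z j) <= real A" using real_arch_simple by blast
  with * show "z \<in> {}" by (auto simp: not_less[symmetric])
 qed
 finally have "EV A. measure N {z\<in>space N. abs(E z j) > real A} < eps"
  using e by (auto dest: order_tendstoD(2)[where a=eps])
 then obtain A where A: "measure N {z\<in>space N. abs(E z j) > real A} < eps"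
  using eventually_happens'[OF sequentially_bot] by blast
 define c where "c x = min 1 (max 0 (abs(x) - real A))" for x
 have c01: "0 <= c x" "c x <= 1" for x by (auto simp: c_def)
 have [measurable]: "c \<in> borel_measurable borel" unfolding c_def by measurable
 have "continuous_on UNIV c" unfolding c_def by (intro continuous_intros)
 then have c_cont: "isCont c x" for x by (simp add: continuous_on_eq_continuous_at)
 have rdM: "real_distribution (distr (M n) borel (%z. D n z j))" for n
  by (intro real_distribution.intro prob_space.prob_space_distr prob_M meas_D real_distribution_axioms.intro) auto
 have rdN: "real_distribution (distr N borel (%z. E z j))"
  by (intro real_distribution.intro prob_space.prob_space_distr prob_N meas_E real_distribution_axioms.intro) auto
 have "weak_conv_m (%n. distr (M n) borel (%z. D n z j)) (distr N borel (%z. E z j))"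
 proof (rule levy_continuity[OF rdM rdN])
  fix t :: real
  have 1: "(\<Sum>i<Suc j. (if i = j then t else 0) * x i) = t * x j" for x :: "nat => real"
   by (simp add: sum.delta if_distrib[where f="%y. y * _"] cong: if_cong)
  have "(%n. LINT z|M n. cis (t * D n z j)) ----> (LINT z|N. cis (t * E z j))"
   using cf[of "%i. if i = j then t else 0" "Suc j"] unfolding 1 .
  then show "(%n. char (distr (M n) borel (%z. D n z j)) t) ----> char (distr N borel (%z. E z j)) t"
   unfolding char_def by (simp add: integral_distr meas_D cis_conv_exp mult_ac)
 qed
 from weak_conv_imp_integral_bdd_continuous_conv[OF rdM rdN this, of c 1]
 have "(%n. LINT x|distr (M n) borel (%z. D n z j). c x) ----> (LINT x|distr N borel (%z. E z j). c x)"
  using c01 c_cont by auto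
 then have lim: "(%n. LINT z|M n. c (D n z j)) ----> (LINT z|N. c (E z j))"
  by (simp add: integral_distr meas_D)
 have "(LINT z|N. c (E z j)) <= (LINT z|N. indicator {z\<in>space N. abs(E z j) > real A} z)"
  by (intro integral_mono N.integrable_const_bound[where B=1]) (auto simp: c01 c_def indicator_def)
 also have "... < eps" using A by simp
 finally have ev: "EV n. (LINT z|M n. c (D n z j)) < eps"
  using order_tendstoD(2)[OF lim] by blast
 have "EV n. measure (M n) {z\<in>space (M n). abs(D n z j) > real A + 1} <= eps"
  using ev
 proof eventually_elim
  case (elim n)
  interpret Mn: prob_space "M n" by (rule prob_M)
  have [measurable]: "(%z. D n z j) \<in> borel_measurable (M n)" by (rule meas_D)
  have "measure (M n) {z\<in>space (M n). abs(D n z j) > real A + 1} =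
   (LINT z|M n. indicator {z\<in>space (M n). abs(D n z j) > real A + 1} z)" by simp
  also have "... <= (LINT z|M n. c (D n z j))"
   by (intro integral_mono Mn.integrable_const_bound[where B=1]) (auto simp: c01 c_def indicator_def)
  finally show ?case using elim by simp
 qed
 moreover have "measure N {z\<in>space N. abs(E z j) > real A + 1} <= eps"
  by (rule order_trans[OF N.finite_measure_mono less_imp_le[OF A]]) auto
 ultimately show ?thesis by (intro exI[of _ "real A + 1"]) auto
qed

text \<open>A continuity theorem in finitely many coordinates. On a box of half-width A the sines of
  c x determine x, so f is there a continuous function of sines, uniformly close to a polynomial in
  them, that is, to a trigonometric polynomial. Off the box only bounds are used, and tightness
  makes its complement unlikely.\<close>

lemma integral_restr_tendsto:
 fixes f :: "(nat => real) => real"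
 assumes cont: "continuous_on UNIV f" and bnd: "!!x. abs(f x) <= B"
 shows "(%n. LINT z|M n. f (restr J (D n z))) ----> (LINT z|N. f (restr J (E z)))"
proof (rule LIMSEQ_I)
 fix r :: real assume r: "0 < r"
 interpret N: prob_space N by (rule prob_N)
 have B0: "0 <= B" using bnd[of "%_. 0"] by simp
 have frestr: "continuous_on UNIV (%x. f (restr J x))"
  by (rule continuous_on_compose2[OF cont continuous_on_restr]) simp
 \<comment> \<open>Twice the approximation error, once for the sequence and once for the limit, must
   stay strictly below r.\<close>
 define eps where "eps = min 1 (r / (4 + 2 * (2 * B + 1) * real J))"
 have den: "4 + 2 * (2 * B + 1) * real J > 0" using B0 by (simp add: add_pos_nonneg)
 have e: "eps > 0" "eps <= 1" using r den by (auto simp: eps_def)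
 have "eps * (4 + 2 * (2 * B + 1) * real J) <= r"
  using den mult_right_mono[of eps "r / (4 + 2 * (2 * B + 1) * real J)" "4 + 2 * (2 * B + 1) * real J"]
  by (auto simp: eps_def)
 then have er: "2 * (eps + (2 * B + 1) * (eps * real J)) < r"
  using e by (simp add: algebra_simps)
 have "ALL j. \<exists>A>0. (EV n. measure (M n) {z\<in>space (M n). abs(D n z j) > A} <= eps) &
  measure N {z\<in>space N. abs(E z j) > A} <= eps"
  using coordinate_tight[OF e(1)] by blast
 from choice[OF this] obtain A' where A': "!!j. A' j > 0"
  "!!j. EV n. measure (M n) {z\<in>space (M n). abs(D n z j) > A' j} <= eps"
  "!!j. measure N {z\<in>space N. abs(E z j) > A' j} <= eps" by auto
 define A where "A = 1 + (\<Sum>j<J. A' j)"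
 have A: "A > 0" using A'(1) by (simp add: A_def add_pos_nonneg less_imp_le sum_nonneg)
 have AA: "A' j <= A" if "j < J" for j
  using member_le_sum[of j "{..<J}" A'] A'(1) that by (force simp: A_def less_imp_le)
 \<comment> \<open>This maps [-A, A] onto [-pi/2, pi/2], where \<open>arcsin\<close> inverts the
   sine.\<close>
 define c where "c = pi / (2 * A)"
 have c: "c > 0" using A by (simp add: c_def)
 define g where "g s = f (%j. if j < J then arcsin (s j) / c else 0)" for s
 have "continuous_on {s :: nat => real. ALL j. s j \<in> {-1..1}} (%s j. if j < J then arcsin (s j) / c else 0)"
 proof (rule continuous_on_coordinatewise_then_product)
  fix j :: nat
  have "continuous_on {s. ALL j. s j \<in> {-1..1}} (%s. arcsin (s j) / c)"
   using c by (intro continuous_intros continuous_on_subset[OF continuous_on_product_coordinates]) auto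
  then show "continuous_on {s. ALL j. s j \<in> {-1..1}} (%s. if j < J then arcsin (s j) / c else 0)"
   by (cases "j < J") auto
 qed
 then have "continuous_on {s. ALL j. s j \<in> {-1..1}} g"
  unfolding g_def by (intro continuous_on_compose2[OF cont]) auto
 from coord_poly_dense[OF this e(1)] obtain h where h: "coord_poly h"
  "!!s. (ALL j. s j \<in> {-1..1}) ==> abs(g s - h s) < eps" by blast
 define t where "t x = h (%j. sin (c * x j))" for x :: "nat => real"
 \<comment> \<open>Valid for every x, not only inside the box: sines always lie in the cube. Hence
   the trigonometric polynomial is bounded by B + eps everywhere.\<close>
 have tg: "abs(g (%j. sin (c * x j)) - t x) < eps" for x
  unfolding t_def by (rule h(2)) auto
 have diff: "abs(f (restr J x) - t x) <= eps + (2 * B + 1) * (if \<exists>j<J. abs(x j) > A then 1 else 0)" for x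
 proof (cases "\<exists>j<J. abs(x j) > A")
  case True
  have "abs(f (restr J x)) <= B" "abs(g (%j. sin (c * x j))) <= B" unfolding g_def by (rule bnd)+
  then show ?thesis using tg[of x] True B0 by (simp add: abs_le_iff abs_less_iff)
 next
  case False
  have "arcsin (sin (c * x j)) / c = x j" if "j < J" for j
  proof -
   have "abs(x j) <= A" using False that by (meson not_less)
   then have "abs(c * x j) <= c * A" using c by (simp add: abs_mult)
   also have "c * A = pi / 2" using A by (simp add: c_def)
   finally have "arcsin (sin (c * x j)) = c * x j" by (intro arcsin_sin) auto
   then show ?thesis using c by simp
  qed
  then have "g (%j. sin (c * x j)) = f (restr J x)"
   unfolding g_def restr_def by (metis (no_types, lifting))
  then show ?thesis using tg[of x] False e by auto
 qed
 have tr: "trig (%x. of_real (t x))" unfolding t_def by (rule trig_coord_poly_sin[OF h(1)])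
 have key: "abs((LINT z|P. f (restr J (X z))) - (LINT z|P. t (X z))) <= eps + (2 * B + 1) * (eps * real J)"
  if P: "prob_space P" and X [measurable]: "!!j. (%z. X z j) \<in> borel_measurable P"
   and tight: "!!j. j < J ==> measure P {z\<in>space P. abs(X z j) > A' j} <= eps"
  for P :: "'c measure" and X
 proof -
  interpret P: prob_space P by (rule P)
  have Xm [measurable]: "X \<in> borel_measurable P" by (rule measurable_coordinatewise_then_product[OF X])
  define Ev where "Ev = {z\<in>space P. \<exists>j<J. abs(X z j) > A}"
  have Ev: "Ev \<in> P.events" unfolding Ev_def by measurable
  have pr: "P.prob Ev <= eps * real J"
  proof -
   have "P.prob Ev <= P.prob (\<Union>j\<in>{..<J}. {z\<in>space P. abs(X z j) > A' j})"
    by (rule P.finite_measure_mono) (use AA in \<open>force simp: Ev_def\<close>, measurable)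
   also have "... <= (\<Sum>j<J. P.prob {z\<in>space P. abs(X z j) > A' j})"
    by (rule P.finite_measure_subadditive_finite) auto
   also have "... <= (\<Sum>j<J. eps)" by (intro sum_mono tight) auto
   finally show ?thesis by (simp add: mult.commute)
  qed
  have "integrable P (%z. complex_of_real (t (X z)))"
   by (rule P.trig_integrable[OF tr X])
  then have it: "integrable P (%z. t (X z))" by (simp only: complex_of_real_integrable_eq)
  have if': "integrable P (%z. f (restr J (X z)))"
   by (rule P.integrable_const_bound[where B=B])
    (use bnd in "auto intro!: measurable_compose[OF Xm borel_measurable_continuous_onI[OF frestr]]")
  have "abs((LINT z|P. f (restr J (X z))) - (LINT z|P. t (X z))) <= eps + (2 * B + 1) * P.prob Ev"
  proof (rule P.integral_diff_le[OF if' it Ev AE_I2])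
   fix z assume "z \<in> space P"
   then have "indicator Ev z = (if \<exists>j<J. abs(X z j) > A then 1 else 0 :: real)"
    unfolding Ev_def indicator_def by simp
   then show "abs(f (restr J (X z)) - t (X z)) <= eps + (2 * B + 1) * indicator Ev z"
    using diff[of "X z"] by simp
  qed
  also have "... <= eps + (2 * B + 1) * (eps * real J)"
   using pr B0 by (intro add_left_mono mult_left_mono) auto
  finally show ?thesis .
 qed
 have evA: "EV n. \<forall>j\<in>{..<J}. measure (M n) {z\<in>space (M n). abs(D n z j) > A' j} <= eps"
  using A'(2) by (intro eventually_ball_finite) auto
 have "(%n. LINT z|M n. complex_of_real (t (D n z))) ----> (LINT z|N. complex_of_real (t (E z)))"
  by (rule trig_tendsto[OF tr])
 then have "(%n. LINT z|M n. t (D n z)) ----> (LINT z|N. t (E z))"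
  by (simp only: integral_complex_of_real tendsto_of_real_iff)
 then have "EV n. abs((LINT z|M n. t (D n z)) - (LINT z|N. t (E z))) < r - 2 * (eps + (2 * B + 1) * (eps * real J))"
  using er by (auto dest!: tendstoD[where e="r - 2 * (eps + (2 * B + 1) * (eps * real J))"] simp: dist_real_def)
 with evA have "EV n. norm ((LINT z|M n. f (restr J (D n z))) - (LINT z|N. f (restr J (E z)))) < r"
 proof eventually_elim
  case (elim n)
  have a: "abs((LINT z|M n. f (restr J (D n z))) - (LINT z|M n. t (D n z))) <= eps + (2 * B + 1) * (eps * real J)"
   by (rule key[OF prob_M meas_D]) (use elim in auto)
  have b: "abs((LINT z|N. f (restr J (E z))) - (LINT z|N. t (E z))) <= eps + (2 * B + 1) * (eps * real J)"
   by (rule key[OF prob_N meas_E A'(3)])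
  define K where "K = eps + (2 * B + 1) * (eps * real J)"
  show ?case using a b elim(2) unfolding real_norm_def K_def[symmetric] by linarith
 qed
 then show "EX no. \<forall>n\<ge>no. norm ((LINT z|M n. f (restr J (D n z))) - (LINT z|N. f (restr J (E z)))) < r"
  by (simp add: eventually_sequentially)
qed

end

text \<open>The convergence theorem for a constant sequence gives equal integrals of bounded
  continuous functions of finitely many coordinates. Dominated convergence removes the restriction
  to J coordinates, and multiples of the distance to the complement, capped at 1, reach open
  sets.\<close>

lemma cf_determines_distr:
 fixes D :: "'a => nat => real" and E :: "'b => nat => real"
 assumes M: "prob_space M" and N: "prob_space N"
  and D: "!!j. (%z. D z j) \<in> borel_measurable M"
  and E: "!!j. (%z. E z j) \<in> borel_measurable N"
  and cf: "!!k l. (LINT z|M. cis (\<Sum>j<k. l j * D z j)) = (LINT z|N. cis (\<Sum>j<k. l j * E z j))"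
 shows "distr M borel D = distr N borel E"
proof -
 interpret M: prob_space M by fact
 interpret N: prob_space N by fact
 have Dm [measurable]: "D \<in> borel_measurable M" by (rule measurable_coordinatewise_then_product[OF D])
 have Em [measurable]: "E \<in> borel_measurable N" by (rule measurable_coordinatewise_then_product[OF E])
 interpret cf_convergence "%_. M" "%_. D" N E
  by unfold_locales (use assms in "auto simp: M.emeasure_space_1")
 have restr_lim: "(%J. f (restr J x)) ----> f x" if "continuous_on UNIV f" for f :: "(nat => real) => real" and x
 proof -
  have "(%J. restr J x) ----> x"
  proof (rule tendsto_fun_coordinatewise)
   fix i
   have "EV J. restr J x i = x i"
    using eventually_gt_at_top[of i] by eventually_elim (simp add: restr_def)
   then show "(%J. restr J x i) ----> x i" by (rule tendsto_eventually)
  qed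
  from continuous_on_tendsto_compose[OF that this] show ?thesis by simp
 qed
 have eq: "(LINT z|M. f (D z)) = (LINT z|N. f (E z))"
  if cont: "continuous_on UNIV f" and bnd: "!!x. abs(f x) <= B" for f :: "(nat => real) => real" and B
 proof -
  have mf: "f \<in> borel_measurable borel" "(%x. f (restr J x)) \<in> borel_measurable borel" for J
   using cont continuous_on_compose2[OF cont continuous_on_restr[of J]]
   by (auto intro: borel_measurable_continuous_onI)
  have 1: "(LINT z|M. f (restr J (D z))) = (LINT z|N. f (restr J (E z)))" for J
   using integral_restr_tendsto[OF cont bnd] by (simp add: LIMSEQ_const_iff)
  have "(%J. LINT z|M. f (restr J (D z))) ----> (LINT z|M. f (D z))"
   by (rule integral_dominated_convergence[where w="%_. B"])
    (use bnd restr_lim[OF cont] in "auto intro!: measurable_compose[OF Dm mf(1)] measurable_compose[OF Dm mf(2)]")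
  moreover have "(%J. LINT z|N. f (restr J (E z))) ----> (LINT z|N. f (E z))"
   by (rule integral_dominated_convergence[where w="%_. B"])
    (use bnd restr_lim[OF cont] in "auto intro!: measurable_compose[OF Em mf(1)] measurable_compose[OF Em mf(2)]")
  ultimately show ?thesis unfolding 1 by (rule LIMSEQ_unique)
 qed
 \<comment> \<open>The distance to an empty set is 0 by convention, so the whole space is a separate
   case.\<close>
 have op: "emeasure (distr M borel D) U = emeasure (distr N borel E) U" if U: "open U" for U
 proof (cases "U = UNIV")
  case True
  then show ?thesis by (simp add: emeasure_distr M.emeasure_space_1 N.emeasure_space_1)
 next
  case False
  define f where "f k x = min 1 (real k * infdist x (- U))" for k x
  have cont: "continuous_on UNIV (f k)" for k unfolding f_def by (intro continuous_intros)
  have bnd: "abs(f k x) <= 1" for k x unfolding f_def by (auto simp: infdist_nonneg)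
  have mf: "f k \<in> borel_measurable borel" for k by (rule borel_measurable_continuous_onI[OF cont])
  have lim: "(%k. f k x) ----> indicator U x" for x
  proof (cases "x \<in> U")
   case True
   have "infdist x (- U) ~= 0"
    using in_closed_iff_infdist_zero[of "- U" x] U True False by (auto simp: closed_def)
   then have p: "infdist x (- U) > 0" using infdist_nonneg[of x "- U"] by linarith
   obtain k0 where k0: "1 / infdist x (- U) <= real k0" using real_arch_simple by blast
   have "EV k. f k x = 1"
    using eventually_ge_at_top[of k0]
   proof eventually_elim
    case (elim k)
    then have "1 / infdist x (- U) <= real k" using k0 by simp
    then have "1 <= real k * infdist x (- U)" using p by (simp add: field_simps)
    then show ?case by (simp add: f_def)
   qed
   then show ?thesis using True by (simp add: tendsto_eventually)
  next
   case False
   then show ?thesis by (simp add: f_def)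
  qed
  have "(%k. LINT z|M. f k (D z)) ----> (LINT z|M. indicator U (D z))"
   by (rule integral_dominated_convergence[where w="%_. 1"])
    (use bnd lim U in "auto intro!: measurable_compose[OF Dm mf] measurable_compose[OF Dm borel_measurable_indicator]")
  moreover have "(%k. LINT z|N. f k (E z)) ----> (LINT z|N. indicator U (E z))"
   by (rule integral_dominated_convergence[where w="%_. 1"])
    (use bnd lim U in "auto intro!: measurable_compose[OF Em mf] measurable_compose[OF Em borel_measurable_indicator]")
  ultimately have i: "(LINT z|M. indicator U (D z)) = (LINT z|N. indicator U (E z) :: real)"
   unfolding eq[OF cont bnd] by (rule LIMSEQ_unique)
  have "measure (distr M borel D) U = (LINT x|distr M borel D. indicator U x)" using U by simp
  also have "... = (LINT z|M. indicator U (D z))" using U by (intro integral_distr) auto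
  finally have a: "measure (distr M borel D) U = (LINT z|M. indicator U (D z))" .
  have "measure (distr N borel E) U = (LINT x|distr N borel E. indicator U x)" using U by simp
  also have "... = (LINT z|N. indicator U (E z))" using U by (intro integral_distr) auto
  finally have b: "measure (distr N borel E) U = (LINT z|N. indicator U (E z))" .
  interpret DM: prob_space "distr M borel D" by (rule M.prob_space_distr[OF Dm])
  interpret DN: prob_space "distr N borel E" by (rule N.prob_space_distr[OF Em])
  show ?thesis using a b i by (simp add: DM.emeasure_eq_measure DN.emeasure_eq_measure)
 qed
 show ?thesis
 proof (rule measure_eqI_generator_eq[where E="{U. open U}" and A="%_. UNIV" and \<Omega>=UNIV])
  show "Int_stable {U :: (nat => real) set. open U}" by (auto simp: Int_stable_def)
  interpret DM: prob_space "distr M borel D" by (rule M.prob_space_distr[OF Dm])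
  show "emeasure (distr M borel D) UNIV ~= \<infinity>" by simp
 qed (auto simp: op, auto simp: borel_def)
qed

section \<open>Step paths\<close>

definition kink :: "real => real => real => real => real" where
 "kink c w k u = min u c + k * max 0 (min (u - c) w) + max 0 (u - c - w)"

lemma time_change_kink:
 assumes "0 <= c" "0 < w" "0 < k" shows "time_change (kink c w k)"
proof (rule time_changeI)
 show "strict_mono_on {0..} (kink c w k)"
 proof (rule strict_mono_onI)
  fix u u' :: real assume uu: "u < u'"
  have m: "min u c <= min u' c" "k * max 0 (min (u - c) w) <= k * max 0 (min (u' - c) w)"
   "max 0 (u - c - w) <= max 0 (u' - c - w)"
   using uu assms by (auto intro!: mult_left_mono)
  consider "u < c" | "c <= u" "u < c + w" | "c + w <= u" by linarith
  then show "kink c w k u < kink c w k u'"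
  proof cases
   case 1
   then have "min u c < min u' c" using uu by auto
   then show ?thesis using m unfolding kink_def by linarith
  next
   case 2
   then have "max 0 (min (u - c) w) < max 0 (min (u' - c) w)" using uu assms by auto
   then have "k * max 0 (min (u - c) w) < k * max 0 (min (u' - c) w)" using assms by simp
   then show ?thesis using m unfolding kink_def by linarith
  next
   case 3
   then have "max 0 (u - c - w) < max 0 (u' - c - w)" using uu by auto
   then show ?thesis using m unfolding kink_def by linarith
  qed
 qed
 show "continuous_on {0..} (kink c w k)" unfolding kink_def by (intro continuous_intros)
 show "kink c w k 0 = 0" using assms by (simp add: kink_def)
 show "\<exists>s\<ge>0. t <= kink c w k s" if "0 <= t" for t
 proof (intro exI[of _ "t + c + w"] conjI)
  show "t <= kink c w k (t + c + w)" using assms that by (simp add: kink_def)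
 qed (use assms that in auto)
qed

text \<open>The induction post-composes with a \<open>kink\<close> at C J: the identity below, the
  required slope on the next piece, slope 1 after it. On each piece the deviation from the identity
  is a convex combination of its values at the end points.\<close>

lemma piecewise_linear_time_change:
 fixes T C :: "nat => real"
 assumes "T 0 = 0" "C 0 = 0" "!!i. i < J ==> T i < T (Suc i)" "!!i. i < J ==> C i < C (Suc i)"
  and "!!i. i <= J ==> abs(T i - C i) <= eps"
 shows "EX l. time_change l & (\<forall>i\<le>J. l (T i) = C i) & (\<forall>t\<ge>0. abs(l t - t) <= eps) &
  (\<forall>t\<ge>T J. l t = C J + (t - T J))"
 using assms(3-5)
proof (induction J)
 case 0
 then show ?case
  using assms(1,2) by (intro exI[of _ "%t. t"]) (auto simp: time_change_id)
next
 case (Suc J)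
 then obtain l where l: "time_change l" "!!i. i <= J ==> l (T i) = C i" "!!t. t >= 0 ==> abs(l t - t) <= eps"
  "!!t. t >= T J ==> l t = C J + (t - T J)" by (metis less_Suc_eq le_SucI)
 \<comment> \<open>Monotonicity is known only up to index J, so the sequence is frozen
   there.\<close>
 have Tm: "T i <= T J" if "i <= J" for i
  using that Suc.prems(1) by (intro lift_Suc_mono_le[of "%j. T (min j J)" i J, simplified min.absorb1 min.idem])
   (auto simp: min_def less_imp_le not_less_eq_eq)
 have Cm: "C i <= C J" if "i <= J" for i
  using that Suc.prems(2) by (intro lift_Suc_mono_le[of "%j. C (min j J)" i J, simplified min.absorb1 min.idem])
   (auto simp: min_def less_imp_le not_less_eq_eq)
 have T0: "T J >= 0" "C J >= 0" using Tm[of 0] Cm[of 0] assms(1,2) by auto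
 define w where "w = T (Suc J) - T J"
 define k where "k = (C (Suc J) - C J) / w"
 have w: "w > 0" using Suc.prems(1)[of J] by (simp add: w_def)
 have k: "k > 0" using Suc.prems(2)[of J] w by (simp add: k_def)
 have kw: "k * w = C (Suc J) - C J" using w by (simp add: k_def)
 define p where "p = kink (C J) w k"
 have p: "time_change p" unfolding p_def by (rule time_change_kink[OF T0(2) w k])
 have p_low: "p u = u" if "u <= C J" for u using that w by (simp add: p_def kink_def)
 have p_mid: "p u = C J + k * (u - C J)" if "C J <= u" "u <= C J + w" for u using that w by (simp add: p_def kink_def)
 have p_high: "p u = C (Suc J) + (u - C J - w)" if "C J + w <= u" for u using that w kw by (simp add: p_def kink_def)
 have lm: "l t <= C J" if "0 <= t" "t <= T J" for t
 proof (cases "t = T J")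
  case False
  then have "l t < l (T J)" using l(1) that T0 unfolding time_change_def strict_mono_on_def by auto
  then show ?thesis using l(2)[of J] by simp
 qed (simp add: l(2))
 have after: "p (l t) = C (Suc J) + (t - T (Suc J))" if "t >= T (Suc J)" for t
  using that w l(4)[of t] p_high[of "l t"] by (simp add: w_def)
 show ?case
 proof (intro exI[of _ "%t. p (l t)"] conjI allI impI)
  show "time_change (%t. p (l t))" by (rule time_change_comp[OF p l(1)])
  show "p (l (T i)) = C i" if "i <= Suc J" for i
  proof (cases "i = Suc J")
   case True
   then show ?thesis using after[of "T (Suc J)"] by simp
  next
   case False
   then have "i <= J" using that by simp
   then show ?thesis using l(2) Cm p_low by simp
  qed
  show "p (l t) = C (Suc J) + (t - T (Suc J))" if "t >= T (Suc J)" for t using after[OF that] .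
  fix t :: real assume t: "0 <= t"
  consider "t <= T J" | "T J <= t" "t <= T (Suc J)" | "T (Suc J) <= t" by linarith
  then show "abs(p (l t) - t) <= eps"
  proof cases
   case 1
   then show ?thesis using p_low[OF lm[OF t 1]] l(3)[OF t] by simp
  next
   case 2
   define s where "s = (t - T J) / w"
   have s: "0 <= s" "s <= 1" using 2 w by (auto simp: s_def w_def)
   have sw: "s * w = t - T J" using w by (simp add: s_def)
   have "p (l t) = C J + k * (t - T J)" using 2 l(4)[of t] p_mid[of "l t"] by (simp add: w_def)
   then have pl: "p (l t) = C J + s * (C (Suc J) - C J)" unfolding kw[symmetric] sw[symmetric] by (simp add: mult_ac)
   have tt: "t = T J + s * (T (Suc J) - T J)" using sw by (simp add: w_def)
   define q where "q = p (l t)"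
   have "q - t = (1 - s) * (C J - T J) + s * (C (Suc J) - T (Suc J))"
    using pl[folded q_def] tt by (simp add: algebra_simps)
   also have "abs(...) <= (1 - s) * abs(C J - T J) + s * abs(C (Suc J) - T (Suc J))"
    using s by (intro order_trans[OF abs_triangle_ineq]) (simp add: abs_mult)
   also have "... <= (1 - s) * eps + s * eps"
    using s Suc.prems(3)[of J] Suc.prems(3)[of "Suc J"]
    by (intro add_mono mult_left_mono) (auto simp: abs_minus_commute)
   finally show ?thesis by (simp add: algebra_simps q_def)
  next
   case 3
   then show ?thesis using after[OF 3] Suc.prems(3)[of "Suc J"] by (simp add: abs_minus_commute)
  qed
 qed
qed

lemma step_cell_exists:
 fixes T :: "nat => real"
 assumes "T 0 <= t" "t < T J"
 obtains j where "j < J" "T j <= t" "t < T (Suc j)"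
proof -
 define k where "k = (LEAST k. t < T k)"
 have k: "t < T k" unfolding k_def by (rule LeastI[of _ J]) (rule assms)
 have kJ: "k <= J" unfolding k_def by (rule Least_le) (rule assms)
 have "k ~= 0" using k assms(1) by (intro notI) simp
 then obtain j where j: "k = Suc j" by (cases k) auto
 then have "\<not> t < T j" using not_less_Least[of j "%k. t < T k"] by (simp add: k_def[symmetric])
 then show ?thesis using that[of j] j k kJ by auto
qed

text \<open>A path \<open>y\<close> with blocks \<open>[R\<^sub>j, R\<^sub>j\<^sub>+\<^sub>1]\<close>, each split at \<open>c\<^sub>j\<close> (the possible big jump) into a part close
  to \<open>v\<^sub>j\<close> and a part close to \<open>v\<^sub>j\<^sub>+\<^sub>1\<close>, is compared to the step path which jumps at the times
  \<open>T\<^sub>j\<close>: the time change sends \<open>T\<^sub>j\<^sub>+\<^sub>1\<close> to \<open>c\<^sub>j\<close>.\<close>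

lemma J1_close_step_path:
 fixes T R c v :: "nat => real"
 assumes T0: "T 0 = 0" and R0: "R 0 = 0"
  and Tinc: "!!j. j < J ==> T j < T (Suc j)"
  and c: "!!j. j < J ==> R j < c j" "!!j. j < J ==> c j <= R (Suc j)"
  and left: "!!j t. j < J ==> R j <= t ==> t < c j ==> abs(y t - v j) <= eps"
  and right: "!!j t. j < J ==> c j <= t ==> t <= R (Suc j) ==> abs(y t - v (Suc j)) <= eps"
  and near: "!!j. j < J ==> abs(T (Suc j) - c j) <= eps"
  and h: "!!j t. j < J ==> T j <= t ==> t < T (Suc j) ==> h t = v j"
  and e: "0 <= eps" and tail: "exp (- T J) <= eps"
 shows "J1_close eps y h"
proof -
 \<comment> \<open>The index shift reflects that the step path takes the value v j between the split
   points of blocks j - 1 and j.\<close>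
 define C where "C j = (case j of 0 => 0 | Suc i => c i)" for j
 have C: "C 0 = 0" "C (Suc i) = c i" for i by (auto simp: C_def)
 have Cinc: "C j < C (Suc j)" if "j < J" for j
  using c(1)[OF that] c(2)[of "j - 1"] that R0 by (cases j) (auto simp: C intro: le_less_trans)
 have nearC: "abs(T j - C j) <= eps" if "j <= J" for j
  using near[of "j - 1"] that T0 e by (cases j) (auto simp: C)
 obtain l where l: "time_change l" "!!i. i <= J ==> l (T i) = C i" "!!t. t >= 0 ==> abs(l t - t) <= eps"
  using piecewise_linear_time_change[OF T0 C(1) Tinc Cinc nearC] by metis
 have lmono: "l s < l t" if "0 <= s" "s < t" for s t
  using l(1) that unfolding time_change_def strict_mono_on_def by auto
 have Tnn: "0 <= T j" if "j <= J" for j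
  using that
 proof (induction j)
  case (Suc j)
  then show ?case using Tinc[of j] by simp
 qed (simp add: T0)
 show ?thesis
  unfolding J1_close_def
 proof (intro exI[of _ l] conjI allI impI l)
  fix t :: real assume t: "0 <= t"
  show "exp (- t) * min 1 \<bar>y (l t) - h t\<bar> <= eps"
  proof (cases "t < T J")
   case True
   then obtain j where j: "j < J" "T j <= t" "t < T (Suc j)"
    using step_cell_exists[of T t J] t T0 by auto
   have 1: "C j <= l t"
    using lmono[of "T j" t] j l(2)[of j] Tnn[of j] by (cases "t = T j") auto
   have 2: "l t < c j" using lmono[of t "T (Suc j)"] j t l(2)[of "Suc j"] by (simp add: C)
   have "abs(y (l t) - v j) <= eps"
   proof (cases "R j <= l t")
    case True
    then show ?thesis using left[OF j(1)] 2 by simp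
   next
    case False
    \<comment> \<open>A time before R j but after C j lies in the right part of the previous block,
      which is also close to v j.\<close>
    with 1 have "j ~= 0" using R0 by (intro notI) (simp add: C)
    then obtain i where i: "j = Suc i" by (cases j) auto
    then show ?thesis using right[of i "l t"] 1 False j by (simp add: C)
   qed
   moreover have "exp (- t) * min 1 \<bar>y (l t) - h t\<bar> <= 1 * abs(y (l t) - h t)"
    using t by (intro mult_mono) auto
   ultimately show ?thesis using h[OF j] by simp
  next
   case False
   have "exp (- t) * min 1 \<bar>y (l t) - h t\<bar> <= exp (- T J) * 1"
    using False by (intro mult_mono) auto
   then show ?thesis using tail by simp
  qed
 qed (use l in auto)
qed

text \<open>Counting the jump times passed gives a total function for arbitrary T and continues with
  v J after the last jump.\<close>

definition step_path :: "nat => (nat => real) => (nat => real) => real => real" where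
 "step_path J T v t = v (card {i. i < J & T (Suc i) <= t})"

lemma step_path_eq:
 assumes inc: "!!i. i < J ==> T i < T (Suc i)" and j: "j <= J" "0 < j ==> T j <= t" "j < J ==> t < T (Suc j)"
 shows "step_path J T v t = v j"
proof -
 have mono: "T i <= T i'" if "i <= i'" "i' <= J" for i i'
  using that
 proof (induction i' rule: dec_induct)
  case (step m)
  then show ?case using inc[of m] by simp
 qed simp
 have "{i. i < J & T (Suc i) <= t} = {..<j}"
 proof safe
  fix i assume i: "i < J" "T (Suc i) <= t"
  show "i < j"
  proof (rule ccontr)
   assume "\<not> i < j"
   then have "j < J" "T (Suc j) <= T (Suc i)" using i by (auto intro: mono)
   then show False using j(3) i by simp
  qed
 next
  fix i assume "i < j"
  then show "i < J" "T (Suc i) <= t" using j(1,2) mono[of "Suc i" j] by auto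
 qed
 then show ?thesis by (simp add: step_path_def)
qed

lemma cadlag_step_path: "cadlag (step_path J T v)"
proof -
 define g where "g S = v (card S)" for S :: "nat set"
 define A where "A t = {i. i < J & T (Suc i) <= t}" for t
 define A' where "A' t = {i. i < J & T (Suc i) < t}" for t
 have eq: "step_path J T v = (%t. g (A t))" by (auto simp: step_path_def g_def A_def)
 have r: "\<forall>\<^sub>F s in at_right t. A s = A t" for t
 proof -
  have "\<forall>\<^sub>F s in at_right t. \<forall>i\<in>{..<J}. (T (Suc i) <= s \<longleftrightarrow> T (Suc i) <= t)"
  proof (rule eventually_ball_finite, simp, rule ballI)
   fix i
   show "\<forall>\<^sub>F s in at_right t. (T (Suc i) <= s \<longleftrightarrow> T (Suc i) <= t)"
   proof (cases "T (Suc i) <= t")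
    case True
    show ?thesis using eventually_at_right_less[of t] by eventually_elim (use True in auto)
   next
    case False
    then have "\<forall>\<^sub>F s in at_right t. s < T (Suc i)" by (intro order_tendstoD(2)[OF tendsto_ident_at]) auto
    then show ?thesis by eventually_elim (use False in auto)
   qed
  qed
  then show ?thesis by eventually_elim (auto simp: A_def)
 qed
 have l: "\<forall>\<^sub>F s in at_left t. A s = A' t" for t
 proof -
  have "\<forall>\<^sub>F s in at_left t. \<forall>i\<in>{..<J}. (T (Suc i) <= s \<longleftrightarrow> T (Suc i) < t)"
  proof (rule eventually_ball_finite, simp, rule ballI)
   fix i
   have ev: "\<forall>\<^sub>F s in at_left t. s < t" by (simp add: eventually_at_filter)
   show "\<forall>\<^sub>F s in at_left t. (T (Suc i) <= s \<longleftrightarrow> T (Suc i) < t)"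
   proof (cases "T (Suc i) < t")
    case True
    then have "\<forall>\<^sub>F s in at_left t. T (Suc i) < s" by (intro order_tendstoD(1)[OF tendsto_ident_at]) auto
    then show ?thesis by eventually_elim (use True in auto)
   next
    case False
    show ?thesis using ev by eventually_elim (use False in auto)
   qed
  qed
  then show ?thesis by eventually_elim (auto simp: A_def A'_def)
 qed
 show ?thesis
  unfolding cadlag_def eq
 proof (intro allI impI conjI)
  fix t :: real
  show "((%t. g (A t)) \<longlongrightarrow> g (A t)) (at_right t)"
   by (rule tendsto_eventually) (use r[of t] in "auto elim: eventually_mono")
  have "((%t. g (A t)) \<longlongrightarrow> g (A' t)) (at_left t)"
   by (rule tendsto_eventually) (use l[of t] in "auto elim: eventually_mono")
  then show "EX l. ((%t. g (A t)) \<longlongrightarrow> l) (at_left t)" by blast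
 qed
qed

lemma cadlag_floor:
 fixes g :: "int => real"
 assumes a: "0 < a" shows "cadlag (%t. g \<lfloor>a * t\<rfloor>)"
 unfolding cadlag_def
proof (intro allI impI conjI)
 fix t :: real
 define k where "k = \<lfloor>a * t\<rfloor>"
 have "t < (of_int k + 1) / a" using a unfolding k_def by (simp add: field_simps) linarith
 then have "\<forall>\<^sub>F s in at_right t. s < (of_int k + 1) / a" by (intro order_tendstoD(2)[OF tendsto_ident_at])
 then have "\<forall>\<^sub>F s in at_right t. g \<lfloor>a * s\<rfloor> = g \<lfloor>a * t\<rfloor>"
  using eventually_at_right_less[of t]
 proof eventually_elim
  case (elim s)
  have "a * t < a * s" using elim a by simp
  moreover have "a * s < of_int k + 1" using elim(1) a by (simp add: field_simps)
  moreover have "of_int k <= a * t" by (simp add: k_def)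
  ultimately have "\<lfloor>a * s\<rfloor> = k" unfolding floor_eq_iff by linarith
  then show ?case by (simp add: k_def)
 qed
 then show "((%t. g \<lfloor>a * t\<rfloor>) \<longlongrightarrow> g \<lfloor>a * t\<rfloor>) (at_right t)" by (rule tendsto_eventually)
 \<comment> \<open>The value of the floor just to the left of t; it differs from the floor at t
   exactly when a t is an integer.\<close>
 define m where "m = \<lceil>a * t\<rceil> - 1"
 have "of_int m / a < t" using a unfolding m_def by (simp add: field_simps) linarith
 then have "\<forall>\<^sub>F s in at_left t. of_int m / a < s" by (intro order_tendstoD(1)[OF tendsto_ident_at])
 moreover have "\<forall>\<^sub>F s in at_left t. s < t" by (simp add: eventually_at_filter)
 ultimately have "\<forall>\<^sub>F s in at_left t. g \<lfloor>a * s\<rfloor> = g m"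
 proof eventually_elim
  case (elim s)
  have "a * s < a * t" using elim a by simp
  moreover have "of_int m < a * s" using elim(1) a by (simp add: field_simps)
  moreover have "a * t <= of_int m + 1" by (simp add: m_def)
  ultimately have "\<lfloor>a * s\<rfloor> = m" unfolding floor_eq_iff by linarith
  then show ?case by simp
 qed
 then have "((%t. g \<lfloor>a * t\<rfloor>) \<longlongrightarrow> g m) (at_left t)" by (rule tendsto_eventually)
 then show "EX l. ((%t. g \<lfloor>a * t\<rfloor>) \<longlongrightarrow> l) (at_left t)" by blast
qed

text \<open>The left Riemann sum of mesh \<delta> for the Lamperti clock; \<open>skel_path\<close>
  is thus a Lamperti transform of a step function.\<close>

definition skel_time :: "real => real => (nat => real) => nat => real" where
 "skel_time \<gamma> \<delta> L j = \<delta> * (\<Sum>i<j. exp (\<gamma> * L i))"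

definition skel_path :: "real => real => nat => (nat => real) => real => real" where
 "skel_path \<gamma> \<delta> J L = step_path J (skel_time \<gamma> \<delta> L) (%j. exp (L j))"

lemma skel_time_0 [simp]: "skel_time \<gamma> \<delta> L 0 = 0"
 by (simp add: skel_time_def)

lemma skel_time_less: "0 < \<delta> ==> skel_time \<gamma> \<delta> L j < skel_time \<gamma> \<delta> L (Suc j)"
 by (simp add: skel_time_def distrib_left)

lemma skel_path_eq:
 assumes "0 < \<delta>" "j < J" "skel_time \<gamma> \<delta> L j <= t" "t < skel_time \<gamma> \<delta> L (Suc j)"
 shows "skel_path \<gamma> \<delta> J L t = exp (L j)"
 unfolding skel_path_def by (rule step_path_eq) (use assms skel_time_less in auto)

lemma cadlag_skel_path: "cadlag (skel_path \<gamma> \<delta> J L)"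
 unfolding skel_path_def by (rule cadlag_step_path)

text \<open>Jump times and jump values converge, and a piecewise linear time change matches the j-th
  jump times, so the values are compared index by index. This is what makes the skeleton a
  continuous function of its increments.\<close>

lemma J1_tendsto_skel_path:
 assumes d: "0 < \<delta>" and L: "!!j. (%k. L k j) ----> L' j"
 shows "J1_tendsto (%k. skel_path \<gamma> \<delta> J (L k)) (skel_path \<gamma> \<delta> J L')"
proof -
 define T where "T = skel_time \<gamma> \<delta> L'"
 define C where "C k = skel_time \<gamma> \<delta> (L k)" for k
 define e where "e k = (\<Sum>i\<le>J. abs(T i - C k i)) + (\<Sum>i\<le>J. abs(exp (L k i) - exp (L' i)))" for k
 have "e ----> (\<Sum>i\<le>J. abs(T i - T i)) + (\<Sum>i\<le>J. abs(exp (L' i) - exp (L' i)))"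
  unfolding e_def C_def T_def skel_time_def by (intro tendsto_intros L)
 then have e0: "e ----> 0" by simp
 have Tinc: "T i < T (Suc i)" "C k i < C k (Suc i)" for i k
  unfolding T_def C_def using skel_time_less[OF d] by auto
 have e1: "abs(T i - C k i) <= e k" "abs(exp (L k i) - exp (L' i)) <= e k" if "i <= J" for i k
  using member_le_sum[of i "{..J}" "%i. abs(T i - C k i)"] member_le_sum[of i "{..J}" "%i. abs(exp (L k i) - exp (L' i))"] that
   sum_nonneg[of "{..J}" "%i. abs(T i - C k i)"] sum_nonneg[of "{..J}" "%i. abs(exp (L k i) - exp (L' i))"]
  unfolding e_def by fastforce+
 have "J1_close (e k) (skel_path \<gamma> \<delta> J (L k)) (skel_path \<gamma> \<delta> J L')" for k
 proof -
  have T0: "T 0 = 0" "C k 0 = 0" by (auto simp: T_def C_def)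
  obtain l where l: "time_change l" "!!i. i <= J ==> l (T i) = C k i" "!!t. t >= 0 ==> abs(l t - t) <= e k"
   using piecewise_linear_time_change[of T "C k" J "e k", OF T0 Tinc(1) Tinc(2) e1(1)] by metis
  have lmono': "l s < l t" if "0 <= s" "s < t" for s t
   using l(1) that unfolding time_change_def strict_mono_on_def by auto
  have lmono: "l s <= l t" if "0 <= s" "s <= t" for s t
   using lmono'[of s t] that by (cases "s = t") auto
  have Tnn: "0 <= T j" for j
   using lift_Suc_mono_le[of T 0 j] Tinc(1) T0 by (auto simp: less_imp_le)
  show ?thesis
   unfolding J1_close_def
  proof (intro exI[of _ l] conjI allI impI)
   fix t :: real assume t: "0 <= t"
   have "\<exists>j\<le>J. T j <= t & (j < J --> t < T (Suc j))"
   proof (cases "t < T J")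
    case True
    then obtain j where "j < J" "T j <= t" "t < T (Suc j)" using step_cell_exists[of T t J] t T0 by auto
    then show ?thesis by (intro exI[of _ j]) auto
   qed (auto simp: not_less)
   then obtain j where j: "j <= J" "T j <= t" "j < J ==> t < T (Suc j)" by blast
   have "skel_path \<gamma> \<delta> J L' t = exp (L' j)"
    unfolding skel_path_def T_def[symmetric] by (rule step_path_eq) (use Tinc j in auto)
   moreover have "skel_path \<gamma> \<delta> J (L k) (l t) = exp (L k j)"
    unfolding skel_path_def C_def[symmetric]
   proof (rule step_path_eq)
    show "C k j <= l t" using lmono[OF Tnn j(2)] l(2)[OF j(1)] by simp
    show "l t < C k (Suc j)" if "j < J" using lmono'[OF t j(3)[OF that]] l(2)[of "Suc j"] that by simp
   qed (use Tinc j in auto)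
   ultimately have "abs(skel_path \<gamma> \<delta> J (L k) (l t) - skel_path \<gamma> \<delta> J L' t) <= e k"
    using e1(2)[OF j(1)] by simp
   moreover have "exp (- t) * min 1 \<bar>skel_path \<gamma> \<delta> J (L k) (l t) - skel_path \<gamma> \<delta> J L' t\<bar>
     <= 1 * abs(skel_path \<gamma> \<delta> J (L k) (l t) - skel_path \<gamma> \<delta> J L' t)"
    using t by (intro mult_mono) auto
   ultimately show "exp (- t) * min 1 \<bar>skel_path \<gamma> \<delta> J (L k) (l t) - skel_path \<gamma> \<delta> J L' t\<bar> <= e k" by simp
  qed (use l in auto)
 qed
 then show ?thesis using e0 by (rule J1_tendsto_if_close)
qed

lemma continuous_on_J1_skel_path:
 assumes F: "J1_bounded_continuous F" and d: "0 < \<delta>"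
 shows "continuous_on UNIV (%L. F (skel_path \<gamma> \<delta> J L))"
 unfolding continuous_on_sequentially
proof safe
 fix x and L :: "nat => real" assume x: "x ----> L"
 have "(%k. x k j) ----> L j" for j
  by (rule continuous_on_tendsto_compose[OF continuous_on_product_coordinates x]) auto
 then have "J1_tendsto (%k. skel_path \<gamma> \<delta> J (x k)) (skel_path \<gamma> \<delta> J L)"
  by (rule J1_tendsto_skel_path[OF d])
 then show "((%L. F (skel_path \<gamma> \<delta> J L)) \<circ> x) ----> F (skel_path \<gamma> \<delta> J L)"
  using F[unfolded J1_bounded_continuous_def, THEN conjunct2, rule_format, of "%k. skel_path \<gamma> \<delta> J (x k)"]
   cadlag_skel_path by (simp add: comp_def)
qed

section \<open>The Lamperti transform of a path\<close>

lemma cadlag_local: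
 assumes x: "cadlag x" and s: "0 <= s" and e: "0 < \<eta>"
 obtains d l where "0 < d" "!!t. s <= t ==> t < s + d ==> abs(x t - x s) <= \<eta>"
  "!!t. 0 <= t ==> s - d < t ==> t < s ==> abs(x t - l) <= \<eta>"
proof -
 have "(x \<longlongrightarrow> x s) (at_right s)" using x s unfolding cadlag_def by blast
 then have "\<forall>\<^sub>F t in at_right s. dist (x t) (x s) < \<eta>" using e by (rule tendstoD)
 then obtain b where b: "b > s" "!!t. s < t ==> t < b ==> abs(x t - x s) < \<eta>"
  unfolding eventually_at_right_field dist_real_def by blast
 show ?thesis
 proof (cases "s = 0")
  case True
  show ?thesis
  \<comment> \<open>There are no times to the left of 0, so the left limit is a dummy.\<close>
  proof (rule that[of "b - s" 0])
   show "abs(x t - x s) <= \<eta>" if "s <= t" "t < s + (b - s)" for t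
    using b(2)[of t] that e by (cases "t = s") auto
  qed (use b True in auto)
 next
  case False
  then obtain l where "(x \<longlongrightarrow> l) (at_left s)" using x s unfolding cadlag_def by auto
  then have "\<forall>\<^sub>F t in at_left s. dist (x t) l < \<eta>" using e by (rule tendstoD)
  then obtain a where a: "a < s" "!!t. a < t ==> t < s ==> abs(x t - l) < \<eta>"
   unfolding eventually_at_left_field dist_real_def by blast
  show ?thesis
  proof (rule that[of "min (b - s) (s - a)" l])
   show "abs(x t - x s) <= \<eta>" if "s <= t" "t < s + min (b - s) (s - a)" for t
    using b(2)[of t] that e by (cases "t = s") (auto simp: min_def split: if_splits)
   show "abs(x t - l) <= \<eta>" if "s - min (b - s) (s - a) < t" "t < s" for t
    using a(2)[of t] that by (auto simp: min_def split: if_splits)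
  qed (use a b in auto)
 qed
qed

lemma cadlag_bounded:
 assumes x: "cadlag x"
 obtains A where "0 < A" "!!t. 0 <= t ==> t <= S ==> abs(x t) <= A"
proof -
 have "EX A. \<forall>t\<in>{0..S}. abs(x t) <= A"
 proof (rule ccontr)
  assume "\<nexists>A. \<forall>t\<in>{0..S}. abs(x t) <= A"
  then have "\<forall>k::nat. EX t. t \<in> {0..S} & abs(x t) > real k" by (meson not_le)
  then obtain t where t: "!!k. t k \<in> {0..S}" "!!k. abs(x (t k)) > real k" by metis
  obtain s r where s: "s \<in> {0..S}" "strict_mono r" "(t \<circ> r) ----> s"
   using compact_Icc[of 0 S] t(1) unfolding compact_def by blast
  obtain d l where d: "0 < d" "!!t. s <= t ==> t < s + d ==> abs(x t - x s) <= 1"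
   "!!t. 0 <= t ==> s - d < t ==> t < s ==> abs(x t - l) <= 1"
   using cadlag_local[OF x, of s 1] s(1) by auto
  have ev: "EV k. dist ((t \<circ> r) k) s < d" using s(3) d(1) by (rule tendstoD)
  obtain K where K: "abs(x s) + abs(l) + 1 <= real K" using real_arch_simple by blast
  from ev eventually_ge_at_top[of K] have "EV k. False"
  proof eventually_elim
   case (elim k)
   have "abs(x (t (r k))) <= abs(x s) + abs(l) + 1"
    using d(2)[of "t (r k)"] d(3)[of "t (r k)"] elim(1) t(1)[of "r k"]
    by (cases "s <= t (r k)") (auto simp: dist_real_def)
   moreover have "real (r k) >= real k" using seq_suble[OF s(2)] by simp
   ultimately show False using t(2)[of "r k"] K elim(2) by linarith
  qed
  then show False by simp
 qed
 then obtain A where "\<forall>t\<in>{0..S}. abs(x t) <= A" by blast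
 then show ?thesis by (intro that[of "max 1 A"]) (auto simp: le_max_iff_disj)
qed

text \<open>Short windows violating this would accumulate at some s. Near s the path oscillates
  little on either side, so a window containing s can be split at s, and one lying on one side of s
  at its right end: a contradiction.\<close>

lemma cadlag_split:
 assumes x: "cadlag x" and e: "0 < \<eta>"
 obtains d where "0 < d"
  "!!u v. 0 <= u ==> u < v ==> v <= S ==> v - u < d ==> EX c. u < c & c <= v &
   (ALL s. u <= s & s < c --> abs(x s - x u) <= \<eta>) & (ALL s. c <= s & s <= v --> abs(x s - x v) <= \<eta>)"
proof -
 define good where "good u v \<longleftrightarrow> (EX c. u < c & c <= v &
   (ALL s. u <= s & s < c --> abs(x s - x u) <= \<eta>) & (ALL s. c <= s & s <= v --> abs(x s - x v) <= \<eta>))" for u v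
 have "\<exists>d>0. ALL u v. 0 <= u & u < v & v <= S & v - u < d --> good u v"
 proof (rule ccontr)
  assume *: "\<not> ?thesis"
  have "EX u v. 0 <= u & u < v & v <= S & v - u < 1 / real (Suc k) & \<not> good u v" for k
  proof -
   have "(0::real) < 1 / real (Suc k)" by simp
   with * show ?thesis by blast
  qed
  then obtain u v where uv: "!!k. 0 <= u k" "!!k. u k < v k" "!!k. v k <= S" "!!k. v k - u k < 1 / real (Suc k)"
   "!!k. \<not> good (u k) (v k)" by metis
  have "u k \<in> {0..S}" for k using uv(1-3)[of k] by auto
  then obtain s r where s: "s \<in> {0..S}" "strict_mono r" "(u \<circ> r) ----> s"
   using compact_Icc[of 0 S] unfolding compact_def by blast
  obtain d l where d: "0 < d" "!!t. s <= t ==> t < s + d ==> abs(x t - x s) <= \<eta>/2"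
   "!!t. 0 <= t ==> s - d < t ==> t < s ==> abs(x t - l) <= \<eta>/2"
   using cadlag_local[OF x, of s "\<eta>/2"] s(1) e by auto
  have "EV k. dist ((u \<circ> r) k) s < d/2" using tendstoD[OF s(3), of "d/2"] d(1) by simp
  moreover have "EV k. 1 / real (Suc k) < d/2"
   using LIMSEQ_inverse_real_of_nat d(1) order_tendstoD(2)[of "%k. inverse (real (Suc k))" 0 sequentially "d/2"]
   by (simp add: inverse_eq_divide)
  ultimately have "EV k. False"
  proof eventually_elim
   case (elim k)
   define a b where "a = u (r k)" and "b = v (r k)"
   have ab: "0 <= a" "a < b" "\<not> good a b" using uv by (auto simp: a_def b_def)
   have "1 / real (Suc (r k)) <= 1 / real (Suc k)" using seq_suble[OF s(2), of k] by (intro divide_left_mono) auto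
   then have near: "s - d < a" "b < s + d"
    using uv(4)[of "r k"] elim ab(2) unfolding a_def b_def comp_def dist_real_def by linarith+
   have tri: "abs(p - q) <= \<eta>" if "abs(p - z) <= \<eta>/2" "abs(q - z) <= \<eta>/2" for p q z
    using that by linarith
   consider "a < s" "s <= b" | "s <= a" | "b < s" using ab by linarith
   then have "good a b"
   proof cases
    case 1
    show ?thesis
     unfolding good_def
    proof (intro exI[of _ s] conjI allI impI)
     show "abs(x t - x a) <= \<eta>" if "a <= t & t < s" for t
      using tri[where z="l", OF d(3)[of t] d(3)[of a]] that near 1 ab by simp
     show "abs(x t - x b) <= \<eta>" if "s <= t & t <= b" for t
      using tri[where z="x s", OF d(2)[of t] d(2)[of b]] that near 1 ab by simp
    qed (use 1 in auto)
   next
    case 2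
    show ?thesis
     unfolding good_def
    proof (intro exI[of _ b] conjI allI impI)
     show "abs(x t - x a) <= \<eta>" if "a <= t & t < b" for t
      using tri[where z="x s", OF d(2)[of t] d(2)[of a]] that near 2 ab by simp
     show "abs(x t - x b) <= \<eta>" if "b <= t & t <= b" for t using that e by (cases "t = b") auto
    qed (use ab in auto)
   next
    case 3
    show ?thesis
     unfolding good_def
    proof (intro exI[of _ b] conjI allI impI)
     show "abs(x t - x a) <= \<eta>" if "a <= t & t < b" for t
      using tri[where z="l", OF d(3)[of t] d(3)[of a]] that near 3 ab by simp
     show "abs(x t - x b) <= \<eta>" if "b <= t & t <= b" for t using that e by (cases "t = b") auto
    qed (use ab in auto)
   qed
   with ab show False by simp
  qed
  then show False by simp
 qed
 then obtain d where "d > 0" "ALL u v. 0 <= u & u < v & v <= S & v - u < d --> good u v" by blast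
 then show ?thesis by (intro that[of d]) (auto simp: good_def)
qed

lemma cadlag_compose_continuous:
 assumes x: "cadlag x" and g: "continuous_on UNIV g" shows "cadlag (%t. g (x t))"
proof -
 have c: "((%t. g (x t)) \<longlongrightarrow> g l) F" if "(x \<longlongrightarrow> l) F" for l F
  using continuous_on_tendsto_compose[OF g that] by simp
 show ?thesis unfolding cadlag_def
 proof (intro allI impI conjI)
  fix t :: real assume "0 <= t"
  then show "((%t. g (x t)) \<longlongrightarrow> g (x t)) (at_right t)" using x unfolding cadlag_def by (intro c) auto
  assume "0 < t"
  then obtain l where "(x \<longlongrightarrow> l) (at_left t)" using x unfolding cadlag_def by (meson less_imp_le)
  then show "EX l. ((%t. g (x t)) \<longlongrightarrow> l) (at_left t)" using c by blast
 qed
qed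

lemma cadlag_compose_time_change:
 assumes x: "cadlag x" and m: "time_change m" shows "cadlag (%t. x (m t))"
 unfolding cadlag_def
proof (intro allI impI conjI)
 fix t :: real assume t: "0 <= t"
 have inc: "m s < m u" if "0 <= s" "s < u" for s u
  using m that unfolding time_change_def strict_mono_on_def by auto
 have mt: "(m \<longlongrightarrow> m t) (at t within {0..})" using m t unfolding time_change_def continuous_on_def by auto
 have "(m \<longlongrightarrow> m t) (at_right t)" by (rule tendsto_within_subset[OF mt]) (use t in auto)
 moreover have "\<forall>\<^sub>F s in at_right t. m s \<in> {m t<..} & m s ~= m t"
  using eventually_at_right_less[of t]
 proof eventually_elim
  case (elim s)
  then show ?case using inc[OF t, of s] by simp
 qed
 ultimately have "filterlim m (at_right (m t)) (at_right t)"
  unfolding filterlim_at by (auto elim: eventually_mono)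
 moreover have "(x \<longlongrightarrow> x (m t)) (at_right (m t))" using x time_change_nonneg[OF m t] unfolding cadlag_def by blast
 ultimately show "((%t. x (m t)) \<longlongrightarrow> x (m t)) (at_right t)" using filterlim_compose by blast
 assume t0: "0 < t"
 have ev0: "\<forall>\<^sub>F s in at_left t. 0 < s" using t0 by (intro order_tendstoD(1)[OF tendsto_ident_at])
 moreover have ev: "\<forall>\<^sub>F s in at_left t. s < t" by (simp add: eventually_at_filter)
 ultimately have "\<forall>\<^sub>F s in at_left t. m s \<in> {..<m t} & m s ~= m t"
 proof eventually_elim
  case (elim s)
  then show ?case using inc[of s t] by auto
 qed
 moreover have "(m \<longlongrightarrow> m t) (at_left t)"
 proof -
  have "(m \<longlongrightarrow> m t) (at t within {0<..<t})" by (rule tendsto_within_subset[OF mt]) auto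
  moreover have "at t within {0<..<t} = at_left t" using t0 by (intro at_within_nhd[of _ "{0<..}"]) auto
  ultimately show ?thesis by simp
 qed
 ultimately have f: "filterlim m (at_left (m t)) (at_left t)"
  unfolding filterlim_at by (auto elim: eventually_mono)
 have "0 < m t" using inc[of 0 t] t0 time_change_zero[OF m] by simp
 then obtain l where "(x \<longlongrightarrow> l) (at_left (m t))" using x unfolding cadlag_def by (meson less_imp_le)
 then show "EX l. ((%t. x (m t)) \<longlongrightarrow> l) (at_left t)" using filterlim_compose f by blast
qed

text \<open>The first grid point strictly to the right of s. Strictness lets right-continuity alone
  give convergence as the mesh tends to 0.\<close>

definition grid_right :: "real => real => real" where
 "grid_right \<delta> s = \<delta> * (real_of_int \<lfloor>s / \<delta>\<rfloor> + 1)"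

lemma grid_right_bounds:
 assumes "0 < \<delta>" shows "s < grid_right \<delta> s" "grid_right \<delta> s <= s + \<delta>"
proof -
 have "s / \<delta> < real_of_int \<lfloor>s / \<delta>\<rfloor> + 1" "real_of_int \<lfloor>s / \<delta>\<rfloor> <= s / \<delta>" by linarith+
 then have "s / \<delta> * \<delta> < (real_of_int \<lfloor>s / \<delta>\<rfloor> + 1) * \<delta>" "real_of_int \<lfloor>s / \<delta>\<rfloor> * \<delta> <= s / \<delta> * \<delta>"
  using assms by (intro mult_strict_right_mono mult_right_mono; simp)+
 then show "s < grid_right \<delta> s" "grid_right \<delta> s <= s + \<delta>"
  using assms by (auto simp: grid_right_def algebra_simps)
qed

lemma cadlag_grid_right:
 assumes x: "cadlag x" and d: "!!k. 0 < \<delta> k" "\<delta> ----> 0" and s: "0 <= s"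
 shows "(%k. x (grid_right (\<delta> k) s)) ----> x s"
proof -
 have "(%k. s + \<delta> k) ----> s + 0" by (intro tendsto_intros d)
 then have up: "(%k. s + \<delta> k) ----> s" by simp
 have "(%k. grid_right (\<delta> k) s) ----> s"
 proof (rule tendsto_sandwich[OF _ _ tendsto_const up])
  show "EV k. s <= grid_right (\<delta> k) s"
   by (rule always_eventually) (use grid_right_bounds(1)[OF d(1)] in "auto intro: less_imp_le")
  show "EV k. grid_right (\<delta> k) s <= s + \<delta> k"
   by (rule always_eventually) (use grid_right_bounds(2)[OF d(1)] in auto)
 qed
 moreover have "EV k. grid_right (\<delta> k) s \<in> {s<..} & grid_right (\<delta> k) s ~= s"
 proof (rule always_eventually, rule allI)
  show "grid_right (\<delta> k) s \<in> {s<..} & grid_right (\<delta> k) s ~= s" for k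
   using grid_right_bounds(1)[OF d(1)[of k], of s] by simp
 qed
 ultimately have "filterlim (%k. grid_right (\<delta> k) s) (at_right s) sequentially"
  unfolding filterlim_at by (auto elim: eventually_mono)
 moreover have "(x \<longlongrightarrow> x s) (at_right s)" using x s unfolding cadlag_def by blast
 ultimately show ?thesis using filterlim_compose by blast
qed

text \<open>True for arbitrary x, because the composition depends on s only through an
  integer.\<close>

lemma grid_right_compose_measurable [measurable]: "(%s. x (grid_right \<delta> s)) \<in> borel_measurable borel"
proof -
 have 1: "(%s::real. \<lfloor>s / \<delta>\<rfloor>) \<in> measurable borel (count_space UNIV)" by measurable
 show ?thesis unfolding grid_right_def
  by (rule measurable_compose[OF 1, of "%i. x (\<delta> * (real_of_int i + 1))"]) simp
qed

lemma cadlag_measurable: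
 assumes x: "cadlag x" shows "(%s. x (max 0 s)) \<in> borel_measurable borel"
proof (rule borel_measurable_LIMSEQ_real[where u="%k s. x (grid_right (1 / real (Suc k)) (max 0 s))"])
 have "(%k. 1 / real (Suc k)) ----> 0"
  using LIMSEQ_inverse_real_of_nat by (simp add: inverse_eq_divide)
 then show "(%k. x (grid_right (1 / real (Suc k)) (max 0 s))) ----> x (max 0 s)" for s
  by (intro cadlag_grid_right[OF x]) auto
 have "(%s::real. max 0 s) \<in> borel_measurable borel" by measurable
 then show "(%s. x (grid_right (1 / real (Suc k)) (max 0 s))) \<in> borel_measurable borel" for k
  by (rule measurable_compose[OF _ grid_right_compose_measurable])
qed

lemma abs_exp_diff_le:
 fixes a b A :: real
 assumes "a <= A" "b <= A" shows "abs(exp a - exp b) <= exp A * abs(a - b)"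
proof -
 have *: "exp a - exp b <= exp A * (a - b)" if "b <= a" "a <= A" for a b
 proof -
  have "1 - exp (b - a) <= a - b" using exp_ge_add_one_self[of "b - a"] by linarith
  then have "exp a * (1 - exp (b - a)) <= exp A * (a - b)"
   using that by (intro mult_mono) auto
  then show ?thesis by (simp add: right_diff_distrib exp_add[symmetric])
 qed
 show ?thesis
  using *[of b a] *[of a b] assms by (cases "b <= a") (auto simp: abs_if)
qed

section \<open>The Lamperti clock of a fixed path\<close>

locale cadlag_path =
 fixes x :: "real => real" and \<gamma> :: real
 assumes cadlag_x: "cadlag x"
begin

definition f :: "real => real" where "f s = exp (\<gamma> * x (max 0 s))"
definition R :: "real => real" where "R s = (LBINT u:{0..s}. exp (\<gamma> * x u))"

lemma f_measurable [measurable]: "f \<in> borel_measurable borel"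
 unfolding f_def using cadlag_measurable[OF cadlag_x] by measurable

lemma f_pos: "0 < f s" by (simp add: f_def)

lemma f_bounded: obtains m B where "0 < m" "0 < B" "!!s. s <= S ==> m <= f s" "!!s. s <= S ==> f s <= B"
proof -
 obtain A where A: "0 < A" "!!t. 0 <= t ==> t <= max 0 S ==> abs(x t) <= A" using cadlag_bounded[OF cadlag_x] by blast
 have *: "abs(\<gamma> * x (max 0 s)) <= abs(\<gamma>) * A" if "s <= S" for s
  unfolding abs_mult using A(2)[of "max 0 s"] that by (intro mult_left_mono) auto
 show ?thesis
 proof (rule that[of "exp (- abs(\<gamma>) * A)" "exp (abs(\<gamma>) * A)"])
  show "exp (- abs(\<gamma>) * A) <= f s" "f s <= exp (abs(\<gamma>) * A)" if "s <= S" for s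
   using *[OF that] by (auto simp: f_def abs_le_iff)
 qed auto
qed

lemma integrable_Ico: "integrable lborel (indicator {a..<b} :: real => real)"
 by (cases "a <= b") (auto simp: emeasure_lborel_Ico)

lemma f_integrable: "set_integrable lborel {a..<b} f"
proof -
 obtain m B where B: "0 < m" "0 < B" "!!s. s <= b ==> m <= f s" "!!s. s <= b ==> f s <= B" using f_bounded by blast
 have "set_integrable lborel {a..<b} (%_. B)" using integrable_Ico by (simp add: set_integrable_def)
 then show ?thesis
  by (rule set_integrable_bound) (use B f_pos in "auto simp: set_borel_measurable_def less_imp_le intro!: AE_I2")
qed

text \<open>Single points are null, and half-open intervals join without overlap, which gives the
  additivity of the clock.\<close>

lemma R_eq: assumes "0 <= s" shows "R s = (LBINT u:{0..<s}. f u)"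
 unfolding R_def set_lebesgue_integral_def
proof (rule integral_cong_AE)
 have eq: "(%u. indicator {0..s} u *\<^sub>R exp (\<gamma> * x u)) = (%u. indicator {0..s} u *\<^sub>R f u)"
  by (auto simp: f_def indicator_def)
 show "(%u. indicator {0..s} u *\<^sub>R exp (\<gamma> * x u)) \<in> borel_measurable lborel" unfolding eq by measurable
 show "AE u in lborel. indicator {0..s} u *\<^sub>R exp (\<gamma> * x u) = indicator {0..<s} u *\<^sub>R f u"
  using AE_lborel_singleton[of s] by eventually_elim (auto simp: f_def indicator_def)
qed simp

lemma R_0: "R 0 = 0" using R_eq[of 0] by (simp add: set_lebesgue_integral_def)

lemma R_add: assumes "0 <= s" "s <= t" shows "R t = R s + (LBINT u:{s..<t}. f u)"
proof -
 have "(LBINT u:{0..<s} \<union> {s..<t}. f u) = (LBINT u:{0..<s}. f u) + (LBINT u:{s..<t}. f u)"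
  by (intro set_integral_Un f_integrable) auto
 moreover have "{0..<s} \<union> {s..<t} = {0..<t}" using assms by auto
 ultimately show ?thesis using assms by (simp add: R_eq)
qed

lemma integral_const_Ico: "a <= b ==> (LBINT u:{a..<b}. c) = (b - a) * (c :: real)"
 by (simp add: set_lebesgue_integral_def)

lemma R_diff_bounds:
 assumes m: "!!s. s <= S ==> m <= f s" and B: "!!s. s <= S ==> f s <= B" and st: "0 <= s" "s <= t" "t <= S"
 shows "m * (t - s) <= R t - R s" "R t - R s <= B * (t - s)"
proof -
 have i: "set_integrable lborel {s..<t} (%_. c)" for c :: real using integrable_Ico by (simp add: set_integrable_def)
 have d: "R t - R s = (LBINT u:{s..<t}. f u)" using R_add[OF st(1,2)] by simp
 have "(LBINT u:{s..<t}. m) <= (LBINT u:{s..<t}. f u)"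
  by (rule set_integral_mono[OF i f_integrable]) (use m st in auto)
 then show "m * (t - s) <= R t - R s" using st by (simp add: d integral_const_Ico mult.commute)
 have "(LBINT u:{s..<t}. f u) <= (LBINT u:{s..<t}. B)"
  by (rule set_integral_mono[OF f_integrable i]) (use B st in auto)
 then show "R t - R s <= B * (t - s)" using st by (simp add: d integral_const_Ico mult.commute)
qed

lemma R_less: assumes "0 <= s" "s < t" shows "R s < R t"
proof -
 obtain m B where B: "0 < m" "0 < B" "!!s. s <= t ==> m <= f s" "!!s. s <= t ==> f s <= B" using f_bounded by blast
 have "m * (t - s) <= R t - R s" by (rule R_diff_bounds(1)[OF B(3,4)]) (use assms in auto)
 moreover have "m * (t - s) > 0" using B assms by simp
 ultimately show ?thesis by linarith
qed

lemma R_less_iff: "0 <= s ==> 0 <= u ==> R s < R u \<longleftrightarrow> s < u"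
 using R_less[of s u] R_less[of u s] by (cases s u rule: linorder_cases) auto

lemma R_le_iff: "0 <= s ==> 0 <= u ==> R s <= R u \<longleftrightarrow> s <= u"
 using R_less_iff[of u s] by (simp add: not_less[symmetric])

lemma R_continuous: "continuous_on {0..} R"
 unfolding continuous_on_iff
proof (intro ballI allI impI)
 fix t eps :: real assume t: "t \<in> {0..}" and e: "0 < eps"
 obtain m B where B: "0 < m" "0 < B" "!!s. s <= t + 1 ==> m <= f s" "!!s. s <= t + 1 ==> f s <= B" using f_bounded by blast
 have *: "abs(R u - R s) <= B * (u - s)" if "0 <= s" "s <= u" "u <= t + 1" for s u
  using R_diff_bounds[OF B(3,4) that] B(1) that by (smt (verit) mult_nonneg_nonneg)
 show "\<exists>d>0. \<forall>s\<in>{0..}. dist s t < d --> dist (R s) (R t) < eps"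
 proof (intro exI[of _ "min 1 (eps / B)"] conjI ballI impI)
  show "0 < min 1 (eps / B)" using e B by simp
  fix s assume s: "s \<in> {0..}" "dist s t < min 1 (eps / B)"
  have "abs(R s - R t) <= B * abs(s - t)"
   using *[of s t] *[of t s] s t by (cases "s <= t") (auto simp: dist_real_def abs_minus_commute)
  also have "... < B * (eps / B)" using s B by (intro mult_strict_left_mono) (auto simp: dist_real_def)
  finally show "dist (R s) (R t) < eps" using B by (simp add: dist_real_def)
 qed
qed

lemma R_nonneg: "0 <= s ==> 0 <= R s"
 using R_less[of 0 s] R_0 by (cases "s = 0") auto

lemma nn_integral_R: assumes "0 <= s" shows "(\<integral>\<^sup>+ u. ennreal (f u) * indicator {0..<s} u \<partial>lborel) = ennreal (R s)"
proof -
 have "(\<integral>\<^sup>+ u. ennreal (f u) * indicator {0..<s} u \<partial>lborel) = (\<integral>\<^sup>+ u. ennreal (indicator {0..<s} u *\<^sub>R f u) \<partial>lborel)"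
  by (intro nn_integral_cong) (auto simp: indicator_def)
 also have "... = ennreal (LBINT u:{0..<s}. f u)"
  unfolding set_lebesgue_integral_def
  by (rule nn_integral_eq_integral) (use f_integrable f_pos in "auto simp: set_integrable_def less_imp_le intro!: AE_I2")
 finally show ?thesis using R_eq[OF assms] by simp
qed

lemma nn_integral_I: "(\<integral>\<^sup>+ s. ennreal (exp (\<gamma> * x s)) * indicator {0..} s \<partial>lborel) = (SUP n::nat. ennreal (R (real n)))"
proof -
 have "(\<integral>\<^sup>+ s. ennreal (exp (\<gamma> * x s)) * indicator {0..} s \<partial>lborel) =
  (\<integral>\<^sup>+ s. (SUP n::nat. ennreal (f s) * indicator {0..<real n} s) \<partial>lborel)"
 proof (rule nn_integral_cong)
  fix s :: real
  show "ennreal (exp (\<gamma> * x s)) * indicator {0..} s = (SUP n::nat. ennreal (f s) * indicator {0..<real n} s)"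
  proof (cases "0 <= s")
   case True
   obtain n :: nat where "s < real n" using reals_Archimedean2 by blast
   then have "ennreal (f s) <= (SUP n::nat. ennreal (f s) * indicator {0..<real n} s)"
    using True by (intro SUP_upper2[of n]) auto
   moreover have "(SUP n::nat. ennreal (f s) * indicator {0..<real n} s) <= ennreal (f s)"
    by (intro SUP_least) (auto simp: indicator_def)
   ultimately show ?thesis using True by (auto simp: f_def)
  qed simp
 qed
 also have "... = (SUP n::nat. (\<integral>\<^sup>+ s. ennreal (f s) * indicator {0..<real n} s \<partial>lborel))"
 proof (rule nn_integral_monotone_convergence_SUP)
  show "incseq (%n s. ennreal (f s) * indicator {0..<real n} s)"
   by (auto simp: incseq_def le_fun_def indicator_def)
 qed simp
 finally show ?thesis by (simp add: nn_integral_R)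
qed

lemma grid_f_integrable: assumes "0 < \<delta>" shows "set_integrable lborel {a..<b} (%s. f (grid_right \<delta> s))"
proof -
 obtain m B where B: "0 < m" "0 < B" "!!s. s <= b + \<delta> ==> m <= f s" "!!s. s <= b + \<delta> ==> f s <= B" using f_bounded by blast
 have "set_integrable lborel {a..<b} (%_. B)" using integrable_Ico by (simp add: set_integrable_def)
 note i = this
 have n: "norm (f (grid_right \<delta> s)) <= norm B" if "s < b" for s
  using B(2) B(4)[of "grid_right \<delta> s"] grid_right_bounds(2)[OF assms, of s] that f_pos[of "grid_right \<delta> s"] by simp
 show ?thesis
  by (rule set_integrable_bound[OF i]) (auto simp: set_borel_measurable_def intro!: AE_I2 n[simplified])
qed

text \<open>The right Riemann sum over j cells is the integral of \<open>f\<close> at the next grid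
  point, so its error is at most the integral of |f o grid_right - f| over [0, S], which tends to 0
  by dominated convergence and does not depend on j.\<close>

lemma skel_time_R:
 assumes d: "!!k. 0 < \<delta> k" "\<delta> ----> 0" and S: "0 <= S"
 shows "EX e. e ----> 0 & (ALL k j. real j * \<delta> k <= S -->
  abs(skel_time \<gamma> (\<delta> k) (%i. x (real i * \<delta> k)) j - R (real j * \<delta> k)) <= e k)"
proof -
 have "Bseq \<delta>" using d(2) by (intro convergent_imp_Bseq) (auto simp: convergent_def)
 then obtain D where D: "D > 0" "!!k. abs(\<delta> k) <= D" unfolding Bseq_def by auto
 obtain m B where B: "0 < m" "0 < B" "!!s. s <= S + D ==> m <= f s" "!!s. s <= S + D ==> f s <= B" using f_bounded by blast
 define g where "g k s = abs(f (grid_right (\<delta> k) s) - f s)" for k s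
 have gm [measurable]: "g k \<in> borel_measurable borel" for k unfolding g_def by measurable
 have gi: "set_integrable lborel {a..<b} (g k)" for a b k
  unfolding g_def by (intro set_integrable_abs set_integral_diff grid_f_integrable f_integrable d)
 define E where "E k = (LBINT s:{0..<S}. g k s)" for k
 have g0: "0 <= g k s" for k s by (simp add: g_def)
 have gB: "g k s <= B" if "s < S" for k s
 proof -
  have "grid_right (\<delta> k) s <= S + D" using grid_right_bounds(2)[OF d(1), of k s] D(2)[of k] that by linarith
  then show ?thesis using B(4)[of s] B(4)[of "grid_right (\<delta> k) s"] f_pos[of s] f_pos[of "grid_right (\<delta> k) s"] that D(1)
   unfolding g_def by (auto simp: abs_if)
 qed
 have "(%k. LINT s|lborel. indicator {0..<S} s *\<^sub>R g k s) ----> (LINT s|(lborel :: real measure). (0::real))"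
 proof (rule integral_dominated_convergence[where w="%s. indicator {0..<S} s *\<^sub>R B"])
  show "AE s in lborel. (%k. indicator {0..<S} s *\<^sub>R g k s) ----> 0"
  proof (rule AE_I2)
   fix s :: real
   show "(%k. indicator {0..<S} s *\<^sub>R g k s) ----> 0"
   proof (cases "s \<in> {0..<S}")
    case True
    then have "(%k. x (grid_right (\<delta> k) s)) ----> x s" by (intro cadlag_grid_right[OF cadlag_x d]) auto
    then have "(%k. abs(exp (\<gamma> * x (grid_right (\<delta> k) s)) - exp (\<gamma> * x s))) ----> abs(exp (\<gamma> * x s) - exp (\<gamma> * x s))"
     by (intro tendsto_intros)
    moreover have "max 0 (grid_right (\<delta> k) s) = grid_right (\<delta> k) s" for k
     using grid_right_bounds(1)[OF d(1), of s k] True by auto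
    ultimately have "(%k. g k s) ----> abs(exp (\<gamma> * x s) - exp (\<gamma> * x s))"
     using True unfolding g_def f_def by simp
    then show ?thesis using True by simp
   qed simp
  qed
  show "AE s in lborel. norm (indicator {0..<S} s *\<^sub>R g k s) <= indicator {0..<S} s *\<^sub>R B" for k
   using g0 gB by (auto intro!: AE_I2 simp: indicator_def)
  show "integrable lborel (%s. indicator {0..<S} s *\<^sub>R B)" using integrable_Ico by simp
 qed simp_all
 then have E0: "E ----> 0" by (simp add: E_def[abs_def] set_lebesgue_integral_def)
 have gadd: "(LBINT s:{0..<b}. g k s) + (LBINT s:{b..<c}. g k s) = (LBINT s:{0..<c}. g k s)" if "0 <= b" "b <= c" for b c k
 proof -
  have "(LBINT s:{0..<b} \<union> {b..<c}. g k s) = (LBINT s:{0..<b}. g k s) + (LBINT s:{b..<c}. g k s)"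
   by (intro set_integral_Un gi) auto
  moreover have "{0..<b} \<union> {b..<c} = {0..<c}" using that by auto
  ultimately show ?thesis by simp
 qed
 have gnn: "0 <= (LBINT s:{b..<c}. g k s)" for b c k
  unfolding set_lebesgue_integral_def by (intro integral_nonneg_AE AE_I2) (simp add: g0)
 have right: "abs(\<delta> k * (\<Sum>i<j. f (real (Suc i) * \<delta> k)) - R (real j * \<delta> k)) <= (LBINT s:{0..<real j * \<delta> k}. g k s)" for j k
 proof (induction j)
  case 0
  then show ?case by (simp add: R_0 set_lebesgue_integral_def)
 next
  case (Suc j)
  define a b where "a = real j * \<delta> k" and "b = real (Suc j) * \<delta> k"
  have ab: "0 <= a" "a <= b" "b - a = \<delta> k" using d(1)[of k] by (auto simp: a_def b_def algebra_simps)
  have gr: "grid_right (\<delta> k) s = b" if "s \<in> {a..<b}" for s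
  proof -
   have "real j <= s / \<delta> k" "s / \<delta> k < real j + 1"
    using that d(1)[of k] by (auto simp: a_def b_def field_simps)
   then have "\<lfloor>s / \<delta> k\<rfloor> = int j" by (simp add: floor_eq_iff)
   then show ?thesis by (simp add: grid_right_def b_def algebra_simps)
  qed
  have "(LBINT s:{a..<b}. f (grid_right (\<delta> k) s)) = (LBINT s:{a..<b}. f b)"
   by (rule set_lebesgue_integral_cong) (auto simp: gr)
  also have "... = \<delta> k * f b" using ab by (simp add: integral_const_Ico)
  finally have 1: "\<delta> k * f b = (LBINT s:{a..<b}. f (grid_right (\<delta> k) s))" by simp
  have "\<delta> k * f b - (LBINT s:{a..<b}. f s) = (LBINT s:{a..<b}. f (grid_right (\<delta> k) s) - f s)"
   unfolding 1 by (rule set_integral_diff(2)[symmetric, OF grid_f_integrable[OF d(1)] f_integrable])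
  moreover have "abs(LBINT s:{a..<b}. f (grid_right (\<delta> k) s) - f s) <= (LBINT s:{a..<b}. g k s)"
   using set_integral_norm_bound[OF set_integral_diff(1)[OF grid_f_integrable[OF d(1)[of k]] f_integrable, of a b]]
   by (simp add: g_def)
  ultimately have 2: "abs(\<delta> k * f b - (LBINT s:{a..<b}. f s)) <= (LBINT s:{a..<b}. g k s)" by simp
  have 3: "R b = R a + (LBINT s:{a..<b}. f s)" by (rule R_add[OF ab(1,2)])
  have 4: "(LBINT s:{0..<a}. g k s) + (LBINT s:{a..<b}. g k s) = (LBINT s:{0..<b}. g k s)" by (rule gadd[OF ab(1,2)])
  have 5: "\<delta> k * (\<Sum>i<Suc j. f (real (Suc i) * \<delta> k)) = \<delta> k * (\<Sum>i<j. f (real (Suc i) * \<delta> k)) + \<delta> k * f b"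
   by (simp add: b_def distrib_left)
  show ?case using Suc.IH 2 3 4 5 unfolding a_def[symmetric] b_def[symmetric] by linarith
 qed
 \<comment> \<open>Left and right sums differ by the two boundary values only, hence the extra error
   \<delta> (2 B).\<close>
 have shift: "(\<Sum>i<j. f (real (Suc i) * \<delta> k)) = (\<Sum>i<j. f (real i * \<delta> k)) + f (real j * \<delta> k) - f 0" for j k
  by (induction j) auto
 have main: "abs(skel_time \<gamma> (\<delta> k) (%i. x (real i * \<delta> k)) j - R (real j * \<delta> k)) <= E k + \<delta> k * (2 * B)"
  if j: "real j * \<delta> k <= S" for j k
 proof -
  have d0: "0 <= \<delta> k" using d(1)[of k] by simp
  have "skel_time \<gamma> (\<delta> k) (%i. x (real i * \<delta> k)) j = \<delta> k * (\<Sum>i<j. f (real i * \<delta> k))"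
   using d0 by (simp add: skel_time_def f_def)
  also have "... = \<delta> k * (\<Sum>i<j. f (real (Suc i) * \<delta> k)) - \<delta> k * (f (real j * \<delta> k) - f 0)"
   unfolding shift by (simp add: algebra_simps)
  finally have 1: "skel_time \<gamma> (\<delta> k) (%i. x (real i * \<delta> k)) j =
   \<delta> k * (\<Sum>i<j. f (real (Suc i) * \<delta> k)) - \<delta> k * (f (real j * \<delta> k) - f 0)" .
  have "abs(f (real j * \<delta> k) - f 0) <= 2 * B"
   using B(4)[of "real j * \<delta> k"] B(4)[of 0] f_pos[of 0] f_pos[of "real j * \<delta> k"] j S D(1) by (simp add: abs_le_iff)
  then have 2: "abs(\<delta> k * (f (real j * \<delta> k) - f 0)) <= \<delta> k * (2 * B)"
   using d0 by (simp add: abs_mult mult_left_mono)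
  have "(LBINT s:{0..<real j * \<delta> k}. g k s) <= E k"
   using gadd[of "real j * \<delta> k" S k] gnn[of "real j * \<delta> k" S k] j d0 unfolding E_def by simp
  then show ?thesis using right[of k j] 1 2 by linarith
 qed
 have "(%k. E k + \<delta> k * (2 * B)) ----> 0 + 0 * (2 * B)" by (intro tendsto_intros E0 d)
 then show ?thesis using main by (intro exI[of _ "%k. E k + \<delta> k * (2 * B)"]) simp
qed

end

lemma cadlag_cong: assumes "!!t. 0 <= t ==> g t = h t" "cadlag g" shows "cadlag h"
 unfolding cadlag_def
proof (intro allI impI conjI)
 fix t :: real assume t: "0 <= t"
 have "\<forall>\<^sub>F s in at_right t. g s = h s"
  using eventually_at_right_less[of t] by eventually_elim (use t assms(1) in auto)
 then show "(h \<longlongrightarrow> h t) (at_right t)"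
  using assms t unfolding cadlag_def by (metis (mono_tags, lifting) tendsto_cong)
 assume t0: "0 < t"
 have "\<forall>\<^sub>F s in at_left t. 0 < s" using t0 by (intro order_tendstoD(1)[OF tendsto_ident_at])
 then have "\<forall>\<^sub>F s in at_left t. g s = h s" by eventually_elim (use assms(1) in auto)
 moreover obtain l where "(g \<longlongrightarrow> l) (at_left t)" using assms(2) t0 t unfolding cadlag_def by blast
 ultimately show "EX l. (h \<longlongrightarrow> l) (at_left t)" using tendsto_cong by blast
qed

locale cadlag_path_unbounded = cadlag_path +
 assumes infinite: "(\<integral>\<^sup>+ s. ennreal (exp (\<gamma> * x s)) * indicator {0..} s \<partial>lborel) = \<infinity>"
begin

lemma R_unbounded: "\<exists>s\<ge>0. t <= R s"
proof (rule ccontr)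
 assume "\<not> ?thesis"
 then have "R (real n) <= t" for n by (meson le_cases of_nat_0_le_iff)
 then have "(SUP n::nat. ennreal (R (real n))) <= ennreal t" by (intro SUP_least ennreal_leI)
 moreover have "(SUP n::nat. ennreal (R (real n))) = top"
  by (rule trans[OF nn_integral_I[symmetric] infinite[unfolded infinity_ennreal_def]])
 ultimately have "top <= ennreal t" by (simp only:)
 then show False by (simp add: top_unique)
qed

lemma R_time_change: "time_change R"
proof (rule time_changeI[OF _ R_continuous R_0 R_unbounded])
 show "strict_mono_on {0..} R" by (rule strict_mono_onI) (auto intro: R_less)
qed

lemma lamperti_R: assumes s: "0 <= s" shows "lamperti \<gamma> x (R s) = exp (x s)"
proof -
 have "{u. 0 <= u & R s < R u} = {s<..}" using s R_less_iff by auto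
 then have "Inf {u. 0 <= u & R s < (LBINT s:{0..u}. exp (\<gamma> * x s))} = s"
  unfolding R_def[symmetric] by simp
 then show ?thesis unfolding lamperti_def infinite by simp
qed

lemma cadlag_lamperti: "cadlag (lamperti \<gamma> x)"
proof -
 obtain m where m: "time_change m" "!!t. 0 <= t ==> R (m t) = t"
  using time_change_inverse[OF R_time_change] by metis
 have "cadlag (%t. exp (x (m t)))"
  by (rule cadlag_compose_continuous[OF cadlag_compose_time_change[OF cadlag_x m(1)]]) (intro continuous_intros)
 moreover have "exp (x (m t)) = lamperti \<gamma> x t" if "0 <= t" for t
  using lamperti_R[OF time_change_nonneg[OF m(1) that]] m(2)[OF that] by simp
 ultimately show ?thesis using cadlag_cong[of "%t. exp (x (m t))"] by blast
qed

text \<open>The blocks are the images under the clock of the mesh cells of x, split at the points of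
  \<open>cadlag_split\<close>. The Riemann sums approximate the images of the grid points, and a
  split point is off by at most the real length B \<delta> of one block.\<close>

lemma J1_close_lamperti:
 assumes d: "!!k. 0 < \<delta> k" "\<delta> ----> 0" and S: "0 < S" and J: "!!k. S <= real (J k) * \<delta> k"
  and e: "exp (- R S) < eps"
 shows "EV k. J1_close eps (lamperti \<gamma> x) (skel_path \<gamma> (\<delta> k) (J k) (%j. x (real j * \<delta> k)))"
proof -
 have e0: "eps > 0" using e by (meson exp_gt_zero less_trans)
 obtain A where A: "0 < A" "!!t. 0 <= t ==> t <= S + 1 ==> abs(x t) <= A" using cadlag_bounded[OF cadlag_x] by blast
 obtain m B where B: "0 < m" "0 < B" "!!s. s <= S + 1 ==> m <= f s" "!!s. s <= S + 1 ==> f s <= B" using f_bounded by blast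
 have "0 < eps / exp A" using e0 by simp
 then obtain d0 where d0: "0 < d0"
  "!!u v. 0 <= u ==> u < v ==> v <= S + 1 ==> v - u < d0 ==> EX c. u < c & c <= v &
   (ALL s. u <= s & s < c --> abs(x s - x u) <= eps / exp A) & (ALL s. c <= s & s <= v --> abs(x s - x v) <= eps / exp A)"
  using cadlag_split[OF cadlag_x, of "eps / exp A" "S + 1"] by metis
 obtain E where E: "E ----> 0" "!!k j. real j * \<delta> k <= S + 1 ==>
  abs(skel_time \<gamma> (\<delta> k) (%i. x (real i * \<delta> k)) j - R (real j * \<delta> k)) <= E k"
  using skel_time_R[OF d, of "S + 1"] S by auto
 have ev1: "EV k. \<delta> k < min 1 d0" using d(2) d0(1) by (intro order_tendstoD(2)) auto
 have "(%k. E k + B * \<delta> k) ----> 0 + B * 0" by (intro tendsto_intros E d)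
 then have ev2: "EV k. E k + B * \<delta> k < eps" using e0 by (intro order_tendstoD(2)) auto
 have "(%k. exp (- (R S - E k))) ----> exp (- (R S - 0))" by (intro tendsto_intros E)
 then have ev3: "EV k. exp (- (R S - E k)) < eps" using e by (intro order_tendstoD(2)) auto
 show ?thesis
  using ev1 ev2 ev3
 proof eventually_elim
  case (elim k)
  define D where "D = \<delta> k"
  define L where "L j = x (real j * D)" for j
  define T where "T = skel_time \<gamma> D L"
  have D: "0 < D" "D < 1" "D < d0" using d(1)[of k] elim(1) by (auto simp: D_def)
  \<comment> \<open>Just enough cells to pass S without passing S + 1, up to which all bounds hold;
    the given number of cells may be much larger.\<close>
  define J' where "J' = nat \<lceil>S / D\<rceil>"
  have J'1: "S <= real J' * D"
  proof -
   have "S / D <= real J'" unfolding J'_def by (simp add: real_nat_ceiling_ge)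
   then show ?thesis using D by (simp add: field_simps)
  qed
  have J'2: "real J' * D <= S + 1"
  proof -
   have "real J' <= S / D + 1" unfolding J'_def using S D by (simp add: of_nat_ceiling)
   then have "real J' * D <= (S / D + 1) * D" using D by (intro mult_right_mono) auto
   then show ?thesis using D by (simp add: distrib_right)
  qed
  have J'3: "J' <= J k"
  proof -
   have "S / D <= real (J k)" using J[of k] D by (simp add: field_simps D_def)
   then show ?thesis unfolding J'_def by (simp add: nat_le_iff ceiling_le_iff)
  qed
  have jS: "real j * D <= S + 1" if "j <= J'" for j
  proof -
   have "real j * D <= real J' * D" using that D by (intro mult_right_mono) auto
   then show ?thesis using J'2 by simp
  qed
  have TR: "abs(T j - R (real j * D)) <= E k" if "j <= J'" for j
   using E(2)[of j k] jS[OF that] unfolding T_def L_def[abs_def] D_def by simp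
  have "ALL j. EX c. j < J' --> real j * D < c & c <= real (Suc j) * D &
   (ALL s. real j * D <= s & s < c --> abs(x s - L j) <= eps / exp A) &
   (ALL s. c <= s & s <= real (Suc j) * D --> abs(x s - L (Suc j)) <= eps / exp A)"
  proof
   fix j
   show "EX c. j < J' --> real j * D < c & c <= real (Suc j) * D &
   (ALL s. real j * D <= s & s < c --> abs(x s - L j) <= eps / exp A) &
   (ALL s. c <= s & s <= real (Suc j) * D --> abs(x s - L (Suc j)) <= eps / exp A)"
   proof (cases "j < J'")
    case True
    then show ?thesis
     using d0(2)[of "real j * D" "real (Suc j) * D"] jS[of "Suc j"] D by (auto simp: L_def algebra_simps)
   qed simp
  qed
  from choice[OF this] obtain c where c: "!!j. j < J' ==> real j * D < c j" "!!j. j < J' ==> c j <= real (Suc j) * D"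
   "!!j s. j < J' ==> real j * D <= s ==> s < c j ==> abs(x s - L j) <= eps / exp A"
   "!!j s. j < J' ==> c j <= s ==> s <= real (Suc j) * D ==> abs(x s - L (Suc j)) <= eps / exp A" by blast
  have nn: "0 <= real j * D" for j using D by simp
  have surj: "\<exists>s\<ge>0. t = R s" if "0 <= t" for t
   using R_time_change that unfolding time_change_def by (metis atLeast_iff imageE)
  have close: "abs(exp (x s) - exp (L j)) <= eps" if "abs(x s - L j) <= eps / exp A" "0 <= s" "s <= S + 1" "j <= J'" for s j
  proof -
   have "x s <= A" "L j <= A" using A(2)[of s] A(2)[of "real j * D"] that nn[of j] jS[of j] by (auto simp: L_def)
   then have "abs(exp (x s) - exp (L j)) <= exp A * abs(x s - L j)" by (rule abs_exp_diff_le)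
   also have "... <= exp A * (eps / exp A)" using that by (intro mult_left_mono) auto
   finally show ?thesis by simp
  qed
  have "J1_close eps (lamperti \<gamma> x) (skel_path \<gamma> D (J k) L)"
  proof (rule J1_close_step_path[where T=T and R="%j. R (real j * D)" and c="%j. R (c j)" and v="%j. exp (L j)" and J=J'])
   show "T 0 = 0" by (simp add: T_def)
   show "R (real 0 * D) = 0" by (simp add: R_0)
   show "T j < T (Suc j)" for j unfolding T_def by (rule skel_time_less[OF D(1)])
   fix j assume j: "j < J'"
   have cn: "0 <= c j" using c(1)[OF j] nn[of j] by linarith
   show "R (real j * D) < R (c j)" using R_less[OF nn c(1)[OF j]] .
   show Rc: "R (c j) <= R (real (Suc j) * D)" using R_le_iff[OF cn nn[of "Suc j"]] c(2)[OF j] by blast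
   have lo: "real j * D <= S + 1" "c j <= S + 1" using jS[of j] jS[of "Suc j"] c(2)[OF j] j by auto
   show "abs(lamperti \<gamma> x t - exp (L j)) <= eps" if "R (real j * D) <= t" "t < R (c j)" for t
   proof -
    have "0 <= t" by (rule order_trans[OF R_nonneg[OF nn[of j]] that(1)])
    then obtain s where s: "0 <= s" "t = R s" using surj by blast
    have "real j * D <= s" "s < c j" using that R_le_iff[OF nn s(1), of j] R_less_iff[OF s(1) cn] s(2) by auto
    then show ?thesis using close[OF c(3)[OF j] s(1)] lo j lamperti_R[OF s(1)] s(2) by simp
   qed
   show "abs(lamperti \<gamma> x t - exp (L (Suc j))) <= eps" if "R (c j) <= t" "t <= R (real (Suc j) * D)" for t
   proof -
    have "0 <= t" by (rule order_trans[OF R_nonneg[OF cn] that(1)])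
    then obtain s where s: "0 <= s" "t = R s" using surj by blast
    have "c j <= s" "s <= real (Suc j) * D" using that R_le_iff[OF cn s(1)] R_le_iff[OF s(1) nn, of "Suc j"] s(2) by blast+
    then show ?thesis using close[OF c(4)[OF j] s(1)] jS[of "Suc j"] j lamperti_R[OF s(1)] s(2) by simp
   qed
   have "R (real (Suc j) * D) - R (c j) <= B * (real (Suc j) * D - c j)"
    by (rule R_diff_bounds(2)[OF B(3,4) cn c(2)[OF j]]) (use jS[of "Suc j"] j in auto)
   also have "... <= B * D" using c(1)[OF j] B(2) by (intro mult_left_mono) (auto simp: algebra_simps)
   finally have 1: "R (real (Suc j) * D) - R (c j) <= B * D" .
   show "abs(T (Suc j) - R (c j)) <= eps" using TR[of "Suc j"] j 1 Rc elim(2) unfolding D_def[symmetric] by linarith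
   show "skel_path \<gamma> D (J k) L t = exp (L j)" if "T j <= t" "t < T (Suc j)" for t
    by (rule skel_path_eq[OF D(1)]) (use that j J'3 in "auto simp: T_def")
  next
   show "0 <= eps" using e0 by simp
   have "R S <= R (real J' * D)" using R_le_iff[of S "real J' * D"] S nn J'1 by auto
   then have "R S - E k <= T J'" using TR[of J'] by linarith
   then have "exp (- T J') <= exp (- (R S - E k))" by simp
   then show "exp (- T J') <= eps" using elim(3) by linarith
  qed
  then show ?case unfolding D_def L_def .
 qed
qed

end

section \<open>Levy processes that do not drift to minus infinity\<close>

lemma sum_lessThan_add: "(\<Sum>j<m + n. f j) = (\<Sum>j<m. f j) + (\<Sum>j<n. f (m + j))"
 for f :: "nat => 'a::comm_monoid_add"
 by (induction n) (auto simp: add.assoc)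

lemma prod_lessThan_add: "(\<Prod>j<m + n. f j) = (\<Prod>j<m. f j) * (\<Prod>j<n. f (m + j))"
 for f :: "nat => 'a::comm_monoid_mult"
 by (induction n) (auto simp: mult.assoc)

lemma min_1_abs_divide:
 fixes x c :: real
 assumes "0 < c" shows "0 <= min 1 (\<bar>x\<bar> / c)" "\<bar>min 1 (\<bar>x\<bar> / c)\<bar> <= 1"
proof -
 show "0 <= min 1 (abs(x) / c)" using assms by simp
 then show "\<bar>min 1 (\<bar>x\<bar> / c)\<bar> <= 1" by simp
qed

lemma coordinate_measurable [measurable]: "(%d :: nat => real. d j) \<in> borel_measurable borel"
 by (rule borel_measurable_continuous_onI) simp

definition incr :: "(real => real) => real => nat => real" where
 "incr x \<delta> j = x (real (Suc j) * \<delta>) - x (real j * \<delta>)"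

text \<open>The discrete clock as a function of the increments, the variables in which independence
  is available.\<close>

definition rho :: "real => real => nat => (nat => real) => real" where
 "rho \<gamma> \<delta> m d = skel_time \<gamma> \<delta> (%i. \<Sum>j<i. d j) m"

lemma rho_measurable [measurable]: "rho \<gamma> \<delta> m \<in> borel_measurable borel"
 unfolding rho_def skel_time_def by measurable

lemma sum_incr: "(\<Sum>j<i. incr x \<delta> j) = x (real i * \<delta>) - x 0"
 by (induction i) (auto simp: incr_def)

lemma sum_incr_shift: "(\<Sum>j<i. incr x \<delta> (m + j)) = x (real (m + i) * \<delta>) - x (real m * \<delta>)"
 using sum_lessThan_add[of "incr x \<delta>" m i] by (simp add: sum_incr)

lemma rho_incr: "x 0 = 0 ==> rho \<gamma> \<delta> m (incr x \<delta>) = skel_time \<gamma> \<delta> (%i. x (real i * \<delta>)) m"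
 by (simp add: rho_def sum_incr)

text \<open>Restarting the path at the m-th grid point divides the later gains of the clock by exp
  (\<gamma> x) at that point.\<close>

lemma rho_incr_shift:
 "rho \<gamma> \<delta> m' (%j. incr x \<delta> (m + j)) = exp (- \<gamma> * x (real m * \<delta>)) *
  (skel_time \<gamma> \<delta> (%i. x (real i * \<delta>)) (m + m') - skel_time \<gamma> \<delta> (%i. x (real i * \<delta>)) m)"
proof -
 have "exp (\<gamma> * (x (real (m + i) * \<delta>) - x (real m * \<delta>))) = exp (- \<gamma> * x (real m * \<delta>)) * exp (\<gamma> * x (real (m + i) * \<delta>))" for i
  by (simp add: exp_add[symmetric] algebra_simps)
 then show ?thesis
  unfolding rho_def skel_time_def sum_incr_shift sum_lessThan_add
  by (simp add: sum_distrib_left algebra_simps)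
qed

locale levy =
 fixes N :: "'b measure" and \<xi> :: "real => 'b => real" and \<Phi> :: "real => complex" and \<gamma> :: real
 assumes levy: "levy_process N \<xi> \<Phi>" and \<gamma>_pos: "0 < \<gamma>"
begin

sublocale N: prob_space N using levy by (simp add: levy_process_def)

lemma \<xi>_measurable [measurable]: "\<xi> t \<in> borel_measurable N" using levy by (simp add: levy_process_def)

lemma \<xi>_0: "om \<in> space N ==> \<xi> 0 om = 0" using levy by (simp add: levy_process_def)

lemma \<xi>_cadlag: "om \<in> space N ==> cadlag (%t. \<xi> t om)" using levy by (simp add: levy_process_def)

definition D :: "real => 'b => nat => real" where "D \<delta> om = incr (%t. \<xi> t om) \<delta>"

lemma D_coordinate_measurable [measurable]: "(%om. D \<delta> om j) \<in> borel_measurable N"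
 unfolding D_def incr_def by measurable

lemma D_measurable [measurable]: "D \<delta> \<in> borel_measurable N"
 by (rule measurable_coordinatewise_then_product) measurable

lemma D_cf:
 assumes "0 <= \<delta>"
 shows "(LINT om|N. cis (\<Sum>j<k. l j * D \<delta> om j)) = (\<Prod>j<k. exp (complex_of_real \<delta> * \<Phi> (l j)))"
proof -
 have "\<forall>k (ts :: nat => real) (ls :: nat => real).
    ts 0 = 0 --> (\<forall>j<k. ts j <= ts (Suc j)) -->
    (LINT om|N. cis (\<Sum>j<k. ls j * (\<xi> (ts (Suc j)) om - \<xi> (ts j) om)))
     = (\<Prod>j<k. exp (complex_of_real (ts (Suc j) - ts j) * \<Phi> (ls j)))"
  using levy unfolding levy_process_def by blast
 from this[rule_format, of "%j. real j * \<delta>" k l] show ?thesis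
  using assms by (simp add: D_def incr_def algebra_simps mult_right_mono)
qed

text \<open>Independence and stationarity in one statement: the first m increments may be continued
  by those of an independent copy. Both laws have the same product of characteristic
  functions.\<close>

lemma markov:
 assumes d: "0 <= \<delta>"
 shows "distr N borel (D \<delta>) =
  distr (N \<Otimes>\<^sub>M N) borel (%p j. if j < m then D \<delta> (fst p) j else D \<delta> (snd p) (j - m))"
proof (rule cf_determines_distr)
 interpret P: pair_prob_space N N by unfold_locales
 show "prob_space N" by unfold_locales
 show "prob_space (N \<Otimes>\<^sub>M N)" by unfold_locales
 show "(%p. if j < m then D \<delta> (fst p) j else D \<delta> (snd p) (j - m)) \<in> borel_measurable (N \<Otimes>\<^sub>M N)" for j
  by (cases "j < m") measurable
 fix k and l :: "nat => real"
 \<comment> \<open>Truncated subtraction: b is nonzero only if k exceeds m, and then a = m.\<close>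
 define a b where "a = min k m" and "b = k - m"
 have k: "k = a + b" by (auto simp: a_def b_def)
 have am: "b ~= 0 ==> a = m" by (auto simp: a_def b_def)
 have eq: "cis (\<Sum>j<k. l j * (if j < m then D \<delta> (fst p) j else D \<delta> (snd p) (j - m)))
  = cis (\<Sum>j<a. l j * D \<delta> (fst p) j) * cis (\<Sum>j<b. l (a + j) * D \<delta> (snd p) j)" for p
 proof -
  have 1: "(\<Sum>j<a. l j * (if j < m then D \<delta> (fst p) j else D \<delta> (snd p) (j - m))) = (\<Sum>j<a. l j * D \<delta> (fst p) j)"
   by (rule sum.cong) (auto simp: a_def)
  have 2: "(\<Sum>j<b. l (a + j) * (if a + j < m then D \<delta> (fst p) (a + j) else D \<delta> (snd p) (a + j - m))) = (\<Sum>j<b. l (a + j) * D \<delta> (snd p) j)"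
   using am by (intro sum.cong) auto
  show ?thesis unfolding k sum_lessThan_add 1 2 by (simp add: cis_mult)
 qed
 have mc: "(%om. cis (\<Sum>j<n. h j * D \<delta> om j)) \<in> borel_measurable N" for n h
  by (rule trig_measurable[OF trig.char[where k=n and l=h]]) measurable
 have "(LINT p|(N \<Otimes>\<^sub>M N). cis (\<Sum>j<k. l j * (if j < m then D \<delta> (fst p) j else D \<delta> (snd p) (j - m))))
  = (LINT x|N. LINT y|N. cis (\<Sum>j<a. l j * D \<delta> x j) * cis (\<Sum>j<b. l (a + j) * D \<delta> y j))"
  unfolding eq
 proof (subst P.integral_fst'[symmetric])
  have "(%p. cis (\<Sum>j<a. l j * D \<delta> (fst p) j)) \<in> borel_measurable (N \<Otimes>\<^sub>M N)"
   by (rule measurable_compose[OF measurable_fst mc])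
  moreover have "(%p. cis (\<Sum>j<b. l (a + j) * D \<delta> (snd p) j)) \<in> borel_measurable (N \<Otimes>\<^sub>M N)"
   by (rule measurable_compose[OF measurable_snd mc[of "%j. l (a + j)" b]])
  ultimately show "integrable (N \<Otimes>\<^sub>M N) (%p. cis (\<Sum>j<a. l j * D \<delta> (fst p) j) * cis (\<Sum>j<b. l (a + j) * D \<delta> (snd p) j))"
   by (intro P.integrable_const_bound[where B=1] borel_measurable_times) (auto simp: norm_mult)
 qed simp
 also have "... = (LINT x|N. cis (\<Sum>j<a. l j * D \<delta> x j)) * (LINT y|N. cis (\<Sum>j<b. l (a + j) * D \<delta> y j))"
  by simp
 also have "... = (\<Prod>j<k. exp (complex_of_real \<delta> * \<Phi> (l j)))"
  unfolding k prod_lessThan_add using D_cf[OF d] by simp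
 also have "... = (LINT om|N. cis (\<Sum>j<k. l j * D \<delta> om j))" by (rule D_cf[OF d, symmetric])
 finally show "(LINT om|N. cis (\<Sum>j<k. l j * D \<delta> om j)) =
  (LINT p|(N \<Otimes>\<^sub>M N). cis (\<Sum>j<k. l j * (if j < m then D \<delta> (fst p) j else D \<delta> (snd p) (j - m))))" by simp
qed measurable

text \<open>By \<open>markov\<close> the integral may be taken over two independent copies. As
  \<open>u\<close> sees only the first m coordinates it is evaluated on the first copy, and
  \<open>v\<close> on the second.\<close>

lemma markov_integral:
 fixes u v :: "(nat => real) => real"
 assumes d: "0 <= \<delta>" and u [measurable]: "u \<in> borel_measurable borel" and v [measurable]: "v \<in> borel_measurable borel"
  and ub: "!!x. abs(u x) <= A" and vb: "!!x. abs(v x) <= B"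
  and dep: "!!x y. (\<forall>j<m. x j = y j) ==> u x = u y"
 shows "(LINT om|N. u (D \<delta> om) * v (%j. D \<delta> om (m + j))) = (LINT om|N. u (D \<delta> om)) * (LINT om|N. v (D \<delta> om))"
proof -
 interpret P: pair_prob_space N N by unfold_locales
 have sh [measurable]: "(%x j. x (m + j)) \<in> borel_measurable (borel :: (nat => real) measure)"
  by (rule measurable_coordinatewise_then_product) measurable
 define w where "w x = u x * v (%j. x (m + j))" for x
 have w [measurable]: "w \<in> borel_measurable borel"
  unfolding w_def by (rule borel_measurable_times[OF u measurable_compose[OF sh v]])
 define E where "E = (%p j. if j < m then D \<delta> (fst p) j else D \<delta> (snd p) (j - m))"
 have E: "E \<in> borel_measurable (N \<Otimes>\<^sub>M N)"
 proof (rule measurable_coordinatewise_then_product)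
  show "(%x. E x i) \<in> borel_measurable (N \<Otimes>\<^sub>M N)" for i unfolding E_def by (cases "i < m") measurable
 qed
 have wE: "w (E p) = u (D \<delta> (fst p)) * v (D \<delta> (snd p))" for p
 proof -
  have "u (E p) = u (D \<delta> (fst p))" by (rule dep) (simp add: E_def)
  moreover have "(%j. E p (m + j)) = D \<delta> (snd p)" by (auto simp: E_def)
  ultimately show ?thesis by (simp add: w_def)
 qed
 have "(LINT om|N. w (D \<delta> om)) = (LINT x|distr N borel (D \<delta>). w x)"
  by (rule integral_distr[OF D_measurable w, symmetric])
 also have "... = (LINT x|distr (N \<Otimes>\<^sub>M N) borel E. w x)" unfolding markov[OF d, of m] E_def ..
 also have "... = (LINT p|(N \<Otimes>\<^sub>M N). w (E p))" by (rule integral_distr[OF E w])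
 also have "... = (LINT x|N. LINT y|N. u (D \<delta> x) * v (D \<delta> y))"
  unfolding wE
 proof (subst P.integral_fst'[symmetric])
  have "abs(u x * v y) <= A * B" for x y
   unfolding abs_mult using ub[of x] vb[of y] by (intro mult_mono) auto
  then show "integrable (N \<Otimes>\<^sub>M N) (%p. u (D \<delta> (fst p)) * v (D \<delta> (snd p)))"
   by (intro P.integrable_const_bound[where B="A * B"] borel_measurable_times AE_I2
     measurable_compose[OF measurable_compose[OF measurable_fst D_measurable] u]
     measurable_compose[OF measurable_compose[OF measurable_snd D_measurable] v]) simp
 qed simp
 finally show ?thesis by (simp add: w_def)
qed

definition Rv :: "nat => 'b => real" where "Rv n om = cadlag_path.R (%t. \<xi> t om) \<gamma> (real n)"

text \<open>Dyadic meshes: integers are grid points for every r, and finer grids contain coarser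
  ones.\<close>

definition grid :: "nat => real" where "grid r = 1 / 2 ^ r"

lemma grid_pos: "0 < grid r" by (simp add: grid_def)

lemma grid_tendsto: "grid ----> 0"
 unfolding grid_def using LIMSEQ_divide_realpow_zero[of 2 1] by simp

lemma cadlag_path: "om \<in> space N ==> cadlag_path (%t. \<xi> t om)"
 by (rule cadlag_path.intro[OF \<xi>_cadlag])

lemma grid_skel_time_tendsto:
 assumes om: "om \<in> space N"
 shows "(%r. skel_time \<gamma> (grid r) (%i. \<xi> (real i * grid r) om) (n * 2 ^ r)) ----> Rv n om"
proof -
 interpret cadlag_path "%t. \<xi> t om" \<gamma> by (rule cadlag_path[OF om])
 obtain e where e: "e ----> 0" "!!k j. real j * grid k <= real n ==>
  abs(skel_time \<gamma> (grid k) (%i. \<xi> (real i * grid k) om) j - R (real j * grid k)) <= e k"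
  using skel_time_R[of grid "real n", OF grid_pos grid_tendsto] by auto
 have n: "real (n * 2 ^ r) * grid r = real n" for r by (simp add: grid_def)
 have "abs(skel_time \<gamma> (grid r) (%i. \<xi> (real i * grid r) om) (n * 2 ^ r) - Rv n om) <= e r" for r
  using e(2)[of "n * 2 ^ r" r] unfolding n Rv_def by simp
 then have "(%r. skel_time \<gamma> (grid r) (%i. \<xi> (real i * grid r) om) (n * 2 ^ r) - Rv n om) ----> 0"
  by (intro Lim_null_comparison[OF _ e(1)]) auto
 then show ?thesis by (rule LIM_zero_cancel)
qed

lemma Rv_measurable [measurable]: "Rv n \<in> borel_measurable N"
 by (rule borel_measurable_LIMSEQ_real[OF grid_skel_time_tendsto]) (simp_all add: skel_time_def)

lemma Rv_nonneg: "om \<in> space N ==> 0 <= Rv n om"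
 unfolding Rv_def by (rule cadlag_path.R_nonneg[OF cadlag_path]) auto

lemma Rv_mono: "om \<in> space N ==> m <= n ==> Rv m om <= Rv n om"
 unfolding Rv_def by (subst cadlag_path.R_le_iff[OF cadlag_path]) auto

lemma Rv_1_pos: "om \<in> space N ==> 0 < Rv 1 om"
 unfolding Rv_def using cadlag_path.R_less[OF cadlag_path, of om 0 1] cadlag_path.R_0[OF cadlag_path] by simp

definition I :: "'b => ennreal" where
 "I om = (\<integral>\<^sup>+ s. ennreal (exp (\<gamma> * \<xi> s om)) * indicator {0..} s \<partial>lborel)"

lemma I_eq: "om \<in> space N ==> I om = (SUP n. ennreal (Rv n om))"
 unfolding I_def Rv_def by (rule cadlag_path.nn_integral_I[OF cadlag_path])

lemma I_measurable [measurable]: "I \<in> borel_measurable N"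
proof -
 have "(%om. SUP n. ennreal (Rv n om)) \<in> borel_measurable N" by measurable
 then show ?thesis by (rule measurable_cong[THEN iffD1, rotated]) (simp add: I_eq)
qed

lemma Rv_tendsto:
 assumes om: "om \<in> space N" and fin: "I om < \<infinity>"
 shows "(%n. Rv n om) ----> enn2real (I om)" "Rv n om <= enn2real (I om)"
proof -
 have inc: "incseq (%n. ennreal (Rv n om))" using Rv_mono[OF om] by (auto simp: incseq_def intro!: ennreal_leI)
 have "(%n. ennreal (Rv n om)) ----> I om" unfolding I_eq[OF om] by (rule LIMSEQ_SUP[OF inc])
 then have "(%n. enn2real (ennreal (Rv n om))) ----> enn2real (I om)"
  using fin by (intro tendsto_enn2real) auto
 then show "(%n. Rv n om) ----> enn2real (I om)" using Rv_nonneg[OF om] by simp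
 have "ennreal (Rv n om) <= I om" unfolding I_eq[OF om] by (rule SUP_upper) simp
 then show "Rv n om <= enn2real (I om)" using fin Rv_nonneg[OF om] enn2real_mono[of "ennreal (Rv n om)" "I om"] by simp
qed

lemma Rv_at_top:
 assumes om: "om \<in> space N" and inf: "I om = \<infinity>"
 shows "filterlim (%n. Rv n om) at_top sequentially"
 unfolding filterlim_at_top
proof
 fix Z :: real
 have "ennreal Z < (SUP n. ennreal (Rv n om))" using I_eq[OF om] inf by simp
 then obtain n where "ennreal Z < ennreal (Rv n om)" unfolding less_SUP_iff by auto
 then have Z: "Z < Rv n om" using Rv_nonneg[OF om, of n] by (metis ennreal_leI not_less)
 show "EV n. Z <= Rv n om"
  using eventually_ge_at_top[of n]
 proof eventually_elim
  case (elim m)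
  then show ?case using Rv_mono[OF om elim] Z by simp
 qed
qed

text \<open>The rescaled future has the law of \<open>R\<^sub>m\<close>; independence is tested against decreasing exponentials.\<close>

lemma future_independent:
 assumes c: "0 <= c" "0 <= c'"
 shows "(LINT om|N. exp (- c * Rv n om) * exp (- c' * (exp (- \<gamma> * \<xi> (real n) om) * (Rv (n + n') om - Rv n om))))
  = (LINT om|N. exp (- c * Rv n om)) * (LINT om|N. exp (- c' * Rv n' om))"
proof -
 define u where "u r d = exp (- c * abs(rho \<gamma> (grid r) (n * 2 ^ r) d))" for r d
 define v where "v r d = exp (- c' * abs(rho \<gamma> (grid r) (n' * 2 ^ r) d))" for r d
 have [measurable]: "u r \<in> borel_measurable borel" "v r \<in> borel_measurable borel" for r
  unfolding u_def v_def by measurable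
 have b: "abs(u r d) <= 1" "abs(v r d) <= 1" for r d using c by (auto simp: u_def v_def)
 have sh [measurable]: "(%om j. D (grid r) om (m + j)) \<in> borel_measurable N" for m r
  by (rule measurable_coordinatewise_then_product) measurable
 have eq: "(LINT om|N. u r (D (grid r) om) * v r (%j. D (grid r) om (n * 2 ^ r + j)))
  = (LINT om|N. u r (D (grid r) om)) * (LINT om|N. v r (D (grid r) om))" for r
 proof (rule markov_integral[where A=1 and B=1])
  fix x y :: "nat => real" assume *: "\<forall>j<n * 2 ^ r. x j = y j"
  then have "(\<Sum>j<i. x j) = (\<Sum>j<i. y j)" if "i < n * 2 ^ r" for i using that by (intro sum.cong) auto
  then have "rho \<gamma> (grid r) (n * 2 ^ r) x = rho \<gamma> (grid r) (n * 2 ^ r) y"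
   by (auto simp: rho_def skel_time_def intro!: sum.cong)
  then show "u r x = u r y" by (simp add: u_def)
 qed (use b grid_pos in "auto simp: less_imp_le")
 have rlim: "(%r. rho \<gamma> (grid r) (m * 2 ^ r) (D (grid r) om)) ----> Rv m om" if "om \<in> space N" for om m
  using grid_skel_time_tendsto[OF that] rho_incr[of "%t. \<xi> t om"] \<xi>_0[OF that] by (simp add: D_def)
 have rlim': "(%r. rho \<gamma> (grid r) (n' * 2 ^ r) (%j. D (grid r) om (n * 2 ^ r + j))) ---->
  exp (- \<gamma> * \<xi> (real n) om) * (Rv (n + n') om - Rv n om)" if om: "om \<in> space N" for om
 proof -
  have g: "real (n * 2 ^ r) * grid r = real n" for r by (simp add: grid_def)
  have s: "n * 2 ^ r + n' * 2 ^ r = (n + n') * 2 ^ r" for r by (simp add: distrib_right)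
  show ?thesis unfolding D_def rho_incr_shift g s
   by (intro tendsto_intros grid_skel_time_tendsto om)
 qed
 have lu: "(%r. u r (D (grid r) om)) ----> exp (- c * Rv n om)" if "om \<in> space N" for om
  using tendsto_exp[OF tendsto_mult_left[OF tendsto_rabs[OF rlim[OF that, of n]], of "- c"]] Rv_nonneg[OF that, of n]
  by (simp add: u_def)
 have lv: "(%r. v r (D (grid r) om)) ----> exp (- c' * Rv n' om)" if "om \<in> space N" for om
  using tendsto_exp[OF tendsto_mult_left[OF tendsto_rabs[OF rlim[OF that, of n']], of "- c'"]] Rv_nonneg[OF that, of n']
  by (simp add: v_def)
 have lv': "(%r. v r (%j. D (grid r) om (n * 2 ^ r + j))) ----> exp (- c' * (exp (- \<gamma> * \<xi> (real n) om) * (Rv (n + n') om - Rv n om)))"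
  if "om \<in> space N" for om
  using tendsto_exp[OF tendsto_mult_left[OF tendsto_rabs[OF rlim'[OF that]], of "- c'"]] Rv_mono[OF that, of n "n + n'"]
  by (simp add: v_def abs_mult)
 have "(%r. LINT om|N. u r (D (grid r) om) * v r (%j. D (grid r) om (n * 2 ^ r + j))) ---->
  (LINT om|N. exp (- c * Rv n om) * exp (- c' * (exp (- \<gamma> * \<xi> (real n) om) * (Rv (n + n') om - Rv n om))))"
 proof (rule integral_dominated_convergence[where w="%_. 1"])
  show "AE om in N. norm (u r (D (grid r) om) * v r (%j. D (grid r) om (n * 2 ^ r + j))) <= 1" for r
   using b by (auto simp: abs_mult intro!: mult_le_one)
 qed (auto intro!: AE_I2 tendsto_mult lu[simplified] lv'[simplified])
 moreover have "(%r. LINT om|N. u r (D (grid r) om)) ----> (LINT om|N. exp (- c * Rv n om))"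
  by (rule integral_dominated_convergence[where w="%_. 1"]) (use b in "auto intro!: AE_I2 lu[simplified]")
 moreover have "(%r. LINT om|N. v r (D (grid r) om)) ----> (LINT om|N. exp (- c' * Rv n' om))"
  by (rule integral_dominated_convergence[where w="%_. 1"]) (use b in "auto intro!: AE_I2 lv[simplified]")
 ultimately show ?thesis unfolding eq by (intro LIMSEQ_unique[OF _ tendsto_mult])
qed

text \<open>Finiteness of the integral is decided by the rescaled future, which is independent of the past and has the law
 of the whole: the event is independent of itself.\<close>

lemma zero_one_law: "N.prob {om\<in>space N. I om < \<infinity>} = 0 \<or> N.prob {om\<in>space N. I om < \<infinity>} = 1"
proof -
 define e where "e n om = exp (- \<gamma> * \<xi> (real n) om)" for n om
 have e_pos: "0 < e n om" for n om by (simp add: e_def)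
 have e_meas [measurable]: "e n \<in> borel_measurable N" for n unfolding e_def by measurable
 \<comment> \<open>The Laplace functional e^(-c I); \<open>enn2real\<close> sends infinity to 0, so
   the value 0 for an infinite clock is written out. \<open>h\<close> is its analogue for the
   rescaled future.\<close>
 define g where "g c om = (if I om < \<infinity> then exp (- c * enn2real (I om)) else 0)" for c om
 define h where "h c n om = (if I om < \<infinity> then exp (- c * (e n om * (enn2real (I om) - Rv n om))) else 0)" for c n om
 have [measurable]: "g c \<in> borel_measurable N" "h c n \<in> borel_measurable N" for c n
  unfolding g_def h_def by measurable
 have inf: "I om = \<infinity>" if "\<not> I om < \<infinity>" for om
  using that top.not_eq_extremum[of "I om"] by auto
 have top: "filterlim (%n. c * (e n0 om * (Rv (n0 + n) om - Rv n0 om))) at_top sequentially"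
  if "om \<in> space N" "\<not> I om < \<infinity>" "0 < c" for om c n0
 proof -
  have "filterlim (%n. Rv n om) at_top sequentially" using Rv_at_top[OF that(1) inf[OF that(2)]] .
  then have "filterlim (%n. Rv (n0 + n) om) at_top sequentially"
   by (rule filterlim_compose) (rule filterlim_add_const_nat_at_top[of n0, unfolded add.commute[of _ n0]])
  then have "filterlim (%n. (- Rv n0 om) + Rv (n0 + n) om) at_top sequentially"
   by (rule filterlim_tendsto_add_at_top[OF tendsto_const])
  then have "filterlim (%n. (c * e n0 om) * (- Rv n0 om + Rv (n0 + n) om)) at_top sequentially"
   by (rule filterlim_tendsto_pos_mult_at_top[OF tendsto_const, rotated]) (use that e_pos in auto)
  then show ?thesis by (simp add: mult.assoc add.commute[of "- _"])
 qed
 have h_lim: "(%n'. exp (- c * (e n om * (Rv (n + n') om - Rv n om)))) ----> h c n om"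
  if om: "om \<in> space N" and c: "0 < c" for om c n
 proof (cases "I om < \<infinity>")
  case True
  have "(%n'. Rv (n + n') om) ----> enn2real (I om)"
   using LIMSEQ_ignore_initial_segment[OF Rv_tendsto(1)[OF om True], of n] by (simp add: add.commute)
  then have "(%n'. exp (- c * (e n om * (Rv (n + n') om - Rv n om)))) ----> exp (- c * (e n om * (enn2real (I om) - Rv n om)))"
   by (intro tendsto_intros)
  then show ?thesis using True by (simp add: h_def)
 next
  case False
  have "(%n'. exp (- (c * (e n om * (Rv (n + n') om - Rv n om))))) ----> 0"
   by (rule filterlim_compose[OF exp_at_bot filterlim_compose[OF filterlim_uminus_at_bot_at_top top[OF om False c]]])
  then show ?thesis using False by (simp add: h_def)
 qed
 have g_lim: "(%n. exp (- c * Rv n om)) ----> g c om" if om: "om \<in> space N" and c: "0 < c" for om c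
 proof (cases "I om < \<infinity>")
  case True
  have "(%n. exp (- c * Rv n om)) ----> exp (- c * enn2real (I om))"
   by (intro tendsto_intros Rv_tendsto(1)[OF om True])
  then show ?thesis using True by (simp add: g_def)
 next
  case False
  have "filterlim (%n. c * Rv n om) at_top sequentially"
   by (rule filterlim_tendsto_pos_mult_at_top[OF tendsto_const c Rv_at_top[OF om inf[OF False]]])
  then have "(%n. exp (- (c * Rv n om))) ----> 0"
   by (rule filterlim_compose[OF exp_at_bot filterlim_compose[OF filterlim_uminus_at_bot_at_top]])
  then show ?thesis using False by (simp add: g_def)
 qed
 have Rb: "0 <= Rv n om" "0 <= Rv (n + n') om - Rv n om" if "om \<in> space N" for n n' om
  using Rv_nonneg[OF that] Rv_mono[OF that, of n "n + n'"] by auto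
 have hb: "0 <= h c n om" "h c n om <= 1" if "om \<in> space N" "0 <= c" for c n om
  using Rv_tendsto(2)[OF that(1), of n] that(2) e_pos[of n om] by (auto simp: h_def intro!: mult_nonneg_nonneg)
 have gb: "0 <= g c om" "g c om <= 1" if "0 <= c" for c om
  using that by (auto simp: g_def)
 have 1: "(LINT om|N. exp (- c * Rv n om) * h c' n om) = (LINT om|N. exp (- c * Rv n om)) * (LINT om|N. g c' om)"
  if c: "0 < c" "0 < c'" for c c' n
 proof -
  have "(%n'. LINT om|N. exp (- c * Rv n om) * exp (- c' * (e n om * (Rv (n + n') om - Rv n om)))) ---->
   (LINT om|N. exp (- c * Rv n om) * h c' n om)"
  proof (rule integral_dominated_convergence[where w="%_. 1"])
   show "AE om in N. norm (exp (- c * Rv n om) * exp (- c' * (e n om * (Rv (n + n') om - Rv n om)))) <= 1" for n'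
   proof (rule AE_I2)
    fix om assume om: "om \<in> space N"
    have a: "0 <= c * Rv n om" using c Rb[OF om] by simp
    have b: "0 <= c' * (e n om * (Rv (n + n') om - Rv n om))"
     using c Rb(2)[OF om, of n n'] e_pos[of n om] by (intro mult_nonneg_nonneg) auto
    show "norm (exp (- c * Rv n om) * exp (- c' * (e n om * (Rv (n + n') om - Rv n om)))) <= 1"
     using a b by (simp add: abs_mult mult_le_one)
   qed
   show "AE om in N. (%n'. exp (- c * Rv n om) * exp (- c' * (e n om * (Rv (n + n') om - Rv n om))))
     ----> exp (- c * Rv n om) * h c' n om"
    by (intro AE_I2 tendsto_mult tendsto_const h_lim c)
  qed measurable
  moreover have "(%n'. (LINT om|N. exp (- c * Rv n om)) * (LINT om|N. exp (- c' * Rv n' om))) ---->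
   (LINT om|N. exp (- c * Rv n om)) * (LINT om|N. g c' om)"
  proof (intro tendsto_mult tendsto_const integral_dominated_convergence[where w="%_. 1"])
   show "AE om in N. norm (exp (- c' * Rv n' om)) <= 1" for n'
    using c Rb by (intro AE_I2) auto
   show "AE om in N. (%n'. exp (- c' * Rv n' om)) ----> g c' om" by (intro AE_I2 g_lim c)
  qed measurable
  ultimately show ?thesis
   using future_independent[of c c' n] c unfolding e_def by (intro LIMSEQ_unique) auto
 qed
 define E where "E = {om\<in>space N. I om < \<infinity>}"
 have E [measurable]: "E \<in> sets N" unfolding E_def by measurable
 define q where "q k = 1 / real (Suc k)" for k
 have q: "0 < q k" "q ----> 0" for k
  unfolding q_def using LIMSEQ_inverse_real_of_nat by (auto simp: inverse_eq_divide)
 have g0: "(%k. LINT om|N. g (q k) om) ----> (LINT om|N. indicator E om)"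
 proof (rule integral_dominated_convergence[where w="%_. 1"])
  show "AE om in N. (%k. g (q k) om) ----> indicator E om"
  proof (rule AE_I2)
   fix om assume "om \<in> space N"
   have "(%k. exp (- q k * enn2real (I om))) ----> exp (- 0 * enn2real (I om))" by (intro tendsto_intros q)
   then show "(%k. g (q k) om) ----> indicator E om"
    using \<open>om \<in> space N\<close> by (cases "I om < \<infinity>") (auto simp: g_def E_def)
  qed
 qed (use gb q in "auto simp: less_imp_le")
 \<comment> \<open>As c' tends to 0 both transforms become the indicator of a finite clock, because
   the rescaling factor of the future is positive and finite. So the past clock is independent of
   that event.\<close>
 have 2: "(LINT om|N. exp (- c * Rv n om) * indicator E om) = (LINT om|N. exp (- c * Rv n om)) * N.prob E"
  if c: "0 < c" for c n
 proof -
  have "(%k. LINT om|N. exp (- c * Rv n om) * h (q k) n om) ----> (LINT om|N. exp (- c * Rv n om) * indicator E om)"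
  proof (rule integral_dominated_convergence[where w="%_. 1"])
   show "AE om in N. (%k. exp (- c * Rv n om) * h (q k) n om) ----> exp (- c * Rv n om) * indicator E om"
   proof (intro AE_I2 tendsto_mult tendsto_const)
    fix om assume "om \<in> space N"
    have "(%k. exp (- q k * (e n om * (enn2real (I om) - Rv n om)))) ----> exp (- 0 * (e n om * (enn2real (I om) - Rv n om)))"
     by (intro tendsto_intros q)
    then show "(%k. h (q k) n om) ----> indicator E om"
     using \<open>om \<in> space N\<close> by (cases "I om < \<infinity>") (auto simp: h_def E_def)
   qed
   show "AE om in N. norm (exp (- c * Rv n om) * h (q k) n om) <= 1" for k
    using c Rb hb q by (intro AE_I2) (auto simp: abs_mult less_imp_le intro!: mult_le_one)
  qed measurable
  moreover have "(%k. (LINT om|N. exp (- c * Rv n om)) * (LINT om|N. g (q k) om)) ----> (LINT om|N. exp (- c * Rv n om)) * (LINT om|N. indicator E om)"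
   by (intro tendsto_mult tendsto_const g0)
  ultimately show ?thesis unfolding 1[OF c q(1)] using E by (simp add: LIMSEQ_unique)
 qed
 \<comment> \<open>As n grows the past clock becomes the whole clock, and \<open>g c\<close>
   vanishes off E. With c tending to 0 this reads P(E) = P(E)^2.\<close>
 have 3: "(LINT om|N. g c om) = (LINT om|N. g c om) * N.prob E" if c: "0 < c" for c
 proof -
  have a: "(%n. LINT om|N. exp (- c * Rv n om) * indicator E om) ----> (LINT om|N. g c om * indicator E om)"
   by (rule integral_dominated_convergence[where w="%_. 1"])
    (use c Rb in "auto intro!: AE_I2 tendsto_mult g_lim[simplified] mult_le_one simp: abs_mult")
  have b: "(%n. (LINT om|N. exp (- c * Rv n om)) * N.prob E) ----> (LINT om|N. g c om) * N.prob E"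
   by (intro tendsto_mult tendsto_const integral_dominated_convergence[where w="%_. 1"])
    (use c Rb in "auto intro!: AE_I2 g_lim[simplified]")
  have eq: "(LINT om|N. g c om * indicator E om) = (LINT om|N. g c om)"
   by (rule Bochner_Integration.integral_cong) (auto simp: g_def E_def indicator_def)
  show ?thesis using LIMSEQ_unique[OF a[unfolded 2[OF c]] b] unfolding eq .
 qed
 have g0': "(%k. LINT om|N. g (q k) om) ----> N.prob E" using g0 E by simp
 have "(%k. (LINT om|N. g (q k) om) * N.prob E) ----> N.prob E * N.prob E"
  by (rule tendsto_mult[OF g0' tendsto_const])
 moreover have "(%k. (LINT om|N. g (q k) om) * N.prob E) = (%k. LINT om|N. g (q k) om)"
  by (rule ext) (rule 3[OF q(1), symmetric])
 ultimately have "N.prob E * N.prob E = N.prob E" using LIMSEQ_unique[OF _ g0'] by metis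
 then show ?thesis unfolding E_def[symmetric] by simp
qed

text \<open>An Ottaviani inequality: from its first entrance above \<open>-K\<close> on, the clock gains at least \<open>exp (-\<gamma> K)\<close> times
 an independent copy of its initial part.\<close>

lemma first_entrance:
 fixes K c :: real
 shows "N.prob {om\<in>space N. \<exists>i\<in>{n0..n1}. - K <= \<xi> (real i * grid r) om} * N.prob {om\<in>space N. c <= rho \<gamma> (grid r) m (D (grid r) om)}
  <= N.prob {om\<in>space N. exp (- \<gamma> * K) * c <= skel_time \<gamma> (grid r) (%i. \<xi> (real i * grid r) om) (n1 + m)
    - skel_time \<gamma> (grid r) (%i. \<xi> (real i * grid r) om) n0}"
proof (cases "c <= 0")
 \<comment> \<open>For c <= 0 the gain of an increasing clock makes the right-hand event certain if
   n0 <= n1; otherwise the entrance event is empty.\<close>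
 case True
 have "0 <= skel_time \<gamma> (grid r) L (n1 + m) - skel_time \<gamma> (grid r) L n0" if "n0 <= n1" for L
 proof -
  have "skel_time \<gamma> (grid r) L n0 <= skel_time \<gamma> (grid r) L (n1 + m)"
   by (rule lift_Suc_mono_le[of "skel_time \<gamma> (grid r) L"]) (use skel_time_less[OF grid_pos] that in "auto simp: less_imp_le")
  then show ?thesis by simp
 qed
 moreover have "exp (- \<gamma> * K) * c <= 0" using True by (simp add: mult_le_0_iff)
 ultimately have "{om\<in>space N. exp (- \<gamma> * K) * c <= skel_time \<gamma> (grid r) (%i. \<xi> (real i * grid r) om) (n1 + m)
    - skel_time \<gamma> (grid r) (%i. \<xi> (real i * grid r) om) n0} = space N" if "n0 <= n1"
  using that by (auto intro: order_trans)
 then show ?thesis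
  by (cases "n0 <= n1") (auto simp: N.prob_space intro!: mult_le_one)
next
 case False
 define H where "H i om = \<xi> (real i * grid r) om" for i om
 have Hm [measurable]: "H i \<in> borel_measurable N" for i unfolding H_def by measurable
 define sh where "sh i om = (%j. D (grid r) om (i + j))" for i om
 have shm [measurable]: "sh i \<in> borel_measurable N" for i
  unfolding sh_def by (rule measurable_coordinatewise_then_product) measurable
 \<comment> \<open>The first entrance after n0 happens at index i. This depends on the first i
   increments only, while \<open>B i\<close> depends on the later ones.\<close>
 define A where "A i = {om\<in>space N. - K <= H i om & (\<forall>l\<in>{n0..<i}. H l om < - K)}" for i
 define B where "B i = {om\<in>space N. c <= rho \<gamma> (grid r) m (sh i om)}" for i
 have Am [measurable]: "A i \<in> sets N" for i unfolding A_def by measurable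
 have Bm [measurable]: "B i \<in> sets N" for i unfolding B_def by measurable
 define B0 where "B0 = {om\<in>space N. c <= rho \<gamma> (grid r) m (D (grid r) om)}"
 have B0m [measurable]: "B0 \<in> sets N" unfolding B0_def by measurable
 define G where "G om = skel_time \<gamma> (grid r) (%i. H i om) (n1 + m) - skel_time \<gamma> (grid r) (%i. H i om) n0" for om
 have Gm [measurable]: "G \<in> borel_measurable N" unfolding G_def skel_time_def by measurable
 have AB: "N.prob (A i \<inter> B i) = N.prob (A i) * N.prob B0" for i
 proof -
  define SA where "SA = {d :: nat => real. - K <= (\<Sum>j<i. d j) & (\<forall>l\<in>{n0..<i}. (\<Sum>j<l. d j) < - K)}"
  define SB where "SB = {d :: nat => real. c <= rho \<gamma> (grid r) m d}"
  have "{d \<in> space borel. - K <= (\<Sum>j<i. d j) & (\<forall>l\<in>{n0..<i}. (\<Sum>j<l. d j) < - K)} \<in> sets (borel :: (nat => real) measure)" by measurable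
  then have SA [measurable]: "SA \<in> sets borel" by (simp add: SA_def)
  have "{d \<in> space borel. c <= rho \<gamma> (grid r) m d} \<in> sets (borel :: (nat => real) measure)" by measurable
  then have SB [measurable]: "SB \<in> sets borel" by (simp add: SB_def)
  have pos: "(\<Sum>j<l. D (grid r) om j) = H l om" if "om \<in> space N" for l om
   unfolding D_def sum_incr H_def using \<xi>_0[OF that] by simp
  have "(LINT om|N. indicator SA (D (grid r) om) * indicator SB (%j. D (grid r) om (i + j)))
   = (LINT om|N. indicator SA (D (grid r) om)) * (LINT om|N. indicator SB (D (grid r) om) :: real)"
  proof (rule markov_integral[where A=1 and B=1])
   fix x y :: "nat => real" assume *: "\<forall>j<i. x j = y j"
   then have "(\<Sum>j<l. x j) = (\<Sum>j<l. y j)" if "l <= i" for l using that by (intro sum.cong) auto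
   then have "x \<in> SA \<longleftrightarrow> y \<in> SA" by (auto simp: SA_def)
   then show "indicator SA x = (indicator SA y :: real)" by (simp add: indicator_def)
  qed (auto simp: indicator_def grid_pos less_imp_le)
  moreover have "(LINT om|N. indicator SA (D (grid r) om) * indicator SB (%j. D (grid r) om (i + j))) = (LINT om|N. indicator (A i \<inter> B i) om :: real)"
   by (rule Bochner_Integration.integral_cong) (auto simp: A_def B_def SA_def SB_def sh_def indicator_def pos)
  moreover have "(LINT om|N. indicator SA (D (grid r) om)) = (LINT om|N. indicator (A i) om :: real)"
   by (rule Bochner_Integration.integral_cong) (auto simp: A_def SA_def indicator_def pos)
  moreover have "(LINT om|N. indicator SB (D (grid r) om)) = (LINT om|N. indicator B0 om :: real)"
   by (rule Bochner_Integration.integral_cong) (auto simp: B0_def SB_def indicator_def)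
  ultimately show ?thesis by simp
 qed
 have disj: "disjoint_family_on A {n0..n1}"
  unfolding disjoint_family_on_def
 proof (intro ballI impI)
  fix i j assume "i \<in> {n0..n1}" "j \<in> {n0..n1}" "i ~= j"
  then show "A i \<inter> A j = {}"
   by (cases "i < j") (force simp: A_def)+
 qed
 have union: "{om\<in>space N. \<exists>i\<in>{n0..n1}. - K <= H i om} \<subseteq> (\<Union>i\<in>{n0..n1}. A i)"
 proof safe
  fix om i assume om: "om \<in> space N" and i: "i \<in> {n0..n1}" "- K <= H i om"
  define k where "k = (LEAST k. n0 <= k & - K <= H k om)"
  have k: "n0 <= k & - K <= H k om" unfolding k_def by (rule LeastI[of _ i]) (use i in auto)
  have "k <= i" unfolding k_def by (rule Least_le) (use i in auto)
  moreover have "H l om < - K" if "l \<in> {n0..<k}" for l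
   using not_less_Least[of l "%k. n0 <= k & - K <= H k om"] that unfolding k_def[symmetric] by auto
  ultimately show "om \<in> (\<Union>i\<in>{n0..n1}. A i)" using k i om by (auto simp: A_def intro!: bexI[of _ k])
 qed
 have "N.prob {om\<in>space N. \<exists>i\<in>{n0..n1}. - K <= H i om} * N.prob B0 <= N.prob (\<Union>i\<in>{n0..n1}. A i) * N.prob B0"
  by (intro mult_right_mono N.finite_measure_mono union) auto
 also have "N.prob (\<Union>i\<in>{n0..n1}. A i) = (\<Sum>i\<in>{n0..n1}. N.prob (A i))"
  by (rule N.finite_measure_finite_Union) (auto simp: disj)
 also have "... * N.prob B0 = (\<Sum>i\<in>{n0..n1}. N.prob (A i \<inter> B i))"
  by (simp add: AB sum_distrib_right)
 also have "... = N.prob (\<Union>i\<in>{n0..n1}. A i \<inter> B i)"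
  by (rule N.finite_measure_finite_Union[symmetric]) (use disj in "auto simp: disjoint_family_on_def")
 also have "... <= N.prob {om\<in>space N. exp (- \<gamma> * K) * c <= G om}"
 proof (rule N.finite_measure_mono)
  show "(\<Union>i\<in>{n0..n1}. A i \<inter> B i) \<subseteq> {om\<in>space N. exp (- \<gamma> * K) * c <= G om}"
  proof safe
   fix i om assume i: "i \<in> {n0..n1}" and A: "om \<in> A i" and B: "om \<in> B i"
   show om: "om \<in> space N" using A by (simp add: A_def)
   define L where "L = (%i. H i om)"
   have mono: "skel_time \<gamma> (grid r) L a <= skel_time \<gamma> (grid r) L b" if "a <= b" for a b
    by (rule lift_Suc_mono_le[of "skel_time \<gamma> (grid r) L"]) (use skel_time_less[OF grid_pos] that in "auto simp: less_imp_le")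
   have HK: "- K <= H i om" using A by (simp add: A_def)
   have "c <= exp (- \<gamma> * H i om) * (skel_time \<gamma> (grid r) L (i + m) - skel_time \<gamma> (grid r) L i)"
    using B unfolding B_def sh_def D_def rho_incr_shift L_def H_def by simp
   then have "exp (\<gamma> * H i om) * c <= exp (\<gamma> * H i om) * (exp (- \<gamma> * H i om) * (skel_time \<gamma> (grid r) L (i + m) - skel_time \<gamma> (grid r) L i))"
    by (intro mult_left_mono) auto
   also have "... = skel_time \<gamma> (grid r) L (i + m) - skel_time \<gamma> (grid r) L i"
    by (simp add: mult.assoc[symmetric] exp_add[symmetric])
   also have "... <= skel_time \<gamma> (grid r) L (n1 + m) - skel_time \<gamma> (grid r) L n0"
    using mono[of "i + m" "n1 + m"] mono[of n0 i] i by simp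
   finally have "exp (\<gamma> * H i om) * c <= G om" by (simp add: G_def L_def)
   moreover have "- \<gamma> * K <= \<gamma> * H i om" using HK \<gamma>_pos mult_left_mono[of "- K" "H i om" \<gamma>] by simp
   then have "exp (- \<gamma> * K) * c <= exp (\<gamma> * H i om) * c" using False by (intro mult_right_mono) auto
   ultimately show "exp (- \<gamma> * K) * c <= G om" by linarith
  qed
 qed measurable
 finally show ?thesis unfolding B0_def G_def H_def .
qed

text \<open>The clock at time 1 is strictly positive, so it is at most 2 c with probability below
  1/2 for some c > 0. A ramp between c and 2 c carries the bound over to fine discrete
  clocks.\<close>

lemma rho_bounded_below:
 obtains c where "0 < c" "EV r. N.prob {om\<in>space N. c <= rho \<gamma> (grid r) (2 ^ r) (D (grid r) om)} >= 1/2"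
proof -
 have "(%k. N.prob {om\<in>space N. Rv 1 om <= 2 / real (Suc k)}) ----> N.prob (\<Inter>k. {om\<in>space N. Rv 1 om <= 2 / real (Suc k)})"
 proof (rule N.finite_Lim_measure_decseq)
  show "decseq (%k. {om\<in>space N. Rv 1 om <= 2 / real (Suc k)})"
   unfolding decseq_def
  proof (intro allI impI subsetI)
   fix m n :: nat and om assume mn: "m <= n" and w: "om \<in> {om\<in>space N. Rv 1 om <= 2 / real (Suc n)}"
   have "2 / real (Suc n) <= 2 / real (Suc m)" using mn by (intro divide_left_mono) auto
   then show "om \<in> {om\<in>space N. Rv 1 om <= 2 / real (Suc m)}" using w by auto
  qed
 qed auto
 also have "(\<Inter>k. {om\<in>space N. Rv 1 om <= 2 / real (Suc k)}) = {}"
 proof (rule ccontr)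
  assume "(\<Inter>k. {om\<in>space N. Rv 1 om <= 2 / real (Suc k)}) ~= {}"
  then obtain om where om: "om \<in> space N" "!!k. Rv 1 om <= 2 / real (Suc k)" by blast
  have "(%k. 2 / real (Suc k)) ----> 0"
   using tendsto_mult[OF tendsto_const[of 2] LIMSEQ_inverse_real_of_nat] by (simp add: divide_inverse)
  then have "Rv 1 om <= 0" using om(2) by (intro LIMSEQ_le_const) auto
  then show False using Rv_1_pos[OF om(1)] by simp
 qed
 finally have "EV k. N.prob {om\<in>space N. Rv 1 om <= 2 / real (Suc k)} < 1/2"
  by (intro order_tendstoD(2)) auto
 then obtain k where k: "N.prob {om\<in>space N. Rv 1 om <= 2 / real (Suc k)} < 1/2"
  using eventually_happens'[OF sequentially_bot] by blast
 define c where "c = 1 / real (Suc k)"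
 have c: "c > 0" by (simp add: c_def)
 have k': "N.prob {om\<in>space N. Rv 1 om <= 2 * c} < 1/2" using k by (simp add: c_def)
 define p where "p z = min 1 (max 0 (2 - z / c))" for z :: real
 have [measurable]: "p \<in> borel_measurable borel" unfolding p_def by measurable
 have p01: "abs(p z) <= 1" for z by (auto simp: p_def)
 have pc: "p z = 1" if "z < c" for z using that c by (simp add: p_def min_def max_def field_simps)
 have p2c: "p z <= (if z <= 2 * c then 1 else 0)" for z using c by (auto simp: p_def min_def max_def field_simps)
 have p0: "0 <= p z" for z by (simp add: p_def)
 have lim: "(%r. LINT om|N. p (rho \<gamma> (grid r) (2 ^ r) (D (grid r) om))) ----> (LINT om|N. p (Rv 1 om))"
 proof (rule integral_dominated_convergence[where w="%_. 1"])
  show "AE om in N. (%r. p (rho \<gamma> (grid r) (2 ^ r) (D (grid r) om))) ----> p (Rv 1 om)"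
  proof (rule AE_I2)
   fix om assume om: "om \<in> space N"
   have "(%r. rho \<gamma> (grid r) (2 ^ r) (D (grid r) om)) ----> Rv 1 om"
    using grid_skel_time_tendsto[OF om, of 1] rho_incr[of "%t. \<xi> t om"] \<xi>_0[OF om] by (simp add: D_def)
   then show "(%r. p (rho \<gamma> (grid r) (2 ^ r) (D (grid r) om))) ----> p (Rv 1 om)"
    unfolding p_def using c by (intro tendsto_intros) auto
  qed
 qed (use p01 in auto)
 have le: "(LINT om|N. p (Rv 1 om)) <= (LINT om|N. indicator {om\<in>space N. Rv 1 om <= 2 * c} om)"
 proof (rule integral_mono)
  show "p (Rv 1 om) <= indicator {om\<in>space N. Rv 1 om <= 2 * c} om" if "om \<in> space N" for om
   using p2c[of "Rv 1 om"] that by (auto simp: indicator_def split: if_splits)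
 qed (auto intro!: N.integrable_const_bound[where B=1] simp: p01 indicator_def)
 have "(LINT om|N. p (Rv 1 om)) < 1/2" using le k' by simp
 from order_tendstoD(2)[OF lim this] have "EV r. N.prob {om\<in>space N. c <= rho \<gamma> (grid r) (2 ^ r) (D (grid r) om)} >= 1/2"
 proof eventually_elim
  case (elim r)
  let ?B = "{om\<in>space N. c <= rho \<gamma> (grid r) (2 ^ r) (D (grid r) om)}"
  have "N.prob (space N - ?B) = (LINT om|N. indicator (space N - ?B) om)" by simp
  also have "... <= (LINT om|N. p (rho \<gamma> (grid r) (2 ^ r) (D (grid r) om)))"
  proof (rule integral_mono)
   show "indicator (space N - ?B) om <= p (rho \<gamma> (grid r) (2 ^ r) (D (grid r) om))" if "om \<in> space N" for om
    using pc p0 that by (auto simp: indicator_def not_le)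
  qed (auto intro!: N.integrable_const_bound[where B=1] simp: p01 indicator_def)
  finally have "N.prob (space N - ?B) < 1/2" using elim by simp
  moreover have "N.prob (space N - ?B) = 1 - N.prob ?B" by (rule N.prob_compl) measurable
  ultimately show ?case by simp
 qed
 with c show ?thesis using that by blast
qed

text \<open>If the clock is finite, its remainder after time m tends to 0. By
  \<open>first_entrance\<close> a visit above -K after m has probability at most twice that of a
  remainder gain of at least exp (-\<gamma> K) c. So such visits cease for every K, first at dyadic
  times and then, by right-continuity, at all times.\<close>

lemma drift_if_finite:
 assumes fin: "AE om in N. I om < \<infinity>"
 shows "AE om in N. filterlim (%t. \<xi> t om) at_bot at_top"
proof -
 obtain c where c: "0 < c" and ev: "EV r. N.prob {om\<in>space N. c <= rho \<gamma> (grid r) (2 ^ r) (D (grid r) om)} >= 1/2"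
  using rho_bounded_below by blast
 \<comment> \<open>A visit above -K at some point of the r-th grid in [m, m'].\<close>
 define U where "U K m m' r = {om\<in>space N. \<exists>i\<in>{m * 2 ^ r..m' * 2 ^ r}. - real K <= \<xi> (real i * grid r) om}" for K m m' r :: nat
 have U [measurable]: "U K m m' r \<in> sets N" for K m m' r unfolding U_def by measurable
 have U_mono: "U K m m' r \<subseteq> U K m m'' r'" if "r <= r'" "m' <= m''" for K m m' m'' r r'
 proof
  fix om assume "om \<in> U K m m' r"
  then obtain i where i: "om \<in> space N" "m * 2 ^ r <= i" "i <= m' * 2 ^ r" "- real K <= \<xi> (real i * grid r) om"
   by (auto simp: U_def)
  define s where "s = (2::nat) ^ (r' - r)"
  have p: "(2::nat) ^ r' = 2 ^ r * s" "(2::real) ^ r' = 2 ^ r * real s"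
   using that by (auto simp: s_def power_add[symmetric])
  have s0: "real s > 0" by (simp add: s_def)
  have 1: "m * 2 ^ r * s <= i * s" and 2: "i * s <= m' * 2 ^ r * s" using i by auto
  have 3: "m' * 2 ^ r * s <= m'' * 2 ^ r * s" using that by auto
  have 4: "real (i * s) * grid r' = real i * grid r" using s0 by (simp add: grid_def p)
  have "i * s \<in> {m * 2 ^ r'..m'' * 2 ^ r'}"
   unfolding p using 1 order_trans[OF 2 3] by (simp add: mult.assoc)
  moreover have "- real K <= \<xi> (real (i * s) * grid r') om" unfolding 4 by (rule i(4))
  ultimately show "om \<in> U K m m'' r'" using i(1) unfolding U_def by blast
 qed
 define a where "a K = exp (- \<gamma> * real K) * c" for K :: nat
 have a: "a K > 0" for K using c by (simp add: a_def)
 \<comment> \<open>The remainder of the clock in units of the gain \<open>a K\<close>, capped at 1;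
   its mean bounds the probability that the remainder reaches one such gain.\<close>
 define w where "w K m om = min 1 (abs(enn2real (I om) - Rv m om) / a K)" for K m om
 have [measurable]: "w K m \<in> borel_measurable N" for K m unfolding w_def by measurable
 define W where "W K m = (LINT om|N. w K m om)" for K m
 have w01: "abs(w K m om) <= 1" for K m om unfolding w_def by (rule min_1_abs_divide(2)[OF a])
 have W0: "(%m. W K m) ----> 0" for K
 proof -
  have "(%m. LINT om|N. w K m om) ----> (LINT om|N. 0)"
  proof (rule integral_dominated_convergence[where w="%_. 1"])
   show "AE om in N. (%m. w K m om) ----> 0"
    using fin AE_space
   proof eventually_elim
    case (elim om)
    have "(%m. w K m om) ----> min 1 (abs(enn2real (I om) - enn2real (I om)) / a K)"
     unfolding w_def using a[of K] by (intro tendsto_intros Rv_tendsto(1) elim) auto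
    then show ?case by simp
   qed
  qed (use w01 in auto)
  then show ?thesis by (simp add: W_def)
 qed
 have bound: "N.prob (U K m m' r) <= 2 * W K m" for K m m' r
 proof -
  define G where "G r' om = skel_time \<gamma> (grid r') (%i. \<xi> (real i * grid r') om) ((m' + 1) * 2 ^ r')
    - skel_time \<gamma> (grid r') (%i. \<xi> (real i * grid r') om) (m * 2 ^ r')" for r' om
  have [measurable]: "G r' \<in> borel_measurable N" for r' unfolding G_def skel_time_def by measurable
  define v where "v r' om = min 1 (abs(G r' om) / a K)" for r' om
  have [measurable]: "v r' \<in> borel_measurable N" for r' unfolding v_def by measurable
  have v01: "abs(v r' om) <= 1" "0 <= v r' om" for r' om unfolding v_def by (rule min_1_abs_divide[OF a])+
  define V where "V om = min 1 (abs(Rv (m' + 1) om - Rv m om) / a K)" for om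
  have [measurable]: "V \<in> borel_measurable N" unfolding V_def by measurable
  have "(%r'. LINT om|N. v r' om) ----> (LINT om|N. V om)"
  proof (rule integral_dominated_convergence[where w="%_. 1"])
   show "AE om in N. (%r'. v r' om) ----> V om"
    unfolding v_def V_def G_def using a[of K]
    by (intro AE_I2 tendsto_intros grid_skel_time_tendsto) auto
  qed (use v01 in auto)
  \<comment> \<open>The entrance inequality is applied on finer grids r', where the discrete clock
    is under control; \<open>U\<close> only grows under refinement.\<close>
  moreover have "EV r'. N.prob (U K m m' r) / 2 <= (LINT om|N. v r' om)"
   using ev eventually_ge_at_top[of r]
  proof eventually_elim
   case (elim r')
   have "N.prob (U K m m' r) * (1/2) <= N.prob (U K m m' r') * N.prob {om\<in>space N. c <= rho \<gamma> (grid r') (2 ^ r') (D (grid r') om)}"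
    using elim U_mono[of r r' m' m' K m] by (intro mult_mono N.finite_measure_mono) auto
   also have "... <= N.prob {om\<in>space N. a K <= G r' om}"
    using first_entrance[of "m * 2 ^ r'" "m' * 2 ^ r'" "real K" r' c "2 ^ r'"]
    unfolding U_def a_def G_def by (simp add: algebra_simps)
   also have "... = (LINT om|N. indicator {om\<in>space N. a K <= G r' om} om)" by simp
   also have "... <= (LINT om|N. v r' om)"
   proof (rule integral_mono)
    show "indicator {om\<in>space N. a K <= G r' om} om <= v r' om" for om
     using v01[of r' om] a[of K] by (auto simp: indicator_def v_def min_def field_simps)
   next
    show "integrable N (v r')" by (rule N.integrable_const_bound[where B=1]) (use v01 in auto)
   qed (auto intro!: N.integrable_const_bound[where B=1] simp: indicator_def)
   finally show ?case by simp
  qed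
  ultimately have 1: "N.prob (U K m m' r) / 2 <= (LINT om|N. V om)"
   by (rule tendsto_lowerbound) simp
  have "(LINT om|N. V om) <= W K m" if "m <= m'"
   unfolding W_def
  proof (rule integral_mono_AE)
   show "AE om in N. V om <= w K m om"
    using fin AE_space
   proof eventually_elim
    case (elim om)
    have "abs(Rv (m' + 1) om - Rv m om) <= abs(enn2real (I om) - Rv m om)"
     using Rv_tendsto(2)[OF elim(2,1), of "m' + 1"] Rv_mono[OF elim(2), of m "m' + 1"] that by simp
    then show ?case unfolding V_def w_def using a[of K] by (intro min.mono divide_right_mono) auto
   qed
  next
   have "abs(V om) <= 1" for om unfolding V_def by (rule min_1_abs_divide(2)[OF a])
   then show "integrable N V" by (intro N.integrable_const_bound[where B=1]) auto
   show "integrable N (w K m)" by (rule N.integrable_const_bound[where B=1]) (use w01 in auto)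
  qed
  moreover have "N.prob (U K m m' r) = 0" if "\<not> m <= m'"
  proof -
   have "U K m m' r = {}" using that by (auto simp: U_def)
   then show ?thesis by simp
  qed
  moreover have "0 <= W K m" unfolding W_def using a by (intro integral_nonneg_AE) (auto simp: w_def less_imp_le)
  ultimately show ?thesis using 1 by (cases "m <= m'") auto
 qed
 \<comment> \<open>Window and refinement grow together in q, so one increasing sequence of events
   covers all dyadic visits after m.\<close>
 have null: "AE om in N. EX m. ALL q. om \<notin> U K m (m + q) q" for K
 proof -
  define B where "B = (\<Inter>m. \<Union>q. U K m (m + q) q)"
  have [measurable]: "B \<in> sets N" unfolding B_def by measurable
  have b: "N.prob B <= 2 * W K m" for m
  proof -
   have "N.prob B <= N.prob (\<Union>q. U K m (m + q) q)" unfolding B_def by (intro N.finite_measure_mono) auto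
   moreover have "(%q. N.prob (U K m (m + q) q)) ----> N.prob (\<Union>q. U K m (m + q) q)"
    
   proof (rule N.finite_Lim_measure_incseq)
    show "incseq (%q. U K m (m + q) q)"
     unfolding incseq_def by (intro allI impI U_mono) auto
   qed auto
   then have "N.prob (\<Union>q. U K m (m + q) q) <= 2 * W K m"
    by (rule LIMSEQ_le_const2) (use bound in auto)
   ultimately show ?thesis by simp
  qed
  have "(%m. 2 * W K m) ----> 2 * 0" by (intro tendsto_intros W0)
  then have "N.prob B <= 2 * 0" by (rule LIMSEQ_le_const) (use b in blast)
  then have "N.prob B = 0" using measure_nonneg[of N B] by linarith
  then have "AE om in N. om \<notin> B" 
   by (intro AE_not_in) (auto simp: null_sets_def N.emeasure_eq_measure)
  then show ?thesis by eventually_elim (auto simp: B_def)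
 qed
 have "AE om in N. ALL K. EX m. ALL q. om \<notin> U K m (m + q) q"
  using null by (simp add: AE_all_countable)
 then show ?thesis
  using AE_space
 proof eventually_elim
  case (elim om)
  show ?case
   unfolding filterlim_at_bot eventually_at_top_linorder
  proof
   fix Z :: real
   obtain K :: nat where K: "- Z <= real K" using real_arch_simple by blast
   obtain m where m: "!!q. om \<notin> U K m (m + q) q" using elim(1) by blast
   show "EX T. \<forall>t\<ge>T. \<xi> t om <= Z"
   proof (intro exI allI impI)
    fix t :: real assume t: "real m <= t"
    have lim: "(%q. \<xi> (grid_right (grid q) t) om) ----> \<xi> t om"
     by (rule cadlag_grid_right[OF \<xi>_cadlag[OF elim(2)] grid_pos grid_tendsto]) (use t in auto)
    obtain q0 :: nat where q0: "t + 1 <= real q0" using real_arch_simple by blast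
    have "EV q. \<xi> (grid_right (grid q) t) om <= - real K"
     using eventually_ge_at_top[of q0]
    proof eventually_elim
     case q: (elim q)
     define i where "i = nat (\<lfloor>t * 2 ^ q\<rfloor> + 1)"
     have t0: "0 <= t * 2 ^ q" using t by (simp add: order_trans[of 0 "real m" t])
     have i: "real i = real_of_int \<lfloor>t * 2 ^ q\<rfloor> + 1" using t0 by (simp add: i_def)
     have gr: "grid_right (grid q) t = real i * grid q" unfolding grid_right_def grid_def i by simp
     have "real (m * 2 ^ q) <= t * 2 ^ q" using t by simp
     then have i1: "m * 2 ^ q <= i" using i by linarith
     have "real i <= t * 2 ^ q + 1 * 2 ^ q" unfolding i using one_le_power[of "2::real" q] by linarith
     also have "... = (t + 1) * 2 ^ q" by (simp add: distrib_right)
     also have "... <= real (m + q) * 2 ^ q" using q0 q by (intro mult_right_mono) auto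
     finally have "real i <= real ((m + q) * 2 ^ q)" by simp
     then have i2: "i <= (m + q) * 2 ^ q" by (simp only: of_nat_le_iff)
     show ?case using m[of q] i1 i2 elim(2) unfolding U_def gr by force
    qed
    then have "\<xi> t om <= - real K" by (intro tendsto_upperbound[OF lim]) auto
    then show "\<xi> t om <= Z" using K by simp
   qed
  qed
 qed
qed

theorem infinite_integral:
 assumes "\<not> (AE om in N. filterlim (%t. \<xi> t om) at_bot at_top)"
 shows "AE om in N. I om = \<infinity>"
proof -
 have "N.prob {om\<in>space N. I om < \<infinity>} ~= 1"
 proof
  assume "N.prob {om\<in>space N. I om < \<infinity>} = 1"
  then have "AE om in N. I om < \<infinity>" by (subst (asm) N.prob_Collect_eq_1) auto
  then show False using drift_if_finite assms by blast
 qed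
 then have "N.prob {om\<in>space N. I om < \<infinity>} = 0" using zero_one_law by blast
 then have "AE om in N. \<not> I om < \<infinity>" by (subst (asm) N.prob_Collect_eq_0) auto
 then show ?thesis by eventually_elim (metis infinity_ennreal_def top.not_eq_extremum)
qed

end

section \<open>The chain up to a bounded number of steps\<close>

text \<open>Adaptedness to the first k steps. It also gives measurability, since there are only
  countably many prefixes.\<close>

definition prefix_dep :: "nat => ((nat => nat) => 'c) => bool" where
 "prefix_dep k g \<longleftrightarrow> (ALL x y. (\<forall>i\<le>k. x i = y i) --> g x = g y)"

lemma prefix_depD: "prefix_dep k g ==> (!!i. i <= k ==> x i = y i) ==> g x = g y"
 unfolding prefix_dep_def by blast

locale markov =
 fixes M :: "'a measure" and X :: "nat => 'a => nat" and step :: "nat => nat pmf" and n :: nat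
 assumes prob: "prob_space M"
  and X_measurable [measurable]: "!!k. X k \<in> measurable M (count_space UNIV)"
  and law: "!!k (xs :: nat => nat). measure M {w \<in> space M. \<forall>j\<le>k. X j w = xs j}
     = (if xs 0 = n then (\<Prod>j<k. pmf (step (xs j)) (xs (Suc j))) else 0)"
begin

sublocale prob_space M by (rule prob)

definition path :: "'a => nat => nat" where "path w k = X k w"

definition pref :: "nat => 'a => nat list" where "pref k w = map (%i. X i w) [0..<Suc k]"

definition ext :: "nat list => nat => nat" where "ext l i = (if i < length l then l ! i else 0)"

lemma ext_pref: "i <= k ==> ext (pref k w) i = X i w"
 by (simp add: ext_def pref_def nth_append less_Suc_eq_le del: upt_Suc)

lemma pref_eq_iff: "pref k w = l \<longleftrightarrow> length l = Suc k & (\<forall>i\<le>k. X i w = ext l i)"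
 by (auto simp: pref_def list_eq_iff_nth_eq ext_def less_Suc_eq_le simp del: upt_Suc)

lemma pref_measurable [measurable]: "pref k \<in> measurable M (count_space UNIV)"
proof (unfold measurable_count_space_eq_countable[OF countableI_type], intro conjI ballI)
 fix l
 have "pref k -` {l} \<inter> space M = {w\<in>space M. pref k w = l}" by auto
 also have "... = {w\<in>space M. length l = Suc k & (\<forall>i\<le>k. X i w = ext l i)}"
  unfolding pref_eq_iff ..
 also have "... \<in> sets M" by measurable
 finally show "pref k -` {l} \<inter> space M \<in> sets M" .
qed simp

lemma prefix_dep_path:
 assumes "prefix_dep k g" shows "g (path w) = g (ext (pref k w))"
 using prefix_depD[OF assms, of "path w" "ext (pref k w)"] by (simp add: ext_pref path_def)

lemma prefix_dep_measurable:
 assumes "prefix_dep k g" shows "(%w. g (path w)) \<in> measurable M (count_space UNIV)"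
 unfolding prefix_dep_path[OF assms] by measurable

lemma prefix_dep_borel: "prefix_dep k g ==> (%w. g (path w)) \<in> borel_measurable M"
 by (rule measurable_compose[OF prefix_dep_measurable, of k g "%x. x"]) auto

lemma prob_pref: "prob {w\<in>space M. pref k w = l} =
 (if length l = Suc k & l ! 0 = n then (\<Prod>j<k. pmf (step (l ! j)) (l ! Suc j)) else 0)"
proof (cases "length l = Suc k")
 case True
 have "(\<Prod>j<k. pmf (step (ext l j)) (ext l (Suc j))) = (\<Prod>j<k. pmf (step (l ! j)) (l ! Suc j))"
  by (rule prod.cong) (use True in "auto simp: ext_def")
 moreover have "ext l 0 = l ! 0" using True by (simp add: ext_def)
 ultimately show ?thesis using law[of k "ext l"] True by (simp add: pref_eq_iff)
qed (simp add: pref_eq_iff)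

text \<open>On a countable space it suffices to compare singletons, where both sides are the
  probability of the prefix times one transition probability. All conditional expectations below
  come from this disintegration.\<close>

lemma law_step: "distr M (count_space UNIV) (%w. (pref k w, X (Suc k) w)) =
 (distr M (count_space UNIV) (pref k)) \<bind> (%l. measure_pmf (map_pmf (Pair l) (step (last l))))" (is "?L = ?R")
proof (rule measure_eqI_countable)
 have K: "(%l. measure_pmf (map_pmf (Pair l) (step (last l)))) \<in> measurable (distr M (count_space UNIV) (pref k)) (subprob_algebra (count_space UNIV))"
  by (simp add: measure_pmf_in_subprob_algebra)
 have sR: "sets ?R = sets (count_space UNIV)"
  by (rule sets_bind) auto
 show "sets ?L = Pow UNIV" by simp
 show "sets ?R = Pow UNIV" using sR by simp
 fix lj :: "nat list \<times> nat"
 obtain l j where lj: "lj = (l, j)" by (cases lj)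
 have pm: "(%w. (pref k w, X (Suc k) w)) \<in> measurable M (count_space UNIV)" by measurable
 have "emeasure ?L {lj} = emeasure M {w\<in>space M. pref (Suc k) w = l @ [j] & length l = Suc k}"
  unfolding lj by (subst emeasure_distr[OF pm]) (auto intro!: arg_cong[where f="emeasure M"] simp: pref_def)
 also have "... = ennreal (if length l = Suc k & l ! 0 = n then (\<Prod>j<k. pmf (step (l ! j)) (l ! Suc j)) * pmf (step (last l)) j else 0)"
 proof (cases "length l = Suc k")
  case True
  then have "l ~= []" by auto
  then have "last l = l ! k" using True by (simp add: last_conv_nth)
  have "(\<Prod>i<k. pmf (step ((l @ [j]) ! i)) ((l @ [j]) ! Suc i)) = (\<Prod>j<k. pmf (step (l ! j)) (l ! Suc j))"
   by (rule prod.cong) (use True in "auto simp: nth_append")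
  then show ?thesis using True prob_pref[of "Suc k" "l @ [j]"] \<open>last l = l ! k\<close>
   by (simp add: emeasure_eq_measure nth_append)
 qed simp
 also have "... = (\<integral>\<^sup>+l'. emeasure (measure_pmf (map_pmf (Pair l') (step (last l')))) {lj} \<partial>distr M (count_space UNIV) (pref k))"
 proof -
  have "emeasure (measure_pmf (map_pmf (Pair l') (step (last l')))) {lj} = ennreal (pmf (step (last l)) j) * indicator {l} l'" for l'
  proof (cases "l' = l")
   case True
   then show ?thesis unfolding lj by (simp add: emeasure_pmf_single pmf_map_inj' inj_on_def)
  next
   case False
   then have "(l, j) \<notin> set_pmf (map_pmf (Pair l') (step (last l')))" by auto
   then have "pmf (map_pmf (Pair l') (step (last l'))) (l, j) = 0" by (simp only: set_pmf_iff not_not)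
   then show ?thesis using False unfolding lj by (simp add: emeasure_pmf_single)
  qed
  then have "(\<integral>\<^sup>+l'. emeasure (measure_pmf (map_pmf (Pair l') (step (last l')))) {lj} \<partial>distr M (count_space UNIV) (pref k))
   = ennreal (pmf (step (last l)) j) * emeasure (distr M (count_space UNIV) (pref k)) {l}"
   by (simp add: nn_integral_cmult_indicator)
  also have "emeasure (distr M (count_space UNIV) (pref k)) {l} = ennreal (prob {w\<in>space M. pref k w = l})"
   by (subst emeasure_distr) (auto simp: emeasure_eq_measure intro!: arg_cong[where f=prob])
  finally show ?thesis unfolding prob_pref by (auto simp: ennreal_mult'[symmetric] mult.commute)
 qed
 also have "... = emeasure ?R {lj}"
  by (rule emeasure_bind[symmetric, OF _ K]) auto
 finally show "emeasure ?L {lj} = emeasure ?R {lj}" .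
qed auto

lemma one_step_real:
 fixes G :: "(nat => nat) => nat => real"
 assumes dep: "prefix_dep k G" and bnd: "!!x j. abs(G x j) <= B"
 shows "expectation (%w. G (path w) (X (Suc k) w)) = expectation (%w. pmf_E (step (X k w)) (G (path w)))"
proof -
 define g where "g lj = G (ext (fst lj)) (snd lj)" for lj
 have pm: "(%w. (pref k w, X (Suc k) w)) \<in> measurable M (count_space UNIV)" by measurable
 have ne: "prob_space (distr M (count_space UNIV) (pref k))" by (rule prob_space_distr) measurable
 have "expectation (%w. G (path w) (X (Suc k) w)) = expectation (%w. g (pref k w, X (Suc k) w))"
  unfolding g_def by (simp add: prefix_dep_path[OF dep])
 also have "... = (LINT lj|distr M (count_space UNIV) (%w. (pref k w, X (Suc k) w)). g lj)"
  by (rule integral_distr[symmetric, OF pm]) simp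
 also have "... = (LINT l|distr M (count_space UNIV) (pref k). (LINT lj|measure_pmf (map_pmf (Pair l) (step (last l))). g lj))"
  unfolding law_step
 proof (rule integral_bind[where K="count_space UNIV" and B=B and B'=1])
  show "finite_measure (distr M (count_space UNIV) (pref k))" using ne by (rule prob_space.finite_measure)
 qed (use bnd in "auto simp: g_def measure_pmf.emeasure_space_1 measure_pmf_in_subprob_algebra")
 also have "... = expectation (%w. LINT lj|measure_pmf (map_pmf (Pair (pref k w)) (step (last (pref k w)))). g lj)"
  by (rule integral_distr) measurable
 also have "... = expectation (%w. pmf_E (step (X k w)) (G (path w)))"
  by (rule Bochner_Integration.integral_cong) (auto simp: g_def prefix_dep_path[OF dep] pref_def)
 finally show ?thesis .
qed

lemma one_step_complex:
 fixes G :: "(nat => nat) => nat => complex"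
 assumes dep: "prefix_dep k G" and bnd: "!!x j. cmod (G x j) <= B"
 shows "expectation (%w. G (path w) (X (Suc k) w)) = expectation (%w. pmf_E (step (X k w)) (G (path w)))"
proof -
 have dR: "prefix_dep k (%x j. Re (G x j))" and dI: "prefix_dep k (%x j. Im (G x j))"
  using dep unfolding prefix_dep_def by metis+
 have ip: "integrable (step i) (G x)" for i x
  by (rule measure_pmf.integrable_const_bound[where B=B]) (use bnd in auto)
 have m: "(%w. G (path w) (X (Suc k) w)) \<in> borel_measurable M"
 proof -
  have "prefix_dep (Suc k) (%x. G x (x (Suc k)))"
   using dep unfolding prefix_dep_def by (metis le_SucI order_refl)
  from prefix_dep_borel[OF this] show ?thesis by (simp add: path_def)
 qed
 have i1: "integrable M (%w. G (path w) (X (Suc k) w))"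
  by (rule integrable_const_bound[where B=B]) (use m bnd in auto)
 have m2: "(%w. pmf_E (step (X k w)) (G (path w))) \<in> borel_measurable M"
 proof -
  have "prefix_dep k (%x. pmf_E (step (x k)) (G x))"
   using dep unfolding prefix_dep_def by (metis order_refl)
  from prefix_dep_borel[OF this] show ?thesis by (simp add: path_def)
 qed
 have b2: "cmod (pmf_E (step i) (G x)) <= B" for i x
 proof -
  have "cmod (pmf_E (step i) (G x)) <= pmf_E (step i) (%j. cmod (G x j))" by (rule integral_norm_bound)
  also have "... <= pmf_E (step i) (%j. B)"
   by (rule integral_mono) (use ip bnd in auto)
  finally show ?thesis by simp
 qed
 have i2: "integrable M (%w. pmf_E (step (X k w)) (G (path w)))"
  by (rule integrable_const_bound[where B=B]) (use m2 b2 in auto)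
 have bR: "abs(Re (G x j)) <= B" "abs(Im (G x j)) <= B" for x j
  using bnd[of x j] abs_Re_le_cmod[of "G x j"] abs_Im_le_cmod[of "G x j"] by linarith+
 show ?thesis
  unfolding complex_eq_iff integral_Re[OF i1, symmetric] integral_Re[OF i2, symmetric] integral_Im[OF i1, symmetric] integral_Im[OF i2, symmetric]
  unfolding integral_Re[OF ip, symmetric] integral_Im[OF ip, symmetric]
  using one_step_real[OF dR bR(1)] one_step_real[OF dI bR(2)] by simp
qed

end

text \<open>The indices satisfying \<open>B\<close> form an interval starting at u. A sum weighted
  by \<open>B\<close> is therefore the increment of g up to the stopping index just after the last
  of them.\<close>

lemma interval_telescope:
 fixes g :: "nat => 'c::comm_ring_1"
 assumes up: "!!k. B k ==> u <= k & k < m" and closed: "!!k i. B k ==> u <= i ==> i <= k ==> B i"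
 shows "(\<Sum>k<m. of_bool (B k) * (g (Suc k) - g k)) = (if EX k. B k then g (Suc (Max {k. B k})) - g u else 0)"
proof (cases "EX k. B k")
 case True
 have fin: "finite {k. B k}" by (rule finite_subset[of _ "{..<m}"]) (use up in auto)
 define v where "v = Max {k. B k}"
 have v: "B v" "!!k. B k ==> k <= v" using Max_in[OF fin] Max_ge[OF fin] True by (auto simp: v_def)
 have eq: "{k. k < m & B k} = {u..<Suc v}"
 proof (intro set_eqI iffI)
  fix k assume "k \<in> {k. k < m & B k}"
  then show "k \<in> {u..<Suc v}" using up[of k] v(2)[of k] by simp
 next
  fix k assume "k \<in> {u..<Suc v}"
  then have "B k" using closed[OF v(1), of k] by simp
  then show "k \<in> {k. k < m & B k}" using up[of k] by simp
 qed
 have "(\<Sum>k<m. of_bool (B k) * (g (Suc k) - g k)) = (\<Sum>k\<in>{k. k < m & B k}. g (Suc k) - g k)"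
  by (rule sum.mono_neutral_cong_right) auto
 also have "... = g (Suc v) - g u" unfolding eq using up[OF v(1)] by (intro sum_Suc_diff') auto
 finally show ?thesis using True by (simp add: v_def)
qed simp

lemma Least_prefix_cong:
 fixes P Q :: "nat => bool"
 assumes "!!i. i <= k ==> P i = Q i" "\<exists>i\<le>k. P i" shows "(LEAST i. P i) = (LEAST i. Q i)"
proof -
 obtain i where i: "i <= k" "P i" using assms(2) by blast
 have L: "(LEAST i. P i) <= k" using Least_le[of P i] i by simp
 have PL: "P (LEAST i. P i)" using i(2) by (rule LeastI)
 show ?thesis
 proof (rule Least_equality[symmetric])
  show "Q (LEAST i. P i)" using assms(1)[OF L] PL by simp
  fix j assume "Q j"
  show "(LEAST i. P i) <= j"
  proof (cases "j <= k")
   case True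
   then show ?thesis using assms(1)[OF True] \<open>Q j\<close> by (intro Least_le) simp
  qed (use L in simp)
 qed
qed

text \<open>The clock in which the chain is compared with \<open>\<xi>\<close>.\<close>

definition clk :: "(nat => real) => (nat => nat) => nat => real" where
 "clk a x k = (\<Sum>i<k. 1 / a (x i))"

definition lg :: "nat => (nat => nat) => nat => real" where
 "lg n x k = ln (real (x k)) - ln (real n)"

definition first :: "(nat => (nat => nat) => bool) => (nat => nat) => nat" where
 "first Q x = (LEAST i. Q i x)"

lemma clk_0 [simp]: "clk a x 0 = 0" and clk_Suc: "clk a x (Suc k) = clk a x k + 1 / a (x k)"
 by (simp_all add: clk_def)

text \<open>A is the half-width of the box on the logarithmic scale and S the clock horizon. In the
  box each step costs between c and e: e bounds the overshoot over a clock level, c the number of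
  steps.\<close>

locale box =
 fixes a :: "nat => real" and n :: nat and A S e c :: real
 assumes a_pos: "!!i. 0 < a i" and A: "0 < A" and S: "0 < S" and e: "0 < e" and c: "0 < c"
  and box_e: "!!i. abs(ln (real i) - ln (real n)) < A ==> 1 / a i <= e"
  and box_c: "!!i. abs(ln (real i) - ln (real n)) < A ==> c <= 1 / a i"
begin

lemma clk_mono: "i <= k ==> clk a x i <= clk a x k"
 unfolding clk_def using a_pos by (intro sum_mono2) (auto intro: less_imp_le)

definition alive :: "(nat => nat) => nat => bool" where
 "alive x k \<longleftrightarrow> (\<forall>i\<le>k. abs(lg n x i) < A) & clk a x k < S"

lemma alive_antimono: "alive x k ==> i <= k ==> alive x i"
 unfolding alive_def using clk_mono[of i k x] by auto

lemma alive_inv_a: "alive x k ==> 1 / a (x k) <= e" "alive x k ==> c <= 1 / a (x k)"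
 unfolding alive_def lg_def using box_e[of "x k"] box_c[of "x k"] by auto

text \<open>In the box every step costs at least \<open>c\<close> units of the clock, so this bounds the number of steps before the
 clock reaches \<open>S\<close>, and all events below depend on finitely many coordinates.\<close>

definition horizon :: nat where "horizon = nat \<lceil>S / c\<rceil>"

lemma alive_less_horizon: assumes "alive x k" shows "k < horizon"
proof -
 have "real k * c = (\<Sum>i<k. c)" by simp
 also have "... <= clk a x k"
  unfolding clk_def using alive_inv_a(2)[OF alive_antimono[OF assms]] by (intro sum_mono) simp
 also have "... < S" using assms by (simp add: alive_def)
 finally have "real k < S / c" using c by (simp add: pos_less_divide_eq)
 also have "S / c <= real horizon" unfolding horizon_def by (rule real_nat_ceiling_ge)
 finally show ?thesis by simp
qed

text \<open>Monitoring starts when Q first holds and goes on while the path stays within \<eta> of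
  its value at that time, in the box, and below the clock level \<beta>. An exit is a monitored step
  that leaves the \<eta>-window.\<close>

definition active :: "(nat => (nat => nat) => bool) => real => real => nat => (nat => nat) => bool" where
 "active Q \<beta> \<eta> k x \<longleftrightarrow> alive x k & (\<exists>i\<le>k. Q i x) & clk a x k < \<beta> &
  (ALL i. first Q x <= i & i <= k --> abs(lg n x i - lg n x (first Q x)) < \<eta>)"

definition exits :: "(nat => (nat => nat) => bool) => real => real => (nat => nat) => bool" where
 "exits Q \<beta> \<eta> x \<longleftrightarrow> (\<exists>k<horizon. active Q \<beta> \<eta> k x & \<eta> <= abs(lg n x (Suc k) - lg n x (first Q x)))"

lemma active_first: assumes "active Q \<beta> \<eta> k x" shows "Q (first Q x) x" "first Q x <= k"
proof -
 obtain i where i: "i <= k" "Q i x" using assms unfolding active_def by blast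
 show "Q (first Q x) x" unfolding first_def using i(2) by (rule LeastI)
 have "first Q x <= i" unfolding first_def using i(2) by (rule Least_le)
 then show "first Q x <= k" using i(1) by simp
qed

lemma active_closed:
 assumes "active Q \<beta> \<eta> k x" "first Q x <= i" "i <= k" shows "active Q \<beta> \<eta> i x"
proof -
 have "\<exists>i'\<le>i. Q i' x" using active_first(1)[OF assms(1)] assms(2) by blast
 then show ?thesis
  using assms alive_antimono[of x k i] clk_mono[of i k x] unfolding active_def by auto
qed

lemma active_interval: "active Q \<beta> \<eta> k x ==> first Q x <= k & k < horizon"
 using active_first(2) alive_less_horizon unfolding active_def by blast

text \<open>The sum telescopes to the value of \<open>sat\<close> at the end of monitoring, its
  value at the start being 0. That value is nonnegative, and at least 1/2 after an exit, whence the
  factor 2.\<close>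

lemma exit_le_sum:
 assumes \<eta>: "0 < \<eta>"
 shows "of_bool (exits Q \<beta> \<eta> x) <= 2 * (\<Sum>k<horizon. of_bool (active Q \<beta> \<eta> k x) *
  (sat ((lg n x (Suc k) - lg n x (first Q x)) / \<eta>) - sat ((lg n x k - lg n x (first Q x)) / \<eta>)))"
proof -
 define g where "g k = sat ((lg n x k - lg n x (first Q x)) / \<eta>)" for k
 have g0: "g (first Q x) = 0" by (simp add: g_def sat_bounds)
 have gnn: "0 <= g k" for k by (simp add: g_def sat_bounds)
 have sum: "(\<Sum>k<horizon. of_bool (active Q \<beta> \<eta> k x) * (g (Suc k) - g k)) =
  (if EX k. active Q \<beta> \<eta> k x then g (Suc (Max {k. active Q \<beta> \<eta> k x})) - g (first Q x) else 0)"
  by (rule interval_telescope[where u="first Q x"]) (use active_interval active_closed in blast)+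
 have "of_bool (exits Q \<beta> \<eta> x) <= 2 * (\<Sum>k<horizon. of_bool (active Q \<beta> \<eta> k x) * (g (Suc k) - g k))"
 proof (cases "exits Q \<beta> \<eta> x")
  case False
  then show ?thesis unfolding sum g0 using gnn by simp
 next
  case True
  then obtain k where k: "active Q \<beta> \<eta> k x" "\<eta> <= abs(lg n x (Suc k) - lg n x (first Q x))" unfolding exits_def by blast
  have "k' <= k" if "active Q \<beta> \<eta> k' x" for k'
  proof (rule ccontr)
   assume "\<not> k' <= k"
   then have "active Q \<beta> \<eta> (Suc k) x" using active_closed[OF that, of "Suc k"] active_first(2)[OF k(1)] by simp
   then have "ALL i. first Q x <= i & i <= Suc k --> abs(lg n x i - lg n x (first Q x)) < \<eta>"
    unfolding active_def by blast
   then have "abs(lg n x (Suc k) - lg n x (first Q x)) < \<eta>" using active_first(2)[OF k(1)] by simp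
   then show False using k(2) by simp
  qed
  note le = this
  have fin: "finite {k. active Q \<beta> \<eta> k x}" by (rule finite_subset[of _ "{..<horizon}"]) (use active_interval in auto)
  have "Max {k. active Q \<beta> \<eta> k x} = k"
   by (rule Max_eqI[OF fin]) (simp_all add: le k(1))
  moreover have "1 <= abs((lg n x (Suc k) - lg n x (first Q x)) / \<eta>)" using k(2) \<eta> by (simp add: abs_divide le_divide_eq)
  then have "1/2 <= g (Suc k)" unfolding g_def by (rule sat_half)
  ultimately show ?thesis unfolding sum g0 using k(1) by auto
 qed
 then show ?thesis by (simp add: g_def)
qed

text \<open>Monitoring runs between the clock levels \<alpha> and \<beta>, up to the overshoot e of
  its last step.\<close>

lemma active_clock_sum:
 assumes \<alpha>: "!!i. Q i x ==> \<alpha> <= clk a x i"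
 shows "(\<Sum>k<horizon. of_bool (active Q \<beta> \<eta> k x) * (1 / a (x k))) <= (\<beta> - \<alpha> + e) * of_bool (EX k. active Q \<beta> \<eta> k x)"
proof -
 have "(\<Sum>k<horizon. of_bool (active Q \<beta> \<eta> k x) * (1 / a (x k))) =
  (\<Sum>k<horizon. of_bool (active Q \<beta> \<eta> k x) * (clk a x (Suc k) - clk a x k))" by (simp add: clk_Suc)
 also have "... = (if EX k. active Q \<beta> \<eta> k x then clk a x (Suc (Max {k. active Q \<beta> \<eta> k x})) - clk a x (first Q x) else 0)"
  by (rule interval_telescope[where u="first Q x"]) (use active_interval active_closed in blast)+
 also have "... <= (\<beta> - \<alpha> + e) * of_bool (EX k. active Q \<beta> \<eta> k x)"
 proof (cases "EX k. active Q \<beta> \<eta> k x")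
  case True
  have fin: "finite {k. active Q \<beta> \<eta> k x}" by (rule finite_subset[of _ "{..<horizon}"]) (use active_interval in auto)
  define v where "v = Max {k. active Q \<beta> \<eta> k x}"
  have v: "active Q \<beta> \<eta> v x" using Max_in[OF fin] True by (auto simp: v_def)
  have "clk a x (Suc v) < \<beta> + e" using v alive_inv_a(1)[of x v] unfolding active_def clk_Suc by linarith
  moreover have "\<alpha> <= clk a x (first Q x)" by (rule \<alpha>[OF active_first(1)[OF v]])
  ultimately show ?thesis using True by (simp add: v_def)
 qed simp
 finally show ?thesis .
qed

lemma alive_clock_sum: "(\<Sum>k<horizon. of_bool (alive x k) * (1 / a (x k))) <= S + e"
proof -
 have "(\<Sum>k<horizon. of_bool (alive x k) * (1 / a (x k))) =
  (\<Sum>k<horizon. of_bool (alive x k) * (clk a x (Suc k) - clk a x k))" by (simp add: clk_Suc)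
 also have "... = (if EX k. alive x k then clk a x (Suc (Max {k. alive x k})) - clk a x 0 else 0)"
  by (rule interval_telescope[where u=0]) (use alive_less_horizon alive_antimono in blast)+
 also have "... <= S + e"
 proof (cases "EX k. alive x k")
  case True
  have fin: "finite {k. alive x k}" by (rule finite_subset[of _ "{..<horizon}"]) (use alive_less_horizon in auto)
  define v where "v = Max {k. alive x k}"
  have v: "alive x v" using Max_in[OF fin] True by (auto simp: v_def)
  have "clk a x (Suc v) < S + e" using v alive_inv_a(1)[OF v] clk_Suc[of a x v] by (simp add: alive_def)
  then show ?thesis using True by (simp add: v_def)
 qed (use S e in simp)
 finally show ?thesis .
qed

lemma clk_cong: "(!!i. i <= k ==> x i = y i) ==> i <= k ==> clk a x i = clk a y i"
 unfolding clk_def by (auto intro!: sum.cong)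

lemma lg_cong: "x i = y i ==> lg n x i = lg n y i"
 by (simp add: lg_def)

lemma alive_cong: "(!!i. i <= k ==> x i = y i) ==> alive x k = alive y k"
 unfolding alive_def using clk_cong[of k x y k] lg_cong[of x _ y] by auto

lemma first_cong:
 assumes Q: "!!i. prefix_dep i (Q i)" and xy: "!!i. i <= k ==> x i = y i" and ex: "\<exists>i\<le>k. Q i x"
 shows "first Q x = first Q y" "first Q x <= k"
proof -
 have *: "Q i x = Q i y" if "i <= k" for i using Q[of i] xy that unfolding prefix_dep_def by auto
 show "first Q x = first Q y" unfolding first_def by (rule Least_prefix_cong[of k]) (use * ex in auto)
 obtain i where "i <= k" "Q i x" using ex by blast
 then show "first Q x <= k" unfolding first_def using Least_le[of "%i. Q i x" i] by simp
qed

lemma active_cong: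
 assumes Q: "!!i. prefix_dep i (Q i)" and xy: "!!i. i <= k ==> x i = y i"
 shows "active Q \<beta> \<eta> k x = active Q \<beta> \<eta> k y"
proof -
 have imp: "active Q \<beta> \<eta> k y" if act: "active Q \<beta> \<eta> k x" and xy: "!!i. i <= k ==> x i = y i" for x y
 proof -
  have ex: "\<exists>i\<le>k. Q i x" using act by (simp add: active_def)
  have f: "first Q x = first Q y" "first Q x <= k" using first_cong[where k=k and x=x and y=y, OF Q xy ex] by auto
  obtain i where i: "i <= k" "Q i x" using ex by blast
  have "Q i x = Q i y" by (rule prefix_depD[OF Q]) (use xy i in auto)
  then have "\<exists>i\<le>k. Q i y" using i by blast
  moreover have "lg n x i = lg n y i" if "i <= k" for i using xy[OF that] by (rule lg_cong)
  ultimately show ?thesis using act alive_cong[of k x y] clk_cong[of k x y k] xy f unfolding active_def by auto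
 qed
 show ?thesis using imp[of x y] imp[of y x] xy by auto
qed

lemma prefix_dep_exits:
 assumes Q: "!!i. prefix_dep i (Q i)" shows "prefix_dep horizon (exits Q \<beta> \<eta>)"
 unfolding prefix_dep_def
proof (intro allI impI)
 have imp: "exits Q \<beta> \<eta> y" if ex: "exits Q \<beta> \<eta> x" and xy: "!!i. i <= horizon ==> x i = y i" for x y
 proof -
  obtain k where k: "k < horizon" "active Q \<beta> \<eta> k x" "\<eta> <= abs(lg n x (Suc k) - lg n x (first Q x))" using ex unfolding exits_def by blast
  have xy': "!!i. i <= k ==> x i = y i" using xy k(1) by simp
  have "active Q \<beta> \<eta> k y" using active_cong[where k=k and x=x and y=y, OF Q xy'] k(2) by blast
  moreover have "first Q x = first Q y" "first Q x <= k"
   using first_cong[where k=k and x=x and y=y, OF Q xy'] k(2) unfolding active_def by auto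
  then have "lg n x (first Q x) = lg n y (first Q y)" "lg n x (Suc k) = lg n y (Suc k)"
   using xy k(1) by (auto intro!: lg_cong)
  ultimately show ?thesis using k unfolding exits_def by auto
 qed
 fix x y :: "nat => nat" assume "\<forall>i\<le>horizon. x i = y i"
 then show "exits Q \<beta> \<eta> x = exits Q \<beta> \<eta> y" using imp[of x y] imp[of y x] by auto
qed

end

locale chain = box a n A S e c + markov M X step n
 for a :: "nat => real" and n :: nat and A S e c :: real and M :: "'a measure" and X :: "nat => 'a => nat" and step :: "nat => nat pmf"
begin

lemma prefix_dep_pred:
 assumes "prefix_dep k P" shows "{w\<in>space M. P (path w)} \<in> events"
proof -
 have "(%w. P (path w)) \<in> measurable M (count_space UNIV)" by (rule prefix_dep_measurable[OF assms])
 then show ?thesis by simp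
qed

lemma prefix_dep_integrable:
 fixes g :: "(nat => nat) => 'c::{banach, second_countable_topology}"
 assumes "prefix_dep k g" "!!x. norm (g x) <= B" shows "integrable M (%w. g (path w))"
 by (rule integrable_const_bound[where B=B]) (use assms prefix_dep_borel[OF assms(1)] in auto)

lemma integral_cmult_indicator: "E \<in> events ==> expectation (%w. r * indicator E w) = r * prob E"
 by simp

text \<open>Optional stopping for \<open>sat ((lg - lg\<^sub>s\<^sub>t\<^sub>a\<^sub>r\<^sub>t) / \<eta>)\<close>, whose generator is at most \<open>C\<close> per unit of the clock and which is at
 least 1/2 at an exit.\<close>

lemma exit_prob:
 assumes Q: "!!i. prefix_dep i (Q i)" and \<eta>: "0 < \<eta>" and C: "0 <= C"
  and gen: "!!i y. abs(ln (real i) - ln (real n)) < A ==>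
   abs(pmf_E (step i) (%j. sat ((y + (ln (real j) - ln (real i))) / \<eta>)) - sat (y / \<eta>)) <= C * (1 / a i)"
  and \<alpha>: "!!i x. Q i x ==> \<alpha> <= clk a x i"
 shows "prob {w\<in>space M. exits Q \<beta> \<eta> (path w)} <= 2 * C * (\<beta> - \<alpha> + e) * prob {w\<in>space M. \<exists>k<horizon. active Q \<beta> \<eta> k (path w)}"
proof -
 define L where "L x = lg n x (first Q x)" for x
 define G where "G k x j = of_bool (active Q \<beta> \<eta> k x) * (sat ((ln (real j) - ln (real n) - L x) / \<eta>) - sat ((lg n x k - L x) / \<eta>))" for k x j
 have G_dep: "prefix_dep k (G k)" for k
  unfolding prefix_dep_def
 proof (intro allI impI ext)
  fix x y :: "nat => nat" and j assume xy: "\<forall>i\<le>k. x i = y i"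
  have act: "active Q \<beta> \<eta> k x = active Q \<beta> \<eta> k y" by (rule active_cong[OF Q]) (use xy in auto)
  show "G k x j = G k y j"
  proof (cases "active Q \<beta> \<eta> k x")
   case True
   then have "\<exists>i\<le>k. Q i x" by (simp add: active_def)
   then have "first Q x = first Q y" "first Q x <= k" using first_cong[where k=k and x=x and y=y, OF Q] xy by auto
   then have "L x = L y" "lg n x k = lg n y k" unfolding L_def using xy by (auto intro!: lg_cong)
   then show ?thesis using act unfolding G_def by auto
  next
   case False
   then show ?thesis using act unfolding G_def by auto
  qed
 qed
 have G_bnd: "abs(G k x j) <= 1" for k x j
  using sat_bounds(1,2)[of "(ln (real j) - ln (real n) - L x) / \<eta>"] sat_bounds(1,2)[of "(lg n x k - L x) / \<eta>"]
  by (auto simp: G_def abs_le_iff)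
 define H where "H k x = G k x (x (Suc k))" for k x
 have H_eq: "H k x = of_bool (active Q \<beta> \<eta> k x) * (sat ((lg n x (Suc k) - L x) / \<eta>) - sat ((lg n x k - L x) / \<eta>))" for k x
  by (simp add: H_def G_def lg_def)
 have H_dep: "prefix_dep (Suc k) (H k)" for k
  unfolding prefix_dep_def
 proof (intro allI impI)
  fix x y :: "nat => nat" assume xy: "\<forall>i\<le>Suc k. x i = y i"
  have "G k x = G k y" by (rule prefix_depD[OF G_dep]) (use xy in auto)
  then show "H k x = H k y" using xy by (simp add: H_def)
 qed
 have H_int: "integrable M (%w. H k (path w))" for k
  by (rule prefix_dep_integrable[OF H_dep, where B=1]) (use G_bnd in "simp add: H_def")
 define W where "W k x = of_bool (active Q \<beta> \<eta> k x) * (1 / a (x k))" for k x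
 have W_dep: "prefix_dep k (W k)" for k
  unfolding prefix_dep_def
 proof (intro allI impI)
  fix x y :: "nat => nat" assume xy: "\<forall>i\<le>k. x i = y i"
  have "active Q \<beta> \<eta> k x = active Q \<beta> \<eta> k y" by (rule active_cong[OF Q]) (use xy in auto)
  then show "W k x = W k y" using xy by (simp add: W_def)
 qed
 have W_bnd: "abs(W k x) <= e" "0 <= W k x" for k x
  using alive_inv_a(1)[of x k] a_pos[of "x k"] e by (auto simp: W_def active_def)
 have W_int: "integrable M (%w. W k (path w))" for k
  by (rule prefix_dep_integrable[OF W_dep, where B=e]) (use W_bnd in simp)
 have step_k: "expectation (%w. H k (path w)) <= C * expectation (%w. W k (path w))" for k
 proof -
  have "expectation (%w. H k (path w)) = expectation (%w. pmf_E (step (X k w)) (G k (path w)))"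
   using one_step_real[OF G_dep G_bnd, of k] by (simp add: H_def path_def)
  also have "... <= expectation (%w. C * W k (path w))"
  proof (rule integral_mono)
   have dep: "prefix_dep k (%x. pmf_E (step (x k)) (G k x))"
    unfolding prefix_dep_def
   proof (intro allI impI)
    fix x y :: "nat => nat" assume xy: "\<forall>i\<le>k. x i = y i"
    have "G k x = G k y" by (rule prefix_depD[OF G_dep]) (use xy in auto)
    then show "pmf_E (step (x k)) (G k x) = pmf_E (step (y k)) (G k y)" using xy by simp
   qed
   have bnd: "norm (pmf_E (step (x k)) (G k x)) <= 1" for x
   proof -
    have "norm (pmf_E (step (x k)) (G k x)) <= pmf_E (step (x k)) (%j. norm (G k x j))" by (rule integral_norm_bound)
    also have "... <= pmf_E (step (x k)) (%j. 1)"
     using G_bnd by (intro integral_mono measure_pmf.integrable_const_bound[where B=1]) auto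
    finally show ?thesis by simp
   qed
   show "integrable M (%w. pmf_E (step (X k w)) (G k (path w)))"
   proof -
    have "X k w = path w k" for w by (simp add: path_def)
    then show ?thesis using prefix_dep_integrable[OF dep bnd] by simp
   qed
   show "integrable M (%w. C * W k (path w))" using W_int by simp
   fix w assume "w \<in> space M"
   define x where "x = path w"
   show "pmf_E (step (X k w)) (G k (path w)) <= C * W k (path w)"
    unfolding x_def[symmetric]
   proof (cases "active Q \<beta> \<eta> k x")
    case True
    define y where "y = lg n x k - L x"
    have xk: "x k = X k w" by (simp add: x_def path_def)
    have box: "abs(ln (real (x k)) - ln (real n)) < A" using True unfolding active_def alive_def lg_def by auto
    have Gx: "G k x = (%j. sat ((y + (ln (real j) - ln (real (x k)))) / \<eta>) - sat (y / \<eta>))"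
     using True by (intro ext) (simp add: G_def y_def lg_def algebra_simps)
    have "integrable (step (x k)) (%j. sat ((y + (ln (real j) - ln (real (x k)))) / \<eta>))"
     using sat_bounds by (intro measure_pmf.integrable_const_bound[where B=1]) auto
    then have "pmf_E (step (x k)) (G k x) = pmf_E (step (x k)) (%j. sat ((y + (ln (real j) - ln (real (x k)))) / \<eta>)) - sat (y / \<eta>)"
     unfolding Gx by simp
    also have "... <= C * (1 / a (x k))" using gen[OF box, of y] by linarith
    finally show "pmf_E (step (X k w)) (G k x) <= C * W k x" using True xk by (simp add: W_def)
   next
    case False
    then have "G k x = (%j. 0)" by (intro ext) (simp add: G_def)
    then show "pmf_E (step (X k w)) (G k x) <= C * W k x" using False by (simp add: W_def)
   qed
  qed
  finally show ?thesis by simp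
 qed
 have ev: "{w\<in>space M. exits Q \<beta> \<eta> (path w)} \<in> events" by (rule prefix_dep_pred[OF prefix_dep_exits[OF Q]])
 have act_dep: "prefix_dep horizon (%x. \<exists>k<horizon. active Q \<beta> \<eta> k x)"
  unfolding prefix_dep_def
 proof (intro allI impI)
  fix x y :: "nat => nat" assume xy: "\<forall>i\<le>horizon. x i = y i"
  have "active Q \<beta> \<eta> k x = active Q \<beta> \<eta> k y" if "k < horizon" for k
   by (rule active_cong[OF Q]) (use xy that in auto)
  then show "(\<exists>k<horizon. active Q \<beta> \<eta> k x) = (\<exists>k<horizon. active Q \<beta> \<eta> k y)" by auto
 qed
 have ev2: "{w\<in>space M. \<exists>k<horizon. active Q \<beta> \<eta> k (path w)} \<in> events" by (rule prefix_dep_pred[OF act_dep])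
 \<comment> \<open>The clock counts only where monitoring takes place. Keeping this event as a
   factor is what makes a second exit in a block quadratically unlikely.\<close>
 have clock: "expectation (%w. \<Sum>k<horizon. W k (path w)) <= expectation (%w. (\<beta> - \<alpha> + e) * indicator {w\<in>space M. \<exists>k<horizon. active Q \<beta> \<eta> k (path w)} w)"
 proof (rule integral_mono)
  show "integrable M (%w. \<Sum>k<horizon. W k (path w))" using W_int by auto
  show "integrable M (%w. (\<beta> - \<alpha> + e) * indicator {w\<in>space M. \<exists>k<horizon. active Q \<beta> \<eta> k (path w)} w)"
   by (rule integrable_mult_right, rule integrable_real_indicator[OF ev2]) (simp add: emeasure_eq_measure)
  show "(\<Sum>k<horizon. W k (path w)) <= (\<beta> - \<alpha> + e) * indicator {w\<in>space M. \<exists>k<horizon. active Q \<beta> \<eta> k (path w)} w" if "w \<in> space M" for w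
  proof -
   have "(EX k. active Q \<beta> \<eta> k (path w)) \<longleftrightarrow> (\<exists>k<horizon. active Q \<beta> \<eta> k (path w))" using active_interval by blast
   then show ?thesis using active_clock_sum[of Q "path w" \<alpha> \<beta> \<eta>] \<alpha> that unfolding W_def by (simp add: indicator_def of_bool_def)
  qed
 qed
 then have clock': "expectation (%w. \<Sum>k<horizon. W k (path w)) <= (\<beta> - \<alpha> + e) * prob {w\<in>space M. \<exists>k<horizon. active Q \<beta> \<eta> k (path w)}" unfolding integral_cmult_indicator[OF ev2] .
 have "prob {w\<in>space M. exits Q \<beta> \<eta> (path w)} = expectation (%w. indicator {w\<in>space M. exits Q \<beta> \<eta> (path w)} w)"
  using integral_cmult_indicator[OF ev, of 1] by (simp only: mult_1)
 also have "... <= expectation (%w. 2 * (\<Sum>k<horizon. H k (path w)))"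
 proof (rule integral_mono)
  show "integrable M (%w. indicator {w\<in>space M. exits Q \<beta> \<eta> (path w)} w :: real)"
   by (rule integrable_real_indicator[OF ev]) (simp add: emeasure_eq_measure)
  show "integrable M (%w. 2 * (\<Sum>k<horizon. H k (path w)))" using H_int by auto
  show "indicator {w\<in>space M. exits Q \<beta> \<eta> (path w)} w <= 2 * (\<Sum>k<horizon. H k (path w))" if "w \<in> space M" for w
   using exit_le_sum[OF \<eta>, of Q \<beta> "path w"] that unfolding H_eq L_def by (simp add: indicator_def of_bool_def)
 qed
 also have "... = 2 * (\<Sum>k<horizon. expectation (%w. H k (path w)))" using H_int by simp
 also have "... <= 2 * (\<Sum>k<horizon. C * expectation (%w. W k (path w)))" by (intro mult_left_mono sum_mono step_k) auto
 also have "... = 2 * C * expectation (%w. \<Sum>k<horizon. W k (path w))" using W_int by (simp add: sum_distrib_left mult.assoc)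
 also have "... <= 2 * C * ((\<beta> - \<alpha> + e) * prob {w\<in>space M. \<exists>k<horizon. active Q \<beta> \<eta> k (path w)})"
  using clock' C by (intro mult_left_mono) auto
 finally show ?thesis by (simp add: mult.assoc)
qed

end

section \<open>Blocks of the clock and their turning points\<close>

context box begin

definition reach :: "real => nat => nat => (nat => nat) => bool" where
 "reach \<delta> j i x \<longleftrightarrow> real j * \<delta> <= clk a x i"

text \<open>The moment just after an exit in block j; as a starting condition it sets off the
  monitoring for a second exit in the same block.\<close>

definition jump :: "real => real => nat => nat => (nat => nat) => bool" where
 "jump \<delta> \<eta> j i x \<longleftrightarrow> (EX k. i = Suc k & active (reach \<delta> j) (real (Suc j) * \<delta>) \<eta> k x &
  \<eta> <= abs(lg n x (Suc k) - lg n x (first (reach \<delta> j) x)))"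

lemma prefix_dep_reach: "prefix_dep i (reach \<delta> j i)"
 unfolding prefix_dep_def
proof (intro allI impI)
 fix x y :: "nat => nat" assume "\<forall>k\<le>i. x k = y k"
 then have "clk a x i = clk a y i" using clk_cong[of i x y i] by simp
 then show "reach \<delta> j i x = reach \<delta> j i y" by (simp add: reach_def)
qed

lemma prefix_dep_jump: "prefix_dep i (jump \<delta> \<eta> j i)"
 unfolding prefix_dep_def
proof (intro allI impI)
 have imp: "jump \<delta> \<eta> j i y" if ex: "jump \<delta> \<eta> j i x" and xy: "!!m. m <= i ==> x m = y m" for x y
 proof -
  obtain k where k: "i = Suc k" "active (reach \<delta> j) (real (Suc j) * \<delta>) \<eta> k x"
   "\<eta> <= abs(lg n x (Suc k) - lg n x (first (reach \<delta> j) x))" using ex unfolding jump_def by blast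
  have xy': "!!m. m <= k ==> x m = y m" using xy k(1) by simp
  have "active (reach \<delta> j) (real (Suc j) * \<delta>) \<eta> k y"
   using active_cong[where Q="reach \<delta> j" and k=k and x=x and y=y, OF prefix_dep_reach xy'] k(2) by blast
  moreover have "first (reach \<delta> j) x = first (reach \<delta> j) y" "first (reach \<delta> j) x <= k"
   using first_cong[where Q="reach \<delta> j" and k=k and x=x and y=y, OF prefix_dep_reach xy'] k(2) unfolding active_def by auto
  then have "lg n x (first (reach \<delta> j) x) = lg n y (first (reach \<delta> j) y)" "lg n x (Suc k) = lg n y (Suc k)"
   using xy k(1) by (auto intro!: lg_cong)
  ultimately show ?thesis using k unfolding jump_def by auto
 qed
 fix x y :: "nat => nat" assume "\<forall>m\<le>i. x m = y m"
 then show "jump \<delta> \<eta> j i x = jump \<delta> \<eta> j i y" using imp[of x y] imp[of y x] by auto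
qed

lemma jump_clk: "jump \<delta> \<eta> j i x ==> real j * \<delta> <= clk a x i"
proof -
 assume "jump \<delta> \<eta> j i x"
 then obtain k where k: "i = Suc k" "active (reach \<delta> j) (real (Suc j) * \<delta>) \<eta> k x" unfolding jump_def by blast
 have "real j * \<delta> <= clk a x (first (reach \<delta> j) x)" using active_first(1)[OF k(2)] by (simp add: reach_def)
 also have "... <= clk a x i" using active_first(2)[OF k(2)] k(1) by (intro clk_mono) simp
 finally show ?thesis .
qed

lemma jump_active_exits:
 "\<exists>k<horizon. active (jump \<delta> \<eta> j) \<beta> \<eta> k x ==> exits (reach \<delta> j) (real (Suc j) * \<delta>) \<eta> x"
proof -
 assume "\<exists>k<horizon. active (jump \<delta> \<eta> j) \<beta> \<eta> k x"
 then obtain k where "active (jump \<delta> \<eta> j) \<beta> \<eta> k x" by blast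
 then obtain i where "jump \<delta> \<eta> j i x" unfolding active_def by blast
 then obtain k where k: "active (reach \<delta> j) (real (Suc j) * \<delta>) \<eta> k x"
   "\<eta> <= abs(lg n x (Suc k) - lg n x (first (reach \<delta> j) x))" unfolding jump_def by blast
 have "k < horizon" using active_interval[OF k(1)] by blast
 then show ?thesis using k unfolding exits_def by blast
qed

text \<open>By induction along the path: while it has stayed in the \<eta>-window it is monitored,
  so the next step leaves the window only by an exit.\<close>

lemma not_exits_window:
 assumes ne: "\<not> exits Q \<beta> \<eta> x" and \<eta>: "0 < \<eta>" and Q: "Q (first Q x) x"
  and al: "!!k. first Q x <= k ==> k < v ==> alive x k & clk a x k < \<beta>"
  and i: "first Q x <= i" "i <= v"
 shows "abs(lg n x i - lg n x (first Q x)) < \<eta>"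
 using i
proof (induction i rule: less_induct)
 case (less i)
 show ?case
 proof (cases "i = first Q x")
  case False
  then obtain k where k: "i = Suc k" "first Q x <= k" "k < v" using less.prems by (cases i) auto
  have "ALL m. first Q x <= m & m <= k --> abs(lg n x m - lg n x (first Q x)) < \<eta>"
   using less.IH k by auto
  then have act: "active Q \<beta> \<eta> k x" unfolding active_def using al[OF k(2,3)] Q k(2) by blast
  then have "k < horizon" using active_interval by blast
  then show ?thesis using ne act k(1) unfolding exits_def by force
 qed (use \<eta> in simp)
qed

end

text \<open>A single path that does not leave the box before clock time S, cut into J blocks at the
  first indices \<open>K j\<close> where the clock reaches j \<delta>. From here to the comparison
  with the skeleton all arguments are pathwise.\<close>

locale inside_path = box a n A S e c for a :: "nat => real" and n :: nat and A S e c :: real +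
 fixes \<delta> :: real and J :: nat and x :: "nat => nat"
 assumes delta: "0 < \<delta>" and S_eq: "real J * \<delta> = S" and e_le: "e <= \<delta>"
  and x0: "x 0 = n" and inside: "\<not> exits (%i x. True) S A x"
begin

abbreviation K :: "nat => nat" where "K j \<equiv> first (reach \<delta> j) x"

lemma first_True: "first (%i x. True) x = 0"
 unfolding first_def by (rule Least_equality) auto

lemma lg_0: "lg n x 0 = 0" by (simp add: lg_def x0)

lemma alive_step: assumes "alive x k" shows "abs(lg n x (Suc k)) < A"
proof -
 have "active (%i x. True) S A k x" using assms unfolding active_def alive_def first_True lg_0 by auto
 moreover have "k < horizon" using assms by (rule alive_less_horizon)
 ultimately have "\<not> A <= abs(lg n x (Suc k) - lg n x (first (%i x. True) x))" using inside unfolding exits_def by blast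
 then show ?thesis unfolding first_True lg_0 by simp
qed

text \<open>Without an exit at scale A from time 0, the box condition can never be the first to
  fail.\<close>

lemma alive_iff: "alive x k \<longleftrightarrow> clk a x k < S"
proof (induction k)
 case 0
 then show ?case using A S by (simp add: alive_def lg_0)
next
 case (Suc k)
 show ?case
 proof
  assume lt: "clk a x (Suc k) < S"
  then have "clk a x k < S" using clk_mono[of k "Suc k" x] by simp
  then have al: "alive x k" using Suc by simp
  then show "alive x (Suc k)" using alive_step[OF al] lt unfolding alive_def by (auto simp: le_Suc_eq)
 qed (simp add: alive_def)
qed

lemma reaches: "EX i. S <= clk a x i"
 using alive_iff[of horizon] alive_less_horizon[of x horizon] by (auto simp: not_less)

lemma K_props:
 assumes j: "j <= J"
 shows "reach \<delta> j (K j) x" and "!!i. i < K j ==> clk a x i < real j * \<delta>" and "!!i. i < K j ==> alive x i"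
  and "clk a x (K j) < real j * \<delta> + e"
proof -
 have le: "real j * \<delta> <= S" using j delta by (simp add: S_eq[symmetric])
 obtain i where "S <= clk a x i" using reaches by blast
 then have "reach \<delta> j i x" using le by (simp add: reach_def)
 then show r: "reach \<delta> j (K j) x" unfolding first_def by (rule LeastI)
 show lt: "clk a x i < real j * \<delta>" if "i < K j" for i
  using not_less_Least[of i "%i. reach \<delta> j i x"] that unfolding first_def reach_def by simp
 show al: "alive x i" if "i < K j" for i using lt[OF that] le alive_iff by simp
 show "clk a x (K j) < real j * \<delta> + e"
 proof (cases "K j")
  case 0
  then show ?thesis using delta e by (simp add: add_nonneg_pos)
 next
  case (Suc m)
  then show ?thesis using lt[of m] al[of m] alive_inv_a(1)[of x m] by (simp add: clk_Suc)
 qed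
qed

lemma K_0: "K 0 = 0"
 unfolding first_def by (rule Least_equality) (auto simp: reach_def)

text \<open>The clock overshoots level j by less than e, and e is at most \<delta>, so level j + 1
  is not yet reached: every block is nonempty.\<close>

lemma K_less: assumes "j < J" shows "K j < K (Suc j)"
proof -
 have "clk a x (K j) < real (Suc j) * \<delta>" using K_props(4)[of j] assms e_le by (simp add: algebra_simps)
 also have "... <= clk a x (K (Suc j))" using K_props(1)[of "Suc j"] assms by (simp add: reach_def)
 finally show ?thesis using clk_mono[of "K (Suc j)" "K j" x] by (meson leD leI)
qed

lemma K_mono: "i <= j ==> j <= J ==> K i <= K j"
proof (induction j rule: dec_induct)
 case (step m)
 then show ?case using K_less[of m] by simp
qed simp

lemma lg_inside: assumes "i <= K J" shows "abs(lg n x i) < A"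
proof (cases i)
 case 0
 then show ?thesis using A lg_0 by simp
next
 case (Suc k)
 then show ?thesis using alive_step[of k] K_props(3)[of J k] assms by simp
qed

lemma block_alive: "j < J ==> K j <= k ==> k < K (Suc j) ==> alive x k & clk a x k < real (Suc j) * \<delta>"
 using K_props(2,3)[of "Suc j" k] by simp

lemma block_duration:
 assumes j: "j < J"
 shows "abs((\<Sum>k\<in>{K j..<K (Suc j)}. 1 / a (x k)) - \<delta>) <= e" "(\<Sum>k\<in>{K j..<K (Suc j)}. 1 / a (x k)) <= 2 * \<delta>"
proof -
 have eq: "(\<Sum>k\<in>{K j..<K (Suc j)}. 1 / a (x k)) = clk a x (K (Suc j)) - clk a x (K j)"
 proof -
  have "(\<Sum>k\<in>{K j..<K (Suc j)}. 1 / a (x k)) = (\<Sum>k\<in>{K j..<K (Suc j)}. clk a x (Suc k) - clk a x k)" by (simp add: clk_Suc)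
  also have "... = clk a x (K (Suc j)) - clk a x (K j)" by (rule sum_Suc_diff') (use K_less[OF j] in simp)
  finally show ?thesis .
 qed
 have "real j * \<delta> <= clk a x (K j)" "clk a x (K j) < real j * \<delta> + e"
  "real j * \<delta> + \<delta> <= clk a x (K (Suc j))" "clk a x (K (Suc j)) < real j * \<delta> + \<delta> + e"
  using K_props(1,4)[of j] K_props(1,4)[of "Suc j"] j by (auto simp: reach_def algebra_simps)
 then show "abs((\<Sum>k\<in>{K j..<K (Suc j)}. 1 / a (x k)) - \<delta>) <= e" "(\<Sum>k\<in>{K j..<K (Suc j)}. 1 / a (x k)) <= 2 * \<delta>"
  unfolding eq using e_le by linarith+
qed

text \<open>The split point of the block: the time just after its exit if there is one, otherwise
  the block's end.\<close>

definition turn :: "real => nat => nat" where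
 "turn \<eta> j = (if exits (reach \<delta> j) (real (Suc j) * \<delta>) \<eta> x then first (jump \<delta> \<eta> j) x else K (Suc j))"

text \<open>Up to the exit the path is near its value at the start of the block, by the definition
  of monitoring; after it, the absence of a second exit keeps the path near its value at the
  turn.\<close>

lemma turn:
 assumes j: "j < J" and \<eta>: "0 < \<eta>" and once: "\<not> exits (jump \<delta> \<eta> j) (real (Suc j) * \<delta>) \<eta> x"
 shows "K j < turn \<eta> j" "turn \<eta> j <= K (Suc j)"
  "!!i. K j <= i ==> i < turn \<eta> j ==> abs(lg n x i - lg n x (K j)) < \<eta>"
  "!!i. turn \<eta> j <= i ==> i <= K (Suc j) ==> abs(lg n x i - lg n x (turn \<eta> j)) < \<eta>"
proof -
 have "(K j < turn \<eta> j & turn \<eta> j <= K (Suc j)) &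
  (ALL i. K j <= i & i < turn \<eta> j --> abs(lg n x i - lg n x (K j)) < \<eta>) &
  (ALL i. turn \<eta> j <= i & i <= K (Suc j) --> abs(lg n x i - lg n x (turn \<eta> j)) < \<eta>)"
 proof (cases "exits (reach \<delta> j) (real (Suc j) * \<delta>) \<eta> x")
  case False
  have "abs(lg n x i - lg n x (K j)) < \<eta>" if "K j <= i" "i <= K (Suc j)" for i
   by (rule not_exits_window[where Q="reach \<delta> j", OF False \<eta> _ _ that]) (use K_props(1)[of j] block_alive[OF j] j in auto)
  then show ?thesis using False K_less[OF j] \<eta> by (auto simp: turn_def)
 next
  case True
  then obtain k where k: "active (reach \<delta> j) (real (Suc j) * \<delta>) \<eta> k x" "\<eta> <= abs(lg n x (Suc k) - lg n x (K j))"
   unfolding exits_def by blast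
  have "jump \<delta> \<eta> j (Suc k) x" unfolding jump_def using k by blast
  then have Jf: "jump \<delta> \<eta> j (first (jump \<delta> \<eta> j) x) x" unfolding first_def by (rule LeastI)
  have t: "turn \<eta> j = first (jump \<delta> \<eta> j) x" using True by (simp add: turn_def)
  obtain m where m: "turn \<eta> j = Suc m" "active (reach \<delta> j) (real (Suc j) * \<delta>) \<eta> m x"
   using Jf unfolding t jump_def by blast
  have "K j <= m" by (rule active_first(2)[OF m(2)])
  moreover have "m < K (Suc j)"
  proof (rule ccontr)
   assume "\<not> m < K (Suc j)"
   then have "clk a x (K (Suc j)) <= clk a x m" by (intro clk_mono) simp
   moreover have "clk a x m < real (Suc j) * \<delta>" using m(2) by (simp add: active_def)
   ultimately show False using K_props(1)[of "Suc j"] j by (simp add: reach_def)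
  qed
  moreover have "abs(lg n x i - lg n x (K j)) < \<eta>" if "K j <= i" "i < turn \<eta> j" for i
   using m(2) that m(1) unfolding active_def by simp
  moreover have "abs(lg n x i - lg n x (turn \<eta> j)) < \<eta>" if i: "turn \<eta> j <= i" "i <= K (Suc j)" for i
  proof -
   have al: "alive x k & clk a x k < real (Suc j) * \<delta>" if "first (jump \<delta> \<eta> j) x <= k" "k < K (Suc j)" for k
    using block_alive[OF j, of k] that m(1) \<open>K j <= m\<close> unfolding t by simp
   show ?thesis unfolding t
    by (rule not_exits_window[where Q="jump \<delta> \<eta> j", OF once \<eta> Jf al i[unfolded t]])
  qed
  ultimately show ?thesis using m(1) by auto
 qed
 then show "K j < turn \<eta> j" "turn \<eta> j <= K (Suc j)"
  "!!i. K j <= i ==> i < turn \<eta> j ==> abs(lg n x i - lg n x (K j)) < \<eta>"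
  "!!i. turn \<eta> j <= i ==> i <= K (Suc j) ==> abs(lg n x i - lg n x (turn \<eta> j)) < \<eta>"
  by auto
qed

text \<open>A step takes real time 1 / a_n = (1 / a_x) (a_x / a_n), that is, clock time times a rate
  close to exp (\<gamma> lg). Without an exit the rate is nearly constant on the block; with one it
  is still off by at most exp (\<gamma> A). The last error term is the clock overshoot.\<close>

lemma block_real_duration:
 assumes j: "j < J" and \<eta>: "0 < \<eta>" and once: "\<not> exits (jump \<delta> \<eta> j) (real (Suc j) * \<delta>) \<eta> x"
  and rate: "!!i. abs(ln (real i) - ln (real n)) < A ==> abs(a i / a n - exp (\<gamma> * (ln (real i) - ln (real n)))) <= eps"
  and \<gamma>: "0 < \<gamma>"
 shows "abs(real (K (Suc j)) / a n - real (K j) / a n - \<delta> * exp (\<gamma> * lg n x (K j))) <=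
  2 * \<delta> * (eps + exp (\<gamma> * A) * (\<gamma> * \<eta> + of_bool (exits (reach \<delta> j) (real (Suc j) * \<delta>) \<eta> x))) + e * exp (\<gamma> * A)"
  and "real (K (Suc j)) / a n - real (K j) / a n <= 2 * \<delta> * (eps + exp (\<gamma> * A))"
proof -
 let ?B = "{K j..<K (Suc j)}"
 let ?b = "of_bool (exits (reach \<delta> j) (real (Suc j) * \<delta>) \<eta> x) :: real"
 let ?E = "exp (\<gamma> * lg n x (K j))"
 have lgA: "abs(lg n x k) < A" if "k \<in> ?B" for k using lg_inside[of k] that K_mono[of "Suc j" J] j by simp
 have kA: "\<gamma> * lg n x k <= \<gamma> * A" if "k \<in> ?B" for k using lgA[OF that] \<gamma> by simp
 have K_in: "K j \<in> ?B" using K_less[OF j] by simp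
 have r: "abs(a (x k) / a n - exp (\<gamma> * lg n x k)) <= eps" if "k \<in> ?B" for k
  using rate[of "x k"] lgA[OF that] by (simp add: lg_def)
 have dev: "abs(exp (\<gamma> * lg n x k) - ?E) <= exp (\<gamma> * A) * (\<gamma> * \<eta> + ?b)" if k: "k \<in> ?B" for k
 proof (cases "exits (reach \<delta> j) (real (Suc j) * \<delta>) \<eta> x")
  case True
  have "exp (\<gamma> * lg n x k) <= exp (\<gamma> * A)" "?E <= exp (\<gamma> * A)" using kA[OF k] kA[OF K_in] by auto
  then have "abs(exp (\<gamma> * lg n x k) - ?E) <= exp (\<gamma> * A) * 1" using exp_gt_zero[of "\<gamma> * lg n x k"] exp_gt_zero[of "\<gamma> * lg n x (K j)"] by linarith
  also have "... <= exp (\<gamma> * A) * (\<gamma> * \<eta> + ?b)" using True \<gamma> \<eta> by (intro mult_left_mono) auto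
  finally show ?thesis .
 next
  case False
  then have "abs(lg n x k - lg n x (K j)) < \<eta>" using turn(3)[OF j \<eta> once, of k] k by (simp add: turn_def)
  then have "abs(\<gamma> * lg n x k - \<gamma> * lg n x (K j)) <= \<gamma> * \<eta>" using \<gamma> by (simp add: right_diff_distrib[symmetric] abs_mult)
  then have "exp (\<gamma> * A) * abs(\<gamma> * lg n x k - \<gamma> * lg n x (K j)) <= exp (\<gamma> * A) * (\<gamma> * \<eta>)" by (rule mult_left_mono) simp
  then have "abs(exp (\<gamma> * lg n x k) - ?E) <= exp (\<gamma> * A) * (\<gamma> * \<eta>)" using abs_exp_diff_le[OF kA[OF k] kA[OF K_in]] by linarith
  then show ?thesis using False by simp
 qed
 have len: "real (K (Suc j)) / a n - real (K j) / a n = (\<Sum>k\<in>?B. (1 / a (x k)) * (a (x k) / a n))"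
 proof -
  have "(1 / a (x k)) * (a (x k) / a n) = 1 / a n" for k using a_pos[of "x k"] by simp
  then have "(\<Sum>k\<in>?B. (1 / a (x k)) * (a (x k) / a n)) = real (card ?B) / a n" by (simp only: sum_constant times_divide_eq_right mult_1_right)
  then show ?thesis using K_less[OF j] by (simp add: diff_divide_distrib of_nat_diff)
 qed
 have "abs((\<Sum>k\<in>?B. (1 / a (x k)) * (a (x k) / a n)) - (\<Sum>k\<in>?B. 1 / a (x k)) * ?E)
  = abs(\<Sum>k\<in>?B. (1 / a (x k)) * (a (x k) / a n - ?E))"
  by (simp add: sum_distrib_right sum_subtractf[symmetric] right_diff_distrib)
 also have "... <= (\<Sum>k\<in>?B. (1 / a (x k)) * (eps + exp (\<gamma> * A) * (\<gamma> * \<eta> + ?b)))"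
 proof (rule order_trans[OF sum_abs], rule sum_mono)
  fix k assume k: "k \<in> ?B"
  have "abs(a (x k) / a n - ?E) <= eps + exp (\<gamma> * A) * (\<gamma> * \<eta> + ?b)" using r[OF k] dev[OF k] by linarith
  moreover have "0 <= 1 / a (x k)" using a_pos[of "x k"] by simp
  ultimately show "abs((1 / a (x k)) * (a (x k) / a n - ?E)) <= (1 / a (x k)) * (eps + exp (\<gamma> * A) * (\<gamma> * \<eta> + ?b))"
   unfolding abs_mult by (intro mult_mono) auto
 qed
 also have "... = (\<Sum>k\<in>?B. 1 / a (x k)) * (eps + exp (\<gamma> * A) * (\<gamma> * \<eta> + ?b))" by (simp only: sum_distrib_right)
 also have "... <= 2 * \<delta> * (eps + exp (\<gamma> * A) * (\<gamma> * \<eta> + ?b))"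
 proof (rule mult_right_mono[OF block_duration(2)[OF j]])
  show "0 <= eps + exp (\<gamma> * A) * (\<gamma> * \<eta> + ?b)" using r[OF K_in] \<gamma> \<eta> by (intro add_nonneg_nonneg mult_nonneg_nonneg) auto
 qed
 finally have 1: "abs(real (K (Suc j)) / a n - real (K j) / a n - (\<Sum>k\<in>?B. 1 / a (x k)) * ?E) <= 2 * \<delta> * (eps + exp (\<gamma> * A) * (\<gamma> * \<eta> + ?b))"
  unfolding len .
 have "abs((\<Sum>k\<in>?B. 1 / a (x k)) * ?E - \<delta> * ?E) = abs((\<Sum>k\<in>?B. 1 / a (x k)) - \<delta>) * ?E" by (simp add: left_diff_distrib[symmetric] abs_mult)
 also have "... <= e * exp (\<gamma> * A)" using block_duration(1)[OF j] kA[OF K_in] e by (intro mult_mono) auto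
 finally show "abs(real (K (Suc j)) / a n - real (K j) / a n - \<delta> * ?E) <=
  2 * \<delta> * (eps + exp (\<gamma> * A) * (\<gamma> * \<eta> + ?b)) + e * exp (\<gamma> * A)" using 1 by linarith
 have "(\<Sum>k\<in>?B. (1 / a (x k)) * (a (x k) / a n)) <= (\<Sum>k\<in>?B. (1 / a (x k)) * (eps + exp (\<gamma> * A)))"
 proof (rule sum_mono)
  fix k assume k: "k \<in> ?B"
  have "exp (\<gamma> * lg n x k) <= exp (\<gamma> * A)" using kA[OF k] by simp
  then have "a (x k) / a n <= eps + exp (\<gamma> * A)" using r[OF k] by linarith
  then show "(1 / a (x k)) * (a (x k) / a n) <= (1 / a (x k)) * (eps + exp (\<gamma> * A))" using a_pos[of "x k"] by (intro mult_left_mono) auto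
 qed
 also have "... = (\<Sum>k\<in>?B. 1 / a (x k)) * (eps + exp (\<gamma> * A))" by (simp only: sum_distrib_right)
 also have "... <= 2 * \<delta> * (eps + exp (\<gamma> * A))"
 proof (rule mult_right_mono[OF block_duration(2)[OF j]])
  show "0 <= eps + exp (\<gamma> * A)" using r[OF K_in] by (intro add_nonneg_nonneg) auto
 qed
 finally show "real (K (Suc j)) / a n - real (K j) / a n <= 2 * \<delta> * (eps + exp (\<gamma> * A))" unfolding len .
qed

text \<open>In the time budget, rates and overshoots accumulate over all blocks, whereas exits count
  only once per affected block and with a factor \<delta>. The last summand is the real length of
  one block, since the turn may lie anywhere in it.\<close>

lemma J1_close_skeleton:
 assumes \<eta>: "0 < \<eta>" and once: "!!j. j < J ==> \<not> exits (jump \<delta> \<eta> j) (real (Suc j) * \<delta>) \<eta> x"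
  and rate: "!!i. abs(ln (real i) - ln (real n)) < A ==> abs(a i / a n - exp (\<gamma> * (ln (real i) - ln (real n)))) <= eps"
  and \<gamma>: "0 < \<gamma>" and pos: "!!i. 0 < x i"
  and time: "2 * S * (eps + exp (\<gamma> * A) * (\<gamma> * \<eta>)) + real J * e * exp (\<gamma> * A)
   + 2 * \<delta> * exp (\<gamma> * A) * (\<Sum>j<J. of_bool (exits (reach \<delta> j) (real (Suc j) * \<delta>) \<eta> x)) + 2 * \<delta> * (eps + exp (\<gamma> * A)) <= \<rho>"
  and space: "exp A * (2 * \<eta>) <= \<rho>"
  and tail: "exp (- skel_time \<gamma> \<delta> (%j. lg n x (K j)) J) <= \<rho>"
 shows "J1_close \<rho> (%t. real (x (nat \<lfloor>a n * t\<rfloor>)) / real n) (skel_path \<gamma> \<delta> J (%j. lg n x (K j)))"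
proof -
 have an: "0 < a n" by (rule a_pos)
 have eps: "0 <= eps" using order_trans[OF abs_ge_zero rate[of n]] A by simp
 have n: "0 < n" using pos[of 0] x0 by simp
 have y: "real (x i) / real n = exp (lg n x i)" for i using pos[of i] n by (simp add: lg_def exp_diff)
 define ex where "ex j = (of_bool (exits (reach \<delta> j) (real (Suc j) * \<delta>) \<eta> x) :: real)" for j
 have Terr: "abs(skel_time \<gamma> \<delta> (%j. lg n x (K j)) j - real (K j) / a n) <=
  real j * (2 * \<delta> * (eps + exp (\<gamma> * A) * (\<gamma> * \<eta>)) + e * exp (\<gamma> * A)) + 2 * \<delta> * exp (\<gamma> * A) * (\<Sum>j<j. ex j)" if "j <= J" for j
  using that
 proof (induction j)
  case 0
  then show ?case by (simp add: K_0)
 next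
  case (Suc j)
  have 1: "abs(skel_time \<gamma> \<delta> (%j. lg n x (K j)) j - real (K j) / a n) <=
  real j * (2 * \<delta> * (eps + exp (\<gamma> * A) * (\<gamma> * \<eta>)) + e * exp (\<gamma> * A)) + 2 * \<delta> * exp (\<gamma> * A) * (\<Sum>j<j. ex j)" using Suc by simp
  have 2: "abs(real (K (Suc j)) / a n - real (K j) / a n - \<delta> * exp (\<gamma> * lg n x (K j))) <=
  2 * \<delta> * (eps + exp (\<gamma> * A) * (\<gamma> * \<eta> + ex j)) + e * exp (\<gamma> * A)"
   unfolding ex_def by (rule block_real_duration(1)[OF _ \<eta> once rate \<gamma>]) (use Suc.prems in auto)
  have 3: "skel_time \<gamma> \<delta> (%j. lg n x (K j)) (Suc j) = skel_time \<gamma> \<delta> (%j. lg n x (K j)) j + \<delta> * exp (\<gamma> * lg n x (K j))"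
   by (simp add: skel_time_def distrib_left)
  have 4: "real (Suc j) * (2 * \<delta> * (eps + exp (\<gamma> * A) * (\<gamma> * \<eta>)) + e * exp (\<gamma> * A)) + 2 * \<delta> * exp (\<gamma> * A) * (\<Sum>j<Suc j. ex j)
   = (real j * (2 * \<delta> * (eps + exp (\<gamma> * A) * (\<gamma> * \<eta>)) + e * exp (\<gamma> * A)) + 2 * \<delta> * exp (\<gamma> * A) * (\<Sum>j<j. ex j)) +
    (2 * \<delta> * (eps + exp (\<gamma> * A) * (\<gamma> * \<eta> + ex j)) + e * exp (\<gamma> * A))" by (simp add: algebra_simps)
  show ?case unfolding 3 4 using 1 2 by linarith
 qed
 have Terr': "abs(skel_time \<gamma> \<delta> (%j. lg n x (K j)) j - real (K j) / a n) <=
  2 * S * (eps + exp (\<gamma> * A) * (\<gamma> * \<eta>)) + real J * e * exp (\<gamma> * A) + 2 * \<delta> * exp (\<gamma> * A) * (\<Sum>j<J. ex j)" if j: "j <= J" for j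
 proof -
  have "real j * (2 * \<delta> * (eps + exp (\<gamma> * A) * (\<gamma> * \<eta>)) + e * exp (\<gamma> * A)) <= real J * (2 * \<delta> * (eps + exp (\<gamma> * A) * (\<gamma> * \<eta>)) + e * exp (\<gamma> * A))"
   using j delta eps e \<gamma> \<eta> by (intro mult_right_mono add_nonneg_nonneg mult_nonneg_nonneg) auto
  also have "... = 2 * S * (eps + exp (\<gamma> * A) * (\<gamma> * \<eta>)) + real J * e * exp (\<gamma> * A)" by (simp add: S_eq[symmetric] algebra_simps)
  finally have 1: "real j * (2 * \<delta> * (eps + exp (\<gamma> * A) * (\<gamma> * \<eta>)) + e * exp (\<gamma> * A)) <= 2 * S * (eps + exp (\<gamma> * A) * (\<gamma> * \<eta>)) + real J * e * exp (\<gamma> * A)" .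
  have "(\<Sum>j<j. ex j) <= (\<Sum>j<J. ex j)" using j by (intro sum_mono2) (auto simp: ex_def)
  then have 2: "2 * \<delta> * exp (\<gamma> * A) * (\<Sum>j<j. ex j) <= 2 * \<delta> * exp (\<gamma> * A) * (\<Sum>j<J. ex j)" using delta by (intro mult_left_mono) auto
  show ?thesis using Terr[OF j] 1 2 by linarith
 qed
 have val: "abs(real (x i) / real n - exp (lg n x k)) <= \<rho>" if i: "i <= K J" "k <= K J" and d: "abs(lg n x i - lg n x k) < 2 * \<eta>" for i k
 proof -
  have "abs(exp (lg n x i) - exp (lg n x k)) <= exp A * abs(lg n x i - lg n x k)"
   by (rule abs_exp_diff_le) (use lg_inside[OF i(1)] lg_inside[OF i(2)] in auto)
  also have "... <= exp A * (2 * \<eta>)" using d by (intro mult_left_mono) auto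
  finally show ?thesis unfolding y using space by linarith
 qed
 show ?thesis
 proof (rule J1_close_step_path[where T="skel_time \<gamma> \<delta> (%j. lg n x (K j))" and R="%j. real (K j) / a n"
    and c="%j. real (turn \<eta> j) / a n" and v="%j. exp (lg n x (K j))" and J=J])
  show "real (K 0) / a n = 0" by (simp add: K_0)
  show "skel_time \<gamma> \<delta> (%j. lg n x (K j)) j < skel_time \<gamma> \<delta> (%j. lg n x (K j)) (Suc j)" for j by (rule skel_time_less[OF delta])
  fix j assume j: "j < J"
  note tn = turn[OF j \<eta> once[OF j]]
  have KJ: "K (Suc j) <= K J" using K_mono[of "Suc j" J] j by simp
  show "real (K j) / a n < real (turn \<eta> j) / a n" using tn(1) an by (simp add: divide_strict_right_mono)
  show "real (turn \<eta> j) / a n <= real (K (Suc j)) / a n" using tn(2) an by (simp add: divide_right_mono)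
  {
   fix t assume "real (K j) / a n <= t" "t < real (turn \<eta> j) / a n"
   then have "real (K j) <= a n * t" "a n * t < real (turn \<eta> j)" using an by (auto simp: field_simps)
   then have "int (K j) <= \<lfloor>a n * t\<rfloor>" "\<lfloor>a n * t\<rfloor> < int (turn \<eta> j)" by (auto simp: le_floor_iff floor_less_iff)
   then have "K j <= nat \<lfloor>a n * t\<rfloor>" "nat \<lfloor>a n * t\<rfloor> < turn \<eta> j" by linarith+
   then show "abs(real (x (nat \<lfloor>a n * t\<rfloor>)) / real n - exp (lg n x (K j))) <= \<rho>"
    using tn(3)[of "nat \<lfloor>a n * t\<rfloor>"] tn(1,2) KJ \<eta> by (intro val) auto
  }
  {
   fix t assume "real (turn \<eta> j) / a n <= t" "t <= real (K (Suc j)) / a n"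
   then have "real (turn \<eta> j) <= a n * t" "a n * t <= real (K (Suc j))" using an by (auto simp: field_simps)
   then have "int (turn \<eta> j) <= \<lfloor>a n * t\<rfloor>" "\<lfloor>a n * t\<rfloor> <= int (K (Suc j))" by (auto simp: le_floor_iff floor_le_iff)
   then have i: "turn \<eta> j <= nat \<lfloor>a n * t\<rfloor>" "nat \<lfloor>a n * t\<rfloor> <= K (Suc j)" by linarith+
   \<comment> \<open>Both values are within \<eta> of the value at the turn, hence the factor
     2.\<close>
   have "abs(lg n x (nat \<lfloor>a n * t\<rfloor>) - lg n x (K (Suc j))) < 2 * \<eta>"
    using tn(4)[of "nat \<lfloor>a n * t\<rfloor>"] tn(4)[of "K (Suc j)"] i tn(2) by linarith
   then show "abs(real (x (nat \<lfloor>a n * t\<rfloor>)) / real n - exp (lg n x (K (Suc j)))) <= \<rho>"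
    using i KJ by (intro val) auto
  }
  have "real (K (Suc j)) / a n - real (K j) / a n <= 2 * \<delta> * (eps + exp (\<gamma> * A))"
   by (rule block_real_duration(2)[OF j \<eta> once[OF j] rate \<gamma>])
  moreover have "real (K j) / a n < real (turn \<eta> j) / a n" "real (turn \<eta> j) / a n <= real (K (Suc j)) / a n" by fact+
  ultimately show "abs(skel_time \<gamma> \<delta> (%j. lg n x (K j)) (Suc j) - real (turn \<eta> j) / a n) <= \<rho>"
   using Terr'[of "Suc j"] j time unfolding ex_def by linarith
 next
  show "skel_path \<gamma> \<delta> J (%j. lg n x (K j)) t = exp (lg n x (K j))"
   if "j < J" "skel_time \<gamma> \<delta> (%j. lg n x (K j)) j <= t" "t < skel_time \<gamma> \<delta> (%j. lg n x (K j)) (Suc j)" for j t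
   by (rule skel_path_eq[OF delta that])
  have "0 <= exp A * (2 * \<eta>)" using \<eta> by simp
  then show "0 <= \<rho>" using space by linarith
  show "exp (- skel_time \<gamma> \<delta> (%j. lg n x (K j)) J) <= \<rho>" by (rule tail)
 qed simp
qed

end

lemma step_path_cong:
 assumes "!!j. j <= J ==> T j = T' j" "!!j. j <= J ==> v j = v' j"
 shows "step_path J T v = step_path J T' v'"
proof
 fix t
 have "{i. i < J & T (Suc i) <= t} = {i. i < J & T' (Suc i) <= t}" using assms(1) by auto
 moreover have "card {i. i < J & T' (Suc i) <= t} <= card {..<J}" by (rule card_mono) auto
 ultimately show "step_path J T v t = step_path J T' v' t" unfolding step_path_def using assms(2) by simp
qed

lemma skel_time_cong: "(!!j. j < J ==> L j = L' j) ==> i <= J ==> skel_time \<gamma> \<delta> L i = skel_time \<gamma> \<delta> L' i"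
 unfolding skel_time_def by (auto intro!: sum.cong)

lemma skel_path_cong: "(!!j. j <= J ==> L j = L' j) ==> skel_path \<gamma> \<delta> J L = skel_path \<gamma> \<delta> J L'"
 unfolding skel_path_def by (rule step_path_cong) (auto intro!: skel_time_cong[of J])

lemma cmod_exp_minus_1: "cmod (exp z - 1) <= exp (cmod z) * cmod z"
proof -
 have "cmod (exp z - (\<Sum>k\<le>0. z ^ k / fact k)) <= exp \<bar>Re z\<bar> * cmod z ^ Suc 0 / fact 0" by (rule Taylor_exp)
 then have "cmod (exp z - 1) <= exp \<bar>Re z\<bar> * cmod z" by simp
 also have "... <= exp (cmod z) * cmod z" using abs_Re_le_cmod[of z] by (intro mult_right_mono) auto
 finally show ?thesis .
qed

lemma cmod_exp_minus_1_minus: assumes "cmod z <= 1" shows "cmod (exp z - 1 - z) <= 3 * (cmod z)\<^sup>2"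
proof -
 have "cmod (exp z - (\<Sum>k\<le>1. z ^ k / fact k)) <= exp \<bar>Re z\<bar> * cmod z ^ Suc 1 / fact 1" by (rule Taylor_exp)
 then have "cmod (exp z - 1 - z) <= exp \<bar>Re z\<bar> * (cmod z)\<^sup>2" by (simp add: power2_eq_square diff_diff_eq)
 also have "... <= 3 * (cmod z)\<^sup>2"
 proof (rule mult_right_mono)
  have "exp \<bar>Re z\<bar> <= exp 1" using abs_Re_le_cmod[of z] assms by simp
  then show "exp \<bar>Re z\<bar> <= 3" using exp_le by linarith
 qed simp
 finally show ?thesis .
qed

section \<open>Skeleton increments as functions of a bounded prefix\<close>

context box begin

text \<open>The alternative \<open>i = horizon\<close> keeps \<open>LEAST\<close> from an empty predicate on paths that leave the box.\<close>

definition capped :: "real => nat => nat => (nat => nat) => bool" where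
 "capped \<delta> j i x \<longleftrightarrow> reach \<delta> j i x \<or> i = horizon"

definition skel :: "real => nat => (nat => nat) => real" where
 "skel \<delta> j x = lg n x (first (capped \<delta> j) x)"

definition incs :: "real => nat => (nat => nat) => nat => real" where
 "incs \<delta> J x j = (if j < J then skel \<delta> (Suc j) x - skel \<delta> j x else 0)"

lemma prefix_dep_skel: "prefix_dep horizon (skel \<delta> j)"
 unfolding prefix_dep_def
proof (intro allI impI)
 fix x y :: "nat => nat" assume xy: "\<forall>m\<le>horizon. x m = y m"
 have dep: "prefix_dep i (capped \<delta> j i)" for i
  using prefix_dep_reach[of i \<delta> j] unfolding prefix_dep_def capped_def by auto
 have ex: "\<exists>i\<le>horizon. capped \<delta> j i x" unfolding capped_def by blast
 have xy': "!!m. m <= horizon ==> x m = y m" using xy by simp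
 have "first (capped \<delta> j) x = first (capped \<delta> j) y" "first (capped \<delta> j) x <= horizon"
  using first_cong[where Q="capped \<delta> j" and k=horizon and x=x and y=y, OF dep xy' ex] by auto
 then show "skel \<delta> j x = skel \<delta> j y" unfolding skel_def using xy' by (auto intro!: lg_cong)
qed

lemma prefix_dep_incs: "prefix_dep horizon (incs \<delta> J)"
 unfolding prefix_dep_def
proof (intro allI impI)
 fix x y :: "nat => nat" assume "\<forall>m\<le>horizon. x m = y m"
 then have "skel \<delta> j x = skel \<delta> j y" for j by (intro prefix_depD[OF prefix_dep_skel]) simp
 then show "incs \<delta> J x = incs \<delta> J y" unfolding incs_def by presburger
qed

end

context inside_path begin

lemma K_le_horizon: "j <= J ==> K j <= horizon"
proof (cases "K j")
 case (Suc m)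
 moreover assume "j <= J"
 ultimately have "alive x m" using K_props(3)[of j m] by simp
 then show "K j <= horizon" using alive_less_horizon[of x m] Suc by simp
qed simp

lemma skel_eq: assumes "j <= J" shows "skel \<delta> j x = lg n x (K j)"
proof -
 have "(LEAST i. capped \<delta> j i x) = K j"
 proof (rule Least_equality)
  show "capped \<delta> j (K j) x" using K_props(1)[OF assms] by (simp add: capped_def)
  fix i assume "capped \<delta> j i x"
  then show "K j <= i" unfolding capped_def
  proof
   assume "reach \<delta> j i x" then show ?thesis unfolding first_def by (rule Least_le)
  qed (use K_le_horizon[OF assms] in simp)
 qed
 then show ?thesis by (simp add: skel_def first_def)
qed

lemma sum_incs: "j <= J ==> (\<Sum>i<j. incs \<delta> J x i) = lg n x (K j)"
proof (induction j)
 case 0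
 then show ?case by (simp add: K_0 lg_0)
next
 case (Suc j)
 then show ?case by (simp add: incs_def skel_eq)
qed

lemma sum_incs_weighted: "(\<Sum>j<J. l j * incs \<delta> J x j) = (\<Sum>j<J. l j * (lg n x (K (Suc j)) - lg n x (K j)))"
 by (rule sum.cong) (auto simp: incs_def skel_eq)

end

section \<open>Probability of paths that defeat the comparison\<close>

context chain begin

lemma inside_prob:
 assumes C: "0 <= C"
  and gen: "!!i y. abs(ln (real i) - ln (real n)) < A ==>
   abs(pmf_E (step i) (%j. sat ((y + (ln (real j) - ln (real i))) / A)) - sat (y / A)) <= C * (1 / a i)"
 shows "prob {w\<in>space M. exits (%i x. True) S A (path w)} <= 2 * C * (S + e)"
proof -
 have "prob {w\<in>space M. exits (%i x. True) S A (path w)} <= 2 * C * (S - 0 + e) * prob {w\<in>space M. \<exists>k<horizon. active (%i x. True) S A k (path w)}"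
  by (rule exit_prob[OF _ A C gen]) (use clk_mono[of 0] in "auto simp: prefix_dep_def")
 also have "... <= 2 * C * (S - 0 + e) * 1" using C S e by (intro mult_left_mono) auto
 finally show ?thesis by simp
qed

text \<open>A block lasts at most \<delta> + e <= 2 \<delta> on the clock, which gives 4 C \<delta>
  for one exit. The monitoring for a second exit starts only after a first one, so the bounds
  multiply.\<close>

lemma exits_reach_prob:
 assumes C: "0 <= C" and \<eta>: "0 < \<eta>" and \<delta>: "0 < \<delta>" "e <= \<delta>"
  and gen: "!!i y. abs(ln (real i) - ln (real n)) < A ==>
   abs(pmf_E (step i) (%j. sat ((y + (ln (real j) - ln (real i))) / \<eta>)) - sat (y / \<eta>)) <= C * (1 / a i)"
 shows "prob {w\<in>space M. exits (reach \<delta> j) (real (Suc j) * \<delta>) \<eta> (path w)} <= 4 * C * \<delta>"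
  and "prob {w\<in>space M. exits (jump \<delta> \<eta> j) (real (Suc j) * \<delta>) \<eta> (path w)} <= (4 * C * \<delta>)\<^sup>2"
proof -
 have d: "2 * C * (real (Suc j) * \<delta> - real j * \<delta> + e) <= 4 * C * \<delta>"
 proof -
  have "2 * C * (real (Suc j) * \<delta> - real j * \<delta> + e) = 2 * C * (\<delta> + e)" by (simp add: algebra_simps)
  also have "... <= 2 * C * (\<delta> + \<delta>)" using C \<delta> by (intro mult_left_mono) auto
  finally show ?thesis by simp
 qed
 have nn: "0 <= 2 * C * (real (Suc j) * \<delta> - real j * \<delta> + e)" using C \<delta> e by (simp add: algebra_simps)
 have "prob {w\<in>space M. exits (reach \<delta> j) (real (Suc j) * \<delta>) \<eta> (path w)}
  <= 2 * C * (real (Suc j) * \<delta> - real j * \<delta> + e) * prob {w\<in>space M. \<exists>k<horizon. active (reach \<delta> j) (real (Suc j) * \<delta>) \<eta> k (path w)}"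
  by (rule exit_prob[OF prefix_dep_reach \<eta> C gen]) (auto simp: reach_def)
 also have "... <= 2 * C * (real (Suc j) * \<delta> - real j * \<delta> + e) * 1" using nn by (intro mult_left_mono) auto
 finally show 1: "prob {w\<in>space M. exits (reach \<delta> j) (real (Suc j) * \<delta>) \<eta> (path w)} <= 4 * C * \<delta>" using d by linarith
 define q where "q = 2 * C * (real (Suc j) * \<delta> - real j * \<delta> + e)"
 define p where "p = prob {w\<in>space M. exits (reach \<delta> j) (real (Suc j) * \<delta>) \<eta> (path w)}"
 have q: "0 <= q" "q <= 4 * C * \<delta>" and p: "p <= 4 * C * \<delta>" "0 <= p" using d nn 1 by (simp_all add: q_def p_def)
 have "prob {w\<in>space M. \<exists>k<horizon. active (jump \<delta> \<eta> j) (real (Suc j) * \<delta>) \<eta> k (path w)} <= p"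
  unfolding p_def by (rule finite_measure_mono[OF _ prefix_dep_pred[OF prefix_dep_exits[OF prefix_dep_reach]]]) (use jump_active_exits in blast)
 then have *: "q * prob {w\<in>space M. \<exists>k<horizon. active (jump \<delta> \<eta> j) (real (Suc j) * \<delta>) \<eta> k (path w)} <= q * p"
  using q(1) by (rule mult_left_mono)
 have "prob {w\<in>space M. exits (jump \<delta> \<eta> j) (real (Suc j) * \<delta>) \<eta> (path w)}
  <= q * prob {w\<in>space M. \<exists>k<horizon. active (jump \<delta> \<eta> j) (real (Suc j) * \<delta>) \<eta> k (path w)}"
  unfolding q_def by (rule exit_prob[OF prefix_dep_jump \<eta> C gen]) (auto dest: jump_clk)
 also note *
 also have "q * p <= (4 * C * \<delta>) * (4 * C * \<delta>)" using q p by (intro mult_mono) linarith+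
 finally show "prob {w\<in>space M. exits (jump \<delta> \<eta> j) (real (Suc j) * \<delta>) \<eta> (path w)} <= (4 * C * \<delta>)\<^sup>2"
  unfolding power2_eq_square .
qed

text \<open>The third alternative, at least \<kappa> blocks with an exit, guards the real time: each
  such block may spoil it by a multiple of \<delta>.\<close>

definition bad :: "real => real => nat => real => (nat => nat) => bool" where
 "bad \<delta> \<eta> J \<kappa> x \<longleftrightarrow> exits (%i x. True) S A x \<or> (\<exists>j<J. exits (jump \<delta> \<eta> j) (real (Suc j) * \<delta>) \<eta> x) \<or>
  \<kappa> <= (\<Sum>j<J. of_bool (exits (reach \<delta> j) (real (Suc j) * \<delta>) \<eta> x))"

lemma exits_event: "(!!i. prefix_dep i (Q i)) ==> {w\<in>space M. exits Q \<beta> \<eta> (path w)} \<in> events"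
 by (rule prefix_dep_pred[OF prefix_dep_exits])

text \<open>With J \<delta> = S the double exits sum to J (4 C \<delta>)^2 = 16 C^2 S \<delta>. The
  mean number of blocks with an exit is at most 4 C S, and Markov's inequality divides it by
  \<kappa>.\<close>

lemma bad_prob:
 assumes C: "0 <= C" and \<eta>: "0 < \<eta>" and \<delta>: "0 < \<delta>" "e <= \<delta>" and J: "real J * \<delta> = S" and \<kappa>: "0 < \<kappa>"
  and gen: "!!i y. abs(ln (real i) - ln (real n)) < A ==>
   abs(pmf_E (step i) (%j. sat ((y + (ln (real j) - ln (real i))) / \<eta>)) - sat (y / \<eta>)) <= C * (1 / a i)"
 shows "{w\<in>space M. bad \<delta> \<eta> J \<kappa> (path w)} \<in> events"
  "prob {w\<in>space M. bad \<delta> \<eta> J \<kappa> (path w)} <= prob {w\<in>space M. exits (%i x. True) S A (path w)} + 16 * C\<^sup>2 * S * \<delta> + 4 * C * S / \<kappa>"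
proof -
 define E0 where "E0 = {w\<in>space M. exits (%i x. True) S A (path w)}"
 define E1 where "E1 j = {w\<in>space M. exits (jump \<delta> \<eta> j) (real (Suc j) * \<delta>) \<eta> (path w)}" for j
 define E2 where "E2 j = {w\<in>space M. exits (reach \<delta> j) (real (Suc j) * \<delta>) \<eta> (path w)}" for j
 have ev: "E0 \<in> events" "E1 j \<in> events" "E2 j \<in> events" for j
  unfolding E0_def E1_def E2_def using exits_event[OF prefix_dep_jump] exits_event[OF prefix_dep_reach] exits_event[of "%i x. True"]
  by (auto simp: prefix_dep_def)
 define f where "f w = (\<Sum>j<J. indicator (E2 j) w :: real)" for w
 have iE2: "integrable M (indicator (E2 j) :: _ => real)" for j
  by (rule integrable_real_indicator[OF ev(3)]) (simp add: emeasure_eq_measure)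
 have f_int: "integrable M f" unfolding f_def by (rule Bochner_Integration.integrable_sum) (rule iE2)
 define E3 where "E3 = {w\<in>space M. \<kappa> <= f w}"
 have ev3: "E3 \<in> events" unfolding E3_def using f_int by measurable
 have eq: "{w\<in>space M. bad \<delta> \<eta> J \<kappa> (path w)} = E0 \<union> (\<Union>j<J. E1 j) \<union> E3"
  unfolding bad_def E0_def E1_def E3_def f_def by (auto simp: E2_def indicator_def of_bool_def)
 show "{w\<in>space M. bad \<delta> \<eta> J \<kappa> (path w)} \<in> events" unfolding eq using ev ev3 by auto
 have "prob E3 <= expectation f / \<kappa>"
  unfolding E3_def by (rule integral_Markov_inequality_measure[OF f_int, of "space M" ]) (use \<kappa> in "auto simp: f_def sum_nonneg")
 also have "expectation f = (\<Sum>j<J. prob (E2 j))"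
  unfolding f_def Bochner_Integration.integral_sum[OF iE2] using ev(3) by simp
 also have "(\<Sum>j<J. prob (E2 j)) / \<kappa> <= (\<Sum>j<J. 4 * C * \<delta>) / \<kappa>"
  using \<kappa> exits_reach_prob(1)[OF C \<eta> \<delta> gen] by (intro divide_right_mono sum_mono) (auto simp: E2_def)
 also have "... = 4 * C * S / \<kappa>" by (simp add: J[symmetric])
 finally have 3: "prob E3 <= 4 * C * S / \<kappa>" .
 have "prob (\<Union>j<J. E1 j) <= (\<Sum>j<J. prob (E1 j))" using ev by (intro finite_measure_subadditive_finite) auto
 also have "... <= (\<Sum>j<J. (4 * C * \<delta>)\<^sup>2)" using exits_reach_prob(2)[OF C \<eta> \<delta> gen] by (intro sum_mono) (auto simp: E1_def)
 also have "... = 16 * C\<^sup>2 * S * \<delta>" by (simp add: J[symmetric] power2_eq_square)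
 finally have 2: "prob (\<Union>j<J. E1 j) <= 16 * C\<^sup>2 * S * \<delta>" .
 have "prob (E0 \<union> (\<Union>j<J. E1 j) \<union> E3) <= prob E0 + prob (\<Union>j<J. E1 j) + prob E3"
 proof -
  have U: "(\<Union>j<J. E1 j) \<in> events" using ev(2) by auto
  have "prob (E0 \<union> (\<Union>j<J. E1 j) \<union> E3) <= prob (E0 \<union> (\<Union>j<J. E1 j)) + prob E3" using ev(1) U ev3 by (intro measure_Un_le) auto
  moreover have "prob (E0 \<union> (\<Union>j<J. E1 j)) <= prob E0 + prob (\<Union>j<J. E1 j)" using ev(1) U by (intro measure_Un_le) auto
  ultimately show ?thesis by linarith
 qed
 then show "prob {w\<in>space M. bad \<delta> \<eta> J \<kappa> (path w)} <= prob {w\<in>space M. exits (%i x. True) S A (path w)} + 16 * C\<^sup>2 * S * \<delta> + 4 * C * S / \<kappa>"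
  unfolding eq using 2 3 unfolding E0_def by linarith
qed

end

section \<open>The exponential martingale of the chain\<close>

definition cell :: "(nat => real) => real => (nat => nat) => nat => nat" where
 "cell a \<delta> x i = nat \<lfloor>clk a x i / \<delta>\<rfloor>"

text \<open>The linear form of the skeleton increments, spread over single steps. The coefficient is
  read off the current clock cell, so it is known before the step is taken.\<close>

definition phase :: "(nat => real) => nat => real => (nat => real) => (nat => nat) => nat => real" where
 "phase a n \<delta> l x k = (\<Sum>i<k. l (cell a \<delta> x i) * (lg n x (Suc i) - lg n x i))"

text \<open>The integral of the coefficients against the clock; it is applied with the Levy
  exponents of the cells.\<close>

definition compensator :: "(nat => real) => real => (nat => complex) => (nat => nat) => nat => complex" where
 "compensator a \<delta> w x k = (\<Sum>i<k. w (cell a \<delta> x i) / of_real (a (x i)))"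

text \<open>Up to the error of the one-step expansion this is a martingale.\<close>

definition mart :: "(nat => real) => nat => real => (nat => real) => (nat => complex) => (nat => nat) => nat => complex" where
 "mart a n \<delta> l w x k = cis (phase a n \<delta> l x k) * exp (- compensator a \<delta> w x k)"

lemma cell_cong: "(!!i. i <= k ==> x i = y i) ==> i <= k ==> cell a \<delta> x i = cell a \<delta> y i"
 unfolding cell_def clk_def by (auto intro!: arg_cong[where f="%u. nat \<lfloor>u / \<delta>\<rfloor>"] sum.cong)

lemma mart_cong:
 assumes "!!i. i <= k ==> x i = y i" shows "mart a n \<delta> l w x k = mart a n \<delta> l w y k"
proof -
 have c: "cell a \<delta> x i = cell a \<delta> y i" if "i < k" for i
  using cell_cong[of k x y i a \<delta>] assms that by simp
 have "phase a n \<delta> l x k = phase a n \<delta> l y k"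
  unfolding phase_def lg_def by (rule sum.cong) (use assms c in auto)
 moreover have "compensator a \<delta> w x k = compensator a \<delta> w y k"
  unfolding compensator_def by (rule sum.cong) (use assms c in auto)
 ultimately show ?thesis by (simp add: mart_def)
qed

context box begin

lemma compensator_le:
 assumes "!!j. cmod (w j) <= B" shows "cmod (compensator a \<delta> w x k) <= B * clk a x k"
proof -
 have "cmod (compensator a \<delta> w x k) <= (\<Sum>i<k. cmod (w (cell a \<delta> x i) / of_real (a (x i))))"
  unfolding compensator_def by (rule norm_sum)
 also have "... <= (\<Sum>i<k. B * (1 / a (x i)))"
 proof (rule sum_mono)
  fix i
  have "cmod (w (cell a \<delta> x i)) / a (x i) <= B / a (x i)"
   using assms a_pos[of "x i"] by (intro divide_right_mono) auto
  then show "cmod (w (cell a \<delta> x i) / of_real (a (x i))) <= B * (1 / a (x i))"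
   using a_pos[of "x i"] by (simp add: norm_divide)
 qed
 finally show ?thesis by (simp add: clk_def sum_distrib_left)
qed

lemma mart_le:
 assumes "!!j. cmod (w j) <= B" shows "cmod (mart a n \<delta> l w x k) <= exp (B * clk a x k)"
proof -
 have "cmod (mart a n \<delta> l w x k) = cmod (exp (- compensator a \<delta> w x k))" by (simp add: mart_def norm_mult)
 also have "... <= exp (cmod (- compensator a \<delta> w x k))" by (rule norm_exp)
 also have "... <= exp (B * clk a x k)" using compensator_le[of w B \<delta> x k] assms by simp
 finally show ?thesis .
qed

lemma mart_telescope:
 "(\<Sum>k<horizon. of_bool (alive x k) * (mart a n \<delta> l w x (Suc k) - mart a n \<delta> l w x k)) =
  (if EX k. alive x k then mart a n \<delta> l w x (Suc (Max {k. alive x k})) - 1 else 0)"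
proof -
 have "(\<Sum>k<horizon. of_bool (alive x k) * (mart a n \<delta> l w x (Suc k) - mart a n \<delta> l w x k)) =
  (if EX k. alive x k then mart a n \<delta> l w x (Suc (Max {k. alive x k})) - mart a n \<delta> l w x 0 else 0)"
  by (rule interval_telescope[where u=0]) (use alive_less_horizon alive_antimono in blast)+
 then show ?thesis by (simp add: mart_def phase_def compensator_def)
qed

lemma mart_sum_le:
 assumes w: "!!j. cmod (w j) <= B" and B: "0 <= B"
 shows "cmod (\<Sum>k<horizon. of_bool (alive x k) * (mart a n \<delta> l w x (Suc k) - mart a n \<delta> l w x k)) <= exp (B * (S + e)) + 1"
proof (cases "EX k. alive x k")
 case True
 have fin: "finite {k. alive x k}" by (rule finite_subset[of _ "{..<horizon}"]) (use alive_less_horizon in auto)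
 define v where "v = Max {k. alive x k}"
 have v: "alive x v" using Max_in[OF fin] True by (auto simp: v_def)
 have "clk a x (Suc v) <= S + e" using v alive_inv_a(1)[OF v] clk_Suc[of a x v] by (simp add: alive_def)
 then have "exp (B * clk a x (Suc v)) <= exp (B * (S + e))" using B by (simp add: mult_left_mono)
 then have "cmod (mart a n \<delta> l w x (Suc v)) <= exp (B * (S + e))" using mart_le[of w B \<delta> l x "Suc v", OF w] by linarith
 then have "cmod (mart a n \<delta> l w x (Suc v) - 1) <= exp (B * (S + e)) + 1"
  using norm_triangle_ineq4[of "mart a n \<delta> l w x (Suc v)" 1] by simp
 then show ?thesis using True unfolding mart_telescope v_def by simp
next
 case False
 have "0 <= exp (B * (S + e)) + 1" by (intro add_nonneg_nonneg) auto
 then show ?thesis unfolding mart_telescope if_not_P[OF False] by simp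
qed

end

context inside_path begin

lemma cell_block: assumes "j < J" "K j <= i" "i < K (Suc j)" shows "cell a \<delta> x i = j"
proof -
 have "real j * \<delta> <= clk a x (K j)" using K_props(1)[of j] assms by (simp add: reach_def)
 also have "... <= clk a x i" using assms by (intro clk_mono)
 finally have "real j <= clk a x i / \<delta>" using delta by (simp add: le_divide_eq)
 moreover have "clk a x i / \<delta> < real (Suc j)" using block_alive[OF assms] delta by (simp add: divide_less_eq)
 ultimately have "\<lfloor>clk a x i / \<delta>\<rfloor> = int j" by (simp add: floor_eq_iff)
 then show ?thesis by (simp add: cell_def)
qed

lemma sum_blocks:
 fixes g :: "nat => 'c::comm_monoid_add"
 assumes "j <= J" shows "(\<Sum>i<K j. g i) = (\<Sum>i<j. \<Sum>k\<in>{K i..<K (Suc i)}. g k)"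
 using assms
proof (induction j)
 case (Suc j)
 have "K j <= K (Suc j)" using K_less[of j] Suc.prems by simp
 then have "{..<K (Suc j)} = {..<K j} \<union> {K j..<K (Suc j)}" by auto
 then have "(\<Sum>i<K (Suc j). g i) = (\<Sum>i<K j. g i) + (\<Sum>i\<in>{K j..<K (Suc j)}. g i)"
  by (simp add: sum.union_disjoint ivl_disj_int)
 then show ?case using Suc by simp
qed (simp add: K_0)

lemma phase_K: "phase a n \<delta> l x (K J) = (\<Sum>j<J. l j * incs \<delta> J x j)"
proof -
 have "phase a n \<delta> l x (K J) = (\<Sum>j<J. \<Sum>i\<in>{K j..<K (Suc j)}. l (cell a \<delta> x i) * (lg n x (Suc i) - lg n x i))"
  unfolding phase_def by (rule sum_blocks) simp
 also have "... = (\<Sum>j<J. l j * (lg n x (K (Suc j)) - lg n x (K j)))"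
 proof (rule sum.cong[OF refl])
  fix j assume "j \<in> {..<J}"
  then have j: "j < J" by simp
  have "(\<Sum>i\<in>{K j..<K (Suc j)}. l (cell a \<delta> x i) * (lg n x (Suc i) - lg n x i)) = (\<Sum>i\<in>{K j..<K (Suc j)}. l j * (lg n x (Suc i) - lg n x i))"
   by (rule sum.cong) (use cell_block[OF j] in auto)
  also have "... = l j * (\<Sum>i\<in>{K j..<K (Suc j)}. lg n x (Suc i) - lg n x i)" by (rule sum_distrib_left[symmetric])
  also have "(\<Sum>i\<in>{K j..<K (Suc j)}. lg n x (Suc i) - lg n x i) = lg n x (K (Suc j)) - lg n x (K j)"
   by (rule sum_Suc_diff') (use K_less[OF j] in simp)
  finally show "(\<Sum>i\<in>{K j..<K (Suc j)}. l (cell a \<delta> x i) * (lg n x (Suc i) - lg n x i)) = l j * (lg n x (K (Suc j)) - lg n x (K j))" .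
 qed
 finally show ?thesis by (simp only: sum_incs_weighted)
qed

text \<open>Each block has clock length \<delta> up to e, so replacing the true compensator by the
  deterministic one costs at most B e per block.\<close>

lemma compensator_K:
 assumes w: "!!j. cmod (w j) <= B"
 shows "cmod ((\<Sum>j<J. of_real \<delta> * w j) - compensator a \<delta> w x (K J)) <= real J * (B * e)"
proof -
 have B: "0 <= B" using w[of 0] norm_ge_zero[of "w 0"] by linarith
 have "compensator a \<delta> w x (K J) = (\<Sum>j<J. \<Sum>i\<in>{K j..<K (Suc j)}. w (cell a \<delta> x i) / of_real (a (x i)))"
  unfolding compensator_def by (rule sum_blocks) simp
 also have "... = (\<Sum>j<J. of_real (\<Sum>i\<in>{K j..<K (Suc j)}. 1 / a (x i)) * w j)"
 proof (rule sum.cong[OF refl])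
  fix j assume "j \<in> {..<J}"
  then have j: "j < J" by simp
  have "(\<Sum>i\<in>{K j..<K (Suc j)}. w (cell a \<delta> x i) / of_real (a (x i))) = (\<Sum>i\<in>{K j..<K (Suc j)}. of_real (1 / a (x i)) * w j)"
   by (rule sum.cong) (use cell_block[OF j] in auto)
  then show "(\<Sum>i\<in>{K j..<K (Suc j)}. w (cell a \<delta> x i) / of_real (a (x i))) = of_real (\<Sum>i\<in>{K j..<K (Suc j)}. 1 / a (x i)) * w j"
   by (simp only: sum_distrib_right of_real_sum)
 qed
 finally have "(\<Sum>j<J. of_real \<delta> * w j) - compensator a \<delta> w x (K J) =
   (\<Sum>j<J. of_real (\<delta> - (\<Sum>i\<in>{K j..<K (Suc j)}. 1 / a (x i))) * w j)"
  by (simp only: sum_subtractf[symmetric] of_real_diff left_diff_distrib)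
 also have "cmod ... <= (\<Sum>j<J. B * e)"
 proof (rule order_trans[OF norm_sum], rule sum_mono)
  fix j assume "j \<in> {..<J}"
  then have j: "j < J" by simp
  have "abs(\<delta> - (\<Sum>i\<in>{K j..<K (Suc j)}. 1 / a (x i))) * cmod (w j) <= e * B"
   by (rule mult_mono) (use block_duration(1)[OF j] w[of j] e in "auto simp: abs_minus_commute")
  then show "cmod (of_real (\<delta> - (\<Sum>i\<in>{K j..<K (Suc j)}. 1 / a (x i))) * w j) <= B * e"
   unfolding norm_mult norm_of_real by (simp only: mult.commute)
 qed
 finally show ?thesis by simp
qed

text \<open>On a path inside the box the steps counted in the sum are exactly those before
  \<open>K J\<close>.\<close>

lemma mart_K: "1 + (\<Sum>k<horizon. of_bool (alive x k) * (mart a n \<delta> l w x (Suc k) - mart a n \<delta> l w x k)) = mart a n \<delta> l w x (K J)"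
proof -
 have r: "S <= clk a x (K J)" using K_props(1)[of J] by (simp add: reach_def S_eq)
 have "K J ~= 0"
 proof
  assume "K J = 0"
  then show False using r S by (simp only: clk_0)
 qed
 then obtain m where m: "K J = Suc m" by (cases "K J") auto
 have eq: "{k. alive x k} = {..m}"
 proof (intro set_eqI iffI)
  fix k assume "k \<in> {k. alive x k}"
  then have "clk a x k < clk a x (K J)" using r alive_iff[of k] by simp
  then show "k \<in> {..m}" using clk_mono[of "K J" k x] m by (cases "k <= m") auto
 next
  fix k assume "k \<in> {..m}"
  then show "k \<in> {k. alive x k}" using K_props(3)[of J k] m by simp
 qed
 have "EX k. alive x k" using eq by auto
 moreover have "Max {k. alive x k} = m" unfolding eq by (rule Max_eqI) auto
 ultimately show ?thesis unfolding mart_telescope m by simp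
qed

lemma skeleton_mart_close:
 assumes w: "!!j. cmod (w j) <= B"
 shows "cmod (cis (\<Sum>j<J. l j * incs \<delta> J x j) - exp (\<Sum>j<J. of_real \<delta> * w j) * mart a n \<delta> l w x (K J))
  <= exp (real J * (B * e)) * (real J * (B * e))"
proof -
 define z where "z = (\<Sum>j<J. of_real \<delta> * w j) - compensator a \<delta> w x (K J)"
 have z: "cmod z <= real J * (B * e)" unfolding z_def by (rule compensator_K[OF w])
 have "cis (\<Sum>j<J. l j * incs \<delta> J x j) - exp (\<Sum>j<J. of_real \<delta> * w j) * mart a n \<delta> l w x (K J)
  = cis (\<Sum>j<J. l j * incs \<delta> J x j) * (1 - exp z)"
  by (simp add: mart_def phase_K z_def exp_diff exp_minus right_diff_distrib divide_inverse mult_ac)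
 then have "cmod (cis (\<Sum>j<J. l j * incs \<delta> J x j) - exp (\<Sum>j<J. of_real \<delta> * w j) * mart a n \<delta> l w x (K J)) = cmod (exp z - 1)"
  by (simp add: norm_mult norm_minus_commute)
 also have "... <= exp (cmod z) * cmod z" by (rule cmod_exp_minus_1)
 also have "... <= exp (real J * (B * e)) * (real J * (B * e))" using z by (intro mult_mono) auto
 finally show ?thesis .
qed

end

context chain begin

text \<open>With V the deterministic compensator, the exponential of the skeleton equals e^V times
  the stopped martingale up to the overshoot error, except when the box is left, where crude bounds
  give the last term. The mean of the stopped martingale is close to 1, because each step has mean
  error proportional to its clock cost and the total cost is at most S + e.\<close>

lemma skeleton_cf:
 assumes x0: "AE q in M. X 0 q = n"
  and \<delta>: "0 < \<delta>" "e <= \<delta>" and J: "real J * \<delta> = S"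
  and w: "!!j. cmod (w j) <= B" and Be: "B * e <= 1" and eps: "0 <= eps"
  and cf: "!!i j. abs(ln (real i) - ln (real n)) < A ==>
   cmod (pmf_E (step i) (%m. cis (l j * (ln (real m) - ln (real i)))) - 1 - w j / of_real (a i)) <= eps * (1 / a i)"
 shows "cmod (expectation (%q. cis (\<Sum>j<J. l j * incs \<delta> J (path q) j)) - exp (\<Sum>j<J. of_real \<delta> * w j)) <=
  exp (real J * (B * e)) * (real J * (B * e)) + exp (B * S) * (3 * exp (B * S) * (eps + 3 * B\<^sup>2 * e) * (S + e))
  + (1 + exp (B * S) * (2 + exp (B * (S + e)))) * prob {q\<in>space M. exits (%i x. True) S A (path q)}"
proof -
 have B: "0 <= B" using w[of 0] norm_ge_zero[of "w 0"] by linarith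
 define V where "V = (\<Sum>j<J. of_real \<delta> * w j)"
 have V: "cmod (exp V) <= exp (B * S)"
 proof -
  have "cmod V <= (\<Sum>j<J. \<delta> * B)"
   unfolding V_def using w \<delta> by (intro order_trans[OF norm_sum] sum_mono) (auto simp: norm_mult)
  also have "... = B * S" by (simp add: J[symmetric])
  finally show ?thesis using norm_exp[of V] by (meson exp_le_cancel_iff order_trans)
 qed
 define G where "G k x m = of_bool (alive x k) * (mart a n \<delta> l w x k *
  (cis (l (cell a \<delta> x k) * (ln (real m) - ln (real (x k)))) * exp (- (w (cell a \<delta> x k) / of_real (a (x k)))) - 1))" for k x and m :: nat
 define Inc where "Inc k x = of_bool (alive x k) * (mart a n \<delta> l w x (Suc k) - mart a n \<delta> l w x k)" for k x
 have G_Inc: "G k x (x (Suc k)) = Inc k x" for k x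
 proof -
  have "mart a n \<delta> l w x (Suc k) = mart a n \<delta> l w x k * (cis (l (cell a \<delta> x k) * (lg n x (Suc k) - lg n x k)) * exp (- (w (cell a \<delta> x k) / of_real (a (x k)))))"
   by (simp add: mart_def phase_def compensator_def cis_mult[symmetric] exp_add[symmetric] mult_ac) (simp add: exp_diff exp_minus divide_inverse mult_ac exp_add)
  then show ?thesis unfolding G_def Inc_def by (simp add: lg_def right_diff_distrib)
 qed
 have G_dep: "prefix_dep k (G k)" for k
  unfolding prefix_dep_def
 proof (intro allI impI ext)
  fix x y :: "nat => nat" and m assume xy: "\<forall>i\<le>k. x i = y i"
  have "alive x k = alive y k" by (rule alive_cong) (use xy in auto)
  moreover have "mart a n \<delta> l w x k = mart a n \<delta> l w y k" by (rule mart_cong) (use xy in auto)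
  moreover have "cell a \<delta> x k = cell a \<delta> y k" by (rule cell_cong[where k=k]) (use xy in auto)
  moreover have "x k = y k" using xy by simp
  ultimately show "G k x m = G k y m" unfolding G_def by simp
 qed
 have small: "cmod (w j / of_real (a (x k))) <= B * (1 / a (x k))" "B * (1 / a (x k)) <= B * e" if al: "alive x k" for x k j
 proof -
  have "cmod (w j) / a (x k) <= B / a (x k)" using w a_pos[of "x k"] by (intro divide_right_mono) auto
  then show "cmod (w j / of_real (a (x k))) <= B * (1 / a (x k))" using a_pos[of "x k"] by (simp add: norm_divide)
  show "B * (1 / a (x k)) <= B * e" using alive_inv_a(1)[OF al] B by (rule mult_left_mono)
 qed
 have mart_alive: "cmod (mart a n \<delta> l w x k) <= exp (B * S)" if al: "alive x k" for x k
 proof -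
  have "exp (B * clk a x k) <= exp (B * S)" using al B by (simp add: alive_def mult_left_mono)
  then show ?thesis using mart_le[of w B \<delta> l x k, OF w] by linarith
 qed
 have exp3: "cmod (exp (- (w j / of_real (a (x k))))) <= 3" if al: "alive x k" for x k j
 proof -
  have "cmod (exp (- (w j / of_real (a (x k))))) <= exp (cmod (- (w j / of_real (a (x k)))))" by (rule norm_exp)
  also have "... <= exp 1" using small(1)[OF al, of j] small(2)[OF al] Be by simp
  finally show ?thesis using exp_le by linarith
 qed
 have G_bnd: "cmod (G k x m) <= exp (B * S) * 4" for k x m
 proof (cases "alive x k")
  case True
  have "cmod (cis (l (cell a \<delta> x k) * (ln (real m) - ln (real (x k)))) * exp (- (w (cell a \<delta> x k) / of_real (a (x k)))) - 1) <= 3 + 1"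
   by (rule order_trans[OF norm_triangle_ineq4]) (use exp3[OF True] in "simp add: norm_mult")
  then show ?thesis using True mart_alive[OF True] unfolding G_def by (simp add: norm_mult mult_mono)
 qed (simp add: G_def)
 define W where "W k x = of_bool (alive x k) * (1 / a (x k))" for k x
 have W_dep: "prefix_dep k (W k)" for k
  unfolding prefix_dep_def
 proof (intro allI impI)
  fix x y :: "nat => nat" assume xy: "\<forall>i\<le>k. x i = y i"
  have "alive x k = alive y k" by (rule alive_cong) (use xy in auto)
  then show "W k x = W k y" using xy by (simp add: W_def)
 qed
 have W_bnd: "abs(W k x) <= e" for k x
  using alive_inv_a(1)[of x k] a_pos[of "x k"] e by (auto simp: W_def)
 have W_int: "integrable M (%q. W k (path q))" for k
  by (rule prefix_dep_integrable[OF W_dep, where B=e]) (use W_bnd in simp)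
 define c1 where "c1 = 3 * exp (B * S) * (eps + 3 * B\<^sup>2 * e)"
 have c1: "0 <= c1" unfolding c1_def using eps e by (intro mult_nonneg_nonneg add_nonneg_nonneg) auto
 have G_mean: "cmod (pmf_E (step (x k)) (G k x)) <= c1 * W k x" for k x
 proof (cases "alive x k")
  case True
  define j where "j = cell a \<delta> x k"
  define \<psi> where "\<psi> = w j / of_real (a (x k))"
  define \<phi> where "\<phi> = pmf_E (step (x k)) (%m. cis (l j * (ln (real m) - ln (real (x k)))))"
  have box: "abs(ln (real (x k)) - ln (real n)) < A" using True unfolding alive_def lg_def by auto
  have int: "integrable (step (x k)) (%m. cis (l j * (ln (real m) - ln (real (x k)))))"
   by (rule measure_pmf.integrable_const_bound[where B=1]) auto
  have Gx: "G k x = (%m. mart a n \<delta> l w x k * (cis (l j * (ln (real m) - ln (real (x k)))) * exp (- \<psi>) - 1))"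
   by (intro ext) (simp add: G_def True j_def \<psi>_def)
  have "pmf_E (step (x k)) (G k x) = mart a n \<delta> l w x k * (\<phi> * exp (- \<psi>) - 1)"
   unfolding Gx \<phi>_def using int by (simp add: Bochner_Integration.integral_diff)
  \<comment> \<open>Both \<phi> and e^\<psi> are compared with 1 + \<psi>: the first bracket is the
    assumed one-step error, the second is quadratic in 1 / a, and one of these factors is at most
    e.\<close>
  also have "\<phi> * exp (- \<psi>) - 1 = exp (- \<psi>) * ((\<phi> - 1 - \<psi>) - (exp \<psi> - 1 - \<psi>))"
   by (simp add: right_diff_distrib exp_minus mult.commute)
  finally have eq: "pmf_E (step (x k)) (G k x) = mart a n \<delta> l w x k * (exp (- \<psi>) * ((\<phi> - 1 - \<psi>) - (exp \<psi> - 1 - \<psi>)))" .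
  have a1: "cmod (\<phi> - 1 - \<psi>) <= eps * (1 / a (x k))" unfolding \<phi>_def \<psi>_def by (rule cf[OF box])
  have p: "cmod \<psi> <= B * (1 / a (x k))" "B * (1 / a (x k)) <= B * e" unfolding \<psi>_def by (rule small[OF True])+
  have "cmod (exp \<psi> - 1 - \<psi>) <= 3 * (cmod \<psi>)\<^sup>2" by (rule cmod_exp_minus_1_minus) (use p Be in linarith)
  also have "(cmod \<psi>)\<^sup>2 <= (B * (1 / a (x k))) * (B * e)" unfolding power2_eq_square using p B a_pos[of "x k"] by (intro mult_mono) auto
  finally have a2: "cmod (exp \<psi> - 1 - \<psi>) <= 3 * B\<^sup>2 * e * (1 / a (x k))" by (simp add: power2_eq_square mult_ac)
  have "cmod ((\<phi> - 1 - \<psi>) - (exp \<psi> - 1 - \<psi>)) <= (eps + 3 * B\<^sup>2 * e) * (1 / a (x k))"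
   unfolding distrib_right by (rule order_trans[OF norm_triangle_ineq4 add_mono[OF a1 a2]])
  then have "cmod (exp (- \<psi>) * ((\<phi> - 1 - \<psi>) - (exp \<psi> - 1 - \<psi>))) <= 3 * ((eps + 3 * B\<^sup>2 * e) * (1 / a (x k)))"
   unfolding norm_mult by (rule mult_mono[rotated]) (use exp3[OF True, of j] in "auto simp: \<psi>_def")
  then have "cmod (pmf_E (step (x k)) (G k x)) <= exp (B * S) * (3 * ((eps + 3 * B\<^sup>2 * e) * (1 / a (x k))))"
   unfolding eq norm_mult[of "mart a n \<delta> l w x k"] by (rule mult_mono[rotated]) (use mart_alive[OF True] in auto)
  also have "exp (B * S) * (3 * ((eps + 3 * B\<^sup>2 * e) * (1 / a (x k)))) = c1 * (1 / a (x k))"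
   unfolding c1_def by (simp only: mult_ac)
  finally show ?thesis using True by (simp only: W_def of_bool_eq(2) mult_1)
 next
  case False
  then have "G k x = (%m. 0)" by (intro ext) (simp add: G_def)
  then show ?thesis using False by (simp add: W_def)
 qed
 have Inc_dep: "prefix_dep (Suc k) (Inc k)" for k
  unfolding prefix_dep_def
 proof (intro allI impI)
  fix x y :: "nat => nat" assume xy: "\<forall>i\<le>Suc k. x i = y i"
  have "G k x = G k y" by (rule prefix_depD[OF G_dep]) (use xy in auto)
  moreover have "x (Suc k) = y (Suc k)" using xy by simp
  ultimately show "Inc k x = Inc k y" unfolding G_Inc[symmetric] by simp
 qed
 have Inc_int: "integrable M (%q. Inc k (path q))" for k
 proof (rule prefix_dep_integrable[OF Inc_dep, where B="exp (B * S) * 4"])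
  show "cmod (Inc k x) <= exp (B * S) * 4" for x unfolding G_Inc[symmetric] by (rule G_bnd)
 qed
 define m where "m q = (\<Sum>k<horizon. Inc k (path q))" for q
 have m_int: "integrable M m" unfolding m_def by (rule Bochner_Integration.integrable_sum) (rule Inc_int)
 have mean_k: "cmod (expectation (%q. Inc k (path q))) <= c1 * expectation (%q. W k (path q))" for k
 proof -
  have "expectation (%q. Inc k (path q)) = expectation (%q. pmf_E (step (path q k)) (G k (path q)))"
   using one_step_complex[OF G_dep G_bnd, of k] by (simp only: G_Inc[symmetric] path_def)
  also have "cmod ... <= expectation (%q. cmod (pmf_E (step (path q k)) (G k (path q))))" by (rule integral_norm_bound)
  also have "... <= expectation (%q. c1 * W k (path q))"
  proof (rule integral_mono)
   have dep: "prefix_dep k (%x. cmod (pmf_E (step (x k)) (G k x)))"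
    unfolding prefix_dep_def
   proof (intro allI impI)
    fix x y :: "nat => nat" assume xy: "\<forall>i\<le>k. x i = y i"
    have "G k x = G k y" by (rule prefix_depD[OF G_dep]) (use xy in auto)
    then show "cmod (pmf_E (step (x k)) (G k x)) = cmod (pmf_E (step (y k)) (G k y))" using xy by simp
   qed
   have bnd: "norm (cmod (pmf_E (step (x k)) (G k x))) <= c1 * e" for x
   proof -
    have "c1 * W k x <= c1 * e" using W_bnd[of k x] c1 by (intro mult_left_mono) auto
    then show ?thesis using G_mean[of x k] by simp
   qed
   show "integrable M (%q. cmod (pmf_E (step (path q k)) (G k (path q))))"
    by (rule prefix_dep_integrable[OF dep bnd])
   show "integrable M (%q. c1 * W k (path q))" by (rule integrable_mult_right[OF W_int])
  qed (rule G_mean)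
  finally show ?thesis by simp
 qed
 have mean_m: "cmod (expectation m) <= c1 * (S + e)"
 proof -
  have "cmod (expectation m) <= (\<Sum>k<horizon. cmod (expectation (%q. Inc k (path q))))"
   unfolding m_def Bochner_Integration.integral_sum[OF Inc_int] by (rule norm_sum)
  also have "... <= (\<Sum>k<horizon. c1 * expectation (%q. W k (path q)))" by (rule sum_mono) (rule mean_k)
  also have "... = c1 * expectation (%q. \<Sum>k<horizon. W k (path q))"
   unfolding Bochner_Integration.integral_sum[OF W_int] by (rule sum_distrib_left[symmetric])
  also have "... <= c1 * expectation (%q. S + e)"
  proof (rule mult_left_mono[OF integral_mono c1])
   show "integrable M (%q. \<Sum>k<horizon. W k (path q))" by (rule Bochner_Integration.integrable_sum) (rule W_int)
   show "(\<Sum>k<horizon. W k (path q)) <= S + e" for q unfolding W_def by (rule alive_clock_sum)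
  qed simp
  finally show ?thesis by (simp add: prob_space)
 qed
 define D where "D q = cis (\<Sum>j<J. l j * incs \<delta> J (path q) j)" for q
 have D_int: "integrable M D"
 proof -
  have "prefix_dep horizon (%x. cis (\<Sum>j<J. l j * incs \<delta> J x j))"
   using prefix_dep_incs[of \<delta> J] unfolding prefix_dep_def by metis
  then show ?thesis unfolding D_def by (rule prefix_dep_integrable[where B=1]) simp
 qed
 define E where "E = {q\<in>space M. exits (%i x. True) S A (path q)}"
 have E: "E \<in> events" unfolding E_def by (rule exits_event) (simp add: prefix_dep_def)
 define c0 where "c0 = exp (real J * (B * e)) * (real J * (B * e))"
 define c2 where "c2 = 1 + exp (B * S) * (2 + exp (B * (S + e)))"
 have c0: "0 <= c0" "0 <= c2" unfolding c0_def c2_def using B e by (auto intro!: add_nonneg_nonneg mult_nonneg_nonneg)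
 \<comment> \<open>Paths inside the box satisfy the pathwise comparison; on E the constant c2 bounds
   both quantities separately.\<close>
 have pw: "AE q in M. cmod (D q - exp V * (1 + m q)) <= c0 + c2 * indicator E q"
  using x0 AE_space
 proof eventually_elim
  case (elim q)
  show ?case
  proof (cases "exits (%i x. True) S A (path q)")
   case False
   interpret inside_path a n A S e c \<delta> J "path q"
    by unfold_locales (use \<delta> J False elim in "auto simp: path_def")
   have "1 + m q = mart a n \<delta> l w (path q) (K J)" unfolding m_def Inc_def by (rule mart_K)
   then have "cmod (D q - exp V * (1 + m q)) <= c0" unfolding D_def V_def c0_def using skeleton_mart_close[OF w] by simp
   also have "c0 <= c0 + c2 * indicator E q" using c0(2) by (simp add: indicator_def)
   finally show ?thesis .
  next
   case True
   have "cmod (m q) <= exp (B * (S + e)) + 1" unfolding m_def Inc_def by (rule mart_sum_le[OF w B])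
   then have "cmod (1 + m q) <= 2 + exp (B * (S + e))" using norm_triangle_ineq[of 1 "m q"] by simp
   then have "cmod (exp V * (1 + m q)) <= exp (B * S) * (2 + exp (B * (S + e)))"
    unfolding norm_mult using V by (intro mult_mono) auto
   then have "cmod (D q - exp V * (1 + m q)) <= c2"
    using norm_triangle_ineq4[of "D q" "exp V * (1 + m q)"] by (simp add: D_def c2_def)
   moreover have "q \<in> E" using True elim(2) by (simp add: E_def)
   ultimately show ?thesis using c0 by simp
  qed
 qed
 have "expectation D - exp V = expectation (%q. D q - exp V * (1 + m q)) + exp V * expectation m"
  using D_int m_int by (simp add: distrib_left prob_space)
 then have "cmod (expectation D - exp V) <= cmod (expectation (%q. D q - exp V * (1 + m q))) + cmod (exp V) * cmod (expectation m)"
  using norm_triangle_ineq[of "expectation (%q. D q - exp V * (1 + m q))" "exp V * expectation m"] by (simp only: norm_mult)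
 moreover have "cmod (exp V) * cmod (expectation m) <= exp (B * S) * (c1 * (S + e))"
  using V mean_m by (intro mult_mono) auto
 moreover have "cmod (expectation (%q. D q - exp V * (1 + m q))) <= c0 + c2 * prob E"
 proof -
  have "integrable M (%q. D q - exp V * (1 + m q))" using D_int m_int by simp
  then have iN: "integrable M (%q. cmod (D q - exp V * (1 + m q)))" by (rule integrable_norm)
  have iE: "integrable M (%q. c0 + c2 * indicator E q)"
   by (rule Bochner_Integration.integrable_add, simp, rule integrable_mult_right, rule integrable_real_indicator[OF E]) (simp add: emeasure_eq_measure)
  have "cmod (expectation (%q. D q - exp V * (1 + m q))) <= expectation (%q. cmod (D q - exp V * (1 + m q)))" by (rule integral_norm_bound)
  also have "... <= expectation (%q. c0 + c2 * indicator E q)" by (rule integral_mono_AE[OF iN iE pw])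
  also have "... = c0 + c2 * prob E"
  proof -
   have "integrable M (%q. c2 * indicator E q)"
    by (rule integrable_mult_right, rule integrable_real_indicator[OF E]) (simp add: emeasure_eq_measure)
   then show ?thesis unfolding integral_cmult_indicator[OF E, symmetric] by (subst Bochner_Integration.integral_add) (auto simp: prob_space)
  qed
  finally show ?thesis .
 qed
 ultimately have "cmod (expectation D - exp V) <= c0 + exp (B * S) * (c1 * (S + e)) + c2 * prob E" by linarith
 then show ?thesis unfolding D_def V_def c0_def c1_def c2_def E_def by simp
qed

end

section \<open>The scaling limit\<close>

text \<open>The lower edge of the box moves to infinity with n, so what holds for all large states
  holds throughout the box.\<close>

lemma eventually_log_box:
 assumes "EV i. P i"
 shows "EV n. ALL i. abs(ln (real i) - ln (real n)) < A --> P i"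
proof -
 obtain i0 where i0: "!!i. i0 <= i ==> P i" using assms unfolding eventually_sequentially by blast
 have "filterlim (%n::nat. ln (real n)) at_top sequentially"
  by (rule filterlim_compose[OF ln_at_top filterlim_real_sequentially])
 \<comment> \<open>As \<open>ln 0 = 0\<close>, the maximum with 0 is what excludes the state i =
   0.\<close>
 then have "EV n. max 0 (ln (real i0)) + A <= ln (real n)"
  unfolding filterlim_at_top by blast
 then show ?thesis
 proof eventually_elim
  case (elim n)
  show ?case
  proof (intro allI impI)
   fix i assume i: "abs(ln (real i) - ln (real n)) < A"
   have lt: "max 0 (ln (real i0)) < ln (real i)" using i elim by linarith
   then have i1: "0 < i" by (cases "i = 0") auto
   show "P i"
   proof (rule i0, cases "i0 = 0")
    case False
    have "ln (real i0) < ln (real i)" using lt by simp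
    then show "i0 <= i" using False i1 by simp
   qed simp
  qed
 qed
qed

lemma (in markov) start: assumes "prob_space M" shows "AE u in M. X 0 u = n"
proof -
 have "prob {u\<in>space M. X 0 u = n} = 1" using law[of 0 "%_. n"] by simp
 then show ?thesis by (subst prob_Collect_eq_1[symmetric]) auto
qed

text \<open>A transition from a positive state into 0 has probability 0, and countably many null
  sets are united. On such paths the exponential of \<open>lg\<close> recovers the scaled
  chain.\<close>

lemma (in markov) positive:
 assumes n: "1 <= n" and step: "!!i. 1 <= i ==> 0 \<notin> set_pmf (step i)"
 shows "AE u in M. ALL k. 0 < X k u"
proof -
 have "AE u in M. 0 < X k u" for k
 proof (induction k)
  case 0
  show ?case using start[OF prob] by eventually_elim (use n in simp)
 next
  case (Suc k)
  define G where "G x j = (of_bool (0 < x k & j = 0) :: real)" for x :: "nat => nat" and j :: nat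
  have dep: "prefix_dep k G" unfolding prefix_dep_def G_def by auto
  have z: "pmf_E (step i) (%j. of_bool (0 < i & j = 0)) = (0::real)" for i
  proof (cases "0 < i")
   case True
   have "AE j in measure_pmf (step i). (of_bool (0 < i & j = 0) :: real) = 0"
    using step[of i] True by (auto simp: AE_measure_pmf_iff intro!: gr0I)
   then have "pmf_E (step i) (%j. of_bool (0 < i & j = 0)) = pmf_E (step i) (%j. 0::real)"
    by (intro integral_cong_AE) auto
   then show ?thesis by simp
  qed simp
  have "expectation (%u. G (path u) (X (Suc k) u)) = expectation (%u. pmf_E (step (X k u)) (G (path u)))"
   by (rule one_step_real[OF dep, where B=1]) (simp add: G_def)
  also have "... = 0" unfolding G_def path_def z by simp
  finally have 0: "expectation (%u. of_bool (0 < X k u & X (Suc k) u = 0) :: real) = 0" by (simp add: G_def path_def)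
  have meas: "(%u. of_bool (0 < X k u & X (Suc k) u = 0) :: real) \<in> borel_measurable M"
  proof -
   have "prefix_dep (Suc k) (%x. of_bool (0 < x k & x (Suc k) = 0) :: real)" unfolding prefix_dep_def by auto
   from prefix_dep_borel[OF this] show ?thesis by (simp only: path_def)
  qed
  have int: "integrable M (%u. of_bool (0 < X k u & X (Suc k) u = 0) :: real)"
   by (rule integrable_const_bound[where B=1, OF _ meas]) simp
  have "AE u in M. (of_bool (0 < X k u & X (Suc k) u = 0) :: real) = 0"
   using 0 integral_nonneg_eq_0_iff_AE[OF int] by simp
  then show ?case using Suc by eventually_elim auto
 qed
 then show ?thesis by (simp add: AE_all_countable)
qed

locale scaling_limit = os: one_step step a Lm b sigma2 + lv: levy N \<xi> "levy_exponent b sigma2 Lm" \<gamma>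
 for step :: "nat => nat pmf" and a :: "nat => real" and Lm :: "real measure" and b sigma2 :: real
  and N :: "'b measure" and \<xi> :: "real => 'b => real" and \<gamma> :: real +
 fixes M :: "nat => 'a measure" and X :: "nat => nat => 'a => nat"
 assumes markov: "!!n. 1 <= n ==> markov (M n) (X n) step n"
  and rv: "regularly_varying a \<gamma>"
  and infinite: "AE u in N. lv.I u = \<infinity>"
begin

abbreviation \<Phi> :: "real => complex" where "\<Phi> \<equiv> levy_exponent b sigma2 Lm"

lemma a_at_top: "filterlim a at_top sequentially"
 by (rule regularly_varying_at_top[OF os.a_pos lv.\<gamma>_pos rv])

text \<open>Any positive \<open>c\<close> below \<open>1 / a\<close> on all boxes \<open>\<bar>ln i - ln n\<bar> < A\<close>, for large \<open>n\<close>, will do; it has to be the same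
 for all \<open>A\<close> since the skeleton depends on it.\<close>

definition floor_c :: "nat => real" where "floor_c n = Min ((%i. 1 / a i) ` {..n\<^sup>2})"

lemma floor_c_pos: "0 < floor_c n"
 unfolding floor_c_def using os.a_pos by (subst Min_gr_iff) auto

lemma floor_c_le: "i <= n\<^sup>2 ==> floor_c n <= 1 / a i"
 unfolding floor_c_def by (rule Min_le) auto

lemma chain_eventually:
 assumes "0 < A" "0 < S" "0 < e"
 shows "EV n. 1 <= n & chain a n A S e (floor_c n) (M n) (X n) step"
proof -
 have "EV i. 1 / e < a i" using a_at_top unfolding filterlim_at_top_dense by blast
 then have "EV i. 1 / a i <= e"
 proof eventually_elim
  case (elim i)
  then show ?case using assms(3) os.a_pos[of i] by (simp add: divide_le_eq divide_less_eq mult.commute)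
 qed
 from eventually_log_box[OF this, of A] have 1: "EV n. ALL i. abs(ln (real i) - ln (real n)) < A --> 1 / a i <= e" .
 have "filterlim (%n::nat. ln (real n)) at_top sequentially"
  by (rule filterlim_compose[OF ln_at_top filterlim_real_sequentially])
 then have 2: "EV n. A <= ln (real n)" unfolding filterlim_at_top by blast
 show ?thesis using 1 2 eventually_ge_at_top[of "1::nat"]
 proof eventually_elim
  case (elim n)
  have "floor_c n <= 1 / a i" if i: "abs(ln (real i) - ln (real n)) < A" for i
  proof (rule floor_c_le, cases "i = 0")
   case False
   have n: "0 < real n" using elim(3) by simp
   \<comment> \<open>Once A is at most ln n the box lies below n^2, the range of the minimum in
     \<open>floor_c\<close>.\<close>
   have "ln (real i) < ln (real n) + ln (real n)" using i elim(2) by linarith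
   also have "... = ln (real n * real n)" using n by (simp add: ln_mult)
   finally have "real i < real n * real n" using False n by (subst (asm) ln_less_cancel_iff) auto
   then have "real i < real (n\<^sup>2)" by (simp add: power2_eq_square)
   then show "i <= n\<^sup>2" by linarith
  qed simp
  then have "box a n A S e (floor_c n)" by (intro box.intro) (use elim assms os.a_pos floor_c_pos in auto)
  then show ?case using markov[of n] elim(3) by (auto intro: chain.intro)
 qed
qed

lemma gen_box:
 assumes "EV n. ALL x. a n * abs(os.E n (%d. sat ((x + d) / \<eta>)) - sat (x / \<eta>)) <= C"
 shows "EV n. ALL i y. abs(ln (real i) - ln (real n)) < A -->
   abs(pmf_E (step i) (%j. sat ((y + (ln (real j) - ln (real i))) / \<eta>)) - sat (y / \<eta>)) <= C * (1 / a i)"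
 using eventually_log_box[OF assms, of A]
proof eventually_elim
 case (elim n)
 show ?case
 proof (intro allI impI)
  fix i y assume "abs(ln (real i) - ln (real n)) < A"
  then have "a i * abs(os.E i (%d. sat ((y + d) / \<eta>)) - sat (y / \<eta>)) <= C" using elim by blast
  then show "abs(pmf_E (step i) (%j. sat ((y + (ln (real j) - ln (real i))) / \<eta>)) - sat (y / \<eta>)) <= C * (1 / a i)"
   using os.a_pos[of i] unfolding os.E_def by (simp add: le_divide_eq mult.commute)
 qed
qed

text \<open>For a large box the generator of \<open>sat\<close> at scale A is at most C, and the
  exit probability is then at most 2 C (S + e).\<close>

lemma inside_eventually:
 assumes S: "0 < S" and eps: "0 < eps"
 obtains A where "0 < A" "EV n.
  measure (M n) {u\<in>space (M n). box.exits a n A S (floor_c n) (%i x. True) S A (markov.path (X n) u)} <= eps"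
proof -
 define C where "C = eps / (2 * (S + 1))"
 have C: "0 < C" using eps S by (simp add: C_def)
 obtain A where A: "0 < A" "EV n. ALL x. a n * abs(os.E n (%d. sat ((x + d) / A)) - sat (x / A)) <= C"
  using os.generator_small[OF C] by blast
 \<comment> \<open>The exit event does not involve the bound e on a clock step, so e = 1 serves here
   and the same A is good for every later choice of e.\<close>
 have "EV n.
  measure (M n) {u\<in>space (M n). box.exits a n A S (floor_c n) (%i x. True) S A (markov.path (X n) u)} <= eps"
  using chain_eventually[OF A(1) S zero_less_one] gen_box[OF A(2), of A]
 proof eventually_elim
  case (elim n)
  interpret chain a n A S 1 "floor_c n" "M n" "X n" step using elim(1) by blast
  have "measure (M n) {u\<in>space (M n). exits (%i x. True) S A (path u)} <= 2 * C * (S + 1)"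
   by (rule inside_prob) (use C elim(2) in auto)
  also have "... = eps" using S unfolding C_def by (simp add: field_simps)
  finally show ?case .
 qed
 then show thesis using that[OF A(1)] by blast
qed

definition pth :: "nat => 'a => nat => nat" where "pth n u = markov.path (X n) u"

definition inc :: "real => nat => nat => 'a => nat => real" where
 "inc S J n u = box.incs a n S (floor_c n) (S / real J) J (pth n u)"

lemma inc_measurable:
 assumes "chain a n A S e (floor_c n) (M n) (X n) step"
 shows "(%u. inc S J n u j) \<in> borel_measurable (M n)"
proof -
 interpret chain a n A S e "floor_c n" "M n" "X n" step by (rule assms)
 have "prefix_dep horizon (%x. incs (S / real J) J x j)"
  using prefix_dep_incs[of "S / real J" J] unfolding prefix_dep_def by metis
 then show ?thesis unfolding inc_def pth_def by (rule prefix_dep_borel)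
qed

lemma char_box:
 assumes "0 < eps"
 shows "EV n. ALL i. abs(ln (real i) - ln (real n)) < A -->
   cmod (pmf_E (step i) (%m. cis (l * (ln (real m) - ln (real i)))) - 1 - \<Phi> l / of_real (a i)) <= eps * (1 / a i)"
proof (rule eventually_log_box)
 have "EV i. dist (complex_of_real (a i) * (pmf_E (step i) (%m. cis (l * (ln (real m) - ln (real i)))) - 1)) (\<Phi> l) < eps"
  using os.char_tendsto[of l] assms unfolding tendsto_iff by blast
 then show "EV i. cmod (pmf_E (step i) (%m. cis (l * (ln (real m) - ln (real i)))) - 1 - \<Phi> l / of_real (a i)) <= eps * (1 / a i)"
 proof eventually_elim
  case (elim i)
  define \<phi> where "\<phi> = pmf_E (step i) (%m. cis (l * (ln (real m) - ln (real i))))"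
  have ai: "0 < a i" by (rule os.a_pos)
  have "complex_of_real (a i) * (\<phi> - 1) - \<Phi> l = complex_of_real (a i) * (\<phi> - 1 - \<Phi> l / of_real (a i))"
   using ai by (simp add: right_diff_distrib)
  then have "a i * cmod (\<phi> - 1 - \<Phi> l / of_real (a i)) < eps" using elim ai unfolding \<phi>_def[symmetric] dist_norm
   by (simp add: norm_mult)
  then show ?case using ai unfolding \<phi>_def[symmetric] by (simp add: le_divide_eq mult.commute)
 qed
qed

lemma levy_exponent_0: "\<Phi> 0 = 0" by (simp add: levy_exponent_def)

text \<open>First A is chosen to make exits from the box unlikely, then e to make the overshoot and
  expansion errors small; only then does n grow.\<close>

lemma inc_cf:
 assumes S: "0 < S" and J: "0 < J"
 shows "(%n. LINT u|M n. cis (\<Sum>j<J. l j * inc S J n u j)) ----> exp (\<Sum>j<J. of_real (S / real J) * \<Phi> (l j))"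
proof (rule tendstoI)
 fix eps :: real assume eps: "0 < eps"
 define \<delta> where "\<delta> = S / real J"
 have \<delta>: "0 < \<delta>" "real J * \<delta> = S" using S J by (auto simp: \<delta>_def)
 \<comment> \<open>Zero coefficients beyond J make the bounds uniform over all cells, as the
   martingale estimate requires.\<close>
 define l' where "l' j = (if j < J then l j else 0)" for j
 define B where "B = (\<Sum>j<J. cmod (\<Phi> (l j))) + 1"
 have B1: "1 <= B" unfolding B_def by (simp add: sum_nonneg)
 have w: "cmod (\<Phi> (l' j)) <= B" for j
 proof (cases "j < J")
  case True
  then have "cmod (\<Phi> (l j)) <= (\<Sum>j<J. cmod (\<Phi> (l j)))" by (intro member_le_sum) auto
  then show ?thesis using True by (simp add: l'_def B_def)
 qed (use B1 in "simp add: l'_def levy_exponent_0")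
 \<comment> \<open>S + 1 in place of S + e makes this constant valid for every e up to 1, so A can
   be fixed before e.\<close>
 define c2 where "c2 = 1 + exp (B * S) * (2 + exp (B * (S + 1)))"
 have c2: "1 <= c2" unfolding c2_def by simp
 obtain A where A: "0 < A" "EV n.
  measure (M n) {u\<in>space (M n). box.exits a n A S (floor_c n) (%i x. True) S A (markov.path (X n) u)} <= eps / (4 * c2)"
  using inside_eventually[OF S, of "eps / (4 * c2)"] eps c2 by auto
 define g1 where "g1 e = exp (real J * (B * e)) * (real J * (B * e))" for e
 define g2 where "g2 e = exp (B * S) * (3 * exp (B * S) * (e + 3 * B\<^sup>2 * e) * (S + e))" for e
 have "(g1 \<longlongrightarrow> exp (real J * (B * 0)) * (real J * (B * 0))) (at_right 0)" unfolding g1_def by (intro tendsto_intros)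
 then have e1: "\<forall>\<^sub>F e in at_right 0. g1 e < eps / 4" using eps by (intro order_tendstoD(2)) auto
 have "(g2 \<longlongrightarrow> exp (B * S) * (3 * exp (B * S) * (0 + 3 * B\<^sup>2 * 0) * (S + 0))) (at_right 0)" unfolding g2_def by (intro tendsto_intros)
 then have e2: "\<forall>\<^sub>F e in at_right 0. g2 e < eps / 4" using eps by (intro order_tendstoD(2)) auto
 have e3: "\<forall>\<^sub>F e in at_right (0::real). e < min (min \<delta> 1) (1 / B)" using \<delta> B1 by (intro order_tendstoD(2)[OF tendsto_ident_at]) auto
 have e4: "\<forall>\<^sub>F e in at_right (0::real). 0 < e" by (rule eventually_at_right_less)
 have "\<forall>\<^sub>F e in at_right 0. g1 e < eps / 4 & g2 e < eps / 4 & e < min (min \<delta> 1) (1 / B) & 0 < e"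
  using e1 e2 e3 e4 by eventually_elim simp
 then obtain e where es: "g1 e < eps / 4" "g2 e < eps / 4" "e < min (min \<delta> 1) (1 / B)" "0 < e"
  using eventually_happens'[of "at_right (0::real)"] by (metis (no_types, lifting) trivial_limit_at_right_real)
 have e': "e <= \<delta>" "e <= 1" "B * e <= 1" using es(3) B1 by (auto simp: less_divide_eq mult.commute)
 have ch: "EV n. \<forall>j\<in>{..J}. ALL i. abs(ln (real i) - ln (real n)) < A -->
   cmod (pmf_E (step i) (%m. cis (l' j * (ln (real m) - ln (real i)))) - 1 - \<Phi> (l' j) / of_real (a i)) <= e * (1 / a i)"
  by (subst eventually_ball_finite_distrib) (use char_box[OF es(4)] in auto)
 show "EV n. dist (LINT u|M n. cis (\<Sum>j<J. l j * inc S J n u j)) (exp (\<Sum>j<J. of_real (S / real J) * \<Phi> (l j))) < eps"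
  using chain_eventually[OF A(1) S es(4)] A(2) ch
 proof eventually_elim
  case (elim n)
  interpret chain a n A S e "floor_c n" "M n" "X n" step using elim(1) by blast
  have cf: "cmod (pmf_E (step i) (%m. cis (l' j * (ln (real m) - ln (real i)))) - 1 - \<Phi> (l' j) / of_real (a i)) <= e * (1 / a i)"
   if "abs(ln (real i) - ln (real n)) < A" for i j
  proof (cases "j < J")
   case True
   then show ?thesis using elim(3) that by simp
  next
   case False
   then have "l' j = l' J" by (simp add: l'_def)
   then show ?thesis using elim(3) that by simp
  qed
  have "cmod (expectation (%u. cis (\<Sum>j<J. l' j * incs \<delta> J (path u) j)) - exp (\<Sum>j<J. of_real \<delta> * \<Phi> (l' j))) <=
   g1 e + g2 e + (1 + exp (B * S) * (2 + exp (B * (S + e)))) * prob {u\<in>space (M n). exits (%i x. True) S A (path u)}"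
   unfolding g1_def g2_def
   by (rule skeleton_cf[OF start[OF prob] \<delta>(1) e'(1) \<delta>(2) w e'(3) less_imp_le[OF es(4)] cf])
  also have "(\<Sum>j<J. of_real \<delta> * \<Phi> (l' j)) = (\<Sum>j<J. of_real (S / real J) * \<Phi> (l j))" by (simp add: l'_def \<delta>_def)
  also have "(%u. cis (\<Sum>j<J. l' j * incs \<delta> J (path u) j)) = (%u. cis (\<Sum>j<J. l j * inc S J n u j))"
   by (intro ext arg_cong[where f=cis] sum.cong) (auto simp: l'_def inc_def pth_def \<delta>_def)
  finally have 1: "cmod (expectation (%u. cis (\<Sum>j<J. l j * inc S J n u j)) - exp (\<Sum>j<J. of_real (S / real J) * \<Phi> (l j))) <=
   g1 e + g2 e + (1 + exp (B * S) * (2 + exp (B * (S + e)))) * prob {u\<in>space (M n). exits (%i x. True) S A (path u)}" .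
  have "1 + exp (B * S) * (2 + exp (B * (S + e))) <= c2" unfolding c2_def using e' B1 by (simp add: mult_left_mono)
  then have "(1 + exp (B * S) * (2 + exp (B * (S + e)))) * prob {u\<in>space (M n). exits (%i x. True) S A (path u)} <= c2 * (eps / (4 * c2))"
   using elim(2) c2 by (intro mult_mono) auto
  also have "... = eps / 4" using c2 by simp
  finally show ?case using 1 es(1,2) eps unfolding dist_norm by linarith
 qed
qed

lemma inc_tendsto:
 fixes f :: "(nat => real) => real"
 assumes S: "0 < S" and J: "0 < J" and f: "continuous_on UNIV f" and B: "!!x. abs(f x) <= B"
 shows "(%n. LINT u|M n. f (inc S J n u)) ----> (LINT u|N. f (restr J (lv.D (S / real J) u)))"
proof -
 \<comment> \<open>The values A = e = 1 serve only to instantiate the chain; the increments depend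
   on neither.\<close>
 obtain n0 where n0: "!!n. n0 <= n ==> 1 <= n & chain a n 1 S 1 (floor_c n) (M n) (X n) step"
  using chain_eventually[OF _ S, of 1 1] unfolding eventually_sequentially by auto
 have r: "restr J (inc S J n u) = inc S J n u" if "n0 <= n" for n u
 proof -
  interpret chain a n 1 S 1 "floor_c n" "M n" "X n" step using n0[OF that] by blast
  show ?thesis by (simp add: restr_def inc_def incs_def fun_eq_iff)
 qed
 define d where "d = S / real J"
 have "cf_convergence (%n. M (n + n0)) (%n. inc S J (n + n0)) N (%u. restr J (lv.D d u))"
 proof (rule cf_convergence.intro)
  show "prob_space N" by (rule lv.N.prob_space_axioms)
  show "prob_space (M (n + n0))" for n using markov[of "n + n0"] n0[of "n + n0"] by (simp add: markov.prob)
  show "(%u. inc S J (n + n0) u j) \<in> borel_measurable (M (n + n0))" for n j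
   using n0[of "n + n0"] by (intro inc_measurable[where A=1 and e=1]) auto
  show "(%u. restr J (lv.D d u) j) \<in> borel_measurable N" for j unfolding restr_def by simp
  fix k :: nat and l :: "nat => real"
  define l' where "l' j = (if j < k then l j else 0 :: real)" for j
  have d0: "0 <= d" using S by (simp add: d_def)
  have sw: "(\<Sum>j<k. l j * restr J x j) = (\<Sum>j<J. l' j * x j)" for x :: "nat => real"
  proof -
   have "(\<Sum>j<k. l j * restr J x j) = (\<Sum>j<min k J. l j * x j)"
    by (rule sum.mono_neutral_cong_right) (auto simp: restr_def)
   also have "... = (\<Sum>j<J. l' j * x j)"
    by (rule sum.mono_neutral_cong_left) (auto simp: l'_def)
   finally show ?thesis .
  qed
  have "(LINT u|N. cis (\<Sum>j<k. l j * restr J (lv.D d u) j)) = (\<Prod>j<J. exp (complex_of_real d * \<Phi> (l' j)))"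
   unfolding sw by (rule lv.D_cf[OF d0])
  also have "... = exp (\<Sum>j<J. of_real d * \<Phi> (l' j))" by (simp add: exp_sum)
  finally have rhs: "(LINT u|N. cis (\<Sum>j<k. l j * restr J (lv.D d u) j)) = exp (\<Sum>j<J. of_real (S / real J) * \<Phi> (l' j))" by (simp only: d_def)
  have lhs: "(\<Sum>j<k. l j * inc S J (n + n0) u j) = (\<Sum>j<J. l' j * inc S J (n + n0) u j)" for n u
   using sw[of "inc S J (n + n0) u"] r[of "n + n0" u] by simp
  show "(%n. LINT u|M (n + n0). cis (\<Sum>j<k. l j * inc S J (n + n0) u j)) ----> (LINT u|N. cis (\<Sum>j<k. l j * restr J (lv.D d u) j))"
   unfolding rhs lhs by (rule LIMSEQ_ignore_initial_segment[OF inc_cf[OF S J]])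
 qed
 then interpret cf_convergence "%n. M (n + n0)" "%n. inc S J (n + n0)" N "%u. restr J (lv.D d u)" .
 have "(%n. LINT u|M (n + n0). f (restr J (inc S J (n + n0) u))) ----> (LINT u|N. f (restr J (restr J (lv.D d u))))"
  by (rule integral_restr_tendsto[OF f B])
 moreover have "restr J (restr J x) = restr J x" for x by (simp add: restr_def fun_eq_iff)
 ultimately have "(%n. LINT u|M (n + n0). f (inc S J (n + n0) u)) ----> (LINT u|N. f (restr J (lv.D d u)))"
  using r by simp
 then show ?thesis unfolding d_def by (rule LIMSEQ_offset)
qed

end

section \<open>Measurability and continuity for the passage to the limit\<close>

lemma J1_tendsto_if_eventually_close:
 assumes "!!eps. 0 < eps ==> EV k. J1_close eps (xs k) x"
 shows "J1_tendsto xs x"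
proof (rule J1_tendsto_if_close)
 have ne: "{eps. J1_close eps (xs k) x} ~= {}" for k
 proof
  assume "{eps. J1_close eps (xs k) x} = {}"
  moreover have "1 \<in> {eps. J1_close eps (xs k) x}" by (simp only: mem_Collect_eq J1_close_1)
  ultimately show False by (simp only: empty_iff)
 qed
 define e where "e k = J1_dist (xs k) x + 1 / real (Suc k)" for k
 show "J1_close (e k) (xs k) x" for k
 proof -
  have "J1_dist (xs k) x < e k" by (simp add: e_def)
  from cInf_lessD[OF ne this[unfolded J1_dist_def]]
  obtain eps where c: "eps \<in> {eps. J1_close eps (xs k) x}" "eps < e k" by (rule bexE)
  show ?thesis by (rule J1_close_mono[OF c(1)[unfolded mem_Collect_eq] less_imp_le[OF c(2)]])
 qed
 have "(%k. J1_dist (xs k) x) ----> 0"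
 proof (rule tendstoI)
  fix eps :: real assume "0 < eps"
  then have "EV k. J1_close (eps / 2) (xs k) x" using assms[of "eps / 2"] by simp
  then show "EV k. dist (J1_dist (xs k) x) 0 < eps"
  proof eventually_elim
   case (elim k)
   have "J1_dist (xs k) x <= eps / 2" unfolding J1_dist_def using elim by (intro cInf_lower bdd_below_J1_close) simp
   moreover have "0 <= J1_dist (xs k) x"
    unfolding J1_dist_def by (rule cInf_greatest[OF ne]) (auto dest: J1_close_nonneg)
   ultimately show ?case using \<open>0 < eps\<close> by simp
  qed
 qed
 then have "(%k. J1_dist (xs k) x + 1 / real (Suc k)) ----> 0 + 0"
  by (intro tendsto_add) (use LIMSEQ_inverse_real_of_nat in "simp_all add: inverse_eq_divide")
 then show "e ----> 0" by (simp add: e_def[abs_def])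
qed

text \<open>Lets a functional of the Lamperti path be integrated, which is known to agree with a
  measurable function only outside a null set.\<close>

lemma borel_measurable_completion_AE:
 fixes f g :: "'c => real"
 assumes g: "g \<in> borel_measurable N" and fg: "AE w in N. f w = g w"
 shows "f \<in> borel_measurable (completion N)"
proof (rule measurableI)
 have gc: "g \<in> borel_measurable (completion N)" using g by (rule measurable_completion)
 fix A :: "real set" assume A: "A \<in> sets borel"
 show "f -` A \<inter> space (completion N) \<in> sets (completion N)"
 proof (rule completion.in_sets_AE)
  have "AE w in completion N. f w = g w" using fg by (rule AE_completion)
  then show "AE w in completion N. w \<in> g -` A \<inter> space (completion N) \<longleftrightarrow> w \<in> f -` A \<inter> space (completion N)"
   by eventually_elim auto
  show "g -` A \<inter> space (completion N) \<in> sets (completion N)" using gc A by (rule measurable_sets)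
 qed auto
qed simp

lemma skel_time_increments_continuous:
 "continuous_on UNIV (%d. skel_time \<gamma> \<delta> (%j. \<Sum>i<j. d i) J)"
 unfolding skel_time_def by (intro continuous_intros) auto

lemma skel_path_increments_continuous:
 assumes "J1_bounded_continuous F" "0 < \<delta>"
 shows "continuous_on UNIV (%d. F (skel_path \<gamma> \<delta> J (%j. \<Sum>i<j. d i)))"
proof -
 have "continuous_on UNIV (%(d :: nat => real) j. \<Sum>i<j. d i)"
  by (intro continuous_on_coordinatewise_then_product continuous_intros) auto
 then show ?thesis
  using continuous_on_compose2[OF continuous_on_J1_skel_path[OF assms, of \<gamma> J]] by fast
qed

text \<open>A continuous function between the indicators of t <= t0 and t < t0 + 1, so that the
  probability of a short clock passes to the limit.\<close>

definition cutoff :: "real => real => real" where "cutoff t0 t = max 0 (min 1 (t0 + 1 - t))"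

lemma cutoff_bounds: "0 <= cutoff t0 t" "cutoff t0 t <= 1" "abs(cutoff t0 t) <= 1" by (auto simp: cutoff_def)

lemma cutoff_1: "t <= t0 ==> cutoff t0 t = 1" and cutoff_0: "t0 + 1 <= t ==> cutoff t0 t = 0" by (auto simp: cutoff_def)

lemma cutoff_continuous: "continuous_on UNIV (cutoff t0)"
 unfolding cutoff_def[abs_def] by (intro continuous_intros)

definition scaled_path :: "real => nat => (nat => nat) => real => real" where
 "scaled_path r n x t = real (x (nat \<lfloor>r * t\<rfloor>)) / real n"

lemma cadlag_scaled_path: "0 < r ==> cadlag (scaled_path r n x)"
 unfolding scaled_path_def[abs_def] using cadlag_floor[of r "%i. real (x (nat i)) / real n"] by simp

text \<open>Freezing the chain at step m leaves the path on [0, T] unchanged once m reaches r T.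
  Frozen paths depend on finitely many coordinates, which gives measurability of continuous
  functionals.\<close>

lemma J1_tendsto_stopped: assumes "0 < r" shows "J1_tendsto (%m. scaled_path r n (%k. x (min k m))) (scaled_path r n x)"
 unfolding J1_tendsto_def
proof (intro exI[of _ "%k t. t"] conjI allI impI)
 show "time_change (%t. t)" by (auto simp: time_change_def strict_mono_on_def)
 fix T eps :: real assume "0 < T" "0 < eps"
 show "EV m. \<forall>t\<in>{0..T}. abs(t - t) < eps & abs(scaled_path r n (%k. x (min k m)) t - scaled_path r n x t) < eps"
  using eventually_ge_at_top[of "nat \<lceil>r * T\<rceil>"]
 proof eventually_elim
  case (elim m)
  show ?case
  proof
   fix t assume t: "t \<in> {0..T}"
   have "r * t <= r * T" using t assms by simp
   then have "\<lfloor>r * t\<rfloor> <= \<lceil>r * T\<rceil>" by linarith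
   then have "nat \<lfloor>r * t\<rfloor> <= m" using elim by linarith
   then show "abs(t - t) < eps & abs(scaled_path r n (%k. x (min k m)) t - scaled_path r n x t) < eps"
    using \<open>0 < eps\<close> by (simp add: scaled_path_def)
  qed
 qed
qed

lemma (in markov) scaled_path_measurable:
 assumes F: "J1_bounded_continuous F" and r: "0 < r"
 shows "(%w. F (scaled_path r n' (path w))) \<in> borel_measurable M"
proof (rule borel_measurable_LIMSEQ_real)
 fix m
 have "prefix_dep m (%x. F (scaled_path r n' (%k. x (min k m))))"
  unfolding prefix_dep_def
 proof (intro allI impI)
  fix x y :: "nat => nat" assume "\<forall>i\<le>m. x i = y i"
  then have "(%k. x (min k m)) = (%k. y (min k m))" by auto
  then show "F (scaled_path r n' (%k. x (min k m))) = F (scaled_path r n' (%k. y (min k m)))" by (rule arg_cong)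
 qed
 then show "(%w. F (scaled_path r n' (%k. path w (min k m)))) \<in> borel_measurable M" by (rule prefix_dep_borel)
next
 fix w
 have cont: "ALL xs x. (ALL k. cadlag (xs k)) --> cadlag x --> J1_tendsto xs x --> (%k. F (xs k)) ----> F x"
  using F unfolding J1_bounded_continuous_def by (rule conjunct2)
 show "(%m. F (scaled_path r n' (%k. path w (min k m)))) ----> F (scaled_path r n' (path w))"
  by (rule cont[rule_format]) (use cadlag_scaled_path[OF r] J1_tendsto_stopped[OF r] in auto)
qed

context scaling_limit begin

lemma log_box_rate:
 assumes A: "0 < A" and eps: "0 < eps"
 shows "EV n. ALL i. abs(ln (real i) - ln (real n)) < A --> abs(a i / a n - exp (\<gamma> * (ln (real i) - ln (real n)))) <= eps"
 using regularly_varying_uniform[OF os.a_pos rv A eps] eventually_log_box[OF eventually_ge_at_top[of "1::nat"], of A] eventually_ge_at_top[of "1::nat"]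
proof eventually_elim
 case (elim n)
 show ?case
 proof (intro allI impI)
  fix i assume i: "abs(ln (real i) - ln (real n)) < A"
  then have "1 <= i" using elim(2) by blast
  then have pos: "0 < real i" "0 < real n" using elim(3) by simp_all
  have "exp (- A) * real n = exp (ln (real n) - A)" using pos by (simp add: exp_diff exp_minus divide_inverse mult.commute)
  also have "... <= exp (ln (real i))" using i by simp
  finally have 1: "exp (- A) * real n <= real i" using pos by simp
  have "exp (ln (real i)) <= exp (A + ln (real n))" using i by simp
  then have 2: "real i <= exp A * real n" using pos by (simp add: exp_add)
  show "abs(a i / a n - exp (\<gamma> * (ln (real i) - ln (real n)))) <= eps" using elim(1) 1 2 by blast
 qed
qed

definition ptime :: "real => nat => (nat => real) => real" where
 "ptime \<delta> J d = skel_time \<gamma> \<delta> (%j. \<Sum>i<j. d i) J"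

definition ppath :: "real => nat => (nat => real) => real => real" where
 "ppath \<delta> J d = skel_path \<gamma> \<delta> J (%j. \<Sum>i<j. d i)"

text \<open>Off the bad paths and the paths with a short skeleton clock, the chain is \<rho>-close
  to its skeleton; elsewhere only the bound 2 B is used. Bad paths have probability at most 3 eps:
  leaving the box, double exits, and too many exits.\<close>

lemma chain_close:
 assumes F: "J1_bounded_continuous F" and B: "!!x. cadlag x ==> abs(F x) <= B"
  and \<rho>: "0 < \<rho>" and unif: "!!x y. cadlag x ==> cadlag y ==> J1_close \<rho> x y ==> abs(F x - F y) <= eps"
  and eps: "0 < eps" and S: "0 < S" and t0: "exp (- t0) <= \<rho>"
 shows "\<exists>\<delta>0>0. \<forall>J>0. S / real J <= \<delta>0 --> (EV n.
  abs((LINT w|M n. F (scaled_path (a n) n (pth n w))) - (LINT w|M n. F (ppath (S / real J) J (inc S J n w))))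
   <= eps + 2 * B * (3 * eps + (LINT w|M n. cutoff t0 (ptime (S / real J) J (inc S J n w)))))"
proof -
 have \<gamma>: "0 < \<gamma>" by (rule lv.\<gamma>_pos)
 obtain A where A: "0 < A" "EV n.
  measure (M n) {w\<in>space (M n). box.exits a n A S (floor_c n) (%i x. True) S A (markov.path (X n) w)} <= eps"
  using inside_eventually[OF S eps] by blast
 define G where "G = exp (\<gamma> * A)"
 have G: "0 < G" by (simp add: G_def)
 \<comment> \<open>The first bound serves the distance of values. The second keeps the rate error
   within one of the five shares \<rho>/5 of the time budget.\<close>
 define \<eta> where "\<eta> = min (\<rho> / (2 * exp A)) (\<rho> / (10 * S * G * \<gamma>))"
 have \<eta>: "0 < \<eta>" using \<rho> S G \<gamma> by (simp add: \<eta>_def)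
 have \<eta>1: "exp A * (2 * \<eta>) <= \<rho>"
 proof -
  have "\<eta> <= \<rho> / (2 * exp A)" by (simp add: \<eta>_def)
  then have "\<eta> * (2 * exp A) <= \<rho>" by (simp add: le_divide_eq)
  then show ?thesis by (simp add: mult_ac)
 qed
 have \<eta>2: "2 * S * (G * (\<gamma> * \<eta>)) <= \<rho> / 5"
 proof -
  have "\<eta> <= \<rho> / (10 * S * G * \<gamma>)" by (simp add: \<eta>_def)
  then have "\<eta> * (10 * S * G * \<gamma>) <= \<rho>" using S G \<gamma> by (simp add: le_divide_eq)
  then show ?thesis by (simp add: mult_ac)
 qed
 obtain C where C: "0 < C" "EV n. ALL x. a n * abs(os.E n (%d. sat ((x + d) / \<eta>)) - sat (x / \<eta>)) <= C"
  using os.generator_bounded[OF \<eta>] by blast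
 define \<kappa> where "\<kappa> = 4 * C * S / eps"
 have \<kappa>: "0 < \<kappa>" "4 * C * S / \<kappa> = eps" using C S eps by (auto simp: \<kappa>_def)
 \<comment> \<open>Three demands: the real time lost to fewer than \<kappa> exits, the probability
   of double exits, and the real length of one block.\<close>
 define \<delta>0 where "\<delta>0 = min (\<rho> / (10 * G * \<kappa>)) (min (eps / (16 * C\<^sup>2 * S)) (\<rho> / (10 * (1 + G))))"
 have G1: "0 < 1 + G" using G by simp
 have \<delta>0: "0 < \<delta>0" using \<rho> G G1 \<kappa> eps C S by (simp add: \<delta>0_def)
 have main: "EV n.
  abs((LINT w|M n. F (scaled_path (a n) n (pth n w))) - (LINT w|M n. F (ppath (S / real J) J (inc S J n w))))
   <= eps + 2 * B * (3 * eps + (LINT w|M n. cutoff t0 (ptime (S / real J) J (inc S J n w))))"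
  if J: "0 < J" "S / real J <= \<delta>0" for J
 proof -
  define \<delta> where "\<delta> = S / real J"
  have \<delta>: "0 < \<delta>" "real J * \<delta> = S" "\<delta> <= \<delta>0" using S J by (auto simp: \<delta>_def)
  have d1: "2 * \<delta> * G * \<kappa> <= \<rho> / 5"
  proof -
   have "\<delta> <= \<rho> / (10 * G * \<kappa>)" using \<delta>(3) by (simp add: \<delta>0_def)
   then have "\<delta> * (10 * G * \<kappa>) <= \<rho>" using G \<kappa>(1) by (simp add: le_divide_eq)
   then show ?thesis by (simp add: mult_ac)
  qed
  have d2: "16 * C\<^sup>2 * S * \<delta> <= eps"
  proof -
   have "\<delta> <= eps / (16 * C\<^sup>2 * S)" using \<delta>(3) by (simp add: \<delta>0_def)
   then have "\<delta> * (16 * C\<^sup>2 * S) <= eps" using C S by (simp add: le_divide_eq)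
   then show ?thesis by (simp add: mult_ac)
  qed
  have d3: "2 * \<delta> * (1 + G) <= \<rho> / 5"
  proof -
   have "\<delta> <= \<rho> / (10 * (1 + G))" using \<delta>(3) by (simp add: \<delta>0_def)
   then have "\<delta> * (10 * (1 + G)) <= \<rho>" using G1 by (subst (asm) le_divide_eq) auto
   then show ?thesis by (simp add: algebra_simps)
  qed
  \<comment> \<open>The clock overshoot is paid once per block, so its bound has to be chosen after
    J.\<close>
  define e where "e = min \<delta> (\<rho> / (5 * real J * G))"
  have e_pos: "0 < e" using \<delta> \<rho> J G by (simp add: e_def)
  have e_le: "e <= \<delta>" by (simp add: e_def)
  have e1: "real J * e * G <= \<rho> / 5"
  proof -
   have "e <= \<rho> / (5 * real J * G)" by (simp add: e_def)
   then have "e * (5 * real J * G) <= \<rho>" using J G by (simp add: le_divide_eq)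
   then show ?thesis by (simp add: mult_ac)
  qed
  define \<theta> where "\<theta> = min 1 (\<rho> / (10 * S))"
  have \<theta>: "0 < \<theta>" "\<theta> <= 1" using \<rho> S by (auto simp: \<theta>_def)
  have \<theta>1: "2 * S * \<theta> <= \<rho> / 5"
  proof -
   have "\<theta> <= \<rho> / (10 * S)" by (simp add: \<theta>_def)
   then have "\<theta> * (10 * S) <= \<rho>" using S by (simp add: le_divide_eq)
   then show ?thesis by (simp add: mult_ac)
  qed
  show ?thesis
   using chain_eventually[OF A(1) S e_pos] A(2) gen_box[OF C(2), of A] log_box_rate[OF A(1) \<theta>(1)]
  proof eventually_elim
   case (elim n)
   have n1: "1 <= n" using elim(1) by blast
   have ch: "chain a n A S e (floor_c n) (M n) (X n) step" using elim(1) by blast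
   interpret ch: chain a n A S e "floor_c n" "M n" "X n" step by (rule ch)
   have pth: "pth n w = ch.path w" for w by (simp add: pth_def)
   define u where "u w = F (scaled_path (a n) n (pth n w))" for w
   define v where "v w = F (ppath \<delta> J (inc S J n w))" for w
   define T where "T w = ptime \<delta> J (inc S J n w)" for w
   have inc_meas: "inc S J n \<in> borel_measurable (M n)"
    by (rule measurable_coordinatewise_then_product) (rule inc_measurable[OF ch])
   have u_meas: "u \<in> borel_measurable (M n)" unfolding u_def[abs_def] pth by (rule ch.scaled_path_measurable[OF F os.a_pos])
   have v_meas: "v \<in> borel_measurable (M n)" unfolding v_def[abs_def] ppath_def
    by (rule borel_measurable_continuous_on[OF skel_path_increments_continuous[OF F \<delta>(1)] inc_meas])
   have T_meas: "T \<in> borel_measurable (M n)" unfolding T_def[abs_def] ptime_def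
    by (rule borel_measurable_continuous_on[OF skel_time_increments_continuous inc_meas])
   have u_bnd: "abs(u w) <= B" for w unfolding u_def by (intro B cadlag_scaled_path os.a_pos)
   have v_bnd: "abs(v w) <= B" for w unfolding v_def ppath_def by (intro B cadlag_skel_path)
   have u_int: "integrable (M n) u" by (rule ch.integrable_const_bound[where B=B]) (use u_bnd u_meas in auto)
   have v_int: "integrable (M n) v" by (rule ch.integrable_const_bound[where B=B]) (use v_bnd v_meas in auto)
   define E1 where "E1 = {w\<in>space (M n). ch.bad \<delta> \<eta> J \<kappa> (ch.path w)}"
   define E2 where "E2 = {w\<in>space (M n). T w <= t0}"
   have gen: "!!i y. abs(ln (real i) - ln (real n)) < A ==>
    abs(pmf_E (step i) (%j. sat ((y + (ln (real j) - ln (real i))) / \<eta>)) - sat (y / \<eta>)) <= C * (1 / a i)"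
    using elim(3) by blast
   have E1: "E1 \<in> sets (M n)" unfolding E1_def
    by (rule ch.bad_prob(1)[OF less_imp_le[OF C(1)] \<eta> \<delta>(1) e_le \<delta>(2) \<kappa>(1) gen])
   have "measure (M n) E1 <= measure (M n) {w\<in>space (M n). ch.exits (%i x. True) S A (ch.path w)} + 16 * C\<^sup>2 * S * \<delta> + 4 * C * S / \<kappa>"
    unfolding E1_def by (rule ch.bad_prob(2)[OF less_imp_le[OF C(1)] \<eta> \<delta>(1) e_le \<delta>(2) \<kappa>(1) gen])
   then have P1: "measure (M n) E1 <= 3 * eps" using elim(2) d2 unfolding \<kappa>(2) by linarith
   have E2: "E2 \<in> sets (M n)" unfolding E2_def using T_meas by measurable
   have r_meas: "(%w. cutoff t0 (T w)) \<in> borel_measurable (M n)" by (rule borel_measurable_continuous_on[OF cutoff_continuous T_meas])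
   have "measure (M n) E2 = (LINT w|M n. indicator E2 w)" using E2 by simp
   also have "... <= (LINT w|M n. cutoff t0 (T w))"
   proof (rule integral_mono)
    show "integrable (M n) (indicator E2 :: _ => real)" by (rule integrable_real_indicator[OF E2]) (simp add: ch.emeasure_eq_measure)
    show "integrable (M n) (%w. cutoff t0 (T w))" by (rule ch.integrable_const_bound[where B=1]) (use cutoff_bounds r_meas in auto)
    show "indicator E2 w <= cutoff t0 (T w)" for w
     using cutoff_1[of "T w" t0] cutoff_bounds[of t0 "T w"] by (auto simp: indicator_def E2_def)
   qed
   finally have P2: "measure (M n) E2 <= (LINT w|M n. cutoff t0 (T w))" .
   have B0: "0 <= B" using u_bnd[of undefined] by linarith
   have pos: "AE w in M n. ALL k. 0 < X n k w" by (rule ch.positive[OF n1]) (rule os.step_pos)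
   have "AE w in M n. abs(u w - v w) <= eps + 2 * B * indicator (E1 \<union> E2) w"
    using ch.start[OF ch.prob] pos AE_space
   proof eventually_elim
    case (elim w)
    show ?case
    proof (cases "w \<in> E1 \<union> E2")
     case True
     have "abs(u w - v w) <= 2 * B" using u_bnd[of w] v_bnd[of w] by linarith
     then show ?thesis using True eps by simp
    next
     case False
     define x where "x = ch.path w"
     have nb: "\<not> ch.bad \<delta> \<eta> J \<kappa> x" and Tt: "t0 < T w" using False elim(3) by (auto simp: E1_def E2_def x_def)
     have x: "x k = X n k w" for k by (simp add: x_def ch.path_def)
     have nb1: "\<not> ch.exits (%i x. True) S A x" using nb unfolding ch.bad_def by blast
     have nb2: "\<not> ch.exits (ch.jump \<delta> \<eta> j) (real (Suc j) * \<delta>) \<eta> x" if "j < J" for j using nb that unfolding ch.bad_def by blast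
     have nb3: "(\<Sum>j<J. of_bool (ch.exits (ch.reach \<delta> j) (real (Suc j) * \<delta>) \<eta> x)) < \<kappa>" using nb unfolding ch.bad_def by auto
     have "inside_path a n A S e (floor_c n) \<delta> J x"
      by (intro inside_path.intro inside_path_axioms.intro ch.box_axioms) (use \<delta> e_le nb1 elim(1) x in auto)
     then interpret ip: inside_path a n A S e "floor_c n" \<delta> J x .
     have inc_eq: "inc S J n w = ch.incs \<delta> J x" by (simp add: inc_def pth x_def \<delta>_def)
     have sums: "(\<Sum>i<j. inc S J n w i) = lg n x (ip.K j)" if "j <= J" for j unfolding inc_eq by (rule ip.sum_incs[OF that])
     have pp: "ppath \<delta> J (inc S J n w) = skel_path \<gamma> \<delta> J (%j. lg n x (ip.K j))"
      unfolding ppath_def by (rule skel_path_cong) (rule sums)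
     have TT: "T w = skel_time \<gamma> \<delta> (%j. lg n x (ip.K j)) J"
      unfolding T_def ptime_def by (rule skel_time_cong[of J]) (use sums in auto)
     have "J1_close \<rho> (%t. real (x (nat \<lfloor>a n * t\<rfloor>)) / real n) (skel_path \<gamma> \<delta> J (%j. lg n x (ip.K j)))"
     proof (rule ip.J1_close_skeleton[where \<eta>=\<eta> and eps=\<theta>])
      show "abs(a i / a n - exp (\<gamma> * (ln (real i) - ln (real n)))) <= \<theta>" if "abs(ln (real i) - ln (real n)) < A" for i
       using \<open>ALL i. abs(ln (real i) - ln (real n)) < A --> abs(a i / a n - exp (\<gamma> * (ln (real i) - ln (real n)))) <= \<theta>\<close> that by blast
      show "0 < x i" for i using elim(2) x by simp
      have 1: "2 * \<delta> * G * (\<Sum>j<J. of_bool (ch.exits (ch.reach \<delta> j) (real (Suc j) * \<delta>) \<eta> x)) <= 2 * \<delta> * G * \<kappa>"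
       using nb3 \<delta>(1) G by (intro mult_left_mono) auto
      have 2: "2 * \<delta> * (\<theta> + G) <= 2 * \<delta> * (1 + G)" using \<theta> \<delta>(1) by (intro mult_left_mono) auto
      have 3: "2 * S * (\<theta> + G * (\<gamma> * \<eta>)) = 2 * S * \<theta> + 2 * S * (G * (\<gamma> * \<eta>))" by (simp add: distrib_left)
      show "2 * S * (\<theta> + exp (\<gamma> * A) * (\<gamma> * \<eta>)) + real J * e * exp (\<gamma> * A)
       + 2 * \<delta> * exp (\<gamma> * A) * (\<Sum>j<J. of_bool (ch.exits (ch.reach \<delta> j) (real (Suc j) * \<delta>) \<eta> x)) + 2 * \<delta> * (\<theta> + exp (\<gamma> * A)) <= \<rho>"
       unfolding G_def[symmetric] 3 using 1 2 d1 d3 e1 \<theta>1 \<eta>2 by linarith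
      have "exp (- T w) <= exp (- t0)" using Tt by simp
      then show "exp (- skel_time \<gamma> \<delta> (%j. lg n x (ip.K j)) J) <= \<rho>" unfolding TT[symmetric] using t0 by linarith
     qed (use \<eta> \<eta>1 nb2 \<gamma> in auto)
     then have cl: "J1_close \<rho> (scaled_path (a n) n x) (ppath \<delta> J (inc S J n w))"
      unfolding pp scaled_path_def[abs_def] .
     have "abs(u w - v w) <= eps" unfolding u_def v_def pth x_def[symmetric]
     proof (rule unif[OF _ _ cl])
      show "cadlag (scaled_path (a n) n x)" by (intro cadlag_scaled_path os.a_pos)
      show "cadlag (ppath \<delta> J (inc S J n w))" unfolding ppath_def by (rule cadlag_skel_path)
     qed
     then show ?thesis using False by simp
    qed
   qed
   then have "abs((LINT w|M n. u w) - (LINT w|M n. v w)) <= eps + 2 * B * measure (M n) (E1 \<union> E2)"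
    by (rule ch.integral_diff_le[OF u_int v_int sets.Un[OF E1 E2]])
   moreover have "measure (M n) (E1 \<union> E2) <= 3 * eps + (LINT w|M n. cutoff t0 (T w))"
    using measure_Un_le[OF E1 E2] P1 P2 by linarith
   then have "2 * B * measure (M n) (E1 \<union> E2) <= 2 * B * (3 * eps + (LINT w|M n. cutoff t0 (T w)))"
    using B0 by (intro mult_left_mono) auto
   ultimately show ?case unfolding u_def v_def T_def \<delta>_def by linarith
  qed
 qed
 show ?thesis using \<delta>0 main by blast
qed

end

section \<open>Dyadic approximation of the limit and conclusion\<close>

context scaling_limit begin

definition limit_path :: "'b => real => real" where "limit_path z = lamperti \<gamma> (%s. \<xi> s z)"

definition grid_path :: "nat => nat => 'b => real => real" where
 "grid_path J r z = ppath (lv.grid r) J (restr J (lv.D (lv.grid r) z))"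

lemma sum_restr_D:
 assumes "z \<in> space N" "j <= J" shows "(\<Sum>i<j. restr J (lv.D \<delta> z) i) = \<xi> (real j * \<delta>) z"
proof -
 have "(\<Sum>i<j. restr J (lv.D \<delta> z) i) = (\<Sum>i<j. incr (%t. \<xi> t z) \<delta> i)"
  by (rule sum.cong) (use assms in "auto simp: restr_def lv.D_def")
 then show ?thesis using lv.\<xi>_0[OF assms(1)] by (simp add: sum_incr)
qed

lemma grid_path_eq: "z \<in> space N ==> grid_path J r z = skel_path \<gamma> (lv.grid r) J (%j. \<xi> (real j * lv.grid r) z)"
 unfolding grid_path_def ppath_def by (rule skel_path_cong) (rule sum_restr_D)

lemma ptime_eq: "z \<in> space N ==>
  ptime (lv.grid r) J (restr J (lv.D (lv.grid r) z)) = skel_time \<gamma> (lv.grid r) (%j. \<xi> (real j * lv.grid r) z) J"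
 unfolding ptime_def by (rule skel_time_cong[of J]) (auto simp: sum_restr_D)

lemma restr_D_measurable: "(%z. restr J (lv.D \<delta> z)) \<in> borel_measurable N"
 by (rule measurable_coordinatewise_then_product) (auto simp: restr_def)

lemma grid_path_measurable: "J1_bounded_continuous F ==> (%z. F (grid_path J r z)) \<in> borel_measurable N"
 unfolding grid_path_def ppath_def
 by (rule borel_measurable_continuous_on[OF skel_path_increments_continuous[OF _ lv.grid_pos] restr_D_measurable])

lemma path_unbounded:
 "AE z in N. z \<in> space N & lv.I z = \<infinity> & cadlag_path_unbounded (%t. \<xi> t z) \<gamma>"
 using infinite AE_space
proof eventually_elim
 case (elim z)
 have "cadlag_path_unbounded (%t. \<xi> t z) \<gamma>"
  by (intro cadlag_path_unbounded.intro cadlag_path_unbounded_axioms.intro lv.cadlag_path[OF elim(2)]) (use elim(1) in "simp add: lv.I_def")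
 then show ?case using elim by simp
qed

lemma grid_path_close:
 assumes z: "z \<in> space N" and ub: "cadlag_path_unbounded (%t. \<xi> t z) \<gamma>"
  and S: "0 < S" and \<rho>: "exp (- lv.Rv S z) < \<rho>" and J: "EV r. S * 2 ^ r <= J r"
 shows "EV r. J1_close \<rho> (limit_path z) (grid_path (J r) r z)"
proof -
 interpret cadlag_path_unbounded "%t. \<xi> t z" \<gamma> by (rule ub)
 \<comment> \<open>Agrees with \<open>J r\<close> for large r and covers the horizon S for every
   r.\<close>
 define J' where "J' r = max (S * 2 ^ r) (J r)" for r
 have le: "real S <= real (J' r) * lv.grid r" for r
 proof -
  have "real S = real (S * 2 ^ r) * lv.grid r" by (simp add: lv.grid_def)
  also have "... <= real (J' r) * lv.grid r"
  proof (rule mult_right_mono)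
   have "S * 2 ^ r <= J' r" by (simp add: J'_def)
   then show "real (S * 2 ^ r) <= real (J' r)" by (simp only: of_nat_le_iff)
  qed (use lv.grid_pos[of r] in simp)
  finally show ?thesis .
 qed
 have "EV r. J1_close \<rho> (lamperti \<gamma> (%t. \<xi> t z)) (skel_path \<gamma> (lv.grid r) (J' r) (%j. \<xi> (real j * lv.grid r) z))"
  by (rule J1_close_lamperti[OF lv.grid_pos lv.grid_tendsto _ le]) (use S \<rho> in "auto simp: lv.Rv_def")
 then show ?thesis using J
 proof eventually_elim
  case (elim r)
  have "J' r = J r" using elim(2) by (simp add: J'_def)
  then show ?case using elim(1) by (simp only: limit_path_def grid_path_eq[OF z])
 qed
qed

lemma cadlag_limit_path: "AE z in N. cadlag (limit_path z)"
 using path_unbounded by eventually_elim (simp add: limit_path_def cadlag_path_unbounded.cadlag_lamperti)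

text \<open>Grid paths of mesh 2^-r up to time r converge almost surely to the Lamperti path. They
  are continuous functions of finitely many increments, so the limit of F along them is
  measurable.\<close>

lemma limit_path_version:
 assumes F: "J1_bounded_continuous F"
 obtains g where "g \<in> borel_measurable N" "AE z in N. F (limit_path z) = g z"
proof
 define f where "f r z = F (grid_path (r * 2 ^ r) r z)" for r z
 show "(%z. lim (%r. f r z)) \<in> borel_measurable N"
  by (rule borel_measurable_lim_metric) (unfold f_def, rule grid_path_measurable[OF F])
 have cont: "ALL xs x. (ALL k. cadlag (xs k)) --> cadlag x --> J1_tendsto xs x --> (%k. F (xs k)) ----> F x"
  using F unfolding J1_bounded_continuous_def by (rule conjunct2)
 show "AE z in N. F (limit_path z) = lim (%r. f r z)"
  using path_unbounded
 proof eventually_elim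
  case (elim z)
  have z: "z \<in> space N" and inf: "lv.I z = \<infinity>" and ub: "cadlag_path_unbounded (%t. \<xi> t z) \<gamma>" using elim by auto
  have "J1_tendsto (%r. grid_path (r * 2 ^ r) r z) (limit_path z)"
  proof (rule J1_tendsto_if_eventually_close)
   fix eps :: real assume eps: "0 < eps"
   \<comment> \<open>Reversing the closeness costs the factor e^\<rho>, which is at most 3
     here.\<close>
   define \<rho> where "\<rho> = min 1 (eps / 3)"
   have \<rho>: "0 < \<rho>" "\<rho> <= 1" "3 * \<rho> <= eps" using eps by (auto simp: \<rho>_def)
   have "EV S. - ln \<rho> < lv.Rv S z"
    using lv.Rv_at_top[OF z inf] unfolding filterlim_at_top_dense by blast
   then have "EV S. - ln \<rho> < lv.Rv S z & 0 < S" using eventually_gt_at_top[of "0::nat"] by eventually_elim simp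
   then obtain S where S: "- ln \<rho> < lv.Rv S z" "0 < S" by (auto dest!: eventually_happens'[OF sequentially_bot])
   have "exp (- lv.Rv S z) < exp (ln \<rho>)" using S(1) by (subst exp_less_cancel_iff) linarith
   then have e: "exp (- lv.Rv S z) < \<rho>" using \<rho>(1) by simp
   have J: "EV r. S * 2 ^ r <= r * 2 ^ r" using eventually_ge_at_top[of S] by eventually_elim simp
   from grid_path_close[OF z ub S(2) e J]
   show "EV r. J1_close eps (grid_path (r * 2 ^ r) r z) (limit_path z)"
   proof eventually_elim
    case (elim r)
    have "exp \<rho> <= exp 1" using \<rho>(2) by simp
    then have "exp \<rho> <= 3" using exp_le by linarith
    then have "exp \<rho> * \<rho> <= 3 * \<rho>" using \<rho>(1) by (intro mult_right_mono) auto
    then have "exp \<rho> * \<rho> <= eps" using \<rho>(3) by linarith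
    then show ?case by (rule J1_close_mono[OF J1_close_sym[OF elim]])
   qed
  qed
  then have "(%r. f r z) ----> F (limit_path z)" unfolding f_def
   by (intro cont[rule_format])
    (auto simp: grid_path_def ppath_def cadlag_skel_path limit_path_def cadlag_path_unbounded.cadlag_lamperti[OF ub])
  then show ?case by (rule limI[symmetric])
 qed
qed

text \<open>With S fixed the grid paths follow the limit only up to the clock value at S, so they
  become \<rho>-close, not convergent, and only where that clock exceeds t0 + 1. The exceptional set
  is paid for by the bound 2 B.\<close>

lemma grid_path_integral_close:
 assumes F: "J1_bounded_continuous F" and B: "!!x. cadlag x ==> abs(F x) <= B"
  and unif: "!!x y. cadlag x ==> cadlag y ==> J1_close \<rho> x y ==> abs(F x - F y) <= eps"
  and eps: "0 < eps" and S: "0 < S" and t0: "exp (- t0) <= \<rho>"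
 shows "EV r. abs((LINT z|completion N. F (limit_path z)) - (LINT z|N. F (grid_path (S * 2 ^ r) r z)))
  <= 2 * eps + 2 * B * measure N {z\<in>space N. lv.Rv S z <= t0 + 1}"
proof -
 obtain g where g: "g \<in> borel_measurable N" "AE z in N. F (limit_path z) = g z" using limit_path_version[OF F] by blast
 have "(LINT z|completion N. F (limit_path z)) = (LINT z|completion N. g z)"
  by (rule integral_cong_AE) (use g borel_measurable_completion_AE[OF g] AE_completion measurable_completion in auto)
 also have "... = (LINT z|N. g z)" by (rule integral_completion[OF g(1)])
 finally have Fg: "(LINT z|completion N. F (limit_path z)) = (LINT z|N. g z)" .
 define H where "H r z = F (grid_path (S * 2 ^ r) r z)" for r z
 have cg: "cadlag (grid_path J r z)" for J r z by (simp add: grid_path_def ppath_def cadlag_skel_path)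
 have H_meas: "H r \<in> borel_measurable N" for r unfolding H_def[abs_def] by (rule grid_path_measurable[OF F])
 have H_bnd: "abs(H r z) <= B" for r z unfolding H_def by (rule B[OF cg])
 have g_bnd: "AE z in N. abs(g z) <= B" using g(2) cadlag_limit_path
 proof eventually_elim
  case (elim z)
  then show ?case using B[of "limit_path z"] by simp
 qed
 define E where "E = {z\<in>space N. lv.Rv S z <= t0 + 1}"
 have E: "E \<in> sets N" unfolding E_def by measurable
 \<comment> \<open>The excess over eps off the exceptional set; it is eventually 0 almost surely, so
   dominated convergence applies although the difference itself need not vanish.\<close>
 define G where "G r z = max 0 (abs(g z - H r z) - eps) * indicator (space N - E) z" for r z
 have G_meas: "G r \<in> borel_measurable N" for r unfolding G_def[abs_def] using g(1) H_meas E by measurable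
 have G_bnd: "AE z in N. norm (G r z) <= 2 * B" for r using g_bnd
 proof eventually_elim
  case (elim z)
  have "0 <= B" using elim by linarith
  then show ?case using elim H_bnd[of r z] eps by (auto simp: G_def indicator_def)
 qed
 have "AE z in N. (%r. G r z) ----> 0" using path_unbounded g(2) cadlag_limit_path
 proof eventually_elim
  case (elim z)
  show ?case
  proof (cases "z \<in> E")
   case False
   then have "t0 + 1 < lv.Rv S z" using elim(1) by (auto simp: E_def)
   then have "exp (- lv.Rv S z) < exp (- t0)" by (subst exp_less_cancel_iff) linarith
   then have e: "exp (- lv.Rv S z) < \<rho>" using t0 by linarith
   have "EV r. J1_close \<rho> (limit_path z) (grid_path (S * 2 ^ r) r z)"
    by (rule grid_path_close[OF _ _ S e]) (use elim(1) in auto)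
   then have "EV r. G r z = 0"
   proof eventually_elim
    fix r assume "J1_close \<rho> (limit_path z) (grid_path (S * 2 ^ r) r z)"
    from unif[OF elim(3) cg this] show "G r z = 0" using elim(2) by (simp add: G_def H_def)
   qed
   then show ?thesis by (rule tendsto_eventually)
  qed (simp add: G_def)
 qed
 then have "(%r. LINT z|N. G r z) ----> (LINT z|N. 0)"
  by (intro integral_dominated_convergence[where w="%_. 2 * B"] G_meas G_bnd) auto
 then have "EV r. (LINT z|N. G r z) < eps" using eps by (intro order_tendstoD(2)[where y="LINT z|N. 0"]) auto
 then show ?thesis
 proof eventually_elim
  case (elim r)
  have gi: "integrable N g" by (rule lv.N.integrable_const_bound[where B=B]) (use g_bnd g(1) in auto)
  have Hi: "integrable N (H r)" by (rule lv.N.integrable_const_bound[where B=B]) (use H_bnd H_meas in auto)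
  have Gi: "integrable N (G r)" by (rule lv.N.integrable_const_bound[OF G_bnd G_meas])
  have Ei: "integrable N (indicator E :: _ => real)" by (rule integrable_real_indicator[OF E]) (simp add: lv.N.emeasure_eq_measure)
  have di: "integrable N (%z. abs(g z - H r z))" using gi Hi by auto
  have ri: "integrable N (%z. eps + G r z + 2 * B * indicator E z)"
   by (intro Bochner_Integration.integrable_add Gi integrable_mult_right Ei) auto
  have "abs((LINT z|N. g z) - (LINT z|N. H r z)) = abs(LINT z|N. g z - H r z)" using gi Hi by simp
  also have "... <= (LINT z|N. abs(g z - H r z))" using integral_norm_bound[of N "%z. g z - H r z"] by simp
  also have "... <= (LINT z|N. eps + G r z + 2 * B * indicator E z)"
  proof (rule integral_mono_AE[OF di ri])
   show "AE z in N. abs(g z - H r z) <= eps + G r z + 2 * B * indicator E z" using g_bnd AE_space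
   proof eventually_elim
    case (elim z)
    show ?case
    proof (cases "z \<in> E")
     case True
     have "abs(g z - H r z) <= 2 * B" using elim(1) H_bnd[of r z] by linarith
     then show ?thesis using True eps by (simp add: G_def)
    next
     case False
     then show ?thesis using elim(2) by (simp add: G_def)
    qed
   qed
  qed
  also have "... = eps + (LINT z|N. G r z) + 2 * B * measure N E"
  proof -
   have "integrable N (%z. 2 * B * indicator E z)" by (rule integrable_mult_right[OF Ei])
   moreover have "(LINT z|N. 2 * B * indicator E z) = 2 * B * measure N E" using E by simp
   ultimately show ?thesis using Gi by (simp add: lv.N.prob_space)
  qed
  finally show ?case using elim unfolding Fg H_def E_def by linarith
 qed
qed

lemma cutoff_grid_tendsto:
 "(%r. LINT z|N. cutoff t0 (ptime (lv.grid r) (S * 2 ^ r) (restr (S * 2 ^ r) (lv.D (lv.grid r) z)))) ----> (LINT z|N. cutoff t0 (lv.Rv S z))"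
proof (rule integral_dominated_convergence[where w="%_. 1"])
 show "(%z. cutoff t0 (lv.Rv S z)) \<in> borel_measurable N"
  by (rule borel_measurable_continuous_on[OF cutoff_continuous]) measurable
 show "(%z. cutoff t0 (ptime (lv.grid r) (S * 2 ^ r) (restr (S * 2 ^ r) (lv.D (lv.grid r) z)))) \<in> borel_measurable N" for r
  unfolding ptime_def
  by (rule borel_measurable_continuous_on[OF cutoff_continuous borel_measurable_continuous_on[OF skel_time_increments_continuous restr_D_measurable]])
 show "AE z in N. (%r. cutoff t0 (ptime (lv.grid r) (S * 2 ^ r) (restr (S * 2 ^ r) (lv.D (lv.grid r) z)))) ----> cutoff t0 (lv.Rv S z)"
  using AE_space
 proof eventually_elim
  case (elim z)
  have "isCont (cutoff t0) (lv.Rv S z)" using cutoff_continuous by (simp add: continuous_on_eq_continuous_at)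
  from isCont_tendsto_compose[OF this lv.grid_skel_time_tendsto[OF elim]]
  show ?case unfolding ptime_eq[OF elim] .
 qed
qed (auto simp: cutoff_bounds)

lemma clock_large:
 assumes eps: "0 < eps" obtains S where "0 < S" "measure N {z\<in>space N. lv.Rv S z <= t} <= eps"
proof -
 define E where "E S = {z\<in>space N. lv.Rv S z <= t}" for S
 have E: "E S \<in> sets N" for S unfolding E_def by measurable
 have "(%S. LINT z|N. indicator (E S) z) ----> (LINT z|N. 0 :: real)"
 proof (rule integral_dominated_convergence[where w="%_. 1"])
  show "AE z in N. (%S. indicator (E S) z :: real) ----> 0" using path_unbounded
  proof eventually_elim
   case (elim z)
   have "EV S. t < lv.Rv S z"
    using lv.Rv_at_top[of z] elim unfolding filterlim_at_top_dense by blast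
   then have "EV S. (indicator (E S) z :: real) = 0" by eventually_elim (simp add: E_def)
   then show ?case by (rule tendsto_eventually)
  qed
  show "AE z in N. norm (indicator (E S) z :: real) <= 1" for S by (simp add: indicator_def)
 qed (use E in auto)
 then have "(%S. measure N (E S)) ----> 0" using E by simp
 then have "EV S. measure N (E S) < eps" using eps by (rule order_tendstoD(2))
 then have "EV S. measure N (E S) < eps & 0 < S" using eventually_gt_at_top[of "0::nat"] by eventually_elim simp
 then obtain S where "measure N (E S) < eps" "0 < S" by (auto dest!: eventually_happens'[OF sequentially_bot])
 then show thesis by (intro that[of S]) (auto simp: E_def)
qed

text \<open>S is fixed first so that the limit clock at S is long with high probability, then the
  mesh, fine enough for both the chain and the limit. For this fixed mesh n tends to infinity by
  convergence of the increments.\<close>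

lemma uniform_tendsto:
 assumes F: "J1_bounded_continuous F" and U: "J1_uniform F"
 shows "(%n. LINT z|M n. F (scaled_path (a n) n (pth n z))) ----> (LINT z|completion N. F (limit_path z))"
proof (rule tendstoI)
 fix eps0 :: real assume eps0: "0 < eps0"
 obtain B where B: "!!x. cadlag x ==> abs(F x) <= B" using F unfolding J1_bounded_continuous_def by blast
 have B0: "0 <= B" using B[OF cadlag_skel_path] abs_ge_zero order_trans by blast
 \<comment> \<open>The errors are eps + 10 B eps between chain and skeleton, eps for the increments,
   and 2 eps + 2 B eps between grid and limit.\<close>
 define eps where "eps = eps0 / (2 * (4 + 14 * B))"
 have eps: "0 < eps" using eps0 B0 by (simp add: eps_def)
 have eps': "4 * eps + 14 * (B * eps) < eps0"
 proof -
  have "4 + 14 * B ~= 0" using B0 by linarith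
  then have "(4 + 14 * B) * eps = eps0 / 2" unfolding eps_def by (simp only: divide_divide_eq_left[symmetric] times_divide_eq_right mult.commute[of 2]) (simp add: mult.commute[of _ eps0])
  then show ?thesis using eps0 by (simp add: algebra_simps)
 qed
 obtain \<rho> where \<rho>: "0 < \<rho>" "!!x y. cadlag x ==> cadlag y ==> J1_close \<rho> x y ==> abs(F x - F y) <= eps"
  using U eps unfolding J1_uniform_def by blast
 define t0 where "t0 = - ln \<rho>"
 have t0: "exp (- t0) <= \<rho>" using \<rho>(1) by (simp add: t0_def)
 obtain S where S: "0 < S" "measure N {z\<in>space N. lv.Rv S z <= t0 + 1} <= eps" using clock_large[OF eps] by blast
 have rS: "0 < real S" using S(1) by simp
 obtain \<delta>0 where \<delta>0: "0 < \<delta>0" "!!J. 0 < J ==> real S / real J <= \<delta>0 ==> EV n.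
  abs((LINT z|M n. F (scaled_path (a n) n (pth n z))) - (LINT z|M n. F (ppath (real S / real J) J (inc (real S) J n z))))
   <= eps + 2 * B * (3 * eps + (LINT z|M n. cutoff t0 (ptime (real S / real J) J (inc (real S) J n z))))"
  using chain_close[OF F B \<rho> eps rS t0] by blast
 have "(LINT z|N. cutoff t0 (lv.Rv S z)) <= eps"
 proof -
  have E: "{z\<in>space N. lv.Rv S z <= t0 + 1} \<in> sets N" by measurable
  have "(LINT z|N. cutoff t0 (lv.Rv S z)) <= (LINT z|N. indicator {z\<in>space N. lv.Rv S z <= t0 + 1} z)"
  proof (rule integral_mono)
   have "(%z. cutoff t0 (lv.Rv S z)) \<in> borel_measurable N" by (rule borel_measurable_continuous_on[OF cutoff_continuous]) measurable
   then show "integrable N (%z. cutoff t0 (lv.Rv S z))" by (intro lv.N.integrable_const_bound[where B=1]) (auto simp: cutoff_bounds)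
   show "integrable N (indicator {z\<in>space N. lv.Rv S z <= t0 + 1} :: _ => real)"
    by (rule integrable_real_indicator[OF E]) (simp add: lv.N.emeasure_eq_measure)
   show "cutoff t0 (lv.Rv S z) <= indicator {z\<in>space N. lv.Rv S z <= t0 + 1} z" if "z \<in> space N" for z
    using cutoff_0[of t0 "lv.Rv S z"] cutoff_bounds[of t0 "lv.Rv S z"] that by (auto simp: indicator_def)
  qed
  also have "... = measure N {z\<in>space N. lv.Rv S z <= t0 + 1}" using E by simp
  finally show ?thesis using S(2) by linarith
 qed
 then have "(LINT z|N. cutoff t0 (lv.Rv S z)) < 2 * eps" using eps by linarith
 from order_tendstoD(2)[OF cutoff_grid_tendsto this]
 have r1: "EV r. (LINT z|N. cutoff t0 (ptime (lv.grid r) (S * 2 ^ r) (restr (S * 2 ^ r) (lv.D (lv.grid r) z)))) < 2 * eps" .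
 have r2: "EV r. lv.grid r < \<delta>0" by (rule order_tendstoD(2)[OF lv.grid_tendsto \<delta>0(1)])
 have r3: "EV r. abs((LINT z|completion N. F (limit_path z)) - (LINT z|N. F (grid_path (S * 2 ^ r) r z)))
  <= 2 * eps + 2 * B * measure N {z\<in>space N. lv.Rv S z <= t0 + 1}"
  by (rule grid_path_integral_close[OF F B \<rho>(2) eps S(1) t0])
 have "EV r. (LINT z|N. cutoff t0 (ptime (lv.grid r) (S * 2 ^ r) (restr (S * 2 ^ r) (lv.D (lv.grid r) z)))) < 2 * eps & lv.grid r < \<delta>0 &
  abs((LINT z|completion N. F (limit_path z)) - (LINT z|N. F (grid_path (S * 2 ^ r) r z)))
  <= 2 * eps + 2 * B * measure N {z\<in>space N. lv.Rv S z <= t0 + 1}"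
  using r1 r2 r3 by eventually_elim simp
 then obtain r where r: "(LINT z|N. cutoff t0 (ptime (lv.grid r) (S * 2 ^ r) (restr (S * 2 ^ r) (lv.D (lv.grid r) z)))) < 2 * eps"
   "lv.grid r < \<delta>0" "abs((LINT z|completion N. F (limit_path z)) - (LINT z|N. F (grid_path (S * 2 ^ r) r z)))
  <= 2 * eps + 2 * B * measure N {z\<in>space N. lv.Rv S z <= t0 + 1}"
  by (auto dest!: eventually_happens'[OF sequentially_bot])
 \<comment> \<open>With this number of blocks the mesh S / J is the dyadic mesh, so the chain's
   skeleton and the grid path are the same function of the increments.\<close>
 define J where "J = S * 2 ^ r"
 have J: "0 < J" "real S / real J = lv.grid r" using S(1) by (auto simp: J_def lv.grid_def)
 define \<delta> where "\<delta> = lv.grid r"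
 have \<delta>: "0 < \<delta>" by (simp add: \<delta>_def lv.grid_pos)
 have "abs(F (ppath \<delta> J d)) <= B" for d unfolding ppath_def by (rule B[OF cadlag_skel_path])
 moreover have "continuous_on UNIV (%d. F (ppath \<delta> J d))" unfolding ppath_def by (rule skel_path_increments_continuous[OF F \<delta>])
 ultimately have "(%n. LINT z|M n. F (ppath \<delta> J (inc (real S) J n z))) ----> (LINT z|N. F (ppath \<delta> J (restr J (lv.D (real S / real J) z))))"
  by (intro inc_tendsto[OF rS J(1)])
 then have n1: "EV n. dist (LINT z|M n. F (ppath \<delta> J (inc (real S) J n z))) (LINT z|N. F (ppath \<delta> J (restr J (lv.D (real S / real J) z)))) < eps"
  using eps unfolding tendsto_iff by blast
 have "continuous_on UNIV (%d. ptime \<delta> J d)" unfolding ptime_def by (rule skel_time_increments_continuous)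
 then have "continuous_on UNIV (%d. cutoff t0 (ptime \<delta> J d))" by (rule continuous_on_compose2[OF cutoff_continuous]) auto
 then have "(%n. LINT z|M n. cutoff t0 (ptime \<delta> J (inc (real S) J n z))) ----> (LINT z|N. cutoff t0 (ptime \<delta> J (restr J (lv.D (real S / real J) z))))"
  by (intro inc_tendsto[OF rS J(1), where B=1]) (auto simp: cutoff_bounds)
 moreover have "(LINT z|N. cutoff t0 (ptime \<delta> J (restr J (lv.D (real S / real J) z)))) < 2 * eps" using r(1) unfolding J(2) \<delta>_def unfolding J_def .
 ultimately have n2: "EV n. (LINT z|M n. cutoff t0 (ptime \<delta> J (inc (real S) J n z))) < 2 * eps" by (rule order_tendstoD(2))
 have n3: "EV n.
  abs((LINT z|M n. F (scaled_path (a n) n (pth n z))) - (LINT z|M n. F (ppath \<delta> J (inc (real S) J n z))))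
   <= eps + 2 * B * (3 * eps + (LINT z|M n. cutoff t0 (ptime \<delta> J (inc (real S) J n z))))"
  using \<delta>0(2)[OF J(1)] r(2) unfolding J(2) \<delta>_def by simp
 have lim: "(LINT z|N. F (grid_path (S * 2 ^ r) r z)) = (LINT z|N. F (ppath \<delta> J (restr J (lv.D (real S / real J) z))))"
  unfolding grid_path_def J(2) unfolding J_def \<delta>_def ..
 have x1: "2 * B * measure N {z\<in>space N. lv.Rv S z <= t0 + 1} <= 2 * B * eps" using S(2) B0 by (intro mult_left_mono) auto
 show "EV n. dist (LINT z|M n. F (scaled_path (a n) n (pth n z))) (LINT z|completion N. F (limit_path z)) < eps0"
  using n1 n2 n3
 proof eventually_elim
  case (elim n)
  have "2 * B * (3 * eps + (LINT z|M n. cutoff t0 (ptime \<delta> J (inc (real S) J n z)))) <= 2 * B * (3 * eps + 2 * eps)"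
   using elim(2) B0 by (intro mult_left_mono) auto
  also have "... = 10 * (B * eps)" by simp
  finally have x2: "2 * B * (3 * eps + (LINT z|M n. cutoff t0 (ptime \<delta> J (inc (real S) J n z)))) <= 10 * (B * eps)" .
  have x3: "2 * B * eps = 2 * (B * eps)" by simp
  have "0 <= B * eps" using B0 eps by simp
  then show ?case using elim(1,3) r(3) x1 x2 eps' eps unfolding lim dist_real_def x3 by linarith
 qed
qed

theorem invariance_principle:
 assumes F: "J1_bounded_continuous F"
 shows "(%n. LINT z|M n. F (scaled_path (a n) n (pth n z))) ----> (LINT z|completion N. F (limit_path z))"
proof -
 interpret J1_convergence_setup M "%n z. scaled_path (a n) n (pth n z)" "completion N" limit_path
 proof (rule J1_convergence_setup.intro)
  show "prob_space (M n)" if "1 <= n" for n using markov[OF that] by (rule markov.prob)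
  show "prob_space (completion N)" by (rule lv.N.prob_space_completion)
  show "cadlag (scaled_path (a n) n (pth n z))" for n z by (intro cadlag_scaled_path os.a_pos)
  show "AE z in completion N. cadlag (limit_path z)" using cadlag_limit_path by (rule AE_completion)
  show "(%z. F (scaled_path (a n) n (pth n z))) \<in> borel_measurable (M n)" if "1 <= n" "J1_bounded_continuous F" for F n
   unfolding pth_def by (rule markov.scaled_path_measurable[OF markov[OF that(1)] that(2) os.a_pos])
  show "(%z. F (limit_path z)) \<in> borel_measurable (completion N)" if F: "J1_bounded_continuous F" for F
  proof -
   obtain g where g: "g \<in> borel_measurable N" "AE z in N. F (limit_path z) = g z" using limit_path_version[OF F] by blast
   show ?thesis by (rule borel_measurable_completion_AE[OF g])
  qed
 qed (rule uniform_tendsto)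
 show ?thesis by (rule integral_tendsto[OF F])
qed

end

text \<open>Rows of \<open>p\<close> are constrained only at states from 1 on, so state 0 is made
  absorbing. The path law also has to hold for sequences visiting 0; there both products vanish at
  the step into 0.\<close>

lemma markov_of_kernel:
 assumes p_nonneg: "!!i j. 1 <= i ==> 0 <= p i j" and p_zero: "!!i. 1 <= i ==> p i 0 = 0"
  and p_sum: "!!i. 1 <= i ==> (%k. p i (Suc k)) sums (1::real)"
 obtains step :: "nat => nat pmf" where "!!i j. 1 <= i ==> pmf (step i) j = p i j"
  "!!i. 1 <= i ==> 0 \<notin> set_pmf (step i)"
  "\<And>(M :: 'a measure) X n. 1 <= n ==> markov_chain M X p n ==> markov M X step n"
proof -
 define step where "step i = (if 1 <= i then embed_pmf (p i) else return_pmf 0)" for i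
 have pmf_step: "pmf (step i) j = p i j" if i: "1 <= i" for i j
 proof -
  have s: "(%k. p i k) sums 1" using sums_Suc_iff[of "p i" 1] p_sum[OF i] p_zero[OF i] by simp
  have "(\<Sum>k. ennreal (p i k)) = ennreal (\<Sum>k. p i k)"
   by (rule suminf_ennreal2[OF p_nonneg[OF i] sums_summable[OF s]])
  then have "(\<integral>\<^sup>+k. ennreal (p i k) \<partial>count_space UNIV) = 1"
   unfolding nn_integral_count_space_nat sums_unique[OF s, symmetric] by simp
  from pmf_embed_pmf[of "p i", OF p_nonneg[OF i] this] show ?thesis unfolding step_def if_P[OF i] .
 qed
 have step_pos: "0 \<notin> set_pmf (step i)" if "1 <= i" for i
  using pmf_step[OF that, of 0] p_zero[OF that] by (simp add: set_pmf_iff)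
 have mk: "markov M X step n" if n: "1 <= n" and ch: "markov_chain M X p n" for M :: "'a measure" and X n
 proof (rule markov.intro)
  show "prob_space M" "!!k. X k \<in> measurable M (count_space UNIV)" using ch by (auto simp: markov_chain_def)
  fix k and xs :: "nat => nat"
  have "(\<Prod>j<k. p (xs j) (xs (Suc j))) = (\<Prod>j<k. pmf (step (xs j)) (xs (Suc j)))" if x0: "xs 0 = n"
  proof (cases "\<exists>j<k. xs j = 0")
   case False
   then show ?thesis by (intro prod.cong) (auto simp: pmf_step Suc_le_eq)
  next
   case True
   \<comment> \<open>The first visit to 0 is not at time 0, because the start n is positive; the
     step into it comes from a positive state and has weight 0 in both products.\<close>
   define j where "j = (LEAST j. xs j = 0)"
   obtain j' where j': "j' < k" "xs j' = 0" using True by blast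
   have xj: "xs j = 0" unfolding j_def using j'(2) by (rule LeastI)
   have jk: "j < k" using Least_le[of "%j. xs j = 0" j'] j' by (simp add: j_def)
   have "j ~= 0"
   proof
    assume "j = 0"
    then show False using xj x0 n by simp
   qed
   then obtain i where i: "j = Suc i" by (cases j) auto
   have "1 <= xs i" using not_less_Least[of i "%j. xs j = 0"] i by (simp add: j_def[symmetric] Suc_le_eq)
   then have z: "p (xs i) (xs (Suc i)) = 0" "pmf (step (xs i)) (xs (Suc i)) = 0" using xj i p_zero pmf_step by auto
   have ik: "i \<in> {..<k}" using jk i by simp
   have "(\<Prod>j<k. p (xs j) (xs (Suc j))) = 0" by (rule prod_zero[OF finite_lessThan], rule bexI[of _ i], rule z(1), rule ik)
   moreover have "(\<Prod>j<k. pmf (step (xs j)) (xs (Suc j))) = 0" by (rule prod_zero[OF finite_lessThan], rule bexI[of _ i], rule z(2), rule ik)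
   ultimately show ?thesis by (simp only:)
  qed
  then show "measure M {w \<in> space M. \<forall>j\<le>k. X j w = xs j}
     = (if xs 0 = n then (\<Prod>j<k. pmf (step (xs j)) (xs (Suc j))) else 0)"
   using ch by (auto simp: markov_chain_def)
 qed
 show thesis by (rule that[OF pmf_step step_pos mk])
qed

lemma (in markov) integral_first_step:
 fixes g :: "nat => real"
 assumes "!!j. abs(g j) <= B" shows "expectation (%w. g (X 1 w)) = pmf_E (step n) g"
proof -
 have "expectation (%w. g (X (Suc 0) w)) = expectation (%w. pmf_E (step (X 0 w)) g)"
  by (rule one_step_real[where G="%x. g" and k=0 and B=B]) (use assms in "auto simp: prefix_dep_def")
 also have "... = expectation (%w. pmf_E (step n) g)"
 proof (rule integral_cong_AE)
  have "prefix_dep 0 (%x. pmf_E (step (x 0)) g)" unfolding prefix_dep_def by auto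
  from prefix_dep_borel[OF this] show "(%w. pmf_E (step (X 0 w)) g) \<in> borel_measurable M" by (simp only: path_def)
  show "AE w in M. pmf_E (step (X 0 w)) g = pmf_E (step n) g"
   using start[OF prob] by eventually_elim simp
 qed simp
 finally show ?thesis by (simp add: prob_space)
qed

lemma bounded_on_ereal_ratios:
 fixes f :: "ereal => real"
 assumes "continuous_on {0..\<infinity>} f" obtains B where "!!j n. abs(f (ereal (real j / real n))) <= B"
proof -
 have "compact (f ` {0..\<infinity>})" by (rule compact_continuous_image[OF assms]) (simp add: compact_eq_closed)
 then obtain B where B: "!!y. y \<in> f ` {0..\<infinity>} ==> norm y <= B" using compact_imp_bounded[of "f ` {0..\<infinity>}"] unfolding bounded_iff by blast
 show thesis
 proof (rule that[of B])
  show "abs(f (ereal (real j / real n))) <= B" for j n using B[of "f (ereal (real j / real n))"] by simp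
 qed
qed

theorem theorem1:
  fixes p :: "nat \<Rightarrow> nat \<Rightarrow> real"
    and M :: "nat \<Rightarrow> 'a measure" and X :: "nat \<Rightarrow> nat \<Rightarrow> 'a \<Rightarrow> nat"
    and a :: "nat \<Rightarrow> real" and \<gamma> :: real
    and Lm :: "real measure" and b sigma2 :: real
    and N :: "'b measure" and \<xi> :: "real \<Rightarrow> 'b \<Rightarrow> real"
  assumes p_nonneg: "\<And>i j. 1 \<le> i \<Longrightarrow> 0 \<le> p i j"
    and p_zero: "\<And>i. 1 \<le> i \<Longrightarrow> p i 0 = 0"
    and p_sum: "\<And>i. 1 \<le> i \<Longrightarrow> (\<lambda>k. p i (Suc k)) sums 1"
    and chain: "\<And>n. 1 \<le> n \<Longrightarrow> markov_chain (M n) (X n) p n"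
    and a_pos: "\<And>n. 0 < a n"
    and gamma_pos: "0 < \<gamma>"
    and a_rv: "regularly_varying a \<gamma>"
    and Lm: "levy_measure Lm" "emeasure Lm {-1, 1} = 0"
    and A1: "\<And>f :: ereal \<Rightarrow> real. continuous_on {0..\<infinity>} f \<Longrightarrow>
              (\<exists>K. compact K \<and> K \<subseteq> {0..\<infinity>} - {1} \<and> (\<forall>x\<in>{0..\<infinity>} - K. f x = 0)) \<Longrightarrow>
              (\<lambda>n. a n * (\<integral>\<omega>. f (ereal (real (X n 1 \<omega>) / real n)) \<partial>M n))
                \<longlonglongrightarrow> (\<integral>x. f (ereal (exp x)) \<partial>Lm)"
    and A2_1: "(\<lambda>n. a n * (LINT x:{-1..1}|Pistar (M n) (X n) n. x)) \<longlonglongrightarrow> b"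
    and A2_2: "sigma2 \<ge> 0"
              "(\<lambda>n. a n * (LINT x:{-1..1}|Pistar (M n) (X n) n. x\<^sup>2))
                 \<longlonglongrightarrow> sigma2 + (LINT x:{-1..1}|Lm. x\<^sup>2)"
    and levy: "levy_process N \<xi> (levy_exponent b sigma2 Lm)"
    and no_drift: "\<not> (AE \<omega> in N. filterlim (\<lambda>t. \<xi> t \<omega>) at_bot at_top)"
  shows "\<forall>F. J1_bounded_continuous F \<longrightarrow>
           (\<lambda>n. \<integral>\<omega>. F (\<lambda>t. real (X n (nat \<lfloor>a n * t\<rfloor>) \<omega>) / real n) \<partial>M n)
             \<longlonglongrightarrow> (\<integral>\<omega>. F (lamperti \<gamma> (\<lambda>s. \<xi> s \<omega>)) \<partial>completion N)"
proof -
 obtain step :: "nat => nat pmf" where step: "!!i. 1 <= i ==> 0 \<notin> set_pmf (step i)"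
  and mk0: "\<And>(M :: 'a measure) X n. 1 <= n ==> markov_chain M X p n ==> markov M X step n"
  using markov_of_kernel[of p, OF p_nonneg p_zero p_sum] by metis
 have mk: "markov (M n) (X n) step n" if "1 <= n" for n by (rule mk0[OF that chain[OF that]])
 have ev: "EV n. (1::nat) <= n" by (rule eventually_ge_at_top)
 have first: "(LINT w|M n. g (X n 1 w)) = pmf_E (step n) g" if "1 <= n" "!!j. abs(g j) <= B" for n B and g :: "nat => real"
  by (rule markov.integral_first_step[OF mk[OF that(1)] that(2)])
 have pistar: "(LINT x:{-1..1}|Pistar (M n) (X n) n. x ^ m) =
   pmf_E (step n) (%j. indicator {-1..1} (ln (real j) - ln (real n)) * (ln (real j) - ln (real n)) ^ m)" if n: "1 <= n" for n m
 proof -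
  interpret markov "M n" "X n" step n by (rule mk[OF n])
  have "(LINT x:{-1..1}|Pistar (M n) (X n) n. x ^ m) = (LINT w|M n. indicator {-1..1} (ln (real (X n 1 w)) - ln (real n)) * (ln (real (X n 1 w)) - ln (real n)) ^ m)"
   unfolding Pistar_def set_lebesgue_integral_def by (subst integral_distr) (auto simp del: One_nat_def)
  also have "... = pmf_E (step n) (%j. indicator {-1..1} (ln (real j) - ln (real n)) * (ln (real j) - ln (real n)) ^ m)"
  proof (rule first[OF n, where B=1])
   show "abs(indicator {-1..1} (ln (real j) - ln (real n)) * (ln (real j) - ln (real n)) ^ m) <= (1::real)" for j
    by (auto simp: indicator_def abs_mult power_abs intro!: power_le_one)
  qed
  finally show ?thesis .
 qed
 interpret scaling_limit step a Lm b sigma2 N \<xi> \<gamma> M X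
 proof (intro scaling_limit.intro scaling_limit_axioms.intro)
  show "one_step step a Lm b sigma2"
  proof (rule one_step.intro[OF step a_pos Lm])
   fix f :: "ereal => real"
   assume f: "continuous_on {0..\<infinity>} f" "EX K. compact K & K \<subseteq> {0..\<infinity>} - {1} & (\<forall>x\<in>{0..\<infinity>} - K. f x = 0)"
   obtain B where B: "!!j n. abs(f (ereal (real j / real n))) <= B" using bounded_on_ereal_ratios[OF f(1)] by blast
   have "EV n. a n * (LINT w|M n. f (ereal (real (X n 1 w) / real n))) = a n * pmf_E (step n) (%j. f (ereal (real j / real n)))"
    using ev by eventually_elim (rule arg_cong[where f="%u. _ * u"], rule first, use B in auto)
   from Lim_transform_eventually[OF A1[OF f] this]
   show "(%n. a n * pmf_E (step n) (%j. f (ereal (real j / real n)))) ----> (LINT x|Lm. f (ereal (exp x)))" .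
  next
   have "EV n. a n * (LINT x:{-1..1}|Pistar (M n) (X n) n. x) = a n * pmf_E (step n) (%j. indicator {-1..1} (ln (real j) - ln (real n)) * (ln (real j) - ln (real n)))"
    using ev
   proof eventually_elim
    case (elim n)
    show ?case using pistar[OF elim, of 1] by simp
   qed
   from Lim_transform_eventually[OF A2_1 this]
   show "(%n. a n * pmf_E (step n) (%j. indicator {-1..1} (ln (real j) - ln (real n)) * (ln (real j) - ln (real n)))) ----> b" .
  next
   have "EV n. a n * (LINT x:{-1..1}|Pistar (M n) (X n) n. x\<^sup>2) = a n * pmf_E (step n) (%j. indicator {-1..1} (ln (real j) - ln (real n)) * (ln (real j) - ln (real n))\<^sup>2)"
    using ev
   proof eventually_elim
    case (elim n)
    show ?case using pistar[OF elim, of 2] by simp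
   qed
   from Lim_transform_eventually[OF A2_2(2) this]
   show "(%n. a n * pmf_E (step n) (%j. indicator {-1..1} (ln (real j) - ln (real n)) * (ln (real j) - ln (real n))\<^sup>2))
    ----> sigma2 + (LINT x:{-1..1}|Lm. x\<^sup>2)" .
  qed (use A2_2(1) in auto)
  show lv: "levy N \<xi> (levy_exponent b sigma2 Lm) \<gamma>" by (rule levy.intro[OF levy gamma_pos])
  show "AE w in N. levy.I \<xi> \<gamma> w = \<infinity>" by (rule levy.infinite_integral[OF lv no_drift])
 qed (use mk a_rv in auto)
 show ?thesis
 proof (intro allI impI)
  fix F assume F: "J1_bounded_continuous F"
  have "EV n. (LINT w|M n. F (scaled_path (a n) n (pth n w))) = (LINT w|M n. F (%t. real (X n (nat \<lfloor>a n * t\<rfloor>) w) / real n))"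
   using ev
  proof eventually_elim
   case (elim n)
   have "scaled_path (a n) n (pth n w) = (%t. real (X n (nat \<lfloor>a n * t\<rfloor>) w) / real n)" for w
    by (intro ext) (simp add: scaled_path_def pth_def markov.path_def[OF mk[OF elim]])
   then show ?case by simp
  qed
  from Lim_transform_eventually[OF invariance_principle[OF F] this]
  show "(%n. LINT w|M n. F (%t. real (X n (nat \<lfloor>a n * t\<rfloor>) w) / real n))
      ----> (LINT w|completion N. F (lamperti \<gamma> (%s. \<xi> s w)))" unfolding limit_path_def .
 qed
qed

end
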